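(* Let $R$ be an associative unital ring and $M$ an $R$-bimodule. Let $\Phi:\mathrm{Sq}(R,M)\to \mathrm{El}(R,M)$ be the map sending a square-zero extension $R'$ to the class of the elementary extension $\tau_{[0,1]}q^*P'_\bullet$, and let $\Psi:\mathrm{El}(R,M)\to \mathrm{Sq}(R,M)$ be the map sending the class of an elementary extension $\langle C_\bullet,a,b\rangle$ to the class of the ring of regular endomorphisms of its canonical splitting (both maps are described in the context). Then $\Phi$ and $\Psi$ are inverse to each other.
   Context: Complexes are homologically graded, $E[m]_n=E_{n-m}$, and $\tau_{[0,1]}$ is the canonical truncation to degrees $0,1$. A sequence of complexes $0\to B_\bullet\xrightarrow{b}E_\bullet\xrightarrow{a}A_\bullet\to 0$ (with $ab=0$) in an abelian category is quasiexact if $b$ is injective, $a$ is surjective and $\operatorname{Ker}a/\operatorname{Im}b$ is acyclic. An elementary extension of an object $A$ by an object $B$ is a quasiexact sequence $0\to B[1]\xrightarrow{b}C_\bullet\xrightarrow{a}A\to0$ with $C_\bullet$ concentrated in degrees $0,1$ (equivalently a four-term exact sequence $0\to B\xrightarrow{b} C_1\xrightarrow{d}C_0\xrightarrow{a}A\to 0$). Morphisms of elementary extensions are maps of complexes $C_\bullet\to C'_\bullet$ compatible with $a$ and $b$. A splitting of an elementary extension is an object $C_{01}$ with maps $c_1:C_1\to C_{01}$ and $c_0:C_{01}\to C_0$ such that $c_1$ is injective, $c_0$ is surjective, $c_0c_1=d$ and $\operatorname{Ker}c_0=c_1(b(B))$; morphisms of splittings are maps compatible with $c_0,c_1$. For rings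 $S,S'$, let $S\text{-proj}$ be the category of finitely generated projective left $S$-modules, and let $\mathcal B(S,S')$ be the abelian category of pointed functors ($F(0)=0$, not necessarily additive) $S\text{-proj}\to S'\text{-mod}$; $\mathcal B(S)=\mathcal B(S,S)$. For an $R$-bimodule $M$, $\mathsf I(M)\in\mathcal B(R)$ is $V\mapsto M\otimes_RV$, and $\mathsf I=\mathsf I(R)$ is the tautological inclusion. An elementary extension of $R$ by $M$ is an elementary extension of $\mathsf I$ by $\mathsf I(M)$ in $\mathcal B(R)$; $\mathrm{El}(R,M)$ is the set of connected components of the category of these. A square-zero extension of $R$ by $M$ is an associative unital ring $R'$ with a short exact sequence of abelian groups $0\to M\xrightarrow{i}R'\xrightarrow{q}R\to0$ such that $q$ is a unital ring map and $i(m)r'=i(mq(r'))$, $r'i(m)=i(q(r')m)$, $i(m)i(m')=0$. $\mathrm{Sq}(R,M)$ is the set of isomorphism classes of square-zero extensions. The map $\Phi$: given $R'$, let $q_*:\mathcal B(R)\to\mathcal B(R,R')$ be composition with restriction of scalars along $q$, and $q^*:\mathcal B(R,R')\to\mathcal B(R)$ composition with $R\otimes_{R'}-$. Choose a projective resolution $P'_\bullet$ of $q_*(\mathsf I)$ in $\mathcal B(R,R')$. Evaluated at $V\in R\text{-proj}$ it is a projective resolution of $q_*V$, and since $R\otimes_{R'}q_*V\cong V$ and $\operatorname{Tor}_1^{R'}(R,q_*V)\cong M\otimes_RV$ (the latter by the connecting map of $0\to M\to R'\to R\to 0$), the complex $\tau_{[0,1]}q^*P'_\bullet$ is an elementary extension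 of $R$ by $M$, whose class in $\mathrm{El}(R,M)$ is independent of choices. The map $\Psi$: let $e_*:\mathcal B(R)\to\mathcal B(R,\mathbb Z)$ be composition with the forgetful functor to abelian groups. For an elementary extension $\langle C_\bullet,a,b\rangle$ of $R$ by $M$, the induced elementary extension $e_*(C_\bullet)$ of $e_*(\mathsf I)$ by $e_*(\mathsf I(M))$ in $\mathcal B(R,\mathbb Z)$ has a splitting $\langle C_{01},c_0,c_1\rangle$, unique up to isomorphism (the canonical splitting). An endomorphism $r'$ of the functor $C_{01}\in \mathcal B(R,\mathbb Z)$ is regular if there is $r\in R$ with $c_0r'=rc_0$ and $r'c_1=c_1r$, where $r$ acts on $C_0$ and $C_1$ through the left $R$-module structure; such $r$ is unique. The regular endomorphisms form a ring $R'$, which with $q:r'\mapsto r$ and $i$ sending $m\in M$ to the endomorphism $x\mapsto c_1(b(m\otimes a(c_0(x))))$ is a square-zero extension of $R$ by $M$. *)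

theory Defs
  imports "HOL-Algebra.Free_Abelian_Groups" "HOL-Algebra.Module" "HOL-Algebra.IntRing"
    "HOL-Library.Equipollence"
begin

text \<open>
  Universe convention. All modules that make up the categories below, the values of the functors
  that are quantified over, and the rings \<open>R'\<close> of square-zero extensions have their carriers in one
  type \<open>'u\<close>, which plays the role of a universe. The main statement only asks that \<open>'u\<close> be infinite
  and that \<open>R\<close> and \<open>M\<close> embed into it. Constructions that leave \<open>'u\<close> (tensor products, quotients,
  rings of endomorphisms of functors) are formed in their own types; their class is the class of any
  isomorphic copy in \<open>'u\<close>.

  Morphisms are functions that are extensional on the carrier, so that equality of morphisms is
  equality of functions. The fields \<open>mult\<close> and \<open>one\<close> of the library record for modules carry
  no meaning for modules.
\<close>

subsection \<open>Modules and bimodules over noncommutative rings\<close>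

text \<open>The library locale \<open>module\<close> is restricted to commutative rings.\<close>

locale left_module = R?: ring R + M?: abelian_group M
  for R :: "('r, 'i) ring_scheme" (structure) and M :: "('r, 'v, 'j) module_scheme" (structure) +
  assumes smult_closed: "\<lbrakk>r \<in> carrier R; x \<in> carrier M\<rbrakk> \<Longrightarrow> r \<odot>\<^bsub>M\<^esub> x \<in> carrier M"
    and smult_l_distr: "\<lbrakk>r \<in> carrier R; s \<in> carrier R; x \<in> carrier M\<rbrakk> \<Longrightarrow>
      (r \<oplus>\<^bsub>R\<^esub> s) \<odot>\<^bsub>M\<^esub> x = r \<odot>\<^bsub>M\<^esub> x \<oplus>\<^bsub>M\<^esub> s \<odot>\<^bsub>M\<^esub> x"
    and smult_r_distr: "\<lbrakk>r \<in> carrier R; x \<in> carrier M; y \<in> carrier M\<rbrakk> \<Longrightarrow>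
      r \<odot>\<^bsub>M\<^esub> (x \<oplus>\<^bsub>M\<^esub> y) = r \<odot>\<^bsub>M\<^esub> x \<oplus>\<^bsub>M\<^esub> r \<odot>\<^bsub>M\<^esub> y"
    and smult_assoc: "\<lbrakk>r \<in> carrier R; s \<in> carrier R; x \<in> carrier M\<rbrakk> \<Longrightarrow>
      (r \<otimes>\<^bsub>R\<^esub> s) \<odot>\<^bsub>M\<^esub> x = r \<odot>\<^bsub>M\<^esub> (s \<odot>\<^bsub>M\<^esub> x)"
    and smult_one: "x \<in> carrier M \<Longrightarrow> \<one>\<^bsub>R\<^esub> \<odot>\<^bsub>M\<^esub> x = x"

record ('s, 't, 'b) bimodule = "('s, 'b) module" +
  ract :: "'b \<Rightarrow> 't \<Rightarrow> 'b"

locale bimodule = left_module S B + T?: ring T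
  for S :: "('s, 'i) ring_scheme" (structure) and T :: "('t, 'j) ring_scheme" (structure)
    and B :: "('s, 't, 'b, 'k) bimodule_scheme" (structure) +
  assumes ract_closed: "\<lbrakk>x \<in> carrier B; t \<in> carrier T\<rbrakk> \<Longrightarrow> ract B x t \<in> carrier B"
    and ract_l_distr: "\<lbrakk>x \<in> carrier B; y \<in> carrier B; t \<in> carrier T\<rbrakk> \<Longrightarrow>
      ract B (x \<oplus>\<^bsub>B\<^esub> y) t = ract B x t \<oplus>\<^bsub>B\<^esub> ract B y t"
    and ract_r_distr: "\<lbrakk>x \<in> carrier B; t \<in> carrier T; t' \<in> carrier T\<rbrakk> \<Longrightarrow>
      ract B x (t \<oplus>\<^bsub>T\<^esub> t') = ract B x t \<oplus>\<^bsub>B\<^esub> ract B x t'"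
    and ract_assoc: "\<lbrakk>x \<in> carrier B; t \<in> carrier T; t' \<in> carrier T\<rbrakk> \<Longrightarrow>
      ract B x (t \<otimes>\<^bsub>T\<^esub> t') = ract B (ract B x t) t'"
    and ract_one: "x \<in> carrier B \<Longrightarrow> ract B x \<one>\<^bsub>T\<^esub> = x"
    and smult_ract: "\<lbrakk>s \<in> carrier S; x \<in> carrier B; t \<in> carrier T\<rbrakk> \<Longrightarrow>
      ract B (s \<odot>\<^bsub>B\<^esub> x) t = s \<odot>\<^bsub>B\<^esub> ract B x t"

definition lin_hom :: "'r ring \<Rightarrow> ('r, 'v) module \<Rightarrow> ('r, 'w) module \<Rightarrow> ('v \<Rightarrow> 'w) set" where
  "lin_hom R V W = {f \<in> carrier V \<rightarrow>\<^sub>E carrier W.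
     (\<forall>x\<in>carrier V. \<forall>y\<in>carrier V. f (x \<oplus>\<^bsub>V\<^esub> y) = f x \<oplus>\<^bsub>W\<^esub> f y) \<and>
     (\<forall>r\<in>carrier R. \<forall>x\<in>carrier V. f (r \<odot>\<^bsub>V\<^esub> x) = r \<odot>\<^bsub>W\<^esub> f x)}"

definition restrict_scalars :: "('s \<Rightarrow> 'r) \<Rightarrow> ('r, 'v) module \<Rightarrow> ('s, 'v) module" where
  "restrict_scalars h V = \<lparr>carrier = carrier V, monoid.mult = monoid.mult V,
     monoid.one = monoid.one V, ring.zero = ring.zero V, ring.add = ring.add V,
     smult = (\<lambda>s x. h s \<odot>\<^bsub>V\<^esub> x)\<rparr>"

definition quotient_module :: "('r, 'v) module \<Rightarrow> 'v set \<Rightarrow> ('r, 'v set) module" where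
  "quotient_module V H = \<lparr>carrier = carrier (V A_Mod H), monoid.mult = undefined,
     monoid.one = undefined, ring.zero = monoid.one (V A_Mod H), ring.add = monoid.mult (V A_Mod H),
     smult = (\<lambda>r X. \<Union>x\<in>X. H +>\<^bsub>V\<^esub> (r \<odot>\<^bsub>V\<^esub> x))\<rparr>"

text \<open>A ring as a bimodule over itself, and restriction of the right action along \<open>q\<close>.\<close>

definition self_bimodule :: "'r ring \<Rightarrow> ('r, 'r, 'r) bimodule" where
  "self_bimodule R = \<lparr>carrier = carrier R, monoid.mult = monoid.mult R,
     monoid.one = monoid.one R, ring.zero = ring.zero R, ring.add = ring.add R,
     smult = monoid.mult R, ract = monoid.mult R\<rparr>"

definition restrict_right :: "('x \<Rightarrow> 't) \<Rightarrow> ('s, 't, 'b) bimodule \<Rightarrow> ('s, 'x, 'b) bimodule" where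
  "restrict_right q B = \<lparr>carrier = carrier B, monoid.mult = monoid.mult B,
     monoid.one = monoid.one B, ring.zero = ring.zero B, ring.add = ring.add B,
     smult = smult B, ract = (\<lambda>b x. ract B b (q x))\<rparr>"


subsection \<open>The tensor product of a bimodule with a left module\<close>

type_synonym ('b, 'v) tens = "('b \<times> 'v \<Rightarrow>\<^sub>0 int) set"

definition tensor_relations ::
    "'t ring \<Rightarrow> ('s, 't, 'b) bimodule \<Rightarrow> ('t, 'v) module \<Rightarrow> ('b \<times> 'v \<Rightarrow>\<^sub>0 int) set" where
  "tensor_relations T B V =
     {frag_of (x \<oplus>\<^bsub>B\<^esub> y, v) - frag_of (x, v) - frag_of (y, v) | x y v.
        x \<in> carrier B \<and> y \<in> carrier B \<and> v \<in> carrier V} \<union>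
     {frag_of (x, v \<oplus>\<^bsub>V\<^esub> w) - frag_of (x, v) - frag_of (x, w) | x v w.
        x \<in> carrier B \<and> v \<in> carrier V \<and> w \<in> carrier V} \<union>
     {frag_of (ract B x t, v) - frag_of (x, t \<odot>\<^bsub>V\<^esub> v) | x t v.
        x \<in> carrier B \<and> t \<in> carrier T \<and> v \<in> carrier V}"

definition tensor_null ::
    "'t ring \<Rightarrow> ('s, 't, 'b) bimodule \<Rightarrow> ('t, 'v) module \<Rightarrow> ('b \<times> 'v \<Rightarrow>\<^sub>0 int) set" where
  "tensor_null T B V =
     generate (free_Abelian_group (carrier B \<times> carrier V)) (tensor_relations T B V)"

text \<open>The underlying additive group of \<open>B \<otimes>\<^sub>T V\<close>, and its pure tensors.\<close>

definition tensor_group ::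
    "'t ring \<Rightarrow> ('s, 't, 'b) bimodule \<Rightarrow> ('t, 'v) module \<Rightarrow> ('b, 'v) tens ring" where
  "tensor_group T B V =
     (let Q = free_Abelian_group (carrier B \<times> carrier V) Mod tensor_null T B V
      in \<lparr>carrier = carrier Q, monoid.mult = undefined,
     monoid.one = undefined,      ring.zero = monoid.one Q, ring.add = monoid.mult Q\<rparr>)"

definition tens ::
    "'t ring \<Rightarrow> ('s, 't, 'b) bimodule \<Rightarrow> ('t, 'v) module \<Rightarrow> 'b \<Rightarrow> 'v \<Rightarrow> ('b, 'v) tens" where
  "tens T B V x v =
     tensor_null T B V #>\<^bsub>free_Abelian_group (carrier B \<times> carrier V)\<^esub> frag_of (x, v)"

text \<open>The additive map \<open>B \<otimes>\<^sub>T V \<rightarrow> G\<close> with \<open>x \<otimes> v \<mapsto> \<beta> x v\<close>, for a balanced map \<open>\<beta>\<close>.\<close>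

definition tensor_lift :: "'t ring \<Rightarrow> ('s, 't, 'b) bimodule \<Rightarrow> ('t, 'v) module \<Rightarrow>
    ('g, 'i) ring_scheme \<Rightarrow> ('b \<Rightarrow> 'v \<Rightarrow> 'g) \<Rightarrow> ('b, 'v) tens \<Rightarrow> 'g" where
  "tensor_lift T B V G \<beta> = (\<lambda>X\<in>carrier (tensor_group T B V).
     the_elem ((\<lambda>c. finsum G (\<lambda>p. [Poly_Mapping.lookup c p] \<cdot>\<^bsub>G\<^esub> \<beta> (fst p) (snd p))
       (Poly_Mapping.keys c)) ` X))"

definition tensor ::
    "'t ring \<Rightarrow> ('s, 't, 'b) bimodule \<Rightarrow> ('t, 'v) module \<Rightarrow> ('s, ('b, 'v) tens) module" where
  "tensor T B V = \<lparr>carrier = carrier (tensor_group T B V), monoid.mult = undefined,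
     monoid.one = undefined, ring.zero = ring.zero (tensor_group T B V), ring.add = ring.add (tensor_group T B V),
     smult = (\<lambda>s. tensor_lift T B V (tensor_group T B V) (\<lambda>x v. tens T B V (s \<odot>\<^bsub>B\<^esub> x) v))\<rparr>"


subsection \<open>Finitely generated projective modules and pointed functors\<close>

text \<open>As \<open>'u\<close> is infinite and at least as large as the ring, it contains copies of all finite free
  modules; so lifting against surjections of modules in \<open>'u\<close> is projectivity for finitely
  generated modules in \<open>'u\<close>.\<close>

definition fg_projective :: "'r ring \<Rightarrow> ('r, 'u) module set" where
  "fg_projective R = {V. left_module R V \<and>
     (\<exists>A. finite A \<and> A \<subseteq> carrier V \<and>
        (\<forall>H. A \<subseteq> H \<and> subgroup H (add_monoid V) \<and> (\<forall>r\<in>carrier R. \<forall>x\<in>H. r \<odot>\<^bsub>V\<^esub> x \<in> H)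
           \<longrightarrow> H = carrier V)) \<and>
     (\<forall>(N :: ('r, 'u) module) (N' :: ('r, 'u) module). left_module R N \<and> left_module R N' \<longrightarrow>
        (\<forall>p\<in>lin_hom R N N'. p ` carrier N = carrier N' \<longrightarrow>
          (\<forall>f\<in>lin_hom R V N'. \<exists>g\<in>lin_hom R V N. compose (carrier V) p g = f)))}"

record ('s, 'u, 't, 'x) pfunctor =
  fobj :: "('s, 'u) module \<Rightarrow> ('t, 'x) module"
  fmap :: "('s, 'u) module \<Rightarrow> ('s, 'u) module \<Rightarrow> ('u \<Rightarrow> 'u) \<Rightarrow> 'x \<Rightarrow> 'x"

text \<open>Objects and morphisms of \<open>\<B>(S,T)\<close>. Kernels, images, injectivity and surjectivity in this
  abelian category are computed objectwise.\<close>

definition pointed_functor :: "'s ring \<Rightarrow> 't ring \<Rightarrow> ('s, 'u, 't, 'x) pfunctor \<Rightarrow> bool" where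
  "pointed_functor S T F \<longleftrightarrow>
     (\<forall>V\<in>fg_projective S. left_module T (fobj F V)) \<and>
     (\<forall>V\<in>fg_projective S. \<forall>W\<in>fg_projective S. \<forall>f\<in>lin_hom S V W.
        fmap F V W f \<in> lin_hom T (fobj F V) (fobj F W)) \<and>
     (\<forall>V\<in>fg_projective S. fmap F V V (\<lambda>x\<in>carrier V. x) = (\<lambda>x\<in>carrier (fobj F V). x)) \<and>
     (\<forall>V\<in>fg_projective S. \<forall>W\<in>fg_projective S. \<forall>U\<in>fg_projective S.
        \<forall>f\<in>lin_hom S V W. \<forall>g\<in>lin_hom S W U.
          fmap F V U (compose (carrier V) g f) =
            compose (carrier (fobj F V)) (fmap F W U g) (fmap F V W f)) \<and>
     (\<forall>V\<in>fg_projective S. carrier V = {\<zero>\<^bsub>V\<^esub>} \<longrightarrow> carrier (fobj F V) = {\<zero>\<^bsub>fobj F V\<^esub>})"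

definition nat_hom :: "'s ring \<Rightarrow> 't ring \<Rightarrow> ('s, 'u, 't, 'x) pfunctor \<Rightarrow> ('s, 'u, 't, 'y) pfunctor \<Rightarrow>
    (('s, 'u) module \<Rightarrow> 'x \<Rightarrow> 'y) set" where
  "nat_hom S T F G = {\<eta> \<in> (\<Pi>\<^sub>E V\<in>fg_projective S. lin_hom T (fobj F V) (fobj G V)).
     \<forall>V\<in>fg_projective S. \<forall>W\<in>fg_projective S. \<forall>f\<in>lin_hom S V W. \<forall>x\<in>carrier (fobj F V).
       \<eta> W (fmap F V W f x) = fmap G V W f (\<eta> V x)}"

definition taut_functor :: "('r, 'u, 'r, 'u) pfunctor" where
  "taut_functor = \<lparr>fobj = (\<lambda>V. V), fmap = (\<lambda>V W f. f)\<rparr>"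

definition restrict_functor ::
    "('t' \<Rightarrow> 't) \<Rightarrow> ('s, 'u, 't, 'x) pfunctor \<Rightarrow> ('s, 'u, 't', 'x) pfunctor" where
  "restrict_functor h F = \<lparr>fobj = (\<lambda>V. restrict_scalars h (fobj F V)), fmap = fmap F\<rparr>"

definition tensor_functor :: "'t ring \<Rightarrow> ('a, 't, 'b) bimodule \<Rightarrow> ('s, 'u, 't, 'x) pfunctor \<Rightarrow>
    ('s, 'u, 'a, ('b, 'x) tens) pfunctor" where
  "tensor_functor T B F = \<lparr>fobj = (\<lambda>V. tensor T B (fobj F V)),
     fmap = (\<lambda>V W f. tensor_lift T B (fobj F V) (tensor T B (fobj F W))
                       (\<lambda>b x. tens T B (fobj F W) b (fmap F V W f x)))\<rparr>"

definition tensor_nat :: "'s ring \<Rightarrow> 't ring \<Rightarrow> ('a, 't, 'b) bimodule \<Rightarrow> ('s, 'u, 't, 'x) pfunctor \<Rightarrow>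
    ('s, 'u, 't, 'y) pfunctor \<Rightarrow> (('s, 'u) module \<Rightarrow> 'x \<Rightarrow> 'y) \<Rightarrow>
    ('s, 'u) module \<Rightarrow> ('b, 'x) tens \<Rightarrow> ('b, 'y) tens" where
  "tensor_nat S T B F G \<eta> = (\<lambda>V\<in>fg_projective S.
     tensor_lift T B (fobj F V) (tensor T B (fobj G V)) (\<lambda>b x. tens T B (fobj G V) b (\<eta> V x)))"

definition quotient_functor :: "('s, 'u, 't, 'x) pfunctor \<Rightarrow> (('s, 'u) module \<Rightarrow> 'x set) \<Rightarrow>
    ('s, 'u, 't, 'x set) pfunctor" where
  "quotient_functor F H = \<lparr>fobj = (\<lambda>V. quotient_module (fobj F V) (H V)),
     fmap = (\<lambda>V W f. \<lambda>X\<in>carrier (quotient_module (fobj F V) (H V)).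
               \<Union>x\<in>X. H W +>\<^bsub>fobj F W\<^esub> fmap F V W f x)\<rparr>"

text \<open>The functor \<open>V \<mapsto> M \<otimes>\<^sub>R V\<close>.\<close>

definition I_functor :: "'r ring \<Rightarrow> ('r, 'r, 'm) bimodule \<Rightarrow> ('r, 'u, 'r, ('m, 'u) tens) pfunctor" where
  "I_functor R M = tensor_functor R M taut_functor"

text \<open>Abelian groups are modules over \<open>\<Z>\<close>, and the forgetful functor is restriction of scalars along
  the unique ring map \<open>\<Z> \<rightarrow> R\<close>.\<close>

definition forget :: "'r ring \<Rightarrow> ('s, 'u, 'r, 'x) pfunctor \<Rightarrow> ('s, 'u, int, 'x) pfunctor" where
  "forget R F = restrict_functor (\<lambda>n. [n] \<cdot>\<^bsub>R\<^esub> \<one>\<^bsub>R\<^esub>) F"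


subsection \<open>Elementary extensions and splittings\<close>

record ('s, 'u, 't, 'a, 'b, 'x, 'y) el_ext =
  C0 :: "('s, 'u, 't, 'x) pfunctor"
  C1 :: "('s, 'u, 't, 'y) pfunctor"
  ediff :: "('s, 'u) module \<Rightarrow> 'y \<Rightarrow> 'x"
  ea :: "('s, 'u) module \<Rightarrow> 'x \<Rightarrow> 'a"
  eb :: "('s, 'u) module \<Rightarrow> 'b \<Rightarrow> 'y"

text \<open>Elementary extensions of \<open>A\<close> by \<open>B\<close> in \<open>\<B>(S,T)\<close>. For a complex in degrees \<open>0,1\<close>, quasiexactness
  of \<open>0 \<rightarrow> B[1] \<rightarrow> C \<rightarrow> A \<rightarrow> 0\<close> says that \<open>b\<close> is injective, \<open>a\<close> is surjective and
  \<open>C\<^sub>1 / b(B) \<rightarrow> Ker a\<close> is an isomorphism, that is, \<open>0 \<rightarrow> B \<rightarrow> C\<^sub>1 \<rightarrow> C\<^sub>0 \<rightarrow> A \<rightarrow> 0\<close> is exact.\<close>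

definition is_el_ext :: "'s ring \<Rightarrow> 't ring \<Rightarrow> ('s, 'u, 't, 'a) pfunctor \<Rightarrow> ('s, 'u, 't, 'b) pfunctor \<Rightarrow>
    ('s, 'u, 't, 'a, 'b, 'x, 'y) el_ext \<Rightarrow> bool" where
  "is_el_ext S T A B E \<longleftrightarrow>
     pointed_functor S T (C0 E) \<and> pointed_functor S T (C1 E) \<and>
     ediff E \<in> nat_hom S T (C1 E) (C0 E) \<and> ea E \<in> nat_hom S T (C0 E) A \<and>
     eb E \<in> nat_hom S T B (C1 E) \<and>
     (\<forall>V\<in>fg_projective S.
        inj_on (eb E V) (carrier (fobj B V)) \<and>
        eb E V ` carrier (fobj B V) = a_kernel (fobj (C1 E) V) (fobj (C0 E) V) (ediff E V) \<and>
        ediff E V ` carrier (fobj (C1 E) V) = a_kernel (fobj (C0 E) V) (fobj A V) (ea E V) \<and>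
        ea E V ` carrier (fobj (C0 E) V) = carrier (fobj A V))"

definition el_mor :: "'s ring \<Rightarrow> 't ring \<Rightarrow> ('s, 'u, 't, 'b) pfunctor \<Rightarrow>
    ('s, 'u, 't, 'a, 'b, 'x, 'y) el_ext \<Rightarrow> ('s, 'u, 't, 'a, 'b, 'x', 'y') el_ext \<Rightarrow>
    (('s, 'u) module \<Rightarrow> 'x \<Rightarrow> 'x') \<Rightarrow> (('s, 'u) module \<Rightarrow> 'y \<Rightarrow> 'y') \<Rightarrow> bool" where
  "el_mor S T B E E' f0 f1 \<longleftrightarrow>
     f0 \<in> nat_hom S T (C0 E) (C0 E') \<and> f1 \<in> nat_hom S T (C1 E) (C1 E') \<and>
     (\<forall>V\<in>fg_projective S.
        (\<forall>y\<in>carrier (fobj (C1 E) V). f0 V (ediff E V y) = ediff E' V (f1 V y)) \<and>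
        (\<forall>x\<in>carrier (fobj (C0 E) V). ea E' V (f0 V x) = ea E V x) \<and>
        (\<forall>z\<in>carrier (fobj B V). f1 V (eb E V z) = eb E' V z))"

definition el_iso :: "'s ring \<Rightarrow> 't ring \<Rightarrow> ('s, 'u, 't, 'b) pfunctor \<Rightarrow>
    ('s, 'u, 't, 'a, 'b, 'x, 'y) el_ext \<Rightarrow> ('s, 'u, 't, 'a, 'b, 'x', 'y') el_ext \<Rightarrow> bool" where
  "el_iso S T B E E' \<longleftrightarrow> (\<exists>f0 f1. el_mor S T B E E' f0 f1 \<and>
     (\<forall>V\<in>fg_projective S.
        bij_betw (f0 V) (carrier (fobj (C0 E) V)) (carrier (fobj (C0 E') V)) \<and>
        bij_betw (f1 V) (carrier (fobj (C1 E) V)) (carrier (fobj (C1 E') V))))"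

record ('s, 'u, 't, 'x, 'y, 'z) splitting =
  C01 :: "('s, 'u, 't, 'z) pfunctor"
  sc1 :: "('s, 'u) module \<Rightarrow> 'y \<Rightarrow> 'z"
  sc0 :: "('s, 'u) module \<Rightarrow> 'z \<Rightarrow> 'x"

definition is_splitting :: "'s ring \<Rightarrow> 't ring \<Rightarrow> ('s, 'u, 't, 'b) pfunctor \<Rightarrow>
    ('s, 'u, 't, 'a, 'b, 'x, 'y) el_ext \<Rightarrow> ('s, 'u, 't, 'x, 'y, 'z) splitting \<Rightarrow> bool" where
  "is_splitting S T B E D \<longleftrightarrow>
     pointed_functor S T (C01 D) \<and>
     sc1 D \<in> nat_hom S T (C1 E) (C01 D) \<and> sc0 D \<in> nat_hom S T (C01 D) (C0 E) \<and>
     (\<forall>V\<in>fg_projective S.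
        inj_on (sc1 D V) (carrier (fobj (C1 E) V)) \<and>
        sc0 D V ` carrier (fobj (C01 D) V) = carrier (fobj (C0 E) V) \<and>
        (\<forall>y\<in>carrier (fobj (C1 E) V). sc0 D V (sc1 D V y) = ediff E V y) \<and>
        a_kernel (fobj (C01 D) V) (fobj (C0 E) V) (sc0 D V) =
          sc1 D V ` eb E V ` carrier (fobj B V))"

text \<open>Postcomposition with the forgetful functor; the maps do not change.\<close>

definition forget_ext :: "'r ring \<Rightarrow> ('s, 'u, 'r, 'a, 'b, 'x, 'y) el_ext \<Rightarrow>
    ('s, 'u, int, 'a, 'b, 'x, 'y) el_ext" where
  "forget_ext R E = \<lparr>C0 = forget R (C0 E), C1 = forget R (C1 E),
     ediff = ediff E, ea = ea E, eb = eb E\<rparr>"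


subsection \<open>The set of classes of elementary extensions of \<open>R\<close> by \<open>M\<close>\<close>

abbreviation el_ext_of :: "'r ring \<Rightarrow> ('r, 'r, 'm) bimodule \<Rightarrow>
    ('r, 'u, 'r, 'u, ('m, 'u) tens, 'x, 'y) el_ext \<Rightarrow> bool" where
  "el_ext_of R M \<equiv> is_el_ext R R taut_functor (I_functor R M)"

definition el_connected :: "'r ring \<Rightarrow> ('r, 'r, 'm) bimodule \<Rightarrow>
    ('r, 'u, 'r, 'u, ('m, 'u) tens, 'u, 'u) el_ext rel" where
  "el_connected R M = {(E, E'). el_ext_of R M E \<and> el_ext_of R M E' \<and>
     equivclp (\<lambda>D D'. el_ext_of R M D \<and> el_ext_of R M D' \<and>
       (\<exists>f0 f1. el_mor R R (I_functor R M) D D' f0 f1)) E E'}"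

definition El :: "'r ring \<Rightarrow> ('r, 'r, 'm) bimodule \<Rightarrow>
    ('r, 'u, 'r, 'u, ('m, 'u) tens, 'u, 'u) el_ext set set" where
  "El R M = {E. el_ext_of R M E} // el_connected R M"

text \<open>The component of an extension \<open>E\<close> whose terms need not have values in \<open>'u\<close>.\<close>

definition el_class :: "'r ring \<Rightarrow> ('r, 'r, 'm) bimodule \<Rightarrow>
    ('r, 'u, 'r, 'u, ('m, 'u) tens, 'x, 'y) el_ext \<Rightarrow>
    ('r, 'u, 'r, 'u, ('m, 'u) tens, 'u, 'u) el_ext set" where
  "el_class R M E = {E'. \<exists>D. el_ext_of R M D \<and> el_iso R R (I_functor R M) D E \<and>
     (D, E') \<in> el_connected R M}"


subsection \<open>Square-zero extensions\<close>

record ('r, 'm, 'x) sq_ext =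
  sq_ring :: "'x ring"
  sq_i :: "'m \<Rightarrow> 'x"
  sq_q :: "'x \<Rightarrow> 'r"

definition is_sq_ext :: "'r ring \<Rightarrow> ('r, 'r, 'm) bimodule \<Rightarrow> ('r, 'm, 'x) sq_ext \<Rightarrow> bool" where
  "is_sq_ext R M X \<longleftrightarrow> ring (sq_ring X) \<and>
     sq_i X \<in> hom (add_monoid M) (add_monoid (sq_ring X)) \<and>
     sq_q X \<in> ring_hom (sq_ring X) R \<and>
     inj_on (sq_i X) (carrier M) \<and>
     sq_q X ` carrier (sq_ring X) = carrier R \<and>
     sq_i X ` carrier M = a_kernel (sq_ring X) R (sq_q X) \<and>
     (\<forall>m\<in>carrier M. \<forall>x\<in>carrier (sq_ring X).
        sq_i X m \<otimes>\<^bsub>sq_ring X\<^esub> x = sq_i X (ract M m (sq_q X x)) \<and>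
        x \<otimes>\<^bsub>sq_ring X\<^esub> sq_i X m = sq_i X (sq_q X x \<odot>\<^bsub>M\<^esub> m)) \<and>
     (\<forall>m\<in>carrier M. \<forall>m'\<in>carrier M. sq_i X m \<otimes>\<^bsub>sq_ring X\<^esub> sq_i X m' = \<zero>\<^bsub>sq_ring X\<^esub>)"

definition sq_iso :: "('r, 'r, 'm) bimodule \<Rightarrow> ('r, 'm, 'x) sq_ext \<Rightarrow> ('r, 'm, 'y) sq_ext \<Rightarrow> bool" where
  "sq_iso M X Y \<longleftrightarrow> (\<exists>\<phi>\<in>ring_iso (sq_ring X) (sq_ring Y).
     (\<forall>m\<in>carrier M. \<phi> (sq_i X m) = sq_i Y m) \<and>
     (\<forall>x\<in>carrier (sq_ring X). sq_q Y (\<phi> x) = sq_q X x))"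

definition Sq :: "'r ring \<Rightarrow> ('r, 'r, 'm) bimodule \<Rightarrow> ('r, 'm, 'u) sq_ext set set" where
  "Sq R M = {X. is_sq_ext R M X} // {(X, Y). is_sq_ext R M X \<and> is_sq_ext R M Y \<and> sq_iso M X Y}"

definition sq_class :: "'r ring \<Rightarrow> ('r, 'r, 'm) bimodule \<Rightarrow> ('r, 'm, 'x) sq_ext \<Rightarrow>
    ('r, 'm, 'u) sq_ext set" where
  "sq_class R M X = {Y. is_sq_ext R M Y \<and> sq_iso M Y X}"


subsection \<open>The map \<open>\<Phi>\<close>\<close>

definition projective_functor :: "'s ring \<Rightarrow> 't ring \<Rightarrow> ('s, 'u, 't, 'x) pfunctor \<Rightarrow> bool" where
  "projective_functor S T P \<longleftrightarrow> pointed_functor S T P \<and>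
     (\<forall>(G :: ('s, 'u, 't, 'x) pfunctor) (H :: ('s, 'u, 't, 'x) pfunctor).
       pointed_functor S T G \<and> pointed_functor S T H \<longrightarrow>
       (\<forall>\<pi>\<in>nat_hom S T G H.
          (\<forall>V\<in>fg_projective S. \<pi> V ` carrier (fobj G V) = carrier (fobj H V)) \<longrightarrow>
          (\<forall>\<phi>\<in>nat_hom S T P H. \<exists>\<psi>\<in>nat_hom S T P G.
             \<forall>V\<in>fg_projective S. \<forall>x\<in>carrier (fobj P V). \<pi> V (\<psi> V x) = \<phi> V x)))"

record ('s, 'u, 't, 'x, 'a) resolution =
  rP :: "nat \<Rightarrow> ('s, 'u, 't, 'x) pfunctor"
  rd :: "nat \<Rightarrow> ('s, 'u) module \<Rightarrow> 'x \<Rightarrow> 'x" \<comment> \<open>\<open>rd n\<close> goes from degree \<open>n + 1\<close> to degree \<open>n\<close>\<close>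
  raug :: "('s, 'u) module \<Rightarrow> 'x \<Rightarrow> 'a"

definition projective_resolution :: "'s ring \<Rightarrow> 't ring \<Rightarrow> ('s, 'u, 't, 'a) pfunctor \<Rightarrow>
    ('s, 'u, 't, 'x, 'a) resolution \<Rightarrow> bool" where
  "projective_resolution S T F P \<longleftrightarrow>
     (\<forall>n. projective_functor S T (rP P n)) \<and>
     (\<forall>n. rd P n \<in> nat_hom S T (rP P (Suc n)) (rP P n)) \<and>
     raug P \<in> nat_hom S T (rP P 0) F \<and>
     (\<forall>V\<in>fg_projective S.
        raug P V ` carrier (fobj (rP P 0) V) = carrier (fobj F V) \<and>
        rd P 0 V ` carrier (fobj (rP P 1) V) =
          a_kernel (fobj (rP P 0) V) (fobj F V) (raug P V) \<and>
        (\<forall>n. rd P (Suc n) V ` carrier (fobj (rP P (Suc (Suc n))) V) =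
          a_kernel (fobj (rP P (Suc n)) V) (fobj (rP P n) V) (rd P n V)))"

definition q_star :: "('r, 'm, 'x) sq_ext \<Rightarrow> ('r, 'u, 'r, 'a) pfunctor \<Rightarrow> ('r, 'u, 'x, 'a) pfunctor" where
  "q_star X F = restrict_functor (sq_q X) F"

text \<open>\<open>R\<close> as an \<open>(R, R')\<close>-bimodule, and \<open>M\<close> as a right \<open>R'\<close>-module.\<close>

abbreviation R_via :: "'r ring \<Rightarrow> ('r, 'm, 'x) sq_ext \<Rightarrow> ('r, 'x, 'r) bimodule" where
  "R_via R X \<equiv> restrict_right (sq_q X) (self_bimodule R)"

abbreviation M_via :: "('r, 'r, 'm) bimodule \<Rightarrow> ('r, 'm, 'x) sq_ext \<Rightarrow> ('r, 'x, 'm) bimodule" where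
  "M_via M X \<equiv> restrict_right (sq_q X) M"

definition q_pull :: "'r ring \<Rightarrow> ('r, 'm, 'x) sq_ext \<Rightarrow> ('r, 'u, 'x, 'y) pfunctor \<Rightarrow>
    ('r, 'u, 'r, ('r, 'y) tens) pfunctor" where
  "q_pull R X F = tensor_functor (sq_ring X) (R_via R X) F"

text \<open>The image of \<open>R \<otimes> P\<^sub>2 \<rightarrow> R \<otimes> P\<^sub>1\<close>.\<close>

definition tau_boundaries :: "'r ring \<Rightarrow> ('r, 'm, 'x) sq_ext \<Rightarrow> ('r, 'u, 'x, 'p, 'u) resolution \<Rightarrow>
    ('r, 'u) module \<Rightarrow> ('r, 'p) tens set" where
  "tau_boundaries R X P V =
     tensor_nat R (sq_ring X) (R_via R X) (rP P 2) (rP P 1) (rd P 1) V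
       ` carrier (fobj (q_pull R X (rP P 2)) V)"

text \<open>The graph of the connecting map \<open>H\<^sub>1(R \<otimes> P) \<rightarrow> H\<^sub>0(M \<otimes> P) = M \<otimes>\<^sub>R V\<close> of the exact sequence
  \<open>0 \<rightarrow> M \<otimes> P \<rightarrow> P \<rightarrow> R \<otimes> P \<rightarrow> 0\<close> of complexes (tensor products over \<open>R'\<close>, evaluated at \<open>V\<close>):
  the class \<open>z\<close> lifts to \<open>x \<in> P\<^sub>1\<close>, whose differential comes from \<open>\<mu> \<in> M \<otimes> P\<^sub>0\<close>, and \<open>\<mu>\<close> is
  mapped to \<open>M \<otimes>\<^sub>R V\<close> by the augmentation.\<close>

definition connecting :: "'r ring \<Rightarrow> ('r, 'r, 'm) bimodule \<Rightarrow> ('r, 'm, 'x) sq_ext \<Rightarrow>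
    ('r, 'u, 'x, 'p, 'u) resolution \<Rightarrow> ('r, 'u) module \<Rightarrow>
    ('r, 'p) tens set \<Rightarrow> ('m, 'u) tens \<Rightarrow> bool" where
  "connecting R M X P V z t \<longleftrightarrow>
     (\<exists>x\<in>carrier (fobj (rP P 1) V).
      \<exists>\<mu>\<in>carrier (tensor_group (sq_ring X) (M_via M X) (fobj (rP P 0) V)).
        z = tau_boundaries R X P V +>\<^bsub>fobj (q_pull R X (rP P 1)) V\<^esub>
              tens (sq_ring X) (R_via R X) (fobj (rP P 1) V) \<one>\<^bsub>R\<^esub> x \<and>
        rd P 0 V x = tensor_lift (sq_ring X) (M_via M X) (fobj (rP P 0) V) (fobj (rP P 0) V)
              (\<lambda>m p. sq_i X m \<odot>\<^bsub>fobj (rP P 0) V\<^esub> p) \<mu> \<and>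
        t = tensor_lift (sq_ring X) (M_via M X) (fobj (rP P 0) V) (tensor R M V)
              (\<lambda>m p. tens R M V m (raug P V p)) \<mu>)"

text \<open>\<open>\<tau>\<^sub>[\<^sub>0\<^sub>,\<^sub>1\<^sub>] q\<^sup>* P\<close>: in degree \<open>0\<close> it is \<open>R \<otimes> P\<^sub>0\<close>, in degree \<open>1\<close> the quotient of
  \<open>R \<otimes> P\<^sub>1\<close> by the boundaries. The map \<open>a\<close> is \<open>r \<otimes> p \<mapsto> r \<epsilon>(p)\<close>, i.e. the augmentation followed by
  \<open>R \<otimes> V \<cong> V\<close>, and \<open>b\<close> is the inverse of the connecting map.\<close>

definition tau_ext :: "'r ring \<Rightarrow> ('r, 'r, 'm) bimodule \<Rightarrow> ('r, 'm, 'x) sq_ext \<Rightarrow>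
    ('r, 'u, 'x, 'p, 'u) resolution \<Rightarrow>
    ('r, 'u, 'r, 'u, ('m, 'u) tens, ('r, 'p) tens, ('r, 'p) tens set) el_ext" where
  "tau_ext R M X P =
     (let K0 = q_pull R X (rP P 0);
          K1 = quotient_functor (q_pull R X (rP P 1)) (tau_boundaries R X P);
          \<delta> = tensor_nat R (sq_ring X) (R_via R X) (rP P 1) (rP P 0) (rd P 0)
      in \<lparr>C0 = K0, C1 = K1,
          ediff = (\<lambda>V\<in>fg_projective R. \<lambda>Y\<in>carrier (fobj K1 V). the_elem (\<delta> V ` Y)),
          ea = (\<lambda>V\<in>fg_projective R.
                  tensor_lift (sq_ring X) (R_via R X) (fobj (rP P 0) V) V
                    (\<lambda>r p. r \<odot>\<^bsub>V\<^esub> raug P V p)),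
          eb = (\<lambda>V\<in>fg_projective R. \<lambda>t\<in>carrier (tensor R M V).
                  THE z. connecting R M X P V z t)\<rparr>)"

text \<open>The description is proper exactly when a resolution exists and the class does not depend on
  the choices of the representative \<open>X\<close> and of the resolution \<open>P\<close>; likewise for \<open>\<Psi>\<close> below with
  the choices of \<open>E\<close> and of its splitting \<open>D\<close>.\<close>

definition Phi :: "'r ring \<Rightarrow> ('r, 'r, 'm) bimodule \<Rightarrow> ('r, 'm, 'u) sq_ext set \<Rightarrow>
    ('r, 'u, 'r, 'u, ('m, 'u) tens, 'u, 'u) el_ext set" where
  "Phi R M \<xi> = (THE e. \<exists>X\<in>\<xi>. \<exists>P :: ('r, 'u, 'u, 'u, 'u) resolution.
     projective_resolution R (sq_ring X) (q_star X taut_functor) P \<and>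
     e = el_class R M (tau_ext R M X P))"


subsection \<open>The map \<open>\<Psi>\<close>\<close>

definition regular_via :: "'r ring \<Rightarrow> ('r, 'u, 'r, 'a, 'b, 'x, 'y) el_ext \<Rightarrow>
    ('r, 'u, int, 'x, 'y, 'z) splitting \<Rightarrow> (('r, 'u) module \<Rightarrow> 'z \<Rightarrow> 'z) \<Rightarrow> 'r \<Rightarrow> bool" where
  "regular_via R E D \<eta> r \<longleftrightarrow> r \<in> carrier R \<and>
     (\<forall>V\<in>fg_projective R.
        (\<forall>x\<in>carrier (fobj (C01 D) V). sc0 D V (\<eta> V x) = r \<odot>\<^bsub>fobj (C0 E) V\<^esub> sc0 D V x) \<and>
        (\<forall>y\<in>carrier (fobj (C1 E) V). \<eta> V (sc1 D V y) = sc1 D V (r \<odot>\<^bsub>fobj (C1 E) V\<^esub> y)))"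

definition regular_ring :: "'r ring \<Rightarrow> ('r, 'u, 'r, 'a, 'b, 'x, 'y) el_ext \<Rightarrow>
    ('r, 'u, int, 'x, 'y, 'z) splitting \<Rightarrow> (('r, 'u) module \<Rightarrow> 'z \<Rightarrow> 'z) ring" where
  "regular_ring R E D =
     \<lparr>carrier = {\<eta> \<in> nat_hom R \<Z> (C01 D) (C01 D). \<exists>r. regular_via R E D \<eta> r},
      monoid.mult = (\<lambda>\<eta> \<theta>. \<lambda>V\<in>fg_projective R. compose (carrier (fobj (C01 D) V)) (\<eta> V) (\<theta> V)),
      monoid.one = (\<lambda>V\<in>fg_projective R. \<lambda>x\<in>carrier (fobj (C01 D) V). x),
      ring.zero = (\<lambda>V\<in>fg_projective R. \<lambda>x\<in>carrier (fobj (C01 D) V). \<zero>\<^bsub>fobj (C01 D) V\<^esub>),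
      ring.add = (\<lambda>\<eta> \<theta>. \<lambda>V\<in>fg_projective R. \<lambda>x\<in>carrier (fobj (C01 D) V).
               \<eta> V x \<oplus>\<^bsub>fobj (C01 D) V\<^esub> \<theta> V x)\<rparr>"

definition regular_ext :: "'r ring \<Rightarrow> ('r, 'r, 'm) bimodule \<Rightarrow>
    ('r, 'u, 'r, 'u, ('m, 'u) tens, 'x, 'y) el_ext \<Rightarrow>
    ('r, 'u, int, 'x, 'y, 'z) splitting \<Rightarrow> ('r, 'm, ('r, 'u) module \<Rightarrow> 'z \<Rightarrow> 'z) sq_ext" where
  "regular_ext R M E D =
     \<lparr>sq_ring = regular_ring R E D,
      sq_i = (\<lambda>m. \<lambda>V\<in>fg_projective R. \<lambda>x\<in>carrier (fobj (C01 D) V).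
                sc1 D V (eb E V (tens R M V m (ea E V (sc0 D V x))))),
      sq_q = (\<lambda>\<eta>. THE r. regular_via R E D \<eta> r)\<rparr>"

definition Psi :: "'r ring \<Rightarrow> ('r, 'r, 'm) bimodule \<Rightarrow>
    ('r, 'u, 'r, 'u, ('m, 'u) tens, 'u, 'u) el_ext set \<Rightarrow> ('r, 'm, 'u) sq_ext set" where
  "Psi R M e = (THE \<xi>. \<exists>E\<in>e. \<exists>D :: ('r, 'u, int, 'u, 'u, 'u) splitting.
     is_splitting R \<Z> (forget R (I_functor R M)) (forget_ext R E) D \<and>
     \<xi> = sq_class R M (regular_ext R M E D))"

end

theory Submission
  imports Defs
begin

text \<open>
  A lift of the generator of the free module of rank one to a splitting \<open>C\<^sub>0\<^sub>1\<close> is, by the Yoneda lemma, a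
  natural section of \<open>C\<^sub>0\<^sub>1 \<rightarrow> V\<close>, in general not additive. Natural operations with values in the additive
  functor \<open>M \<otimes> V\<close> are determined by their restrictions to direct summands, so the failure of additivity is
  controlled by one element at the free module of rank two. This yields the splitting as an extension by a
  cocycle, and shows that maps out of it are determined by \<open>C\<^sub>1\<close> and the section; in particular the ring
  of regular endomorphisms is invariant under morphisms of elementary extensions.

  For a resolution \<open>P\<close> over a square-zero extension \<open>X\<close> with augmentation \<open>\<epsilon>\<close>, the quotient
  \<open>P\<^sub>0 / M Ker \<epsilon>\<close> is a splitting of the truncated complex on which \<open>X\<close> acts by regular endomorphisms, and
  a morphism of square-zero extensions is an isomorphism; so \<open>\<Psi>\<close> after \<open>\<Phi>\<close> is the identity. Conversely, if
  \<open>X\<close> acts on the splitting \<open>C\<^sub>0\<^sub>1\<close> of \<open>E\<close>, then \<open>\<epsilon>\<close> lifts to \<open>P\<^sub>0 \<rightarrow> C\<^sub>0\<^sub>1\<close> by projectivity, and the lift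
  induces a morphism from the truncated complex to \<open>E\<close>; so \<open>\<Phi>\<close> after \<open>\<Psi>\<close> is the identity.
\<close>

text \<open>Two obstacles shape the proof. The terms of an extension need not be additive functors,
  so identities cannot be tested on generators of a module. They are tested on tuples: two natural
  operations with the same image under \<open>d\<close> or \<open>c0\<close> differ by an operation
  with values in \<open>M \<otimes> V\<close>, which vanishes as soon as it does so when the first
  argument is zero and when all the others are. Moreover \<open>C01\<close> is only a functor to
  abelian groups; the value at the lift of the generator, together with the scalar, serves as a
  coordinate for its regular endomorphisms.

  Uniqueness of the splitting is not proved separately: invariance under morphisms, applied to the
  identity, compares any two splittings of one extension.

  Injectivity of \<open>b\<close> for the truncated complex is the computation of a Tor group. It is
  obtained by lifting the augmentation of \<open>P0\<close> to a functor with free values, where a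
  relation among elements \<open>i(m) p\<close> is read off in coordinates. The lifting property is
  used for this and for the map to \<open>C01\<close>, both times in degree zero; the component in
  degree one is then forced by injectivity of \<open>c1\<close>.\<close>

abbreviation add_in ("_ \<oplus>[_] _" [65, 0, 66] 65) where "x \<oplus>[G] y \<equiv> x \<oplus>\<^bsub>G\<^esub> y"
abbreviation minus_in ("_ \<ominus>[_] _" [65, 0, 66] 65) where "x \<ominus>[G] y \<equiv> x \<ominus>\<^bsub>G\<^esub> y"
abbreviation neg_in ("\<ominus>[_] _" [0, 81] 80) where "\<ominus>[G] x \<equiv> \<ominus>\<^bsub>G\<^esub> x"
abbreviation mult_in ("_ \<otimes>[_] _" [70, 0, 71] 70) where "x \<otimes>[G] y \<equiv> x \<otimes>\<^bsub>G\<^esub> y"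
abbreviation smult_in ("_ \<odot>[_] _" [70, 0, 71] 70) where "r \<odot>[V] x \<equiv> r \<odot>\<^bsub>V\<^esub> x"
abbreviation zero_in ("\<zero>[_]") where "\<zero>[G] \<equiv> \<zero>\<^bsub>G\<^esub>"
abbreviation one_in ("\<one>[_]") where "\<one>[G] \<equiv> \<one>\<^bsub>G\<^esub>"
abbreviation pts :: "('s, 'u, 't, 'x) pfunctor \<Rightarrow> ('s, 'u) module \<Rightarrow> 'x set" where "pts F V \<equiv> carrier (fobj F V)"
abbreviation fgp :: "'r ring \<Rightarrow> ('r, 'u) module set" where "fgp \<equiv> fg_projective"

section \<open>Calculation in abelian groups and additive maps\<close>

context abelian_group begin

lemma cancel_neg2: "\<lbrakk>x\<in>carrier G; y\<in>carrier G; z\<in>carrier G\<rbrakk> \<Longrightarrow> x \<oplus> (y \<oplus> (\<ominus> x \<oplus> z)) = y \<oplus> z"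
  by (metis a_closed a_inv_closed a_lcomm r_neg2)

lemma cancel_neg1: "\<lbrakk>x\<in>carrier G; y\<in>carrier G\<rbrakk> \<Longrightarrow> x \<oplus> (y \<oplus> \<ominus> x) = y"
  using cancel_neg2[of x y \<zero>] by simp

text \<open>Ordered rewriting with \<open>a_ac\<close> sorts a sum but may leave other summands
  between \<open>x\<close> and \<open>\<ominus> x\<close>. These rules cancel such a pair across up
  to four summands, so that \<open>group_simps\<close> settles most identities met below.\<close>

lemma cancel_neg:
  "\<lbrakk>x\<in>carrier G; y\<in>carrier G; z\<in>carrier G\<rbrakk> \<Longrightarrow> x \<oplus> (y \<oplus> (z \<oplus> \<ominus> x)) = y \<oplus> z"
  "\<lbrakk>x\<in>carrier G; y\<in>carrier G; z\<in>carrier G; w\<in>carrier G\<rbrakk> \<Longrightarrow> x \<oplus> (y \<oplus> (z \<oplus> (\<ominus> x \<oplus> w))) = y \<oplus> (z \<oplus> w)"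
  "\<lbrakk>x\<in>carrier G; y\<in>carrier G; z\<in>carrier G; w\<in>carrier G\<rbrakk> \<Longrightarrow> x \<oplus> (y \<oplus> (z \<oplus> (w \<oplus> \<ominus> x))) = y \<oplus> (z \<oplus> w)"
  "\<lbrakk>x\<in>carrier G; y\<in>carrier G; z\<in>carrier G; w\<in>carrier G; u\<in>carrier G\<rbrakk> \<Longrightarrow>
    x \<oplus> (y \<oplus> (z \<oplus> (w \<oplus> (\<ominus> x \<oplus> u)))) = y \<oplus> (z \<oplus> (w \<oplus> u))"
  "\<lbrakk>x\<in>carrier G; y\<in>carrier G; z\<in>carrier G; w\<in>carrier G; u\<in>carrier G\<rbrakk> \<Longrightarrow>
    x \<oplus> (y \<oplus> (z \<oplus> (w \<oplus> (u \<oplus> \<ominus> x)))) = y \<oplus> (z \<oplus> (w \<oplus> u))"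
  using cancel_neg1[of x "y \<oplus> z"] cancel_neg2[of x "y \<oplus> z" w] cancel_neg1[of x "y \<oplus> (z \<oplus> w)"]
    cancel_neg2[of x "y \<oplus> (z \<oplus> w)" u] cancel_neg1[of x "y \<oplus> (z \<oplus> (w \<oplus> u))"]
  by (simp_all add: a_assoc)

lemma neg_zero: "\<ominus> \<zero> = \<zero>"
  by (rule minus_equality) auto

lemmas group_simps = a_ac minus_add minus_eq r_neg r_neg1 r_neg2 cancel_neg1 cancel_neg2 cancel_neg minus_minus neg_zero

lemma diff_zero_iff: "\<lbrakk>x\<in>carrier G; y\<in>carrier G\<rbrakk> \<Longrightarrow> x \<ominus> y = \<zero> \<longleftrightarrow> x = y"
  using minus_equality[of x "\<ominus> y"] by (auto simp: minus_eq r_neg)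

end

text \<open>A copy of \<open>abelian_group_hom\<close> whose basic facts can be cited under the
  prefix \<open>add_hom\<close>. Only the additive structures of source and target matter, so they
  may be modules over different rings.\<close>

locale add_hom = abelian_group_hom
begin

lemmas hom_closed = hom_closed and hom_add = hom_add and hom_zero = hom_zero and hom_a_inv = hom_a_inv

end

lemma add_homI:
  assumes "abelian_group G" "abelian_group H"
    and "\<And>x. x\<in>carrier G \<Longrightarrow> f x\<in>carrier H"
    and "\<And>x y. \<lbrakk>x\<in>carrier G; y\<in>carrier G\<rbrakk> \<Longrightarrow> f (x \<oplus>[G] y) = f x \<oplus>[H] f y"
  shows "add_hom G H f"
proof (intro add_hom.intro abelian_group_homI)
  interpret G: abelian_group G by fact
  interpret H: abelian_group H by fact
  show "group_hom (add_monoid G) (add_monoid H) f"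
    using assms(3,4) by unfold_locales (auto simp: hom_def)
qed (use assms in auto)

lemma (in add_hom) hom_minus:
  "\<lbrakk>x\<in>carrier G; y\<in>carrier G\<rbrakk> \<Longrightarrow> h (x \<ominus> y) = h x \<ominus>[H] h y"
  by (simp add: G.minus_eq H.minus_eq)

lemma add_hom_comp:
  assumes "add_hom G H f" "add_hom H K g"
  shows "add_hom G K (\<lambda>x. g (f x))"
proof -
  interpret f: add_hom G H f by fact
  interpret g: add_hom H K g by fact
  show ?thesis
    by (rule add_homI) (auto simp: f.G.abelian_group_axioms g.H.abelian_group_axioms)
qed

lemma abelian_group_cong:
  assumes "abelian_group G" "carrier H = carrier G" "\<zero>[H] = \<zero>[G]"
    and "\<And>x y. x \<oplus>[H] y = x \<oplus>[G] y"
  shows "abelian_group H"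
proof -
  interpret G: abelian_group G by fact
  show ?thesis
    by (rule abelian_groupI) (auto simp: assms G.a_ac intro: G.l_neg G.a_inv_closed)
qed

declare (in abelian_group_hom) kernel_zero [simp del]

lemma in_a_kernel: "x\<in>a_kernel G H f \<longleftrightarrow> x\<in>carrier G \<and> f x = \<zero>[H]"
  by (simp add: a_kernel_def')

lemma (in add_hom) inj_on_iff_kernel:
  "inj_on h (carrier G) \<longleftrightarrow> (\<forall>x\<in>carrier G. h x = \<zero>[H] \<longrightarrow> x = \<zero>)"
proof
  assume "inj_on h (carrier G)"
  then show "\<forall>x\<in>carrier G. h x = \<zero>[H] \<longrightarrow> x = \<zero>"
    by (metis G.zero_closed hom_zero inj_onD)
next
  assume k: "\<forall>x\<in>carrier G. h x = \<zero>[H] \<longrightarrow> x = \<zero>"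
  show "inj_on h (carrier G)"
  proof (rule inj_onI)
    fix x y assume "x\<in>carrier G" "y\<in>carrier G" "h x = h y"
    then have "h (x \<ominus> y) = \<zero>[H]" by (simp add: hom_minus H.diff_zero_iff)
    then show "x = y" using k \<open>x\<in>_\<close> \<open>y\<in>_\<close> by (metis G.minus_closed G.diff_zero_iff)
  qed
qed

section \<open>Left modules, linear maps, bimodules and change of rings\<close>

lemma left_moduleI:
  assumes "ring R" "abelian_group V"
    and "\<And>r x. \<lbrakk>r\<in>carrier R; x\<in>carrier V\<rbrakk> \<Longrightarrow> r \<odot>[V] x\<in>carrier V"
    and "\<And>r s x. \<lbrakk>r\<in>carrier R; s\<in>carrier R; x\<in>carrier V\<rbrakk> \<Longrightarrow>
      (r \<oplus>[R] s) \<odot>[V] x = r \<odot>[V] x \<oplus>[V] s \<odot>[V] x"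
    and "\<And>r x y. \<lbrakk>r\<in>carrier R; x\<in>carrier V; y\<in>carrier V\<rbrakk> \<Longrightarrow>
      r \<odot>[V] (x \<oplus>[V] y) = r \<odot>[V] x \<oplus>[V] r \<odot>[V] y"
    and "\<And>r s x. \<lbrakk>r\<in>carrier R; s\<in>carrier R; x\<in>carrier V\<rbrakk> \<Longrightarrow>
      (r \<otimes>[R] s) \<odot>[V] x = r \<odot>[V] (s \<odot>[V] x)"
    and "\<And>x. x\<in>carrier V \<Longrightarrow> \<one>[R] \<odot>[V] x = x"
  shows "left_module R V"
  using assms by (intro left_module.intro left_module_axioms.intro) auto

lemma lm_abelian: "left_module R V \<Longrightarrow> abelian_group V"
  by (rule left_module.axioms(2))

lemma lm_ring: "left_module R V \<Longrightarrow> ring R"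
  by (rule left_module.axioms(1))

lemma lm_smult_hom:
  assumes "left_module R V" "r\<in>carrier R"
  shows "add_hom V V (\<lambda>x. r \<odot>[V] x)"
  using assms
  by (intro add_homI) (auto simp: lm_abelian left_module.smult_closed left_module.smult_r_distr)

lemma lm_scalar_hom:
  assumes "left_module R V" "x\<in>carrier V"
  shows "add_hom R V (\<lambda>r. r \<odot>[V] x)"
proof -
  interpret R: ring R using assms(1) by (rule lm_ring)
  show ?thesis
    by (rule add_homI[OF R.is_abelian_group lm_abelian[OF assms(1)]])
      (simp_all add: assms left_module.smult_closed[OF assms(1)] left_module.smult_l_distr[OF assms(1)])
qed

lemma lm_smult_zero: "\<lbrakk>left_module R V; r\<in>carrier R\<rbrakk> \<Longrightarrow> r \<odot>[V] \<zero>[V] = \<zero>[V]"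
  using add_hom.hom_zero[OF lm_smult_hom] .

lemma lm_zero_smult: "\<lbrakk>left_module R V; x\<in>carrier V\<rbrakk> \<Longrightarrow> \<zero>[R] \<odot>[V] x = \<zero>[V]"
  using add_hom.hom_zero[OF lm_scalar_hom] .

lemma lin_homI:
  assumes "\<And>x. x\<in>carrier V \<Longrightarrow> f x\<in>carrier W"
    and "\<And>x. x \<notin> carrier V \<Longrightarrow> f x = undefined"
    and "\<And>x y. \<lbrakk>x\<in>carrier V; y\<in>carrier V\<rbrakk> \<Longrightarrow> f (x \<oplus>[V] y) = f x \<oplus>[W] f y"
    and "\<And>r x. \<lbrakk>r\<in>carrier R; x\<in>carrier V\<rbrakk> \<Longrightarrow> f (r \<odot>[V] x) = r \<odot>[W] f x"
  shows "f\<in>lin_hom R V W"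
  using assms by (auto simp: lin_hom_def PiE_def extensional_def)

lemma lin_homD:
  assumes "f\<in>lin_hom R V W"
  shows "x\<in>carrier V \<Longrightarrow> f x\<in>carrier W"
    "x \<notin> carrier V \<Longrightarrow> f x = undefined"
    "\<lbrakk>x\<in>carrier V; y\<in>carrier V\<rbrakk> \<Longrightarrow> f (x \<oplus>[V] y) = f x \<oplus>[W] f y"
    "\<lbrakk>r\<in>carrier R; x\<in>carrier V\<rbrakk> \<Longrightarrow> f (r \<odot>[V] x) = r \<odot>[W] f x"
  using assms by (auto simp: lin_hom_def PiE_def extensional_def)

lemma lin_hom_eqI:
  assumes "f\<in>lin_hom R V W" "g\<in>lin_hom R' V W'" "\<And>x. x\<in>carrier V \<Longrightarrow> f x = g x"
  shows "f = g"
proof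
  fix x show "f x = g x"
    using assms(3)[of x] lin_homD(2)[OF assms(1), of x] lin_homD(2)[OF assms(2), of x] by (cases "x\<in>carrier V") auto
qed

lemma lin_add_hom:
  assumes "f\<in>lin_hom R V W" "left_module R V" "left_module R W"
  shows "add_hom V W f"
  using lm_abelian[OF assms(2)] lm_abelian[OF assms(3)] lin_homD(1,3)[OF assms(1)]
  by (rule add_homI)

lemma lin_hom_compose:
  assumes "f\<in>lin_hom R V W" "g\<in>lin_hom R W U" "left_module R V"
  shows "compose (carrier V) g f\<in>lin_hom R V U"
proof -
  interpret V: abelian_group V using assms(3) by (rule lm_abelian)
  show ?thesis
    using lin_homD[OF assms(1)] lin_homD[OF assms(2)] left_module.smult_closed[OF assms(3)]
    by (intro lin_homI) (auto simp: compose_def)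
qed

lemma lin_hom_id: "left_module R V \<Longrightarrow> (\<lambda>x\<in>carrier V. x)\<in>lin_hom R V V"
  using left_module.smult_closed[of R V] abelian_groupE(1)[OF lm_abelian, of R V]
  by (intro lin_homI) auto

lemma lm_restrict:
  assumes "ring S" "h\<in>ring_hom S R" "left_module R V"
  shows "left_module S (restrict_scalars h V)"
proof -
  interpret V: abelian_group V using assms(3) by (rule lm_abelian)
  have "abelian_group (restrict_scalars h V)"
    by (rule abelian_group_cong[OF V.abelian_group_axioms]) (simp_all add: restrict_scalars_def)
  moreover have "h s\<in>carrier R" if "s\<in>carrier S" for s
    using ring_hom_closed[OF assms(2) that] .
  ultimately show ?thesis
    by (intro left_moduleI assms(1))
      (simp_all add: restrict_scalars_def left_module.smult_closed[OF assms(3)]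
        left_module.smult_l_distr[OF assms(3)] left_module.smult_r_distr[OF assms(3)]
        left_module.smult_assoc[OF assms(3)] left_module.smult_one[OF assms(3)]
        ring_hom_add[OF assms(2)] ring_hom_mult[OF assms(2)] ring_hom_one[OF assms(2)])
qed

lemma restrict_scalars_simps [simp]:
  "carrier (restrict_scalars h V) = carrier V"
  "\<zero>[restrict_scalars h V] = \<zero>[V]"
  "x \<oplus>[restrict_scalars h V] y = x \<oplus>[V] y"
  "s \<odot>[restrict_scalars h V] x = h s \<odot>[V] x"
  by (simp_all add: restrict_scalars_def)

lemma bimodule_self:
  assumes "ring R" shows "bimodule R R (self_bimodule R)"
proof -
  interpret ring R by fact
  have "abelian_group (self_bimodule R)"
    by (rule abelian_group_cong[OF is_abelian_group]) (simp_all add: self_bimodule_def)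
  then have "left_module R (self_bimodule R)"
    by (intro left_moduleI assms) (auto simp: self_bimodule_def l_distr r_distr m_assoc)
  then show ?thesis
    by (intro bimodule.intro bimodule_axioms.intro assms)
      (auto simp: self_bimodule_def l_distr r_distr m_assoc)
qed

lemma bimodule_restrict_right:
  assumes "ring X" "q\<in>ring_hom X T" "bimodule S T B"
  shows "bimodule S X (restrict_right q B)"
proof -
  interpret B: bimodule S T B by fact
  have "abelian_group (restrict_right q B)"
    by (rule abelian_group_cong[OF B.M.abelian_group_axioms]) (simp_all add: restrict_right_def)
  then have "left_module S (restrict_right q B)"
    by (intro left_moduleI)
      (auto simp: restrict_right_def B.smult_closed B.smult_l_distr B.smult_r_distr B.smult_assoc
        B.smult_one B.R.ring_axioms)
  then show ?thesis
    using ring_hom_memE[OF assms(2)]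
    by (intro bimodule.intro bimodule_axioms.intro assms)
      (auto simp: restrict_right_def B.ract_closed B.ract_l_distr B.ract_r_distr
        B.ract_assoc B.ract_one B.smult_ract)
qed

subsection \<open>The universal property of the tensor product\<close>

definition balanced :: "'t ring \<Rightarrow> ('s, 't, 'b) bimodule \<Rightarrow> ('t, 'v) module \<Rightarrow>
    ('g, 'i) ring_scheme \<Rightarrow> ('b \<Rightarrow> 'v \<Rightarrow> 'g) \<Rightarrow> bool" where
  "balanced T B V G \<beta> \<longleftrightarrow>
    (\<forall>x\<in>carrier B. \<forall>v\<in>carrier V. \<beta> x v\<in>carrier G) \<and>
    (\<forall>x\<in>carrier B. \<forall>y\<in>carrier B. \<forall>v\<in>carrier V. \<beta> (x \<oplus>[B] y) v = \<beta> x v \<oplus>[G] \<beta> y v) \<and>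
    (\<forall>x\<in>carrier B. \<forall>v\<in>carrier V. \<forall>w\<in>carrier V. \<beta> x (v \<oplus>[V] w) = \<beta> x v \<oplus>[G] \<beta> x w) \<and>
    (\<forall>x\<in>carrier B. \<forall>t\<in>carrier T. \<forall>v\<in>carrier V. \<beta> (ract B x t) v = \<beta> x (t \<odot>[V] v))"

lemma balancedI:
  assumes "\<And>x v. \<lbrakk>x\<in>carrier B; v\<in>carrier V\<rbrakk> \<Longrightarrow> \<beta> x v\<in>carrier G"
    and "\<And>x y v. \<lbrakk>x\<in>carrier B; y\<in>carrier B; v\<in>carrier V\<rbrakk> \<Longrightarrow> \<beta> (x \<oplus>[B] y) v = \<beta> x v \<oplus>[G] \<beta> y v"
    and "\<And>x v w. \<lbrakk>x\<in>carrier B; v\<in>carrier V; w\<in>carrier V\<rbrakk> \<Longrightarrow> \<beta> x (v \<oplus>[V] w) = \<beta> x v \<oplus>[G] \<beta> x w"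
    and "\<And>x t v. \<lbrakk>x\<in>carrier B; t\<in>carrier T; v\<in>carrier V\<rbrakk> \<Longrightarrow> \<beta> (ract B x t) v = \<beta> x (t \<odot>[V] v)"
  shows "balanced T B V G \<beta>"
  using assms by (auto simp: balanced_def)

locale tensor_product =
  fixes S :: "'s ring" and T :: "'t ring" and B :: "('s, 't, 'b) bimodule"
    and V :: "('t, 'v) module"
  assumes bim: "bimodule S T B" and mod: "left_module T V"
begin

abbreviation "FA \<equiv> free_Abelian_group (carrier B \<times> carrier V)"
abbreviation "N \<equiv> tensor_null T B V"
abbreviation "TG \<equiv> tensor_group T B V"

sublocale B: bimodule S T B by (rule bim)
sublocale V: abelian_group V using mod by (rule lm_abelian)

lemma keys_diff_subset: "\<lbrakk>Poly_Mapping.keys c \<subseteq> A; Poly_Mapping.keys d \<subseteq> A\<rbrakk> \<Longrightarrow> Poly_Mapping.keys (c - d) \<subseteq> A"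
  using keys_diff[of c d] by blast

lemma relations_subset: "tensor_relations T B V \<subseteq> carrier FA"
proof -
  have "frag_of (x \<oplus>[B] y, v) - frag_of (x, v) - frag_of (y, v)\<in>carrier FA"
    if "x\<in>carrier B" "y\<in>carrier B" "v\<in>carrier V" for x y v
    using that B.M.a_closed[of x y]
    by (simp add: keys_diff_subset)
  moreover have "frag_of (x, v \<oplus>[V] w) - frag_of (x, v) - frag_of (x, w)\<in>carrier FA"
    if "x\<in>carrier B" "v\<in>carrier V" "w\<in>carrier V" for x v w
    using that V.a_closed[of v w]
    by (simp add: keys_diff_subset)
  moreover have "frag_of (ract B x t, v) - frag_of (x, t \<odot>[V] v)\<in>carrier FA"
    if "x\<in>carrier B" "t\<in>carrier T" "v\<in>carrier V" for x t v
    using that B.ract_closed[of x t] left_module.smult_closed[OF mod, of t v]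
    by (simp add: keys_diff_subset)
  ultimately show ?thesis
    by (auto simp: tensor_relations_def simp del: carrier_free_Abelian_group_iff)
qed

lemma normal_N: "N \<lhd> FA"
  unfolding tensor_null_def
  by (intro comm_group.subgroup_imp_normal abelian_free_Abelian_group
      group.generate_is_subgroup group_free_Abelian_group relations_subset)

lemma add_monoid_TG: "add_monoid TG = FA Mod N"
  by (simp add: tensor_group_def Let_def FactGroup_def)

lemma TG_abelian: "abelian_group TG"
proof (rule comm_group_abelian_groupI)
  show "comm_group (add_monoid TG)"
    using comm_group.abelian_FactGroup[OF abelian_free_Abelian_group normal_imp_subgroup[OF normal_N]]
    by (subst add_monoid_TG)
qed

sublocale TG: abelian_group TG by (rule TG_abelian)

definition "coset_of c = N #>\<^bsub>FA\<^esub> c"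

lemma coset_of_hom: "group_hom FA (add_monoid TG) coset_of"
proof -
  have "(\<lambda>a. N #>\<^bsub>FA\<^esub> a)\<in>hom FA (FA Mod N)"
    by (rule normal.r_coset_hom_Mod[OF normal_N])
  then show ?thesis
    using TG.a_group unfolding coset_of_def
    by (intro group_hom.intro group_hom_axioms.intro) (simp_all only: add_monoid_TG group_free_Abelian_group)
qed

lemma coset_of_closed: "Poly_Mapping.keys c \<subseteq> carrier B \<times> carrier V \<Longrightarrow> coset_of c\<in>carrier TG"
  using group_hom.hom_closed[OF coset_of_hom, of c] by simp

lemma coset_of_diff:
  assumes "Poly_Mapping.keys c \<subseteq> carrier B \<times> carrier V" "Poly_Mapping.keys d \<subseteq> carrier B \<times> carrier V"
  shows "coset_of (c - d) = coset_of c \<ominus>[TG] coset_of d"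
proof -
  have "coset_of (c + - d) = coset_of c \<oplus>[TG] coset_of (- d)"
    using group_hom.hom_mult[OF coset_of_hom, of c "- d"] assms by simp
  moreover have "coset_of (- d) = \<ominus>[TG] coset_of d"
    using group_hom.hom_inv[OF coset_of_hom, of d] assms by (simp add: a_inv_def)
  ultimately show ?thesis by (simp add: TG.minus_eq)
qed

lemma coset_of_null: "c\<in>N \<Longrightarrow> coset_of c = \<zero>[TG]"
  using subgroup.rcos_const[OF normal_imp_subgroup[OF normal_N] group_free_Abelian_group]
  by (simp add: coset_of_def tensor_group_def FactGroup_def)

lemma coset_of_relation: "c\<in>tensor_relations T B V \<Longrightarrow> coset_of c = \<zero>[TG]"
  by (rule coset_of_null) (auto simp: tensor_null_def intro: generate.incl)

lemma TG_E:
  assumes "X\<in>carrier TG"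
  obtains c where "Poly_Mapping.keys c \<subseteq> carrier B \<times> carrier V" "X = coset_of c"
proof -
  have "X\<in>carrier (FA Mod N)" using assms by (simp add: tensor_group_def Let_def)
  then show thesis using that by (auto simp: FactGroup_def RCOSETS_def coset_of_def)
qed

abbreviation "pt \<equiv> tens T B V"

lemma tens_coset_of: "pt x v = coset_of (frag_of (x, v))"
  by (simp add: tens_def coset_of_def)

lemma tens_closed: "\<lbrakk>x\<in>carrier B; v\<in>carrier V\<rbrakk> \<Longrightarrow> pt x v\<in>carrier TG"
  unfolding tens_coset_of by (rule coset_of_closed) auto

lemma tens_balanced: "balanced T B V TG pt"
proof (rule balancedI)
  fix x y v assume a: "x\<in>carrier B" "y\<in>carrier B" "v\<in>carrier V"
  then have "coset_of (frag_of (x \<oplus>[B] y, v) - frag_of (x, v) - frag_of (y, v)) = \<zero>[TG]"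
    by (intro coset_of_relation) (auto simp: tensor_relations_def)
  then have "pt (x \<oplus>[B] y) v \<ominus>[TG] pt x v \<ominus>[TG] pt y v = \<zero>[TG]"
    using a by (subst (asm) coset_of_diff; simp add: coset_of_diff tens_coset_of keys_diff_subset)
  then have "pt (x \<oplus>[B] y) v \<ominus>[TG] (pt x v \<oplus>[TG] pt y v) = \<zero>[TG]"
    using a by (simp add: tens_closed TG.group_simps)
  then show "pt (x \<oplus>[B] y) v = pt x v \<oplus>[TG] pt y v"
    using a by (subst (asm) TG.diff_zero_iff) (auto intro: tens_closed)
next
  fix x v w assume a: "x\<in>carrier B" "v\<in>carrier V" "w\<in>carrier V"
  then have "coset_of (frag_of (x, v \<oplus>[V] w) - frag_of (x, v) - frag_of (x, w)) = \<zero>[TG]"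
    by (intro coset_of_relation) (auto simp: tensor_relations_def)
  then have "pt x (v \<oplus>[V] w) \<ominus>[TG] pt x v \<ominus>[TG] pt x w = \<zero>[TG]"
    using a by (subst (asm) coset_of_diff; simp add: coset_of_diff tens_coset_of keys_diff_subset)
  then have "pt x (v \<oplus>[V] w) \<ominus>[TG] (pt x v \<oplus>[TG] pt x w) = \<zero>[TG]"
    using a by (simp add: tens_closed TG.group_simps)
  then show "pt x (v \<oplus>[V] w) = pt x v \<oplus>[TG] pt x w"
    using a by (subst (asm) TG.diff_zero_iff) (auto intro: tens_closed)
next
  fix x t v assume a: "x\<in>carrier B" "t\<in>carrier T" "v\<in>carrier V"
  note cl = B.ract_closed[OF a(1,2)] left_module.smult_closed[OF mod a(2,3)]
  have "coset_of (frag_of (ract B x t, v) - frag_of (x, t \<odot>[V] v)) = \<zero>[TG]"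
    using a by (intro coset_of_relation) (auto simp: tensor_relations_def)
  then have "pt (ract B x t) v \<ominus>[TG] pt x (t \<odot>[V] v) = \<zero>[TG]"
    using a cl by (simp add: coset_of_diff tens_coset_of)
  then show "pt (ract B x t) v = pt x (t \<odot>[V] v)"
    using a cl by (subst (asm) TG.diff_zero_iff) (auto intro: tens_closed)
qed (rule tens_closed)

lemma tens_add_left: "\<lbrakk>x\<in>carrier B; y\<in>carrier B; v\<in>carrier V\<rbrakk> \<Longrightarrow> pt (x \<oplus>[B] y) v = pt x v \<oplus>[TG] pt y v"
  and tens_add_right: "\<lbrakk>x\<in>carrier B; v\<in>carrier V; w\<in>carrier V\<rbrakk> \<Longrightarrow> pt x (v \<oplus>[V] w) = pt x v \<oplus>[TG] pt x w"
  and tens_ract: "\<lbrakk>x\<in>carrier B; t\<in>carrier T; v\<in>carrier V\<rbrakk> \<Longrightarrow> pt (ract B x t) v = pt x (t \<odot>[V] v)"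
  using tens_balanced by (auto simp: balanced_def)

lemma tens_hom_left: "v\<in>carrier V \<Longrightarrow> add_hom B TG (\<lambda>x. pt x v)"
  by (intro add_homI B.M.abelian_group_axioms TG_abelian tens_closed tens_add_left)

lemma tens_hom_right: "x\<in>carrier B \<Longrightarrow> add_hom V TG (pt x)"
  by (intro add_homI V.abelian_group_axioms TG_abelian tens_closed tens_add_right)

lemma tens_zero_left: "v\<in>carrier V \<Longrightarrow> pt \<zero>[B] v = \<zero>[TG]"
  using add_hom.hom_zero[OF tens_hom_left] .

lemma tens_zero_right: "x\<in>carrier B \<Longrightarrow> pt x \<zero>[V] = \<zero>[TG]"
  using add_hom.hom_zero[OF tens_hom_right] .

text \<open>Negatives need no case of their own, because the negative of \<open>pt x v\<close> is
  \<open>pt (\<ominus>[B] x) v\<close>, again a pure tensor.\<close>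

lemma TG_induct [consumes 1, case_names tens add]:
  assumes "X\<in>carrier TG"
    and t: "\<And>x v. \<lbrakk>x\<in>carrier B; v\<in>carrier V\<rbrakk> \<Longrightarrow> P (pt x v)"
    and add: "\<And>X Y. \<lbrakk>X\<in>carrier TG; Y\<in>carrier TG; P X; P Y\<rbrakk> \<Longrightarrow> P (X \<oplus>[TG] Y)"
  shows "P X"
proof -
  obtain c where c: "Poly_Mapping.keys c \<subseteq> carrier B \<times> carrier V" and X: "X = coset_of c"
    using assms(1) by (rule TG_E)
  have z: "P \<zero>[TG]"
    using t[OF B.M.zero_closed V.zero_closed] by (simp add: tens_zero_left)
  \<comment> \<open>The induction on formal sums passes through differences, so the claim is carried
    along for the negative too.\<close>
  have "P (coset_of c) \<and> P (\<ominus>[TG] coset_of c)"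
    using c
  proof (induction c rule: free_Abelian_group_induct[consumes 1])
    case 1
    have "coset_of 0 = \<zero>[TG]"
      using group_hom.hom_one[OF coset_of_hom] by simp
    then show ?case using z by (simp add: TG.neg_zero)
  next
    case (2 c d)
    then have "coset_of c\<in>carrier TG" "coset_of d\<in>carrier TG" by (auto intro: coset_of_closed)
    then show ?case
      using 2 by (simp add: coset_of_diff TG.minus_eq TG.minus_add TG.minus_minus add)
  next
    case (3 p)
    obtain x v where p: "p = (x, v)" "x\<in>carrier B" "v\<in>carrier V" using 3 by auto
    have "\<ominus>[TG] pt x v = pt (\<ominus>[B] x) v"
      using add_hom.hom_a_inv[OF tens_hom_left] p by simp
    then show ?case using t[of x v] t[of "\<ominus>[B] x" v] p by (simp add: tens_coset_of)
  qed
  then show ?thesis by (simp add: X)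
qed

context
  fixes G :: "('g, 'i) ring_scheme" and \<beta> :: "'b \<Rightarrow> 'v \<Rightarrow> 'g"
  assumes G: "abelian_group G" and \<beta>: "balanced T B V G \<beta>"
begin

interpretation G: abelian_group G by (rule G)

lemma \<beta>_closed: "\<lbrakk>x\<in>carrier B; v\<in>carrier V\<rbrakk> \<Longrightarrow> \<beta> x v\<in>carrier G"
  using \<beta> by (simp add: balanced_def)

definition frag_lift :: "('b \<times> 'v \<Rightarrow>\<^sub>0 int) \<Rightarrow> 'g" where
  "frag_lift c = finsum G (\<lambda>p. [Poly_Mapping.lookup c p] \<cdot>\<^bsub>G\<^esub> \<beta> (fst p) (snd p)) (Poly_Mapping.keys c)"

text \<open>Sums over the supports of different elements can only be compared on a common finite
  set; the extra terms have coefficient zero.\<close>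

lemma frag_lift_mono:
  assumes "Poly_Mapping.keys c \<subseteq> A" "A \<subseteq> carrier B \<times> carrier V" "finite A"
  shows "frag_lift c = finsum G (\<lambda>p. [Poly_Mapping.lookup c p] \<cdot>\<^bsub>G\<^esub> \<beta> (fst p) (snd p)) A"
proof -
  have z: "[(0::int)] \<cdot>\<^bsub>G\<^esub> x = \<zero>[G]" for x by (simp add: add_pow_def)
  show ?thesis
    unfolding frag_lift_def using assms
    by (intro G.add.finprod_mono_neutral_cong_left)
      (auto simp: in_keys_iff subset_iff z intro!: G.add.int_pow_closed \<beta>_closed)
qed

lemma frag_lift_hom: "group_hom FA (add_monoid G) frag_lift"
proof -
  have "frag_lift\<in>hom FA (add_monoid G)"
  proof (rule homI)
    fix c assume "c\<in>carrier FA"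
    then show "frag_lift c\<in>carrier (add_monoid G)"
      unfolding frag_lift_def by (auto intro!: G.finsum_closed G.add.int_pow_closed \<beta>_closed)
  next
    fix c d
    assume "c\<in>carrier FA" "d\<in>carrier FA"
    then have cd: "Poly_Mapping.keys c \<subseteq> carrier B \<times> carrier V" "Poly_Mapping.keys d \<subseteq> carrier B \<times> carrier V"
      by simp_all
    let ?A = "Poly_Mapping.keys c \<union> Poly_Mapping.keys d"
    have cl: "\<beta> (fst p) (snd p)\<in>carrier G" if "p\<in>?A" for p
      using that cd by (auto intro!: \<beta>_closed)
    have "frag_lift (c + d) = finsum G (\<lambda>p. [Poly_Mapping.lookup (c + d) p] \<cdot>\<^bsub>G\<^esub> \<beta> (fst p) (snd p)) ?A"
      using cd by (intro frag_lift_mono keys_add) auto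
    also have "\<dots> = finsum G (\<lambda>p. [Poly_Mapping.lookup c p] \<cdot>\<^bsub>G\<^esub> \<beta> (fst p) (snd p) \<oplus>[G]
        [Poly_Mapping.lookup d p] \<cdot>\<^bsub>G\<^esub> \<beta> (fst p) (snd p)) ?A"
      using cl by (intro G.finsum_cong') (auto simp: lookup_add G.add.int_pow_mult intro!: G.add.int_pow_closed G.a_closed)
    also have "\<dots> = frag_lift c \<oplus>[G] frag_lift d"
      using cl cd frag_lift_mono[of c ?A] frag_lift_mono[of d ?A]
      by (subst G.finsum_addf) (auto intro!: G.add.int_pow_closed)
    finally show "frag_lift (c \<otimes>[FA] d) = frag_lift c \<otimes>[add_monoid G] frag_lift d"
      by simp
  qed
  then show ?thesis using G.a_group
    by (intro group_hom.intro group_hom_axioms.intro) auto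
qed

lemma frag_lift_of: "\<lbrakk>x\<in>carrier B; v\<in>carrier V\<rbrakk> \<Longrightarrow> frag_lift (frag_of (x, v)) = \<beta> x v"
  by (simp add: frag_lift_def \<beta>_closed G.add.int_pow_1)

lemma frag_lift_diff:
  assumes "Poly_Mapping.keys c \<subseteq> carrier B \<times> carrier V" "Poly_Mapping.keys d \<subseteq> carrier B \<times> carrier V"
  shows "frag_lift (c - d) = frag_lift c \<ominus>[G] frag_lift d"
proof -
  have "frag_lift (c + - d) = frag_lift c \<oplus>[G] frag_lift (- d)"
    using group_hom.hom_mult[OF frag_lift_hom, of c "- d"] assms by simp
  moreover have "frag_lift (- d) = \<ominus>[G] frag_lift d"
    using group_hom.hom_inv[OF frag_lift_hom, of d] assms by (simp add: a_inv_def)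
  ultimately show ?thesis by (simp add: G.minus_eq)
qed

lemma frag_lift_null: "c\<in>N \<Longrightarrow> frag_lift c = \<zero>[G]"
proof -
  have rel: "frag_lift c = \<zero>[G]" if c: "c\<in>tensor_relations T B V" for c
  proof -
    have *: "a \<ominus>[G] b \<ominus>[G] d = \<zero>[G]" if "a = b \<oplus>[G] d" "b\<in>carrier G" "d\<in>carrier G" for a b d
      using that by (simp add: G.group_simps)
    consider x y v where "c = frag_of (x \<oplus>[B] y, v) - frag_of (x, v) - frag_of (y, v)"
        "x\<in>carrier B" "y\<in>carrier B" "v\<in>carrier V"
      | x v w where "c = frag_of (x, v \<oplus>[V] w) - frag_of (x, v) - frag_of (x, w)"
        "x\<in>carrier B" "v\<in>carrier V" "w\<in>carrier V"
      | x t v where "c = frag_of (ract B x t, v) - frag_of (x, t \<odot>[V] v)"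
        "x\<in>carrier B" "t\<in>carrier T" "v\<in>carrier V"
      using c by (auto simp: tensor_relations_def)
    then show ?thesis
    proof cases
      case 1
      then show ?thesis
        using \<beta> by (simp add: frag_lift_diff frag_lift_of keys_diff_subset balanced_def *)
    next
      case 2
      then show ?thesis
        using \<beta> by (simp add: frag_lift_diff frag_lift_of keys_diff_subset balanced_def *)
    next
      case 3
      then show ?thesis
        using \<beta> B.ract_closed left_module.smult_closed[OF mod]
        by (simp add: frag_lift_diff frag_lift_of balanced_def G.r_neg G.minus_eq)
    qed
  qed
  have sub: "N \<subseteq> carrier FA"
    using normal_imp_subgroup[OF normal_N] by (rule subgroup.subset)
  assume "c\<in>N"
  then show ?thesis
    unfolding tensor_null_def
  proof (induction rule: generate.induct)
    case one
    show ?case using group_hom.hom_one[OF frag_lift_hom] by simp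
  next
    case (incl h) then show ?case by (rule rel)
  next
    case (inv h)
    then have "h\<in>carrier FA" using relations_subset by blast
    then show ?case
      using group_hom.hom_inv[OF frag_lift_hom, of h] rel[OF inv] G.add.inv_one
      by (simp add: a_inv_def)
  next
    case (eng h k)
    have "h\<in>carrier FA" "k\<in>carrier FA"
      using subsetD[OF sub[unfolded tensor_null_def]] eng(1,2) by blast+
    then show ?case
      using group_hom.hom_mult[OF frag_lift_hom, of h k] eng by simp
  qed
qed

text \<open>\<open>tensor_lift\<close> takes \<open>the_elem\<close> of the image of a coset. That
  image is a singleton since \<open>frag_lift\<close> vanishes on the relations and is therefore
  constant on the coset.\<close>

lemma tensor_lift_coset_of:
  assumes "Poly_Mapping.keys c \<subseteq> carrier B \<times> carrier V"
  shows "tensor_lift T B V G \<beta> (coset_of c) = frag_lift c"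
proof -
  have "frag_lift ` coset_of c = {frag_lift c}"
  proof -
    have "frag_lift (n + c) = frag_lift c" if "n\<in>N" for n
    proof -
      have "n\<in>carrier FA" using that normal_imp_subgroup[OF normal_N] by (rule subgroup.subset[THEN subsetD, rotated])
      then show ?thesis
        using group_hom.hom_mult[OF frag_lift_hom, of n c] group_hom.hom_closed[OF frag_lift_hom, of c]
          frag_lift_null[OF that] assms by simp
    qed
    moreover have "\<one>[FA]\<in>N" by (rule subgroup.one_closed[OF normal_imp_subgroup[OF normal_N]])
    ultimately show ?thesis
      by (auto simp: coset_of_def r_coset_def)
  qed
  then have "the_elem (frag_lift ` coset_of c) = frag_lift c" by simp
  then show ?thesis
    using coset_of_closed[OF assms] unfolding tensor_lift_def frag_lift_def by simp
qed

lemma tensor_lift_tens: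
  "\<lbrakk>x\<in>carrier B; v\<in>carrier V\<rbrakk> \<Longrightarrow> tensor_lift T B V G \<beta> (pt x v) = \<beta> x v"
  by (simp add: tens_coset_of tensor_lift_coset_of frag_lift_of)

lemma tensor_lift_hom: "add_hom TG G (tensor_lift T B V G \<beta>)"
proof (rule add_homI[OF TG_abelian G])
  fix X assume "X\<in>carrier TG"
  then show "tensor_lift T B V G \<beta> X\<in>carrier G"
    by (elim TG_E) (use group_hom.hom_closed[OF frag_lift_hom] in \<open>auto simp: tensor_lift_coset_of\<close>)
next
  fix X Y assume "X\<in>carrier TG" "Y\<in>carrier TG"
  then obtain c d where c: "Poly_Mapping.keys c \<subseteq> carrier B \<times> carrier V" "X = coset_of c"
    and d: "Poly_Mapping.keys d \<subseteq> carrier B \<times> carrier V" "Y = coset_of d" by (auto elim!: TG_E)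
  have "X \<oplus>[TG] Y = coset_of (c + d)"
    using group_hom.hom_mult[OF coset_of_hom, of c d] c d by simp
  then show "tensor_lift T B V G \<beta> (X \<oplus>[TG] Y) = tensor_lift T B V G \<beta> X \<oplus>[G] tensor_lift T B V G \<beta> Y"
    using c d group_hom.hom_mult[OF frag_lift_hom, of c d]
    by (simp add: tensor_lift_coset_of order_trans[OF keys_add])
qed

end

lemma tensor_lift_undefined: "X \<notin> carrier TG \<Longrightarrow> tensor_lift T B V G \<beta> X = undefined"
  by (simp add: tensor_lift_def)

abbreviation "TM \<equiv> tensor T B V"

lemma tensor_simps [simp]:
  "carrier TM = carrier TG" "X \<oplus>[TM] Y = X \<oplus>[TG] Y" "\<zero>[TM] = \<zero>[TG]"
  by (simp_all add: tensor_def)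

lemma smult_balanced: "s\<in>carrier S \<Longrightarrow> balanced T B V TG (\<lambda>x v. pt (s \<odot>[B] x) v)"
  by (rule balancedI)
    (auto simp: B.smult_closed B.smult_r_distr tens_closed tens_add_left tens_add_right tens_ract
      B.smult_ract[symmetric] simp del: tensor_simps)

lemma tensor_smult_hom: "s\<in>carrier S \<Longrightarrow> add_hom TG TG (\<lambda>X. s \<odot>[TM] X)"
  using tensor_lift_hom[OF TG_abelian smult_balanced] by (simp add: tensor_def)

lemma tensor_smult_tens:
  "\<lbrakk>s\<in>carrier S; x\<in>carrier B; v\<in>carrier V\<rbrakk> \<Longrightarrow> s \<odot>[TM] pt x v = pt (s \<odot>[B] x) v"
  using tensor_lift_tens[OF TG_abelian smult_balanced] by (simp add: tensor_def)

lemma tensor_abelian: "abelian_group TM"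
  by (rule abelian_group_cong[OF TG_abelian]) (simp_all add: tensor_def)

lemma tensor_left_module: "left_module S TM"
proof (rule left_moduleI)
  show "ring S" by (rule B.R.ring_axioms)
  show "abelian_group TM" by (rule tensor_abelian)
  note h = add_hom.hom_closed[OF tensor_smult_hom] add_hom.hom_add[OF tensor_smult_hom]
  { fix r X assume "r\<in>carrier S" "X\<in>carrier TM" then show "r \<odot>[TM] X\<in>carrier TM" by (simp add: h) }
  { fix r X Y assume "r\<in>carrier S" "X\<in>carrier TM" "Y\<in>carrier TM"
    then show "r \<odot>[TM] (X \<oplus>[TM] Y) = r \<odot>[TM] X \<oplus>[TM] r \<odot>[TM] Y" by (simp add: h) }
  { fix r s X assume rs: "r\<in>carrier S" "s\<in>carrier S" and "X\<in>carrier TM"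
    then have "X\<in>carrier TG" by simp
    then show "(r \<oplus>[S] s) \<odot>[TM] X = r \<odot>[TM] X \<oplus>[TM] s \<odot>[TM] X"
    proof (induction rule: TG_induct)
      case (tens x v) with rs show ?case
        by (simp add: tensor_smult_tens B.smult_l_distr tens_add_left B.smult_closed)
    next
      case (add X Y) with rs show ?case by (simp add: h TG.a_ac)
    qed
  }
  { fix r s X assume rs: "r\<in>carrier S" "s\<in>carrier S" and "X\<in>carrier TM"
    then have "X\<in>carrier TG" by simp
    then show "(r \<otimes>[S] s) \<odot>[TM] X = r \<odot>[TM] (s \<odot>[TM] X)"
    proof (induction rule: TG_induct)
      case (tens x v) with rs show ?case
        by (simp add: tensor_smult_tens B.smult_assoc B.smult_closed)
    next
      case (add X Y) with rs show ?case by (simp add: h)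
    qed
  }
  { fix X assume "X\<in>carrier TM"
    then have "X\<in>carrier TG" by simp
    then show "\<one>[S] \<odot>[TM] X = X"
    proof (induction rule: TG_induct)
      case (tens x v) then show ?case
        by (simp add: tensor_smult_tens B.smult_one)
    next
      case (add X Y) then show ?case by (simp add: h)
    qed
  }
qed

text \<open>\<open>TM\<close> and \<open>TG\<close> are different records with the same carrier and
  addition; induction lives on \<open>TG\<close>, functors take the value \<open>TM\<close>.\<close>

lemma hom_TM_iff: "add_hom TM G f \<longleftrightarrow> add_hom TG G f"
proof -
  show ?thesis
  proof
    assume "add_hom TM G f"
    then interpret f: add_hom TM G f .
    show "add_hom TG G f"
      using f.hom_closed f.hom_add by (intro add_homI TG_abelian f.H.abelian_group_axioms) simp_all
  next
    assume "add_hom TG G f"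
    then interpret f: add_hom TG G f .
    show "add_hom TM G f"
      by (intro add_homI tensor_abelian f.H.abelian_group_axioms) simp_all
  qed
qed

lemma tensor_lift_lin:
  assumes "left_module S G" "balanced T B V G \<beta>"
    and s: "\<And>s x v. \<lbrakk>s\<in>carrier S; x\<in>carrier B; v\<in>carrier V\<rbrakk> \<Longrightarrow> \<beta> (s \<odot>[B] x) v = s \<odot>[G] \<beta> x v"
  shows "tensor_lift T B V G \<beta>\<in>lin_hom S TM G"
proof (rule lin_homI)
  interpret G: abelian_group G using assms(1) by (rule lm_abelian)
  interpret l: add_hom TG G "tensor_lift T B V G \<beta>"
    using G.abelian_group_axioms assms(2) by (rule tensor_lift_hom)
  { fix X assume "X\<in>carrier TM" then show "tensor_lift T B V G \<beta> X\<in>carrier G" by simp }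
  { fix X assume "X \<notin> carrier TM" then show "tensor_lift T B V G \<beta> X = undefined" by (simp add: tensor_lift_undefined) }
  { fix X Y assume "X\<in>carrier TM" "Y\<in>carrier TM"
    then show "tensor_lift T B V G \<beta> (X \<oplus>[TM] Y) = tensor_lift T B V G \<beta> X \<oplus>[G] tensor_lift T B V G \<beta> Y"
      by simp }
  fix r X assume r: "r\<in>carrier S" and "X\<in>carrier TM"
  then have "X\<in>carrier TG" by simp
  then show "tensor_lift T B V G \<beta> (r \<odot>[TM] X) = r \<odot>[G] tensor_lift T B V G \<beta> X"
  proof (induction rule: TG_induct)
    case (tens x v) with r show ?case
      using assms(2) by (simp add: tensor_smult_tens B.smult_closed tensor_lift_tens[OF G.abelian_group_axioms] s)
  next
    case (add X Y) with r show ?case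
      by (simp add: add_hom.hom_closed[OF tensor_smult_hom]
          add_hom.hom_add[OF tensor_smult_hom] left_module.smult_r_distr[OF assms(1)])
  qed
qed

end

subsection \<open>Pointed functors\<close>

lemma fgp_module: "V\<in>fgp R \<Longrightarrow> left_module R V"
  by (simp add: fg_projective_def)

text \<open>Each element of \<open>W\<close> is some \<open>h x\<close>, so every module axiom is
  pulled back to \<open>V\<close>. This serves quotients and transport of structure alike.\<close>

lemma left_module_surj_image:
  assumes V: "left_module R V" and W: "abelian_group W"
    and h: "add_hom V W h" "h ` carrier V = carrier W"
    and s: "\<And>r x. \<lbrakk>r\<in>carrier R; x\<in>carrier V\<rbrakk> \<Longrightarrow> r \<odot>[W] h x = h (r \<odot>[V] x)"
  shows "left_module R W"
proof -
  interpret h: add_hom V W h by fact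
  have ex: "\<exists>x\<in>carrier V. y = h x" if "y\<in>carrier W" for y using that h(2) by auto
  note m = left_module.smult_closed[OF V]
  show ?thesis
  proof (rule left_moduleI[OF lm_ring[OF V] W])
    fix r y assume "r\<in>carrier R" "y\<in>carrier W"
    then show "r \<odot>[W] y\<in>carrier W" using ex[of y] by (auto simp: s m)
  next
    fix r q y assume "r\<in>carrier R" "q\<in>carrier R" "y\<in>carrier W"
    then show "(r \<oplus>[R] q) \<odot>[W] y = r \<odot>[W] y \<oplus>[W] q \<odot>[W] y"
      using ex[of y] abelian_groupE(1)[OF ring.is_abelian_group[OF lm_ring[OF V]], of r q]
      by (auto simp: s m left_module.smult_l_distr[OF V] simp flip: h.hom_add)
  next
    fix r y z assume "r\<in>carrier R" "y\<in>carrier W" "z\<in>carrier W"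
    then show "r \<odot>[W] (y \<oplus>[W] z) = r \<odot>[W] y \<oplus>[W] r \<odot>[W] z"
      using ex[of y] ex[of z] by (auto simp: s m left_module.smult_r_distr[OF V] simp flip: h.hom_add)
  next
    fix r q y assume "r\<in>carrier R" "q\<in>carrier R" "y\<in>carrier W"
    then show "(r \<otimes>[R] q) \<odot>[W] y = r \<odot>[W] (q \<odot>[W] y)"
      using ex[of y] ring.ring_simprules(5)[OF lm_ring[OF V], of r q]
      by (auto simp: s m left_module.smult_assoc[OF V])
  next
    fix y assume "y\<in>carrier W"
    then show "\<one>[R] \<odot>[W] y = y"
      using ex[of y] ring.ring_simprules(6)[OF lm_ring[OF V]]
      by (auto simp: s left_module.smult_one[OF V])
  qed
qed

lemma pointed_functorI:
  fixes S :: "'s ring" and F :: "('s, 'u, 't, 'x) pfunctor"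
  assumes "\<And>V. V\<in>fgp S \<Longrightarrow> left_module T (fobj F V)"
    and "\<And>V W f. \<lbrakk>V\<in>fgp S; W\<in>fgp S; f\<in>lin_hom S V W\<rbrakk> \<Longrightarrow>
      fmap F V W f\<in>lin_hom T (fobj F V) (fobj F W)"
    and "\<And>V x. \<lbrakk>V\<in>fgp S; x\<in>pts F V\<rbrakk> \<Longrightarrow> fmap F V V (\<lambda>x\<in>carrier V. x) x = x"
    and "\<And>V W U f g x. \<lbrakk>V\<in>fgp S; W\<in>fgp S; U\<in>fgp S;
      f\<in>lin_hom S V W; g\<in>lin_hom S W U; x\<in>pts F V\<rbrakk> \<Longrightarrow>
      fmap F V U (compose (carrier V) g f) x = fmap F W U g (fmap F V W f x)"
    and "\<And>V. \<lbrakk>V\<in>fgp S; carrier V = {\<zero>[V]}\<rbrakk> \<Longrightarrow> pts F V \<subseteq> {\<zero>[fobj F V]}"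
  shows "pointed_functor S T F"
  unfolding pointed_functor_def
proof (intro conjI ballI impI)
  fix V :: "('s, 'u) module" assume V: "V\<in>fgp S"
  have i: "(\<lambda>x\<in>carrier V. x)\<in>lin_hom S V V"
    by (rule lin_hom_id[OF fgp_module[OF V]])
  show "fmap F V V (\<lambda>x\<in>carrier V. x) = (\<lambda>x\<in>pts F V. x)"
    by (rule lin_hom_eqI[OF assms(2)[OF V V i] lin_hom_id[OF assms(1)[OF V]]])
      (simp add: assms(3)[OF V])
next
  fix V W U :: "('s, 'u) module" and f g
  assume a: "V\<in>fgp S" "W\<in>fgp S" "U\<in>fgp S"
    "f\<in>lin_hom S V W" "g\<in>lin_hom S W U"
  show "fmap F V U (compose (carrier V) g f) = compose (pts F V) (fmap F W U g) (fmap F V W f)"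
    by (rule lin_hom_eqI[OF assms(2)[OF a(1,3) lin_hom_compose[OF a(4,5) fgp_module[OF a(1)]]]
      lin_hom_compose[OF assms(2)[OF a(1,2,4)] assms(2)[OF a(2,3,5)] assms(1)[OF a(1)]]])
     (simp add: assms(4)[OF a] compose_eq)
next
  fix V :: "('s, 'u) module" assume a: "V\<in>fgp S" "carrier V = {\<zero>[V]}"
  show "pts F V = {\<zero>[fobj F V]}"
    using assms(5)[OF a] abelian_groupE(2)[OF lm_abelian[OF assms(1)[OF a(1)]]] by blast
qed (use assms in auto)

context
  fixes S :: "'s ring" and T :: "'t ring" and F :: "('s, 'u, 't, 'x) pfunctor"
  assumes F: "pointed_functor S T F"
begin

lemma functor_obj: "V\<in>fgp S \<Longrightarrow> left_module T (fobj F V)"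
  using F by (simp add: pointed_functor_def)

lemma functor_abelian: "V\<in>fgp S \<Longrightarrow> abelian_group (fobj F V)"
  using functor_obj by (rule lm_abelian)

lemma functor_map: "\<lbrakk>V\<in>fgp S; W\<in>fgp S; f\<in>lin_hom S V W\<rbrakk> \<Longrightarrow>
    fmap F V W f\<in>lin_hom T (fobj F V) (fobj F W)"
  using F by (simp add: pointed_functor_def)

lemma functor_map_hom: "\<lbrakk>V\<in>fgp S; W\<in>fgp S; f\<in>lin_hom S V W\<rbrakk> \<Longrightarrow>
    add_hom (fobj F V) (fobj F W) (fmap F V W f)"
  by (rule lin_add_hom[OF functor_map functor_obj functor_obj])

lemma functor_map_id: "\<lbrakk>V\<in>fgp S; x\<in>pts F V\<rbrakk> \<Longrightarrow> fmap F V V (\<lambda>x\<in>carrier V. x) x = x"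
  using F by (simp add: pointed_functor_def)

lemma functor_map_comp: "\<lbrakk>V\<in>fgp S; W\<in>fgp S; U\<in>fgp S;
      f\<in>lin_hom S V W; g\<in>lin_hom S W U; x\<in>pts F V\<rbrakk> \<Longrightarrow>
      fmap F W U g (fmap F V W f x) = fmap F V U (compose (carrier V) g f) x"
  using F by (simp add: pointed_functor_def compose_eq)

lemma functor_zero: "\<lbrakk>V\<in>fgp S; carrier V = {\<zero>[V]}\<rbrakk> \<Longrightarrow> pts F V = {\<zero>[fobj F V]}"
  using F by (simp add: pointed_functor_def)

end

section \<open>Natural transformations\<close>

lemma nat_homI:
  fixes S :: "'s ring" and F :: "('s, 'u, 't, 'x) pfunctor"
  assumes "\<And>V. V\<in>fgp S \<Longrightarrow> \<eta> V\<in>lin_hom T (fobj F V) (fobj G V)"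
    and "\<And>V. V \<notin> fgp S \<Longrightarrow> \<eta> V = undefined"
    and "\<And>V W f x. \<lbrakk>V\<in>fgp S; W\<in>fgp S; f\<in>lin_hom S V W;
      x\<in>pts F V\<rbrakk> \<Longrightarrow> \<eta> W (fmap F V W f x) = fmap G V W f (\<eta> V x)"
  shows "\<eta>\<in>nat_hom S T F G"
  using assms by (auto simp: nat_hom_def PiE_def extensional_def)

lemma nat_hom_lin: "\<lbrakk>\<eta>\<in>nat_hom S T F G; V\<in>fgp S\<rbrakk> \<Longrightarrow> \<eta> V\<in>lin_hom T (fobj F V) (fobj G V)"
  by (auto simp: nat_hom_def)

lemma nat_hom_natural: "\<lbrakk>\<eta>\<in>nat_hom S T F G; V\<in>fgp S; W\<in>fgp S; f\<in>lin_hom S V W;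
      x\<in>pts F V\<rbrakk> \<Longrightarrow> \<eta> W (fmap F V W f x) = fmap G V W f (\<eta> V x)"
  by (auto simp: nat_hom_def)

lemma nat_hom_undefined: "\<lbrakk>\<eta>\<in>nat_hom S T F G; V \<notin> fgp S\<rbrakk> \<Longrightarrow> \<eta> V = undefined"
  by (auto simp: nat_hom_def PiE_def extensional_def)

lemma nat_hom_hom:
  "\<lbrakk>\<eta>\<in>nat_hom S T F G; pointed_functor S T F; pointed_functor S T G; V\<in>fgp S\<rbrakk> \<Longrightarrow>
    add_hom (fobj F V) (fobj G V) (\<eta> V)"
  by (rule lin_add_hom[OF nat_hom_lin functor_obj functor_obj])

lemma nat_hom_eqI:
  fixes S :: "'s ring" and F :: "('s, 'u, 't, 'x) pfunctor"
  assumes "\<eta>\<in>nat_hom S T F G" "\<theta>\<in>nat_hom S T' F G'"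
    and "\<And>V x. \<lbrakk>V\<in>fgp S; x\<in>pts F V\<rbrakk> \<Longrightarrow> \<eta> V x = \<theta> V x"
  shows "\<eta> = \<theta>"
proof
  fix V :: "('s, 'u) module" show "\<eta> V = \<theta> V"
  proof (cases "V\<in>fgp S")
    case True
    then show ?thesis
      by (intro lin_hom_eqI[OF nat_hom_lin[OF assms(1)] nat_hom_lin[OF assms(2)]] assms(3))
  next
    case False
    then show ?thesis using nat_hom_undefined[OF assms(1)] nat_hom_undefined[OF assms(2)] by simp
  qed
qed

text \<open>Both a transformation and its components have to be extensional for equality to mean
  equality of functions; this brings an arbitrary family of functions into that form.\<close>

definition nat_restrict :: "'s ring \<Rightarrow> ('s, 'u, 't, 'x) pfunctor \<Rightarrow> (('s, 'u) module \<Rightarrow> 'x \<Rightarrow> 'y) \<Rightarrow>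
    ('s, 'u) module \<Rightarrow> 'x \<Rightarrow> 'y" where
  "nat_restrict S F \<eta> = (\<lambda>V\<in>fgp S. \<lambda>x\<in>pts F V. \<eta> V x)"

lemma nat_restrict_apply [simp]:
  "\<lbrakk>V\<in>fgp S; x\<in>pts F V\<rbrakk> \<Longrightarrow> nat_restrict S F \<eta> V x = \<eta> V x"
  by (simp add: nat_restrict_def)

lemma nat_restrictI:
  fixes S :: "'s ring" and F :: "('s, 'u, 't, 'x) pfunctor"
  assumes F: "pointed_functor S T F"
    and "\<And>V x. \<lbrakk>V\<in>fgp S; x\<in>pts F V\<rbrakk> \<Longrightarrow> \<eta> V x\<in>pts G V"
    and "\<And>V x y. \<lbrakk>V\<in>fgp S; x\<in>pts F V; y\<in>pts F V\<rbrakk> \<Longrightarrow>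
      \<eta> V (x \<oplus>[fobj F V] y) = \<eta> V x \<oplus>[fobj G V] \<eta> V y"
    and "\<And>V r x. \<lbrakk>V\<in>fgp S; r\<in>carrier T; x\<in>pts F V\<rbrakk> \<Longrightarrow>
      \<eta> V (r \<odot>[fobj F V] x) = r \<odot>[fobj G V] \<eta> V x"
    and "\<And>V W f x. \<lbrakk>V\<in>fgp S; W\<in>fgp S; f\<in>lin_hom S V W;
      x\<in>pts F V\<rbrakk> \<Longrightarrow> \<eta> W (fmap F V W f x) = fmap G V W f (\<eta> V x)"
  shows "nat_restrict S F \<eta>\<in>nat_hom S T F G"
proof (rule nat_homI)
  fix V :: "('s, 'u) module" assume V: "V\<in>fgp S"
  show "nat_restrict S F \<eta> V\<in>lin_hom T (fobj F V) (fobj G V)"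
    using V assms(2-4)[OF V] left_module.smult_closed[OF functor_obj[OF F V]]
      abelian_groupE(1)[OF functor_abelian[OF F V]]
    by (intro lin_homI) (auto simp: nat_restrict_def)
next
  fix V W :: "('s, 'u) module" and f x assume a: "V\<in>fgp S" "W\<in>fgp S" "f\<in>lin_hom S V W"
      "x\<in>pts F V"
  then show "nat_restrict S F \<eta> W (fmap F V W f x) = fmap G V W f (nat_restrict S F \<eta> V x)"
    using lin_homD(1)[OF functor_map[OF F a(1-3)] a(4)] assms(5) by simp
qed (simp add: nat_restrict_def)

lemma nat_hom_compose:
  assumes "\<eta>\<in>nat_hom S T F G" "\<theta>\<in>nat_hom S T G H" "pointed_functor S T F"
  shows "nat_restrict S F (\<lambda>V x. \<theta> V (\<eta> V x))\<in>nat_hom S T F H"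
proof -
  have c: "\<eta> V x\<in>pts G V" if "V\<in>fgp S" "x\<in>pts F V" for V x
    using lin_homD(1)[OF nat_hom_lin[OF assms(1)]] that .
  show ?thesis
    by (rule nat_restrictI[OF assms(3)])
      (simp_all add: c lin_homD(1,3,4)[OF nat_hom_lin[OF assms(1)]] lin_homD(1,3,4)[OF nat_hom_lin[OF assms(2)]]
       nat_hom_natural[OF assms(1)] nat_hom_natural[OF assms(2)])
qed

lemma nat_hom_id:
  assumes "pointed_functor S T F"
  shows "nat_restrict S F (\<lambda>V x. x)\<in>nat_hom S T F F"
  by (rule nat_restrictI[OF assms]) auto

subsection \<open>Functoriality of the tensor product\<close>

context tensor_product begin

lemma hom_TG_eqI:
  assumes "add_hom TG G f" "add_hom TG G g"
    and "\<And>x v. \<lbrakk>x\<in>carrier B; v\<in>carrier V\<rbrakk> \<Longrightarrow> f (pt x v) = g (pt x v)"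
    and "X\<in>carrier TG"
  shows "f X = g X"
proof -
  interpret f: add_hom TG G f by fact
  interpret g: add_hom TG G g by fact
  from assms(4) show ?thesis
    by (induction rule: TG_induct) (auto simp: assms(3))
qed

context
  fixes W :: "('t, 'w) module" and h :: "'v \<Rightarrow> 'w"
  assumes W: "left_module T W" and h: "h\<in>lin_hom T V W"
begin

lemma tensor_map_balanced: "balanced T B V (tensor T B W) (\<lambda>b x. tens T B W b (h x))"
proof -
  interpret W: tensor_product S T B W using bim W by (rule tensor_product.intro)
  show ?thesis
    using lin_homD[OF h] by (intro balancedI) (simp_all add: W.tens_closed W.tens_add_left W.tens_add_right W.tens_ract)
qed

lemma tensor_map_tens:
  "\<lbrakk>b\<in>carrier B; x\<in>carrier V\<rbrakk> \<Longrightarrow>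
    tensor_lift T B V (tensor T B W) (\<lambda>b x. tens T B W b (h x)) (pt b x) = tens T B W b (h x)"
proof -
  interpret W: tensor_product S T B W using bim W by (rule tensor_product.intro)
  show "\<lbrakk>b\<in>carrier B; x\<in>carrier V\<rbrakk> \<Longrightarrow> ?thesis"
    by (rule tensor_lift_tens[OF W.tensor_abelian tensor_map_balanced])
qed

lemma tensor_map_lin:
  "tensor_lift T B V (tensor T B W) (\<lambda>b x. tens T B W b (h x))\<in>lin_hom S TM (tensor T B W)"
proof -
  interpret W: tensor_product S T B W using bim W by (rule tensor_product.intro)
  show ?thesis
    using lin_homD(1)[OF h]
    by (intro tensor_lift_lin W.tensor_left_module tensor_map_balanced) (simp add: W.tensor_smult_tens)
qed

end
end

lemma tensor_functor_product:
  "\<lbrakk>bimodule A T B; pointed_functor S T F; V\<in>fgp S\<rbrakk> \<Longrightarrow> tensor_product A T B (fobj F V)"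
  by (intro tensor_product.intro functor_obj)

lemma tensor_functor_map_tens:
  fixes S :: "'s ring" and A :: "'a ring" and F :: "('s, 'u, 't, 'x) pfunctor" and V W :: "('s, 'u) module"
  assumes "bimodule A T B" "pointed_functor S T F" "V\<in>fgp S" "W\<in>fgp S"
    "f\<in>lin_hom S V W" "b\<in>carrier B" "x\<in>pts F V"
  shows "fmap (tensor_functor T B F) V W f (tens T B (fobj F V) b x) = tens T B (fobj F W) b (fmap F V W f x)"
  using tensor_product.tensor_map_tens[OF tensor_functor_product[OF assms(1-3)] functor_obj[OF assms(2,4)]
      functor_map[OF assms(2-5)] assms(6,7)] by (simp add: tensor_functor_def)

lemma tensor_functor_pointed:
  fixes S :: "'s ring" and F :: "('s, 'u, 't, 'x) pfunctor"
  assumes B: "bimodule A T B" and F: "pointed_functor S T F"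
  shows "pointed_functor S A (tensor_functor T B F)"
proof (rule pointed_functorI)
  fix V :: "('s, 'u) module" assume V: "V\<in>fgp S"
  interpret V: tensor_product A T B "fobj F V" by (rule tensor_functor_product[OF B F V])
  show "left_module A (fobj (tensor_functor T B F) V)"
    using V.tensor_left_module by (simp add: tensor_functor_def)
  fix W :: "('s, 'u) module" and f assume W: "W\<in>fgp S" and f: "f\<in>lin_hom S V W"
  show "fmap (tensor_functor T B F) V W f\<in>lin_hom A (fobj (tensor_functor T B F) V) (fobj (tensor_functor T B F) W)"
    using V.tensor_map_lin[OF functor_obj[OF F W] functor_map[OF F V W f]] by (simp add: tensor_functor_def)
next
  fix V :: "('s, 'u) module" and x assume V: "V\<in>fgp S" and x: "x\<in>pts (tensor_functor T B F) V"
  interpret V: tensor_product A T B "fobj F V" by (rule tensor_functor_product[OF B F V])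
  note i = lin_hom_id[OF fgp_module[OF V]]
  have l: "add_hom V.TG V.TM (fmap (tensor_functor T B F) V V (\<lambda>x\<in>carrier V. x))"
    using lin_add_hom[OF V.tensor_map_lin[OF functor_obj[OF F V] functor_map[OF F V V i]]]
      V.tensor_left_module by (simp add: tensor_functor_def V.hom_TM_iff)
  show "fmap (tensor_functor T B F) V V (\<lambda>x\<in>carrier V. x) x = x"
  proof (rule V.hom_TG_eqI[OF l])
    show "add_hom V.TG V.TM (\<lambda>x. x)"
      by (intro add_homI V.TG_abelian V.tensor_abelian) simp_all
    show "x\<in>carrier V.TG" using x by (simp add: tensor_functor_def)
  qed (simp add: tensor_functor_map_tens[OF B F V V i] functor_map_id[OF F V])
next
  fix V W U :: "('s, 'u) module" and f g x
  assume V: "V\<in>fgp S" and W: "W\<in>fgp S" and U: "U\<in>fgp S"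
    and f: "f\<in>lin_hom S V W" and g: "g\<in>lin_hom S W U" and x: "x\<in>pts (tensor_functor T B F) V"
  interpret V: tensor_product A T B "fobj F V" by (rule tensor_functor_product[OF B F V])
  interpret W: tensor_product A T B "fobj F W" by (rule tensor_functor_product[OF B F W])
  interpret U: tensor_product A T B "fobj F U" by (rule tensor_functor_product[OF B F U])
  note gf = lin_hom_compose[OF f g fgp_module[OF V]]
  let ?m = "fmap (tensor_functor T B F)"
  have 1: "add_hom V.TG U.TM (?m V U (compose (carrier V) g f))"
    using lin_add_hom[OF V.tensor_map_lin[OF functor_obj[OF F U] functor_map[OF F V U gf]]]
      V.tensor_left_module U.tensor_left_module by (simp add: tensor_functor_def V.hom_TM_iff)
  have 2: "add_hom V.TG W.TM (?m V W f)"
    using lin_add_hom[OF V.tensor_map_lin[OF functor_obj[OF F W] functor_map[OF F V W f]]]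
      V.tensor_left_module W.tensor_left_module by (simp add: tensor_functor_def V.hom_TM_iff)
  have 3: "add_hom W.TM U.TM (?m W U g)"
    using lin_add_hom[OF W.tensor_map_lin[OF functor_obj[OF F U] functor_map[OF F W U g]]]
      W.tensor_left_module U.tensor_left_module by (simp add: tensor_functor_def)
  show "?m V U (compose (carrier V) g f) x = ?m W U g (?m V W f x)"
  proof (rule V.hom_TG_eqI[OF 1 add_hom_comp[OF 2 3]])
    show "x\<in>carrier V.TG" using x by (simp add: tensor_functor_def)
  qed (simp add: tensor_functor_map_tens[OF B F V U gf] tensor_functor_map_tens[OF B F V W f]
        tensor_functor_map_tens[OF B F W U g] functor_map_comp[OF F V W U f g]
        lin_homD(1)[OF functor_map[OF F V W f]])
next
  fix V :: "('s, 'u) module" assume V: "V\<in>fgp S" and z: "carrier V = {\<zero>[V]}"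
  interpret V: tensor_product A T B "fobj F V" by (rule tensor_functor_product[OF B F V])
  have "X = \<zero>[V.TG]" if "X\<in>carrier V.TG" for X
    using that
    by (induction rule: V.TG_induct) (simp_all add: functor_zero[OF F V z] V.tens_zero_right)
  then show "pts (tensor_functor T B F) V \<subseteq> {\<zero>[fobj (tensor_functor T B F) V]}"
    by (auto simp: tensor_functor_def)
qed

lemma tensor_nat_tens:
  fixes S :: "'s ring" and A :: "'a ring" and F :: "('s, 'u, 't, 'x) pfunctor" and V :: "('s, 'u) module"
  assumes "bimodule A T B" "pointed_functor S T F" "pointed_functor S T G" "\<eta>\<in>nat_hom S T F G"
    "V\<in>fgp S" "b\<in>carrier B" "x\<in>pts F V"
  shows "tensor_nat S T B F G \<eta> V (tens T B (fobj F V) b x) = tens T B (fobj G V) b (\<eta> V x)"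
  using tensor_product.tensor_map_tens[OF tensor_functor_product[OF assms(1,2,5)] functor_obj[OF assms(3,5)]
      nat_hom_lin[OF assms(4,5)] assms(6,7)] assms(5) by (simp add: tensor_nat_def)

subsection \<open>Quotients, subfunctors and transport of structure\<close>

definition submodule_of :: "'r ring \<Rightarrow> ('r, 'v) module \<Rightarrow> 'v set \<Rightarrow> bool" where
  "submodule_of R V H \<longleftrightarrow> H \<subseteq> carrier V \<and> \<zero>[V]\<in>H \<and> (\<forall>x\<in>H. \<forall>y\<in>H. x \<oplus>[V] y\<in>H) \<and>
    (\<forall>r\<in>carrier R. \<forall>x\<in>H. r \<odot>[V] x\<in>H)"

lemma submodule_of_neg:
  assumes "left_module R V" "submodule_of R V H" "x\<in>H"
  shows "\<ominus>[V] x\<in>H"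
proof -
  interpret R: ring R using assms(1) by (rule lm_ring)
  have "x\<in>carrier V" using assms by (auto simp: submodule_of_def)
  then have "(\<ominus>[R] \<one>[R]) \<odot>[V] x = \<ominus>[V] x"
    using add_hom.hom_a_inv[OF lm_scalar_hom[OF assms(1)], of x "\<one>[R]"]
    by (simp add: left_module.smult_one[OF assms(1)])
  moreover have "(\<ominus>[R] \<one>[R]) \<odot>[V] x\<in>H"
    using assms by (simp add: submodule_of_def)
  ultimately show ?thesis by simp
qed

locale quotient_of =
  fixes R :: "'r ring" and V :: "('r, 'v) module" and H :: "'v set"
  assumes mod: "left_module R V" and sub: "submodule_of R V H"
begin

sublocale V: abelian_group V using mod by (rule lm_abelian)

lemma abelian_sub: "abelian_subgroup H V"
proof -
  have "subgroup H (add_monoid V)"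
    using sub submodule_of_neg[OF mod sub]
    by (intro subgroup.intro) (auto simp: submodule_of_def a_inv_def[symmetric])
  then show ?thesis
    by (intro abelian_subgroupI3 additive_subgroupI V.abelian_group_axioms)
qed

sublocale H: abelian_subgroup H V by (rule abelian_sub)

abbreviation "Q \<equiv> quotient_module V H"
abbreviation "\<pi> \<equiv> a_r_coset V H"

lemma carrier_Q: "carrier Q = \<pi> ` carrier V"
  by (auto simp: quotient_module_def A_FactGroup_def FactGroup_def RCOSETS_def a_r_coset_def)

lemma zero_Q: "\<zero>[Q] = \<pi> \<zero>[V]"
  using H.a_rcos_const[of "\<zero>[V]"] sub
  by (auto simp: quotient_module_def A_FactGroup_def FactGroup_def submodule_of_def)

lemma add_Q: "\<lbrakk>x\<in>carrier V; y\<in>carrier V\<rbrakk> \<Longrightarrow> \<pi> x \<oplus>[Q] \<pi> y = \<pi> (x \<oplus>[V] y)"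
  by (simp add: quotient_module_def H.a_rcos_sum)

lemma proj_eq_iff: "\<lbrakk>x\<in>carrier V; y\<in>carrier V\<rbrakk> \<Longrightarrow> \<pi> x = \<pi> y \<longleftrightarrow> x \<ominus>[V] y\<in>H"
  by (metis H.a_rcos_module H.a_rcos_self H.a_repr_independence' V.minus_eq)

lemma mem_proj: "\<lbrakk>x\<in>carrier V; y\<in>\<pi> x\<rbrakk> \<Longrightarrow> y\<in>carrier V \<and> \<pi> y = \<pi> x"
  using H.a_repr_independence' V.a_r_coset_subset_G[of H x] H.a_subset by blast

text \<open>A scalar acts on a coset through a union over all representatives. The cosets in that
  union coincide because \<open>H\<close> is closed under scalars.\<close>

lemma smult_Q:
  assumes "r\<in>carrier R" "x\<in>carrier V"
  shows "r \<odot>[Q] \<pi> x = \<pi> (r \<odot>[V] x)"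
proof -
  have "\<pi> (r \<odot>[V] y) = \<pi> (r \<odot>[V] x)" if "y\<in>\<pi> x" for y
  proof -
    have y: "y\<in>carrier V" "y \<ominus>[V] x\<in>H" using mem_proj[OF assms(2) that] assms(2) by (auto simp: proj_eq_iff)
    have "r \<odot>[V] y \<ominus>[V] r \<odot>[V] x = r \<odot>[V] (y \<ominus>[V] x)"
      using add_hom.hom_minus[OF lm_smult_hom[OF mod assms(1)] y(1) assms(2)] by simp
    then show ?thesis using y assms sub left_module.smult_closed[OF mod]
      by (simp add: proj_eq_iff submodule_of_def)
  qed
  moreover have "x\<in>\<pi> x" using assms(2) by (rule H.a_rcos_self)
  ultimately have "(\<Union>y\<in>\<pi> x. \<pi> (r \<odot>[V] y)) = \<pi> (r \<odot>[V] x)" by blast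
  then show ?thesis by (simp add: quotient_module_def)
qed

lemma Q_abelian: "abelian_group Q"
proof (rule abelian_groupI)
  fix X Y assume "X\<in>carrier Q" "Y\<in>carrier Q"
  then show "X \<oplus>[Q] Y\<in>carrier Q" by (auto simp: carrier_Q add_Q)
next
  show "\<zero>[Q]\<in>carrier Q" by (auto simp: carrier_Q zero_Q)
next
  fix X Y Z assume "X\<in>carrier Q" "Y\<in>carrier Q" "Z\<in>carrier Q"
  then show "X \<oplus>[Q] Y \<oplus>[Q] Z = X \<oplus>[Q] (Y \<oplus>[Q] Z)" by (auto simp: carrier_Q add_Q V.a_assoc)
next
  fix X Y assume "X\<in>carrier Q" "Y\<in>carrier Q"
  then show "X \<oplus>[Q] Y = Y \<oplus>[Q] X" by (auto simp: carrier_Q add_Q V.a_comm)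
next
  fix X assume "X\<in>carrier Q"
  then show "\<zero>[Q] \<oplus>[Q] X = X" by (auto simp: carrier_Q add_Q zero_Q)
next
  fix X assume "X\<in>carrier Q"
  then obtain x where x: "x\<in>carrier V" "X = \<pi> x" by (auto simp: carrier_Q)
  then show "\<exists>Y\<in>carrier Q. Y \<oplus>[Q] X = \<zero>[Q]"
    by (intro bexI[of _ "\<pi> (\<ominus>[V] x)"]) (auto simp: add_Q zero_Q V.l_neg carrier_Q)
qed

lemma proj_hom: "add_hom V Q \<pi>"
  by (intro add_homI V.abelian_group_axioms Q_abelian) (auto simp: carrier_Q add_Q)

lemma Q_left_module: "left_module R Q"
  by (rule left_module_surj_image[OF mod Q_abelian proj_hom]) (auto simp: carrier_Q smult_Q)

lemma proj_zero_iff: "x\<in>carrier V \<Longrightarrow> \<pi> x = \<zero>[Q] \<longleftrightarrow> x\<in>H"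
  using proj_eq_iff[of x "\<zero>[V]"] by (simp add: zero_Q V.minus_eq V.neg_zero)

lemma Union_proj:
  assumes x: "x\<in>carrier V" and "\<And>y. \<lbrakk>y\<in>carrier V; \<pi> y = \<pi> x\<rbrakk> \<Longrightarrow> g y = g x"
  shows "(\<Union>y\<in>\<pi> x. g y) = g x"
  using mem_proj[OF x] assms(2) H.a_rcos_self[OF x] by blast

end

section \<open>Quotient functors\<close>

lemma quotient_functor_aux:
  assumes "pointed_functor S T F" "\<And>V. V\<in>fgp S \<Longrightarrow> submodule_of T (fobj F V) (H V)"
    "V\<in>fgp S"
  shows "quotient_of T (fobj F V) (H V)"
  using assms by (intro quotient_of.intro functor_obj) auto

locale quotient_functor_of =
  fixes S :: "'s ring" and T :: "'t ring" and F :: "('s, 'u, 't, 'x) pfunctor"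
    and H :: "('s, 'u) module \<Rightarrow> 'x set"
  assumes F: "pointed_functor S T F"
    and subm: "\<And>V. V\<in>fgp S \<Longrightarrow> submodule_of T (fobj F V) (H V)"
    and map_sub: "\<And>V W f x. \<lbrakk>V\<in>fgp S; W\<in>fgp S; f\<in>lin_hom S V W; x\<in>H V\<rbrakk> \<Longrightarrow>
      fmap F V W f x\<in>H W"
begin

lemma quotient: "V\<in>fgp S \<Longrightarrow> quotient_of T (fobj F V) (H V)"
  using F subm by (rule quotient_functor_aux)

abbreviation "QF \<equiv> quotient_functor F H"
abbreviation "proj V \<equiv> a_r_coset (fobj F V) (H V)"

lemma fobj_QF: "fobj QF V = quotient_module (fobj F V) (H V)"
  by (simp add: quotient_functor_def)

lemma fmap_proj:
  assumes V: "V\<in>fgp S" and W: "W\<in>fgp S" and f: "f\<in>lin_hom S V W"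
    and x: "x\<in>pts F V"
  shows "fmap QF V W f (proj V x) = proj W (fmap F V W f x)"
proof -
  interpret V: quotient_of T "fobj F V" "H V" using V by (rule quotient)
  interpret W: quotient_of T "fobj F W" "H W" using W by (rule quotient)
  interpret f: add_hom "fobj F V" "fobj F W" "fmap F V W f" by (rule functor_map_hom[OF F V W f])
  have "(\<Union>y\<in>proj V x. proj W (fmap F V W f y)) = proj W (fmap F V W f x)"
    by (rule V.Union_proj[OF x])
      (simp add: x V.proj_eq_iff W.proj_eq_iff map_sub[OF V W f] flip: f.hom_minus)
  then show ?thesis using x by (simp add: quotient_functor_def V.carrier_Q)
qed

lemma QF_pointed: "pointed_functor S T QF"
proof (rule pointed_functorI)
  fix V :: "('s, 'u) module" assume V: "V\<in>fgp S"
  interpret V: quotient_of T "fobj F V" "H V" using V by (rule quotient)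
  show "left_module T (fobj QF V)" using V.Q_left_module by (simp add: fobj_QF)
  { fix W :: "('s, 'u) module" and f assume W: "W\<in>fgp S" and f: "f\<in>lin_hom S V W"
    interpret W: quotient_of T "fobj F W" "H W" using W by (rule quotient)
    interpret f: add_hom "fobj F V" "fobj F W" "fmap F V W f" by (rule functor_map_hom[OF F V W f])
    show "fmap QF V W f\<in>lin_hom T (fobj QF V) (fobj QF W)"
    proof (rule lin_homI)
      fix r X assume "r\<in>carrier T" "X\<in>pts QF V"
      then show "fmap QF V W f (r \<odot>[fobj QF V] X) = r \<odot>[fobj QF W] fmap QF V W f X"
        by (auto simp: fobj_QF V.carrier_Q V.smult_Q fmap_proj[OF V W f] W.smult_Q
          left_module.smult_closed[OF V.mod] lin_homD(4)[OF functor_map[OF F V W f]])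
    next
      fix X assume "X \<notin> pts QF V"
      then show "fmap QF V W f X = undefined"
        by (auto simp: quotient_functor_def)
    qed (auto simp: fobj_QF V.carrier_Q W.carrier_Q fmap_proj[OF V W f] V.add_Q W.add_Q)
  }
  show "fmap QF V V (\<lambda>x\<in>carrier V. x) x = x" if "x\<in>pts QF V" for x
    using that lin_hom_id[OF fgp_module[OF V]]
    by (auto simp: fobj_QF V.carrier_Q fmap_proj[OF V V] functor_map_id[OF F V])
  { fix W U :: "('s, 'u) module" and f g x
    assume W: "W\<in>fgp S" and U: "U\<in>fgp S"
      and f: "f\<in>lin_hom S V W" and g: "g\<in>lin_hom S W U" and x: "x\<in>pts QF V"
    show "fmap QF V U (compose (carrier V) g f) x = fmap QF W U g (fmap QF V W f x)"
      using x lin_hom_compose[OF f g fgp_module[OF V]]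
      by (auto simp: fobj_QF V.carrier_Q fmap_proj[OF V W f] fmap_proj[OF W U g] fmap_proj[OF V U]
        functor_map_comp[OF F V W U f g] lin_homD(1)[OF functor_map[OF F V W f]])
  }
  show "pts QF V \<subseteq> {\<zero>[fobj QF V]}" if "carrier V = {\<zero>[V]}"
    using functor_zero[OF F V that] by (auto simp: fobj_QF V.carrier_Q V.zero_Q)
qed

end

section \<open>Subfunctors and copies of functors\<close>

definition subfunctor :: "('s, 'u, 't, 'x) pfunctor \<Rightarrow> (('s, 'u) module \<Rightarrow> 'x set) \<Rightarrow> ('s, 'u, 't, 'x) pfunctor" where
  "subfunctor F H = \<lparr>fobj = (\<lambda>V. (fobj F V)\<lparr>carrier := H V\<rparr>), fmap = (\<lambda>V W f. restrict (fmap F V W f) (H V))\<rparr>"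

lemma subfunctor_pointed:
  fixes S :: "'s ring" and F :: "('s, 'u, 't, 'x) pfunctor"
  assumes F: "pointed_functor S T F"
    and subm: "\<And>V. V\<in>fgp S \<Longrightarrow> submodule_of T (fobj F V) (H V)"
    and map_sub: "\<And>V W f x. \<lbrakk>V\<in>fgp S; W\<in>fgp S; f\<in>lin_hom S V W; x\<in>H V\<rbrakk> \<Longrightarrow>
      fmap F V W f x\<in>H W"
  shows "pointed_functor S T (subfunctor F H)"
proof (rule pointed_functorI)
  fix V :: "('s, 'u) module" assume V: "V\<in>fgp S"
  note m = functor_obj[OF F V]
  interpret V: abelian_group "fobj F V" using m by (rule lm_abelian)
  note s = subm[OF V, unfolded submodule_of_def]
  have sc: "x\<in>pts F V" if "x\<in>H V" for x using s that by blast
  have "abelian_group (fobj (subfunctor F H) V)"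
  proof (rule abelian_groupI)
    fix x assume "x\<in>pts (subfunctor F H) V"
    then show "\<exists>y\<in>pts (subfunctor F H) V. y \<oplus>[fobj (subfunctor F H) V] x = \<zero>[fobj (subfunctor F H) V]"
      using submodule_of_neg[OF m subm[OF V], of x] sc[of x]
      by (intro bexI[of _ "\<ominus>[fobj F V] x"]) (auto simp: subfunctor_def V.l_neg)
  qed (use s in \<open>auto simp: subfunctor_def sc V.a_ac\<close>)
  then show "left_module T (fobj (subfunctor F H) V)"
    using s by (intro left_moduleI lm_ring[OF m])
      (simp_all add: subfunctor_def sc left_module.smult_l_distr[OF m]
        left_module.smult_r_distr[OF m] left_module.smult_assoc[OF m] left_module.smult_one[OF m])
  { fix W :: "('s, 'u) module" and f assume W: "W\<in>fgp S" and f: "f\<in>lin_hom S V W"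
    show "fmap (subfunctor F H) V W f\<in>lin_hom T (fobj (subfunctor F H) V) (fobj (subfunctor F H) W)"
      using map_sub[OF V W f] s lin_homD(3,4)[OF functor_map[OF F V W f]] sc
      by (intro lin_homI) (auto simp: subfunctor_def)
  }
  show "fmap (subfunctor F H) V V (\<lambda>x\<in>carrier V. x) x = x" if "x\<in>pts (subfunctor F H) V" for x
    using that sc[of x] by (simp add: subfunctor_def functor_map_id[OF F V])
  { fix W U :: "('s, 'u) module" and f g x
    assume W: "W\<in>fgp S" and U: "U\<in>fgp S"
      and f: "f\<in>lin_hom S V W" and g: "g\<in>lin_hom S W U" and x: "x\<in>pts (subfunctor F H) V"
    show "fmap (subfunctor F H) V U (compose (carrier V) g f) x = fmap (subfunctor F H) W U g (fmap (subfunctor F H) V W f x)"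
      using x map_sub[OF V W f] sc[of x] by (simp add: subfunctor_def functor_map_comp[OF F V W U f g])
  }
  show "pts (subfunctor F H) V \<subseteq> {\<zero>[fobj (subfunctor F H) V]}" if "carrier V = {\<zero>[V]}"
    using functor_zero[OF F V that] s by (auto simp: subfunctor_def)
qed

lemma subfunctor_simps [simp]:
  "pts (subfunctor F H) V = H V" "\<zero>[fobj (subfunctor F H) V] = \<zero>[fobj F V]"
  "x \<oplus>[fobj (subfunctor F H) V] y = x \<oplus>[fobj F V] y" "r \<odot>[fobj (subfunctor F H) V] x = r \<odot>[fobj F V] x"
  "x\<in>H V \<Longrightarrow> fmap (subfunctor F H) V W f x = fmap F V W f x"
  by (simp_all add: subfunctor_def)

text \<open>Gives a module an isomorphic copy with elements of another type, in particular a copy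
  inside the universe. The operations go back along \<open>e\<close> by \<open>the_inv_into\<close>,
  so \<open>e\<close> has to be injective on the carrier.\<close>

definition transport_module :: "('x \<Rightarrow> 'y) \<Rightarrow> ('r, 'x) module \<Rightarrow> ('r, 'y) module" where
  "transport_module e V = \<lparr>carrier = e ` carrier V, monoid.mult = undefined, monoid.one = undefined,
    ring.zero = e \<zero>[V],
    ring.add = (\<lambda>x y. e (the_inv_into (carrier V) e x \<oplus>[V] the_inv_into (carrier V) e y)),
    smult = (\<lambda>r x. e (r \<odot>[V] the_inv_into (carrier V) e x))\<rparr>"

lemma transport_module_simps:
  assumes "inj_on e (carrier V)"
  shows "carrier (transport_module e V) = e ` carrier V" "\<zero>[transport_module e V] = e \<zero>[V]"
    "\<lbrakk>x\<in>carrier V; y\<in>carrier V\<rbrakk> \<Longrightarrow> e x \<oplus>[transport_module e V] e y = e (x \<oplus>[V] y)"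
    "x\<in>carrier V \<Longrightarrow> r \<odot>[transport_module e V] e x = e (r \<odot>[V] x)"
  using assms by (auto simp: transport_module_def the_inv_into_f_f)

lemma transport_module_left_module:
  assumes e: "inj_on e (carrier V)" and V: "left_module R V"
  shows "left_module R (transport_module e V)" (is "left_module R ?W")
proof -
  interpret V: abelian_group V using V by (rule lm_abelian)
  note s = transport_module_simps[OF e]
  have a: "abelian_group ?W"
  proof (rule abelian_groupI)
    fix x assume "x\<in>carrier ?W"
    then obtain y where "y\<in>carrier V" "x = e y" by (auto simp: s)
    then show "\<exists>y\<in>carrier ?W. y \<oplus>[?W] x = \<zero>[?W]"
      by (intro bexI[of _ "e (\<ominus>[V] y)"]) (auto simp: s V.l_neg)
  qed (auto simp: s V.a_ac)
  moreover have "add_hom V ?W e"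
    by (intro add_homI V.abelian_group_axioms a) (auto simp: s)
  ultimately show ?thesis
    by (intro left_module_surj_image[OF V]) (auto simp: s)
qed

definition transport_functor :: "(('s, 'u) module \<Rightarrow> 'x \<Rightarrow> 'y) \<Rightarrow> ('s, 'u, 't, 'x) pfunctor \<Rightarrow> ('s, 'u, 't, 'y) pfunctor" where
  "transport_functor e F = \<lparr>fobj = (\<lambda>V. transport_module (e V) (fobj F V)),
    fmap = (\<lambda>V W f. \<lambda>y\<in>e V ` pts F V.
      e W (fmap F V W f (the_inv_into (pts F V) (e V) y)))\<rparr>"

lemma transport_functor_map:
  assumes "inj_on (e V) (pts F V)" "x\<in>pts F V"
  shows "fmap (transport_functor e F) V W f (e V x) = e W (fmap F V W f x)"
  using assms by (simp add: transport_functor_def the_inv_into_f_f)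

lemma transport_functor_pointed:
  fixes S :: "'s ring" and F :: "('s, 'u, 't, 'x) pfunctor"
  assumes F: "pointed_functor S T F" and e: "\<And>V. V\<in>fgp S \<Longrightarrow> inj_on (e V) (pts F V)"
  shows "pointed_functor S T (transport_functor e F)"
proof (rule pointed_functorI)
  fix V :: "('s, 'u) module" assume V: "V\<in>fgp S"
  note m = functor_obj[OF F V]
  note eV = e[OF V]
  note s = transport_module_simps[OF eV]
  interpret V: abelian_group "fobj F V" using m by (rule lm_abelian)
  have o: "fobj (transport_functor e F) V = transport_module (e V) (fobj F V)" for V by (simp add: transport_functor_def)
  note mp = transport_functor_map[of e V F, OF eV]
  show "left_module T (fobj (transport_functor e F) V)"
    using transport_module_left_module[OF eV m] by (simp add: o)
  { fix W :: "('s, 'u) module" and f assume W: "W\<in>fgp S" and f: "f\<in>lin_hom S V W"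
    note s' = transport_module_simps[OF e[OF W]]
    show "fmap (transport_functor e F) V W f\<in>lin_hom T (fobj (transport_functor e F) V) (fobj (transport_functor e F) W)"
    proof (rule lin_homI)
      fix x assume "x \<notin> pts (transport_functor e F) V"
      then show "fmap (transport_functor e F) V W f x = undefined" by (auto simp: transport_functor_def s)
    qed (auto simp: o s s' mp lin_homD(1,3,4)[OF functor_map[OF F V W f]] left_module.smult_closed[OF m])
  }
  show "fmap (transport_functor e F) V V (\<lambda>x\<in>carrier V. x) x = x" if "x\<in>pts (transport_functor e F) V" for x
    using that by (auto simp: o s mp functor_map_id[OF F V])
  { fix W U :: "('s, 'u) module" and f g x
    assume W: "W\<in>fgp S" and U: "U\<in>fgp S"
      and f: "f\<in>lin_hom S V W" and g: "g\<in>lin_hom S W U" and x: "x\<in>pts (transport_functor e F) V"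
    show "fmap (transport_functor e F) V U (compose (carrier V) g f) x = fmap (transport_functor e F) W U g (fmap (transport_functor e F) V W f x)"
      using x by (auto simp: o s mp transport_functor_map[of e W F, OF e[OF W]] functor_map_comp[OF F V W U f g] lin_homD(1)[OF functor_map[OF F V W f]])
  }
  show "pts (transport_functor e F) V \<subseteq> {\<zero>[fobj (transport_functor e F) V]}" if "carrier V = {\<zero>[V]}"
    using functor_zero[OF F V that] by (auto simp: o s)
qed

context
  fixes S :: "'s ring" and T :: "'t ring" and F :: "('s, 'u, 't, 'x) pfunctor"
    and e :: "('s, 'u) module \<Rightarrow> 'x \<Rightarrow> 'y"
  assumes F: "pointed_functor S T F" and e: "\<And>V. V\<in>fgp S \<Longrightarrow> inj_on (e V) (pts F V)"
begin

lemma transport_to: "nat_restrict S F e\<in>nat_hom S T F (transport_functor e F)"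
  by (rule nat_restrictI[OF F])
    (simp_all add: transport_functor_map[of e _ F, OF e] transport_module_simps[OF e] transport_functor_def
      the_inv_into_f_f[OF e])

lemma transport_carrier: "V\<in>fgp S \<Longrightarrow> pts (transport_functor e F) V = e V ` pts F V"
  by (simp add: transport_functor_def transport_module_simps[OF e])

definition "untransport V = the_inv_into (pts F V) (e V)"

lemma untransport_e: "\<lbrakk>V\<in>fgp S; x\<in>pts F V\<rbrakk> \<Longrightarrow> untransport V (e V x) = x"
  by (simp add: untransport_def the_inv_into_f_f[OF e])

lemma transport_from: "nat_restrict S (transport_functor e F) untransport\<in>nat_hom S T (transport_functor e F) F"
  by (rule nat_restrictI[OF transport_functor_pointed[OF F e]])
    (auto simp: transport_carrier untransport_e transport_functor_map[of e _ F, OF e] transport_module_simps[OF e] 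
      lin_homD(1)[OF functor_map[OF F]] left_module.smult_closed[OF functor_obj[OF F]]
      abelian_groupE(1)[OF functor_abelian[OF F]]
      transport_functor_def[of e F, THEN arg_cong[of _ _ fobj]])

end

subsection \<open>Restriction of scalars and forgetting to abelian groups\<close>

lemma restrict_functor_pointed:
  fixes S :: "'s ring" and F :: "('s, 'u, 't, 'x) pfunctor"
  assumes "ring T'" "h\<in>ring_hom T' T" "pointed_functor S T F"
  shows "pointed_functor S T' (restrict_functor h F)"
proof (rule pointed_functorI)
  fix V W :: "('s, 'u) module" and f assume a: "V\<in>fgp S" "W\<in>fgp S" "f\<in>lin_hom S V W"
  show "fmap (restrict_functor h F) V W f\<in>lin_hom T' (fobj (restrict_functor h F) V) (fobj (restrict_functor h F) W)"
    using lin_homD[OF functor_map[OF assms(3) a]] ring_hom_closed[OF assms(2)]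
    by (intro lin_homI) (auto simp: restrict_functor_def)
qed (auto simp: restrict_functor_def functor_zero[OF assms(3)] functor_map_id[OF assms(3)]
   functor_map_comp[OF assms(3)] intro: lm_restrict[OF assms(1,2)] functor_obj[OF assms(3)])

lemma int_ring_hom:
  assumes "ring R" shows "(\<lambda>n::int. [n] \<cdot>\<^bsub>R\<^esub> \<one>[R])\<in>ring_hom \<Z> R"
proof -
  interpret ring R by fact
  have "[(m * n)] \<cdot>\<^bsub>R\<^esub> \<one>[R] = [m] \<cdot>\<^bsub>R\<^esub> \<one>[R] \<otimes>[R] [n] \<cdot>\<^bsub>R\<^esub> \<one>[R]" for m n :: int
    using add.int_pow_pow[of "\<one>[R]" m n] by (simp add: add_pow_ldistr_int mult.commute)
  then show ?thesis
    by (intro ring_hom_memI) (auto simp: add.int_pow_mult)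
qed

lemma forget_pointed: "\<lbrakk>ring R; pointed_functor S R F\<rbrakk> \<Longrightarrow> pointed_functor S \<Z> (forget R F)"
  unfolding forget_def by (rule restrict_functor_pointed[OF int.ring_axioms int_ring_hom])

lemma forget_simps [simp]:
  "pts (forget R F) V = pts F V"
  "\<zero>[fobj (forget R F) V] = \<zero>[fobj F V]"
  "x \<oplus>[fobj (forget R F) V] y = x \<oplus>[fobj F V] y"
  "fmap (forget R F) = fmap F"
  by (simp_all add: forget_def restrict_functor_def)

text \<open>Both sides are additive in \<open>n\<close> and agree at \<open>n = 1\<close>. Hence a
  transformation between functors to abelian groups only has to be additive, which is the content of
  \<open>nat_hom_intI\<close>.\<close>

lemma additive_int_linear:
  assumes "left_module \<Z> V" "left_module \<Z> W" "add_hom V W f" "x\<in>carrier V"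
  shows "f (n \<odot>[V] x) = n \<odot>[W] f x"
proof -
  interpret f: add_hom V W f by fact
  interpret s: add_hom \<Z> V "\<lambda>n. n \<odot>[V] x" by (rule lm_scalar_hom[OF assms(1,4)])
  interpret t: add_hom \<Z> W "\<lambda>n. n \<odot>[W] f x" by (rule lm_scalar_hom[OF assms(2)]) (use assms in simp)
  have "f (m \<odot>[V] x) = m \<odot>[W] f x" if "m \<ge> 0" for m
    using that
  proof (induction m rule: int_ge_induct)
    case base
    show ?case using s.hom_zero t.hom_zero by simp
  next
    case (step i)
    then show ?case
      using s.hom_add[of i 1] t.hom_add[of i 1] left_module.smult_one[OF assms(1,4)] left_module.smult_one[OF assms(2), of "f x"] s.hom_closed[of i]
       assms(4) by simp
  qed
  moreover have "f ((- m) \<odot>[V] x) = (- m) \<odot>[W] f x" if "f (m \<odot>[V] x) = m \<odot>[W] f x" for m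
  proof -
    have "\<ominus>[\<Z>] m = - m" by (rule abelian_group.minus_equality[OF ring.is_abelian_group[OF int.ring_axioms]]) simp_all
    then show ?thesis
      using s.hom_a_inv[of m] t.hom_a_inv[of m] s.hom_closed[of m] that by simp
  qed
  ultimately show ?thesis
    by (metis minus_minus linear neg_0_le_iff_le)
qed

lemma nat_hom_intI:
  fixes S :: "'s ring" and F :: "('s, 'u, int, 'x) pfunctor"
  assumes F: "pointed_functor S \<Z> F" and G: "pointed_functor S \<Z> G"
    and "\<And>V x. \<lbrakk>V\<in>fgp S; x\<in>pts F V\<rbrakk> \<Longrightarrow> \<eta> V x\<in>pts G V"
    and "\<And>V x y. \<lbrakk>V\<in>fgp S; x\<in>pts F V; y\<in>pts F V\<rbrakk> \<Longrightarrow>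
      \<eta> V (x \<oplus>[fobj F V] y) = \<eta> V x \<oplus>[fobj G V] \<eta> V y"
    and "\<And>V W f x. \<lbrakk>V\<in>fgp S; W\<in>fgp S; f\<in>lin_hom S V W;
      x\<in>pts F V\<rbrakk> \<Longrightarrow> \<eta> W (fmap F V W f x) = fmap G V W f (\<eta> V x)"
  shows "nat_restrict S F \<eta>\<in>nat_hom S \<Z> F G"
proof (rule nat_restrictI[OF F assms(3-4) _ assms(5)])
  fix V :: "('s, 'u) module" and r x assume V: "V\<in>fgp S" and x: "x\<in>pts F V"
  have "add_hom (fobj F V) (fobj G V) (\<eta> V)"
    using V by (intro add_homI functor_abelian[OF F] functor_abelian[OF G] assms(3,4))
  then show "\<eta> V (r \<odot>[fobj F V] x) = r \<odot>[fobj G V] \<eta> V x"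
    by (rule additive_int_linear[OF functor_obj[OF F V] functor_obj[OF G V] _ x])
qed

lemma nat_hom_forget:
  fixes S :: "'s ring" and F :: "('s, 'u, 't, 'x) pfunctor"
  assumes "ring R" "\<eta>\<in>nat_hom S R F G"
  shows "\<eta>\<in>nat_hom S \<Z> (forget R F) (forget R G)"
proof (rule nat_homI)
  fix V :: "('s, 'u) module" assume V: "V\<in>fgp S"
  show "\<eta> V\<in>lin_hom \<Z> (fobj (forget R F) V) (fobj (forget R G) V)"
    using lin_homD[OF nat_hom_lin[OF assms(2) V]] ring_hom_closed[OF int_ring_hom[OF assms(1)]]
    by (intro lin_homI) (auto simp: forget_def restrict_functor_def)
qed (auto simp: nat_hom_natural[OF assms(2)] nat_hom_undefined[OF assms(2)])

subsection \<open>Free modules\<close>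

lemma (in add_hom) hom_finsum:
  assumes "f\<in>A \<rightarrow> carrier G"
  shows "h (finsum G f A) = finsum H (\<lambda>x. h (f x)) A"
  using assms
proof (induction A rule: infinite_finite_induct)
  case (insert a A)
  then have "f\<in>A \<rightarrow> carrier G" "f a\<in>carrier G" by auto
  then show ?case
    using insert by (subst G.finsum_insert, simp_all, subst H.finsum_insert) (auto simp: Pi_def)
qed auto

definition free_module :: "'r ring \<Rightarrow> 'j set \<Rightarrow> ('r, 'j \<Rightarrow> 'r) module" where
  "free_module R J = \<lparr>carrier = {f\<in>J \<rightarrow>\<^sub>E carrier R. finite {j\<in>J. f j \<noteq> \<zero>[R]}},
     monoid.mult = undefined, monoid.one = undefined, ring.zero = (\<lambda>j\<in>J. \<zero>[R]),
     ring.add = (\<lambda>f g. \<lambda>j\<in>J. f j \<oplus>[R] g j), smult = (\<lambda>r f. \<lambda>j\<in>J. r \<otimes>[R] f j)\<rparr>"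

definition free_basis :: "'r ring \<Rightarrow> 'j set \<Rightarrow> 'j \<Rightarrow> 'j \<Rightarrow> 'r" where
  "free_basis R J i = (\<lambda>j\<in>J. if i = j then \<one>[R] else \<zero>[R])"

definition free_lift :: "'r ring \<Rightarrow> 'j set \<Rightarrow> ('r, 'v) module \<Rightarrow> ('j \<Rightarrow> 'v) \<Rightarrow> ('j \<Rightarrow> 'r) \<Rightarrow> 'v" where
  "free_lift R J V h = (\<lambda>f\<in>carrier (free_module R J). finsum V (\<lambda>j. f j \<odot>[V] h j) {j\<in>J. f j \<noteq> \<zero>[R]})"

locale free_over =
  fixes R :: "'r ring" and J :: "'j set"
  assumes ring: "ring R"
begin

sublocale R: ring R by (rule ring)

abbreviation "FR \<equiv> free_module R J"

lemma free_carrier_iff: "f\<in>carrier FR \<longleftrightarrow> f\<in>J \<rightarrow>\<^sub>E carrier R \<and> finite {j\<in>J. f j \<noteq> \<zero>[R]}"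
  by (simp add: free_module_def)

lemma free_coeff: "\<lbrakk>f\<in>carrier FR; j\<in>J\<rbrakk> \<Longrightarrow> f j\<in>carrier R"
  by (auto simp: free_carrier_iff)

lemma free_simps:
  "\<zero>[FR] = (\<lambda>j\<in>J. \<zero>[R])" "f \<oplus>[FR] g = (\<lambda>j\<in>J. f j \<oplus>[R] g j)" "r \<odot>[FR] f = (\<lambda>j\<in>J. r \<otimes>[R] f j)"
  by (simp_all add: free_module_def)

lemma free_eqI: "\<lbrakk>f\<in>carrier FR; g\<in>carrier FR; \<And>j. j\<in>J \<Longrightarrow> f j = g j\<rbrakk> \<Longrightarrow> f = g"
  unfolding free_carrier_iff by (meson PiE_ext)

lemma free_add_closed:
  assumes "f\<in>carrier FR" "g\<in>carrier FR"
  shows "f \<oplus>[FR] g\<in>carrier FR"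
proof -
  have "{j\<in>J. f j \<oplus>[R] g j \<noteq> \<zero>[R]} \<subseteq> {j\<in>J. f j \<noteq> \<zero>[R]} \<union> {j\<in>J. g j \<noteq> \<zero>[R]}" by auto
  then have "finite {j\<in>J. f j \<oplus>[R] g j \<noteq> \<zero>[R]}"
    using assms by (auto simp: free_carrier_iff intro: finite_subset)
  then show ?thesis
    using assms free_coeff[OF assms(1)] free_coeff[OF assms(2)]
    by (auto simp: free_carrier_iff free_simps cong: conj_cong)
qed

lemma free_smult_closed:
  assumes "f\<in>carrier FR" "r\<in>carrier R"
  shows "r \<odot>[FR] f\<in>carrier FR"
proof -
  have "{j\<in>J. r \<otimes>[R] f j \<noteq> \<zero>[R]} \<subseteq> {j\<in>J. f j \<noteq> \<zero>[R]}" using assms by auto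
  then have "finite {j\<in>J. r \<otimes>[R] f j \<noteq> \<zero>[R]}"
    using assms by (auto simp: free_carrier_iff intro: finite_subset)
  then show ?thesis
    using assms free_coeff[OF assms(1)]
    by (auto simp: free_carrier_iff free_simps cong: conj_cong)
qed

lemma free_abelian: "abelian_group FR"
proof (rule abelian_groupI)
  show z: "\<zero>[FR]\<in>carrier FR" by (auto simp: free_carrier_iff free_simps cong: conj_cong)
  fix f assume f: "f\<in>carrier FR"
  have "(\<ominus>[R] \<one>[R]) \<odot>[FR] f \<oplus>[FR] f = \<zero>[FR]"
    using f free_coeff[OF f]
    by (intro free_eqI free_add_closed free_smult_closed z) (auto simp: free_simps R.l_minus R.l_neg)
  moreover have "(\<ominus>[R] \<one>[R]) \<odot>[FR] f\<in>carrier FR"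
    using f by (intro free_smult_closed) auto
  ultimately show "\<exists>g\<in>carrier FR. g \<oplus>[FR] f = \<zero>[FR]" by blast
  show "\<zero>[FR] \<oplus>[FR] f = f"
    using f free_coeff[OF f] by (intro free_eqI free_add_closed z) (auto simp: free_simps)
  fix g assume g: "g\<in>carrier FR"
  show "f \<oplus>[FR] g\<in>carrier FR" using f g by (rule free_add_closed)
  show "f \<oplus>[FR] g = g \<oplus>[FR] f"
    using f g free_coeff[OF f] free_coeff[OF g]
    by (intro free_eqI free_add_closed) (auto simp: free_simps R.add.m_comm)
  fix h assume h: "h\<in>carrier FR"
  show "f \<oplus>[FR] g \<oplus>[FR] h = f \<oplus>[FR] (g \<oplus>[FR] h)"
    using f g h free_coeff[OF f] free_coeff[OF g] free_coeff[OF h]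
    by (intro free_eqI free_add_closed) (auto simp: free_simps R.add.m_assoc)
qed

sublocale FR: abelian_group FR by (rule free_abelian)

lemma free_left_module: "left_module R FR"
proof (rule left_moduleI[OF ring free_abelian])
  fix r s f assume rs: "r\<in>carrier R" "s\<in>carrier R" and f: "f\<in>carrier FR"
  show "(r \<oplus>[R] s) \<odot>[FR] f = r \<odot>[FR] f \<oplus>[FR] s \<odot>[FR] f"
    using rs f free_coeff[OF f]
    by (intro free_eqI free_add_closed free_smult_closed) (auto simp: free_simps R.l_distr)
  show "(r \<otimes>[R] s) \<odot>[FR] f = r \<odot>[FR] (s \<odot>[FR] f)"
    using rs f free_coeff[OF f]
    by (intro free_eqI free_smult_closed) (auto simp: free_simps R.m_assoc)
next
  fix f assume f: "f\<in>carrier FR"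
  show "\<one>[R] \<odot>[FR] f = f"
    using f free_coeff[OF f] by (intro free_eqI free_smult_closed) (auto simp: free_simps)
next
  fix r f g assume r: "r\<in>carrier R" and f: "f\<in>carrier FR" and g: "g\<in>carrier FR"
  show "r \<odot>[FR] (f \<oplus>[FR] g) = r \<odot>[FR] f \<oplus>[FR] r \<odot>[FR] g"
    using r f g free_coeff[OF f] free_coeff[OF g]
    by (intro free_eqI free_add_closed free_smult_closed) (auto simp: free_simps R.r_distr)
qed (rule free_smult_closed)

lemma free_basis_closed: "free_basis R J i\<in>carrier FR"
proof -
  have "{j\<in>J. (if i = j then \<one>[R] else \<zero>[R]) \<noteq> \<zero>[R]} \<subseteq> {i}" by auto
  then have "finite {j\<in>J. (if i = j then \<one>[R] else \<zero>[R]) \<noteq> \<zero>[R]}" by (rule finite_subset) auto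
  then show ?thesis by (auto simp: free_carrier_iff free_basis_def cong: conj_cong)
qed

lemma free_coeff_hom: "j\<in>J \<Longrightarrow> add_hom FR R (\<lambda>f. f j)"
  by (intro add_homI free_abelian R.is_abelian_group) (auto simp: free_coeff free_simps)

text \<open>Evaluation at a coordinate is additive, so it passes through the sum, where only one
  term survives. The case of a zero coordinate is separate because then that term is missing from
  the index set.\<close>

lemma free_decomp:
  assumes f: "f\<in>carrier FR"
  shows "f = finsum FR (\<lambda>i. f i \<odot>[FR] free_basis R J i) {j\<in>J. f j \<noteq> \<zero>[R]}"
proof -
  let ?A = "{j\<in>J. f j \<noteq> \<zero>[R]}"
  have fin: "finite ?A" using f by (simp add: free_carrier_iff)
  have cl: "(\<lambda>i. f i \<odot>[FR] free_basis R J i)\<in>?A \<rightarrow> carrier FR"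
    using f by (auto intro!: free_smult_closed free_basis_closed free_coeff)
  show ?thesis
  proof (rule free_eqI[OF f])
    show "finsum FR (\<lambda>i. f i \<odot>[FR] free_basis R J i) ?A\<in>carrier FR"
      using cl by (rule FR.finsum_closed)
    fix j assume j: "j\<in>J"
    have "(finsum FR (\<lambda>i. f i \<odot>[FR] free_basis R J i) ?A) j = finsum R (\<lambda>i. (f i \<odot>[FR] free_basis R J i) j) ?A"
      by (rule add_hom.hom_finsum[OF free_coeff_hom[OF j] cl])
    also have "\<dots> = finsum R (\<lambda>i. if j = i then f i else \<zero>[R]) ?A"
      using j f free_coeff[OF f] by (intro R.finsum_cong') (auto simp: free_simps free_basis_def)
    also have "\<dots> = f j"
    proof (cases "f j = \<zero>[R]")
      case True
      then have "finsum R (\<lambda>i. if j = i then f i else \<zero>[R]) ?A = finsum R (\<lambda>i. \<zero>[R]) ?A"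
        by (intro R.finsum_cong') auto
      then show ?thesis using True by simp
    next
      case False
      then show ?thesis using j f free_coeff[OF f] fin by (intro R.finsum_singleton) auto
    qed
    finally show "f j = (finsum FR (\<lambda>i. f i \<odot>[FR] free_basis R J i) ?A) j" by simp
  qed
qed

context
  fixes V :: "('r, 'v) module" and h :: "'j \<Rightarrow> 'v"
  assumes V: "left_module R V" and h: "\<And>j. j\<in>J \<Longrightarrow> h j\<in>carrier V"
begin

interpretation V: abelian_group V using V by (rule lm_abelian)

lemma free_lift_mono:
  assumes "f\<in>carrier FR" "finite A" "A \<subseteq> J" "{j\<in>J. f j \<noteq> \<zero>[R]} \<subseteq> A"
  shows "free_lift R J V h f = finsum V (\<lambda>j. f j \<odot>[V] h j) A"
proof -
  have "finsum V (\<lambda>j. f j \<odot>[V] h j) {j\<in>J. f j \<noteq> \<zero>[R]} = finsum V (\<lambda>j. f j \<odot>[V] h j) A"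
    using assms lm_zero_smult[OF V h]
    by (intro V.add.finprod_mono_neutral_cong_left) (auto intro!: left_module.smult_closed[OF V] free_coeff h)
  then show ?thesis using assms(1) by (simp add: free_lift_def)
qed

lemma free_lift_closed: "f\<in>carrier FR \<Longrightarrow> free_lift R J V h f\<in>carrier V"
  by (auto simp: free_lift_def intro!: V.finsum_closed left_module.smult_closed[OF V] free_coeff h)

lemma free_lift_basis: "i\<in>J \<Longrightarrow> free_lift R J V h (free_basis R J i) = h i"
proof -
  assume i: "i\<in>J"
  have "free_lift R J V h (free_basis R J i) = finsum V (\<lambda>j. free_basis R J i j \<odot>[V] h j) {i}"
    using i by (intro free_lift_mono free_basis_closed) (auto simp: free_basis_def)
  also have "\<dots> = h i"
    using i h[OF i] by (simp add: free_basis_def left_module.smult_one[OF V])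
  finally show ?thesis .
qed

lemma free_lift_lin: "free_lift R J V h\<in>lin_hom R FR V"
proof (rule lin_homI)
  fix f g assume f: "f\<in>carrier FR" and g: "g\<in>carrier FR"
  let ?A = "{j\<in>J. f j \<noteq> \<zero>[R]} \<union> {j\<in>J. g j \<noteq> \<zero>[R]}"
  have A: "finite ?A" "?A \<subseteq> J" using f g by (auto simp: free_carrier_iff)
  have "free_lift R J V h (f \<oplus>[FR] g) = finsum V (\<lambda>j. (f \<oplus>[FR] g) j \<odot>[V] h j) ?A"
    using A by (intro free_lift_mono free_add_closed f g) (auto simp: free_simps)
  also have "\<dots> = finsum V (\<lambda>j. f j \<odot>[V] h j \<oplus>[V] g j \<odot>[V] h j) ?A"
    using free_coeff[OF f] free_coeff[OF g]
    by (intro V.finsum_cong') (auto simp: free_simps left_module.smult_l_distr[OF V] h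
        intro!: left_module.smult_closed[OF V] V.a_closed)
  also have "\<dots> = finsum V (\<lambda>j. f j \<odot>[V] h j) ?A \<oplus>[V] finsum V (\<lambda>j. g j \<odot>[V] h j) ?A"
    using free_coeff[OF f] free_coeff[OF g]
    by (intro V.finsum_addf) (auto intro!: left_module.smult_closed[OF V] h)
  also have "\<dots> = free_lift R J V h f \<oplus>[V] free_lift R J V h g"
    using free_lift_mono[OF f A] free_lift_mono[OF g A] by simp
  finally show "free_lift R J V h (f \<oplus>[FR] g) = free_lift R J V h f \<oplus>[V] free_lift R J V h g" .
next
  fix r f assume r: "r\<in>carrier R" and f: "f\<in>carrier FR"
  let ?A = "{j\<in>J. f j \<noteq> \<zero>[R]}"
  have A: "finite ?A" "?A \<subseteq> J" using f by (auto simp: free_carrier_iff)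
  have "free_lift R J V h (r \<odot>[FR] f) = finsum V (\<lambda>j. (r \<odot>[FR] f) j \<odot>[V] h j) ?A"
    using A r by (intro free_lift_mono free_smult_closed f) (auto simp: free_simps)
  also have "\<dots> = finsum V (\<lambda>j. r \<odot>[V] (f j \<odot>[V] h j)) ?A"
    using free_coeff[OF f] r
    by (intro V.finsum_cong') (auto simp: free_simps left_module.smult_assoc[OF V] h
        intro!: left_module.smult_closed[OF V])
  also have "\<dots> = r \<odot>[V] finsum V (\<lambda>j. f j \<odot>[V] h j) ?A"
    using free_coeff[OF f]
    by (intro add_hom.hom_finsum[OF lm_smult_hom[OF V r], symmetric])
      (auto intro!: left_module.smult_closed[OF V] h)
  also have "\<dots> = r \<odot>[V] free_lift R J V h f"
    using free_lift_mono[OF f A] by simp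
  finally show "free_lift R J V h (r \<odot>[FR] f) = r \<odot>[V] free_lift R J V h f" .
qed (simp_all add: free_lift_closed, simp add: free_lift_def)

end

lemma free_hom_eq:
  assumes V: "left_module R V" and f: "f\<in>lin_hom R FR V" and g: "g\<in>lin_hom R FR V"
    and e: "\<And>j. j\<in>J \<Longrightarrow> f (free_basis R J j) = g (free_basis R J j)"
  shows "f = g"
proof (rule lin_hom_eqI[OF f g])
  fix x assume x: "x\<in>carrier FR"
  interpret V: abelian_group V using V by (rule lm_abelian)
  let ?A = "{j\<in>J. x j \<noteq> \<zero>[R]}"
  have cl: "(\<lambda>i. x i \<odot>[FR] free_basis R J i)\<in>?A \<rightarrow> carrier FR"
    using x by (auto intro!: free_smult_closed free_basis_closed free_coeff)
  have *: "k x = finsum V (\<lambda>i. x i \<odot>[V] k (free_basis R J i)) ?A" if k: "k\<in>lin_hom R FR V" for k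
  proof -
    have "k x = finsum V (\<lambda>i. k (x i \<odot>[FR] free_basis R J i)) ?A"
      using add_hom.hom_finsum[OF lin_add_hom[OF k free_left_module V] cl] free_decomp[OF x] by simp
    also have "\<dots> = finsum V (\<lambda>i. x i \<odot>[V] k (free_basis R J i)) ?A"
      using lin_homD(1,4)[OF k] free_coeff[OF x] free_basis_closed
      by (intro V.finsum_cong') (auto intro!: left_module.smult_closed[OF V])
    finally show ?thesis .
  qed
  have "finsum V (\<lambda>i. x i \<odot>[V] f (free_basis R J i)) ?A = finsum V (\<lambda>i. x i \<odot>[V] g (free_basis R J i)) ?A"
    using e lin_homD(1)[OF g] free_coeff[OF x] free_basis_closed
    by (intro V.finsum_cong') (auto intro!: left_module.smult_closed[OF V])
  then show "f x = g x" using *[OF f] *[OF g] by simp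
qed

end

section \<open>Size of free modules\<close>

lemma times_lepoll_infinite:
  assumes "infinite (UNIV :: 'u set)" "A \<lesssim> (UNIV :: 'u set)" "B \<lesssim> (UNIV :: 'u set)"
  shows "A \<times> B \<lesssim> (UNIV :: 'u set)"
proof -
  have "A \<times> B \<lesssim> (UNIV :: 'u set) \<times> (UNIV :: 'u set)" using assms(2,3) by (rule times_lepoll_mono)
  moreover have "(UNIV :: 'u set) \<times> (UNIV :: 'u set) \<approx> (UNIV :: 'u set)"
    unfolding eqpoll_iff_card_of_ordIso using assms(1) by (rule card_of_Times_same_infinite)
  ultimately show ?thesis by (rule lepoll_trans2)
qed

lemma lists_lepoll_infinite:
  assumes "infinite (UNIV :: 'u set)" "A \<lesssim> (UNIV :: 'u set)"
  shows "lists A \<lesssim> (UNIV :: 'u set)"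
proof -
  have "lists A \<lesssim> lists (UNIV :: 'u set)" using assms(2) by (rule lists_lepoll_mono)
  moreover have "lists (UNIV :: 'u set) \<approx> (UNIV :: 'u set)"
    unfolding eqpoll_iff_card_of_ordIso using assms(1) by (rule card_of_lists_infinite)
  ultimately show ?thesis by (rule lepoll_trans2)
qed

text \<open>A function of finite support is determined by the graph of its nonzero part, a finite
  set of pairs; an infinite set has as many finite subsets as elements.\<close>

lemma free_module_lepoll:
  assumes "infinite (UNIV :: 'u set)" "J \<lesssim> (UNIV :: 'u set)" "carrier R \<lesssim> (UNIV :: 'u set)"
  shows "carrier (free_module R J) \<lesssim> (UNIV :: 'u set)"
proof -
  let ?g = "\<lambda>f. {(j, f j) | j. j\<in>J \<and> f j \<noteq> \<zero>[R]}"
  have "inj_on ?g (carrier (free_module R J))"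
  proof (rule inj_onI)
    fix f g assume fg: "f\<in>carrier (free_module R J)" "g\<in>carrier (free_module R J)" and e: "?g f = ?g g"
    have "f j = g j" if "j\<in>J" for j
    proof (cases "f j = \<zero>[R]")
      case True
      then have "(j, g j) \<notin> ?g f" by auto
      then have "g j = \<zero>[R]" using that unfolding e by auto
      then show ?thesis using True by simp
    next
      case False
      then have "(j, f j)\<in>?g g" using that unfolding e[symmetric] by auto
      then show ?thesis by auto
    qed
    then show "f = g" using fg by (auto simp: free_module_def intro: PiE_ext)
  qed
  moreover have "?g ` carrier (free_module R J) \<subseteq> Fpow (J \<times> carrier R)"
  proof
    fix y assume "y\<in>?g ` carrier (free_module R J)"
    then obtain f where f: "f\<in>carrier (free_module R J)" "y = ?g f" by blast
    have "y = (\<lambda>j. (j, f j)) ` {j\<in>J. f j \<noteq> \<zero>[R]}" using f by auto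
    then have "finite y" using f by (simp add: free_module_def)
    moreover have "y \<subseteq> J \<times> carrier R" using f by (auto simp: free_module_def)
    ultimately show "y\<in>Fpow (J \<times> carrier R)" by (simp add: Fpow_def)
  qed
  ultimately have 1: "carrier (free_module R J) \<lesssim> Fpow (J \<times> carrier R)"
    unfolding lepoll_def by blast
  obtain e where e: "inj_on e (J \<times> carrier R)" "e ` (J \<times> carrier R) \<subseteq> (UNIV :: 'u set)"
    using times_lepoll_infinite[OF assms] unfolding lepoll_def by blast
  have "inj_on ((`) e) (Fpow (J \<times> carrier R))"
    using e(1) by (intro inj_on_subset[OF inj_on_image_Pow]) (auto simp: Fpow_def)
  moreover have "(`) e ` Fpow (J \<times> carrier R) \<subseteq> Fpow (UNIV :: 'u set)" by (auto simp: Fpow_def)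
  ultimately have 2: "Fpow (J \<times> carrier R) \<lesssim> Fpow (UNIV :: 'u set)" unfolding lepoll_def by blast
  have 3: "Fpow (UNIV :: 'u set) \<approx> (UNIV :: 'u set)" using assms(1) by (rule eqpoll_Fpow)
  show ?thesis by (rule lepoll_trans2[OF lepoll_trans[OF 1 2] 3])
qed

subsection \<open>Finite free modules in the universe\<close>

type_synonym ('r, 'u) u_res = "('r, 'u, 'u, 'u, 'u) resolution"
type_synonym ('r, 'u) u_split = "('r, 'u, int, 'u, 'u, 'u) splitting"

text \<open>The argument \<open>u\<close> carries the type of the universe, which does not occur in
  the type of \<open>R\<close>.\<close>

locale universe =
  fixes R :: "'r ring" and u :: "'u itself"
  assumes ring: "ring R" and inf: "infinite (UNIV :: 'u set)" and small: "carrier R \<lesssim> (UNIV :: 'u set)"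
begin

abbreviation Proj :: "('r, 'u) module set" where "Proj \<equiv> fg_projective R"

text \<open>An arbitrary injection of the free module of rank \<open>n\<close> into the universe;
  \<open>code_inj\<close> shows that one exists because the universe is infinite and at least as
  large as \<open>R\<close>.\<close>

definition code :: "nat \<Rightarrow> (nat \<Rightarrow> 'r) \<Rightarrow> 'u" where
  "code n = (SOME e. inj_on e (carrier (free_module R {..<n})))"

definition FM :: "nat \<Rightarrow> ('r, 'u) module" where
  "FM n = transport_module (code n) (free_module R {..<n})"

abbreviation "F1 \<equiv> FM (Suc 0)"

definition gen :: "nat \<Rightarrow> nat \<Rightarrow> 'u" where
  "gen n i = code n (free_basis R {..<n} i)"

definition gens :: "nat \<Rightarrow> 'u list" where
  "gens n = map (gen n) [0..<n]"

text \<open>The linear map on the copy \<open>FM (length w)\<close> with prescribed values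
  \<open>w\<close> on the generators. With lists, \<open>lmap\<close> is the bijection between
  tuples in \<open>W\<close> and linear maps from a finite free module to \<open>W\<close>.\<close>

definition lmap :: "('r, 'v) module \<Rightarrow> 'v list \<Rightarrow> 'u \<Rightarrow> 'v" where
  "lmap W w = (\<lambda>z\<in>carrier (FM (length w)). free_lift R {..<length w} W (\<lambda>i. w ! i)
     (the_inv_into (carrier (free_module R {..<length w})) (code (length w)) z))"

lemma code_inj: "inj_on (code n) (carrier (free_module R {..<n}))"
proof -
  have "{..<n} \<lesssim> (UNIV :: 'u set)"
    by (rule finite_lepoll_infinite[OF inf]) simp
  then have "carrier (free_module R {..<n}) \<lesssim> (UNIV :: 'u set)"
    by (rule free_module_lepoll[OF inf _ small])
  then have "\<exists>e :: (nat \<Rightarrow> 'r) \<Rightarrow> 'u. inj_on e (carrier (free_module R {..<n}))"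
    unfolding lepoll_def by blast
  then show ?thesis unfolding code_def by (rule someI_ex)
qed

lemma free_over: "free_over R" by (rule free_over.intro[OF ring])

lemmas FM_simps = transport_module_simps[OF code_inj, folded FM_def]

lemma FM_left_module: "left_module R (FM n)"
  unfolding FM_def by (rule transport_module_left_module[OF code_inj free_over.free_left_module[OF free_over]])

lemma gen_closed: "gen n i\<in>carrier (FM n)"
  by (simp add: FM_simps gen_def free_over.free_basis_closed[OF free_over])

lemma gens_closed: "set (gens n) \<subseteq> carrier (FM n)" "length (gens n) = n"
  by (auto simp: gens_def gen_closed)

lemma lmap_code: "z\<in>carrier (free_module R {..<length w}) \<Longrightarrow>
    lmap W w (code (length w) z) = free_lift R {..<length w} W (\<lambda>i. w ! i) z"
  by (simp add: lmap_def FM_simps the_inv_into_f_f[OF code_inj])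

lemma lmap_lin:
  assumes "left_module R W" "set w \<subseteq> carrier W" "length w = n"
  shows "lmap W w\<in>lin_hom R (FM n) W"
proof -
  have h: "w ! i\<in>carrier W" if "i\<in>{..<length w}" for i using assms(2) that by auto
  have l: "free_lift R {..<length w} W ((!) w)\<in>lin_hom R (free_module R {..<length w}) W"
    by (rule free_over.free_lift_lin[OF free_over assms(1)]) (rule h)
  show ?thesis
    unfolding assms(3)[symmetric]
  proof (rule lin_homI)
    fix x assume "x \<notin> carrier (FM (length w))" then show "lmap W w x = undefined" by (simp add: lmap_def)
  qed (auto simp: FM_simps lmap_code lin_homD(1,3,4)[OF l] free_over.free_add_closed[OF free_over]
      free_over.free_smult_closed[OF free_over])
qed

lemma lmap_gen:
  assumes "left_module R W" "set w \<subseteq> carrier W" "length w = n" "i < n"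
  shows "lmap W w (gen n i) = w ! i"
proof -
  have h: "w ! i\<in>carrier W" if "i\<in>{..<length w}" for i using assms(2) that by auto
  have "free_lift R {..<length w} W ((!) w) (free_basis R {..<length w} i) = w ! i"
    by (rule free_over.free_lift_basis[OF free_over assms(1)]) (use h assms(3,4) in auto)
  then show ?thesis
    unfolding gen_def assms(3)[symmetric]
    by (simp add: lmap_code free_over.free_basis_closed[OF free_over])
qed

lemma FM_hom_eq:
  assumes W: "left_module R W" and f: "f\<in>lin_hom R (FM n) W" and g: "g\<in>lin_hom R (FM n) W"
    and e: "\<And>i. i < n \<Longrightarrow> f (gen n i) = g (gen n i)"
  shows "f = g"
proof (rule lin_hom_eqI[OF f g])
  let ?F = "free_module R {..<n}"
  have *: "(\<lambda>x\<in>carrier ?F. k (code n x))\<in>lin_hom R ?F W" if k: "k\<in>lin_hom R (FM n) W" for k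
  proof (rule lin_homI)
    fix x y assume x: "x\<in>carrier ?F" and y: "y\<in>carrier ?F"
    have "k (code n (x \<oplus>[?F] y)) = k (code n x \<oplus>[FM n] code n y)"
      using x y by (simp add: FM_simps)
    then show "(\<lambda>x\<in>carrier ?F. k (code n x)) (x \<oplus>[?F] y) =
        (\<lambda>x\<in>carrier ?F. k (code n x)) x \<oplus>[W] (\<lambda>x\<in>carrier ?F. k (code n x)) y"
      using x y lin_homD(3)[OF k, of "code n x" "code n y"] free_over.free_add_closed[OF free_over, of x "{..<n}" y]
      by (simp add: FM_simps)
  next
    fix r x assume r: "r\<in>carrier R" and x: "x\<in>carrier ?F"
    have "k (code n (r \<odot>[?F] x)) = k (r \<odot>[FM n] code n x)"
      using x by (simp add: FM_simps)
    then show "(\<lambda>x\<in>carrier ?F. k (code n x)) (r \<odot>[?F] x) = r \<odot>[W] (\<lambda>x\<in>carrier ?F. k (code n x)) x"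
      using r x lin_homD(4)[OF k r, of "code n x"] free_over.free_smult_closed[OF free_over, of x "{..<n}" r]
      by (simp add: FM_simps)
  qed (use lin_homD(1)[OF k] in \<open>auto simp: FM_simps\<close>)
  fix x assume "x\<in>carrier (FM n)"
  then obtain y where y: "y\<in>carrier ?F" "x = code n y" by (auto simp: FM_simps)
  have "(\<lambda>x\<in>carrier ?F. f (code n x)) = (\<lambda>x\<in>carrier ?F. g (code n x))"
    by (rule free_over.free_hom_eq[OF free_over W *[OF f] *[OF g]])
      (simp add: e[unfolded gen_def] free_over.free_basis_closed[OF free_over])
  from fun_cong[OF this, of y] show "f x = g x" using y by simp
qed

lemma lmap_unique:
  assumes "left_module R W" "f\<in>lin_hom R (FM n) W"
  shows "f = lmap W (map f (gens n))"
proof -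
  have c: "set (map f (gens n)) \<subseteq> carrier W" "length (map f (gens n)) = n"
    using lin_homD(1)[OF assms(2) gen_closed] by (auto simp: gens_def)
  show ?thesis
    by (rule FM_hom_eq[OF assms lmap_lin[OF assms(1) c]])
     (simp add: lmap_gen[OF assms(1) c], simp add: gens_def)
qed

lemma map_lmap_gens:
  assumes "left_module R W" "set w \<subseteq> carrier W" "length w = n"
  shows "map (lmap W w) (gens n) = w"
  using assms lmap_gen[OF assms] by (intro nth_equalityI) (auto simp: gens_def)

lemma lmap_comp:
  assumes "left_module R W" "left_module R U" "set w \<subseteq> carrier W" "length w = n" "g\<in>lin_hom R W U"
  shows "compose (carrier (FM n)) g (lmap W w) = lmap U (map g w)"
proof -
  note c = lin_hom_compose[OF lmap_lin[OF assms(1,3,4)] assms(5) FM_left_module]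
  have "map (compose (carrier (FM n)) g (lmap W w)) (gens n) = map g (map (lmap W w) (gens n))"
    using gens_closed[of n] by (auto simp: compose_eq subset_iff)
  then show ?thesis
    using lmap_unique[OF assms(2) c] map_lmap_gens[OF assms(1,3,4)] by simp
qed

lemma lmap_gens: "lmap (FM n) (gens n) = (\<lambda>x\<in>carrier (FM n). x)"
proof -
  have "map (\<lambda>x\<in>carrier (FM n). x) (gens n) = gens n"
    using gens_closed(1)[of n] by (auto intro!: map_idI)
  then show ?thesis
    using lmap_unique[OF FM_left_module lin_hom_id[OF FM_left_module], of n] by simp
qed

lemma FM_fgp: "FM n\<in>Proj"
proof -
  have fg: "H = carrier (FM n)"
    if H: "set (gens n) \<subseteq> H" "subgroup H (add_monoid (FM n))" "\<forall>r\<in>carrier R. \<forall>x\<in>H. r \<odot>[FM n] x\<in>H" for H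
  proof -
    have "submodule_of R (FM n) H"
      using H subgroup.subset[OF H(2)] subgroup.one_closed[OF H(2)] subgroup.m_closed[OF H(2)]
      by (auto simp: submodule_of_def)
    \<comment> \<open>The projection modulo \<open>H\<close> and the zero map agree on the
      generators and are therefore equal, so \<open>H\<close> is everything.\<close>
    then interpret Q: quotient_of R "FM n" H by (intro quotient_of.intro FM_left_module)
    let ?p = "\<lambda>x\<in>carrier (FM n). Q.\<pi> x" and ?z = "\<lambda>x\<in>carrier (FM n). \<zero>[Q.Q]"
    have p: "?p\<in>lin_hom R (FM n) Q.Q"
      by (rule lin_homI) (auto simp: Q.carrier_Q Q.add_Q Q.smult_Q left_module.smult_closed[OF FM_left_module])
    interpret QQ: abelian_group Q.Q by (rule Q.Q_abelian)
    have z: "?z\<in>lin_hom R (FM n) Q.Q"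
      by (rule lin_homI) (auto simp: lm_smult_zero[OF Q.Q_left_module] left_module.smult_closed[OF FM_left_module])
    have "?p = ?z"
    proof (rule FM_hom_eq[OF Q.Q_left_module p z])
      fix i assume "i < n"
      then have "gen n i\<in>H" using H(1) by (auto simp: gens_def)
      then show "?p (gen n i) = ?z (gen n i)" by (simp add: gen_closed Q.proj_zero_iff)
    qed
    have "x\<in>H" if x: "x\<in>carrier (FM n)" for x
    proof -
      have "Q.\<pi> x = \<zero>[Q.Q]" using fun_cong[OF \<open>?p = ?z\<close>, of x] x by simp
      then show ?thesis using Q.proj_zero_iff[OF x] by simp
    qed
    then show ?thesis using subgroup.subset[OF H(2)] by auto
  qed
  have pr: "\<exists>g\<in>lin_hom R (FM n) N. compose (carrier (FM n)) p g = f"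
    if N: "left_module R N" "left_module R N'" and p: "p\<in>lin_hom R N N'" "p ` carrier N = carrier N'"
      and f: "f\<in>lin_hom R (FM n) N'"
    for N N' :: "('r, 'u) module" and p f
  proof -
    have "\<exists>y. y\<in>carrier N \<and> p y = x" if "x\<in>carrier N'" for x
      using that unfolding p(2)[symmetric] by auto
    then obtain c where c: "\<And>x. x\<in>carrier N' \<Longrightarrow> c x\<in>carrier N \<and> p (c x) = x" by metis
    \<comment> \<open>Lifting is done generator by generator, with an arbitrary preimage of each
      image.\<close>
    let ?w = "map (\<lambda>x. c (f x)) (gens n)"
    have w: "set ?w \<subseteq> carrier N" "length ?w = n"
      using c lin_homD(1)[OF f gen_closed] by (auto simp: gens_def)
    have e: "map p ?w = map f (gens n)" using c lin_homD(1)[OF f gen_closed] by (auto simp: gens_def)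
    have "compose (carrier (FM n)) p (lmap N ?w) = f"
      unfolding lmap_comp[OF N w p(1)] e by (rule lmap_unique[OF N(2) f, symmetric])
    then show ?thesis using lmap_lin[OF N(1) w] by blast
  qed
  show ?thesis
    unfolding fg_projective_def using FM_left_module gens_closed[of n] fg pr
    by (auto intro!: exI[of _ "set (gens n)"])
qed

text \<open>Addition of tuples is addition of linear maps. Through this, additivity of
  \<open>I\<close> on morphisms acts on the arguments of operations.\<close>

lemma lmap_add:
  assumes W: "left_module R W" and w: "set w \<subseteq> carrier W" "length w = n" "set v \<subseteq> carrier W" "length v = n"
    and x: "x\<in>carrier (FM n)"
  shows "lmap W (map2 (\<oplus>\<^bsub>W\<^esub>) v w) x = lmap W v x \<oplus>[W] lmap W w x"
proof -
  interpret W: abelian_group W using W by (rule lm_abelian)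
  have s: "set (map2 (\<oplus>\<^bsub>W\<^esub>) v w) \<subseteq> carrier W" "length (map2 (\<oplus>\<^bsub>W\<^esub>) v w) = n"
    using w by (auto dest: set_zip_leftD set_zip_rightD)
  note lv = lmap_lin[OF W w(3,4)] and lw = lmap_lin[OF W w(1,2)]
  interpret F: abelian_group "FM n" using FM_left_module by (rule lm_abelian)
  have "(\<lambda>x\<in>carrier (FM n). lmap W v x \<oplus>[W] lmap W w x)\<in>lin_hom R (FM n) W"
    using lin_homD(1,3,4)[OF lv] lin_homD(1,3,4)[OF lw] left_module.smult_r_distr[OF W] left_module.smult_closed[OF FM_left_module]
    by (intro lin_homI) (auto simp: W.a_ac)
  then have "lmap W (map2 (\<oplus>\<^bsub>W\<^esub>) v w) = (\<lambda>x\<in>carrier (FM n). lmap W v x \<oplus>[W] lmap W w x)"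
    using w by (intro FM_hom_eq[OF W lmap_lin[OF W s]])
      (simp_all add: lmap_gen[OF W s] lmap_gen[OF W w(1,2)] lmap_gen[OF W w(3,4)] gen_closed)
  then show ?thesis using x by simp
qed

lemma FM_zero: "carrier (FM 0) = {\<zero>[FM 0]}"
  by (auto simp: FM_simps free_module_def restrict_def)

lemma fgp_lift:
  fixes V N N' :: "('r, 'u) module"
  assumes "V\<in>Proj" "left_module R N" "left_module R N'"
    "p\<in>lin_hom R N N'" "p ` carrier N = carrier N'" "f\<in>lin_hom R V N'"
  shows "\<exists>g\<in>lin_hom R V N. compose (carrier V) p g = f"
proof -
  have "\<forall>(N :: ('r, 'u) module) (N' :: ('r, 'u) module). left_module R N \<and> left_module R N' \<longrightarrow>
        (\<forall>p\<in>lin_hom R N N'. p ` carrier N = carrier N' \<longrightarrow>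
          (\<forall>f\<in>lin_hom R V N'. \<exists>g\<in>lin_hom R V N. compose (carrier V) p g = f))"
    using assms(1) unfolding fg_projective_def mem_Collect_eq by (elim conjE)
  then show ?thesis using assms(2-6) by simp
qed

text \<open>Finitely many generators give a surjection from a finite free module of the universe,
  and projectivity splits it.\<close>

lemma fgp_retract:
  assumes V: "V\<in>(Proj :: ('r, 'u) module set)"
  obtains w g where "set w \<subseteq> carrier V" "g\<in>lin_hom R V (FM (length w))"
    "compose (carrier V) (lmap V w) g = (\<lambda>x\<in>carrier V. x)"
proof -
  note m = fgp_module[OF V]
  have "\<exists>A. finite A \<and> A \<subseteq> carrier V \<and>
      (\<forall>H. A \<subseteq> H \<and> subgroup H (add_monoid V) \<and> (\<forall>r\<in>carrier R. \<forall>x\<in>H. r \<odot>[V] x\<in>H) \<longrightarrow> H = carrier V)"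
    using V unfolding fg_projective_def mem_Collect_eq by (elim conjE)
  then obtain A where A: "finite A" "A \<subseteq> carrier V"
    and gen: "\<forall>H. A \<subseteq> H \<and> subgroup H (add_monoid V) \<and> (\<forall>r\<in>carrier R. \<forall>x\<in>H. r \<odot>[V] x\<in>H) \<longrightarrow> H = carrier V"
    by (elim exE conjE)
  obtain w where w: "set w = A" using finite_list[OF A(1)] by blast
  then have sw: "set w \<subseteq> carrier V" using A by simp
  let ?n = "length w"
  note l = lmap_lin[OF m sw refl]
  interpret l: add_hom "FM ?n" V "lmap V w" by (rule lin_add_hom[OF l FM_left_module m])
  have "lmap V w ` carrier (FM ?n) = carrier V"
  proof (rule gen[rule_format], intro conjI)
    show "A \<subseteq> lmap V w ` carrier (FM ?n)"
    proof
      fix a assume "a\<in>A"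
      then obtain i where "i < ?n" "a = w ! i" using w by (metis in_set_conv_nth)
      then have "a = lmap V w (gen ?n i)" using lmap_gen[OF m sw refl] by simp
      then show "a\<in>lmap V w ` carrier (FM ?n)" using gen_closed by blast
    qed
    show "subgroup (lmap V w ` carrier (FM ?n)) (add_monoid V)"
      using group_hom.img_is_subgroup[OF l.a_group_hom] by simp
    show "\<forall>r\<in>carrier R. \<forall>x\<in>lmap V w ` carrier (FM ?n). r \<odot>[V] x\<in>lmap V w ` carrier (FM ?n)"
      using left_module.smult_closed[OF FM_left_module]
      by (auto simp flip: lin_homD(4)[OF l])
  qed
  then obtain g where "g\<in>lin_hom R V (FM ?n)" "compose (carrier V) (lmap V w) g = (\<lambda>x\<in>carrier V. x)"
    using fgp_lift[OF V FM_left_module m l _ lin_hom_id[OF m]] by blast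
  then show thesis using that sw by blast
qed

subsection \<open>Operations defined by elements of values at free modules\<close>

text \<open>Yoneda: linear maps \<open>FM n \<rightarrow> W\<close> are \<open>n\<close>-tuples in
  \<open>W\<close>, so an element \<open>x\<close> of the value of \<open>F\<close> at
  \<open>FM n\<close> is the same as a natural operation sending \<open>n\<close>-tuples in
  \<open>W\<close> to elements of the value of \<open>F\<close> at \<open>W\<close>.\<close>

definition op :: "('r, 'u, 't, 'x) pfunctor \<Rightarrow> 'x \<Rightarrow> ('r, 'u) module \<Rightarrow> 'u list \<Rightarrow> 'x" where
  "op F x W w = fmap F (FM (length w)) W (lmap W w) x"

context
  fixes T :: "'t ring" and F :: "('r, 'u, 't, 'x) pfunctor"
  assumes F: "pointed_functor R T F"
begin

lemma op_closed:
  assumes "W\<in>Proj" "set w \<subseteq> carrier W" "length w = n" "x\<in>pts F (FM n)"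
  shows "op F x W w\<in>pts F W"
  using lin_homD(1)[OF functor_map[OF F FM_fgp assms(1) lmap_lin[OF fgp_module[OF assms(1)] assms(2,3)]] assms(4)]
  by (simp add: op_def assms(3))

lemma op_natural:
  assumes "W\<in>Proj" "U\<in>Proj" "f\<in>lin_hom R W U"
    "set w \<subseteq> carrier W" "length w = n" "x\<in>pts F (FM n)"
  shows "fmap F W U f (op F x W w) = op F x U (map f w)"
proof -
  note W = fgp_module[OF assms(1)] and U = fgp_module[OF assms(2)]
  show ?thesis
    using functor_map_comp[OF F FM_fgp assms(1,2) lmap_lin[OF W assms(4,5)] assms(3,6)]
      lmap_comp[OF W U assms(4,5,3)] by (simp add: op_def assms(5))
qed

lemma op_gens: "x\<in>pts F (FM n) \<Longrightarrow> op F x (FM n) (gens n) = x"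
  using functor_map_id[OF F FM_fgp] by (simp add: op_def gens_closed lmap_gens)

text \<open>\<open>F\<close> is not assumed additive; the zero map factors through the zero module
  \<open>FM 0\<close>, at which a pointed functor vanishes.\<close>

lemma functor_zero_map:
  assumes V: "V\<in>Proj" and W: "W\<in>Proj" and x: "x\<in>pts F V"
  shows "fmap F V W (\<lambda>x\<in>carrier V. \<zero>[W]) x = \<zero>[fobj F W]"
proof -
  interpret V: abelian_group V using fgp_module[OF V] by (rule lm_abelian)
  interpret W: abelian_group W using fgp_module[OF W] by (rule lm_abelian)
  interpret Z: abelian_group "FM 0" using FM_left_module by (rule lm_abelian)
  let ?a = "\<lambda>x\<in>carrier V. \<zero>[FM 0]" and ?b = "\<lambda>x\<in>carrier (FM 0). \<zero>[W]"
  have a: "?a\<in>lin_hom R V (FM 0)"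
    by (rule lin_homI) (auto simp: lm_smult_zero[OF FM_left_module] left_module.smult_closed[OF fgp_module[OF V]])
  have b: "?b\<in>lin_hom R (FM 0) W"
    by (rule lin_homI) (auto simp: lm_smult_zero[OF fgp_module[OF W]] left_module.smult_closed[OF FM_left_module])
  have "(\<lambda>x\<in>carrier V. \<zero>[W]) = compose (carrier V) ?b ?a" by (auto simp: compose_def)
  then have "fmap F V W (\<lambda>x\<in>carrier V. \<zero>[W]) x = fmap F (FM 0) W ?b (fmap F V (FM 0) ?a x)"
    using functor_map_comp[OF F V FM_fgp W a b x] by simp
  moreover have "fmap F V (FM 0) ?a x\<in>pts F (FM 0)"
    by (rule lin_homD(1)[OF functor_map[OF F V FM_fgp a] x])
  then have "fmap F V (FM 0) ?a x = \<zero>[fobj F (FM 0)]"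
    using functor_zero[OF F FM_fgp FM_zero] by simp
  ultimately show ?thesis
    using add_hom.hom_zero[OF functor_map_hom[OF F FM_fgp W b]] by simp
qed

lemma op_zero:
  assumes W: "W\<in>Proj" and w: "set w \<subseteq> {\<zero>[W]}" "length w = n" and x: "x\<in>pts F (FM n)"
  shows "op F x W w = \<zero>[fobj F W]"
proof -
  note m = fgp_module[OF W]
  interpret W: abelian_group W using m by (rule lm_abelian)
  have sw: "set w \<subseteq> carrier W" using w by auto
  have w0: "w ! i = \<zero>[W]" if "i < n" for i
    using subsetD[OF w(1) nth_mem, of i] that w(2) by simp
  have z: "(\<lambda>x\<in>carrier (FM n). \<zero>[W])\<in>lin_hom R (FM n) W"
    using abelian_groupE(1)[OF lm_abelian[OF FM_left_module]]
    by (intro lin_homI) (auto simp: lm_smult_zero[OF m] left_module.smult_closed[OF FM_left_module])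
  have "lmap W w = (\<lambda>x\<in>carrier (FM n). \<zero>[W])"
    by (intro FM_hom_eq[OF m lmap_lin[OF m sw w(2)] z]) (auto simp: lmap_gen[OF m sw w(2)] gen_closed w0)
  then show ?thesis using functor_zero_map[OF FM_fgp W x] w(2) by (simp add: op_def)
qed

end

lemma op_nat:
  assumes "\<eta>\<in>nat_hom R T F G" "W\<in>Proj" "set w \<subseteq> carrier W" "length w = n" "x\<in>pts F (FM n)"
  shows "\<eta> W (op F x W w) = op G (\<eta> (FM n) x) W w"
  using nat_hom_natural[OF assms(1) FM_fgp assms(2) lmap_lin[OF fgp_module[OF assms(2)] assms(3,4)] assms(5)]
  by (simp add: op_def assms(4))

end

subsection \<open>Projective resolutions\<close>

context universe begin

text \<open>Indices of the basis of a projective functor mapping onto \<open>F\<close>: the triple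
  \<open>(n, x, w)\<close> stands for \<open>x\<close> moved along \<open>lmap W w\<close>. Tuples
  of zeros are left out in order that the functor be pointed.\<close>

definition gidx :: "('r, 'u, 't, 'x) pfunctor \<Rightarrow> ('r, 'u) module \<Rightarrow> (nat \<times> 'x \<times> 'u list) set" where
  "gidx F W = {(n, x, w). x\<in>pts F (FM n) \<and> length w = n \<and> set w \<subseteq> carrier W \<and>
     \<not> set w \<subseteq> {\<zero>[W]}}"

text \<open>The basis element of an index, extended by zero to the tuples that were left out. With
  this convention a linear map acts on \<open>bas\<close> by one formula, even when it sends a
  nonzero tuple to zeros.\<close>

definition bas :: "'t ring \<Rightarrow> ('r, 'u, 't, 'x) pfunctor \<Rightarrow> ('r, 'u) module \<Rightarrow> nat \<times> 'x \<times> 'u list \<Rightarrow>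
    nat \<times> 'x \<times> 'u list \<Rightarrow> 't" where
  "bas T F W j = (if j\<in>gidx F W then free_basis T (gidx F W) j else \<zero>[free_module T (gidx F W)])"

text \<open>Each \<open>n\<close> and \<open>x\<close> contributes the free module on the linear
  maps \<open>FM n \<rightarrow> W\<close> with the zero map set to zero, a reduced representable
  functor. By Yoneda such functors are projective among pointed functors.\<close>

definition cover :: "'t ring \<Rightarrow> ('r, 'u, 't, 'x) pfunctor \<Rightarrow>
    ('r, 'u, 't, nat \<times> 'x \<times> 'u list \<Rightarrow> 't) pfunctor" where
  "cover T F = \<lparr>fobj = (\<lambda>W. free_module T (gidx F W)),
     fmap = (\<lambda>W U g. free_lift T (gidx F W) (free_module T (gidx F U)) (\<lambda>(n, x, w). bas T F U (n, x, map g w)))\<rparr>"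

text \<open>The transformation that takes the universal basis element at
  \<open>(n, x, gens n)\<close> to \<open>y n x\<close>.\<close>

definition cover_lift :: "'t ring \<Rightarrow> ('r, 'u, 't, 'x) pfunctor \<Rightarrow> ('r, 'u, 't, 'y) pfunctor \<Rightarrow>
    (nat \<Rightarrow> 'x \<Rightarrow> 'y) \<Rightarrow> ('r, 'u) module \<Rightarrow> (nat \<times> 'x \<times> 'u list \<Rightarrow> 't) \<Rightarrow> 'y" where
  "cover_lift T F G y = (\<lambda>W\<in>Proj.
     free_lift T (gidx F W) (fobj G W) (\<lambda>(n, x, w). op G (y n x) W w))"

context
  fixes T :: "'t ring" and F :: "('r, 'u, 't, 'x) pfunctor"
  assumes T: "ring T"
begin

interpretation FO: free_over T J for J :: "(nat \<times> 'x \<times> 'u list) set"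
  using T by (rule free_over.intro)

lemma fobj_cover: "fobj (cover T F) W = free_module T (gidx F W)"
  by (simp add: cover_def)

lemma bas_closed: "bas T F W j\<in>pts (cover T F) W"
  by (simp add: bas_def fobj_cover FO.free_basis_closed FO.FR.zero_closed)

lemma cover_hom_eq:
  assumes "left_module T V" "f\<in>lin_hom T (fobj (cover T F) W) V" "g\<in>lin_hom T (fobj (cover T F) W) V"
    and "\<And>n x w. \<lbrakk>x\<in>pts F (FM n); length w = n; set w \<subseteq> carrier W\<rbrakk> \<Longrightarrow>
      f (bas T F W (n, x, w)) = g (bas T F W (n, x, w))"
  shows "f = g"
proof (rule FO.free_hom_eq[OF assms(1) assms(2,3)[unfolded fobj_cover]])
  fix j assume j: "j\<in>gidx F W"
  then obtain n x w where "j = (n, x, w)" "x\<in>pts F (FM n)" "length w = n" "set w \<subseteq> carrier W"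
    by (auto simp: gidx_def)
  then show "f (free_basis T (gidx F W) j) = g (free_basis T (gidx F W) j)"
    using assms(4)[of x n w] j by (simp add: bas_def)
qed

lemma cover_left_module: "left_module T (fobj (cover T F) W)"
  unfolding fobj_cover by (rule FO.free_left_module)

lemma cover_map_lin: "fmap (cover T F) W U g\<in>lin_hom T (fobj (cover T F) W) (fobj (cover T F) U)"
proof -
  have "free_lift T (gidx F W) (free_module T (gidx F U)) (\<lambda>(n, x, w). bas T F U (n, x, map g w))
     \<in>lin_hom T (free_module T (gidx F W)) (free_module T (gidx F U))"
    by (rule FO.free_lift_lin[OF FO.free_left_module]) (auto simp: bas_closed[unfolded fobj_cover])
  then show ?thesis by (simp add: cover_def)
qed

lemma cover_map_bas:
  assumes g: "g\<in>lin_hom R W U" and W: "left_module R W" and U: "left_module R U"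
    and x: "x\<in>pts F (FM n)" and w: "length w = n" "set w \<subseteq> carrier W"
  shows "fmap (cover T F) W U g (bas T F W (n, x, w)) = bas T F U (n, x, map g w)"
proof (cases "(n, x, w)\<in>gidx F W")
  case True
  have "free_lift T (gidx F W) (free_module T (gidx F U)) (\<lambda>(n, x, w). bas T F U (n, x, map g w))
      (free_basis T (gidx F W) (n, x, w)) = (\<lambda>(n, x, w). bas T F U (n, x, map g w)) (n, x, w)"
    by (rule FO.free_lift_basis[OF FO.free_left_module]) (auto simp: bas_closed[unfolded fobj_cover] True)
  then show ?thesis using True by (simp add: bas_def cover_def)
next
  \<comment> \<open>A tuple of zeros stays a tuple of zeros under a linear map, so both sides are
    zero.\<close>
  case False
  then have "set w \<subseteq> {\<zero>[W]}" using x w by (auto simp: gidx_def)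
  then have "set (map g w) \<subseteq> {\<zero>[U]}"
    using add_hom.hom_zero[OF lin_add_hom[OF g W U]] by auto
  then have "(n, x, map g w) \<notin> gidx F U" by (auto simp: gidx_def)
  then show ?thesis
    using False add_hom.hom_zero[OF lin_add_hom[OF cover_map_lin cover_left_module cover_left_module]]
    by (simp add: bas_def fobj_cover)
qed

lemma cover_pointed: "pointed_functor R T (cover T F)"
proof (rule pointed_functorI)
  fix V assume V: "V\<in>Proj"
  note mV = fgp_module[OF V]
  show "left_module T (fobj (cover T F) V)" by (rule cover_left_module)
  show "fmap (cover T F) V W f\<in>lin_hom T (fobj (cover T F) V) (fobj (cover T F) W)" for W f
    by (rule cover_map_lin)
  { fix z assume z: "z\<in>pts (cover T F) V"
    have "fmap (cover T F) V V (\<lambda>x\<in>carrier V. x) = (\<lambda>x\<in>pts (cover T F) V. x)"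
    proof (rule cover_hom_eq[OF cover_left_module cover_map_lin lin_hom_id[OF cover_left_module]])
      fix n x w assume a: "x\<in>pts F (FM n)" "length w = n" "set w \<subseteq> carrier V"
      have "map (\<lambda>x\<in>carrier V. x) w = w" using a(3) by (auto intro!: map_idI)
      then show "fmap (cover T F) V V (\<lambda>x\<in>carrier V. x) (bas T F V (n, x, w)) =
          (\<lambda>x\<in>pts (cover T F) V. x) (bas T F V (n, x, w))"
        using cover_map_bas[OF lin_hom_id[OF mV] mV mV a] bas_closed by simp
    qed
    then show "fmap (cover T F) V V (\<lambda>x\<in>carrier V. x) z = z" using z by simp
  }
  { fix W U f g z
    assume W: "W\<in>Proj" and U: "U\<in>Proj"
      and f: "f\<in>lin_hom R V W" and g: "g\<in>lin_hom R W U" and z: "z\<in>pts (cover T F) V"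
    note mW = fgp_module[OF W] and mU = fgp_module[OF U]
    have "fmap (cover T F) V U (compose (carrier V) g f) =
        compose (pts (cover T F) V) (fmap (cover T F) W U g) (fmap (cover T F) V W f)"
    proof (rule cover_hom_eq[OF cover_left_module cover_map_lin lin_hom_compose[OF cover_map_lin cover_map_lin cover_left_module]])
      fix n x w assume a: "x\<in>pts F (FM n)" "length w = n" "set w \<subseteq> carrier V"
      have m: "map (compose (carrier V) g f) w = map g (map f w)" using a(3) by (auto simp: compose_eq)
      have b: "length (map f w) = n" "set (map f w) \<subseteq> carrier W"
        using a lin_homD(1)[OF f] by auto
      show "fmap (cover T F) V U (compose (carrier V) g f) (bas T F V (n, x, w)) =
          compose (pts (cover T F) V) (fmap (cover T F) W U g) (fmap (cover T F) V W f) (bas T F V (n, x, w))"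
        using cover_map_bas[OF lin_hom_compose[OF f g mV] mV mU a] cover_map_bas[OF f mV mW a]
          cover_map_bas[OF g mW mU a(1) b] bas_closed m by (simp add: compose_eq)
    qed
    then show "fmap (cover T F) V U (compose (carrier V) g f) z = fmap (cover T F) W U g (fmap (cover T F) V W f z)"
      using z by (simp add: compose_eq)
  }
  show "pts (cover T F) V \<subseteq> {\<zero>[fobj (cover T F) V]}" if "carrier V = {\<zero>[V]}"
  proof -
    have "gidx F V = {}" using that by (auto simp: gidx_def)
    then show ?thesis by (auto simp: fobj_cover free_module_def restrict_def)
  qed
qed

context
  fixes G :: "('r, 'u, 't, 'y) pfunctor" and y :: "nat \<Rightarrow> 'x \<Rightarrow> 'y"
  assumes G: "pointed_functor R T G"
    and y: "\<And>n x. x\<in>pts F (FM n) \<Longrightarrow> y n x\<in>pts G (FM n)"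
begin

lemma cover_lift_lin: "W\<in>Proj \<Longrightarrow> cover_lift T F G y W\<in>lin_hom T (fobj (cover T F) W) (fobj G W)"
proof -
  assume W: "W\<in>Proj"
  have "free_lift T (gidx F W) (fobj G W) (\<lambda>(n, x, w). op G (y n x) W w)
     \<in>lin_hom T (free_module T (gidx F W)) (fobj G W)"
    by (rule FO.free_lift_lin[OF functor_obj[OF G W]]) (auto simp: gidx_def intro!: op_closed[OF G W] y)
  then show ?thesis using W by (simp add: cover_lift_def fobj_cover)
qed

lemma cover_lift_bas:
  assumes W: "W\<in>Proj" and x: "x\<in>pts F (FM n)" and w: "length w = n" "set w \<subseteq> carrier W"
  shows "cover_lift T F G y W (bas T F W (n, x, w)) = op G (y n x) W w"
proof (cases "(n, x, w)\<in>gidx F W")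
  case True
  have "free_lift T (gidx F W) (fobj G W) (\<lambda>(n, x, w). op G (y n x) W w) (free_basis T (gidx F W) (n, x, w)) =
      (\<lambda>(n, x, w). op G (y n x) W w) (n, x, w)"
    by (rule FO.free_lift_basis[OF functor_obj[OF G W]]) (auto simp: gidx_def True[unfolded gidx_def, simplified] intro!: op_closed[OF G W] y)
  then show ?thesis using True W by (simp add: cover_lift_def bas_def)
next
  case False
  then have "set w \<subseteq> {\<zero>[W]}" using x w by (auto simp: gidx_def)
  then have "op G (y n x) W w = \<zero>[fobj G W]" by (intro op_zero[OF G W _ w(1)] y x)
  then show ?thesis
    using False add_hom.hom_zero[OF lin_add_hom[OF cover_lift_lin[OF W] cover_left_module functor_obj[OF G W]]]
    by (simp add: bas_def fobj_cover)
qed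

lemma cover_lift_nat_hom: "cover_lift T F G y\<in>nat_hom R T (cover T F) G"
proof (rule nat_homI)
  fix V W f z
  assume V: "V\<in>Proj" and W: "W\<in>Proj" and f: "f\<in>lin_hom R V W"
    and z: "z\<in>pts (cover T F) V"
  note mV = fgp_module[OF V] and mW = fgp_module[OF W]
  have "compose (pts (cover T F) V) (cover_lift T F G y W) (fmap (cover T F) V W f) =
      compose (pts (cover T F) V) (fmap G V W f) (cover_lift T F G y V)"
  proof (rule cover_hom_eq[OF functor_obj[OF G W] lin_hom_compose[OF cover_map_lin cover_lift_lin[OF W] cover_left_module]
        lin_hom_compose[OF cover_lift_lin[OF V] functor_map[OF G V W f] cover_left_module]])
    fix n x w assume a: "x\<in>pts F (FM n)" "length w = n" "set w \<subseteq> carrier V"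
    have b: "length (map f w) = n" "set (map f w) \<subseteq> carrier W"
      using a lin_homD(1)[OF f] by auto
    show "compose (pts (cover T F) V) (cover_lift T F G y W) (fmap (cover T F) V W f) (bas T F V (n, x, w)) =
        compose (pts (cover T F) V) (fmap G V W f) (cover_lift T F G y V) (bas T F V (n, x, w))"
      by (simp add: compose_eq bas_closed cover_map_bas[OF f mV mW a] cover_lift_bas[OF W a(1) b]
         cover_lift_bas[OF V a] op_natural[OF G V W f a(3,2) y[OF a(1)]])
  qed
  from fun_cong[OF this, of z] show "cover_lift T F G y W (fmap (cover T F) V W f z) = fmap G V W f (cover_lift T F G y V z)"
    using z by (simp add: compose_eq)
qed (simp_all add: cover_lift_lin, simp add: cover_lift_def)

end

text \<open>The uniqueness half of Yoneda: \<open>bas\<close> at \<open>(n, x, w)\<close> is the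
  image under \<open>lmap W w\<close> of \<open>bas\<close> at
  \<open>(n, x, gens n)\<close>.\<close>

lemma cover_nat_hom_eq:
  assumes "pointed_functor R T G" "\<eta>\<in>nat_hom R T (cover T F) G" "\<theta>\<in>nat_hom R T (cover T F) G"
    and "\<And>n x. x\<in>pts F (FM n) \<Longrightarrow>
      \<eta> (FM n) (bas T F (FM n) (n, x, gens n)) = \<theta> (FM n) (bas T F (FM n) (n, x, gens n))"
  shows "\<eta> = \<theta>"
proof (rule nat_hom_eqI[OF assms(2,3)])
  fix W z
  assume W: "W\<in>Proj" and z: "z\<in>pts (cover T F) W"
  note m = fgp_module[OF W]
  have "\<eta> W = \<theta> W"
  proof (rule cover_hom_eq[OF functor_obj[OF assms(1) W] nat_hom_lin[OF assms(2) W] nat_hom_lin[OF assms(3) W]])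
    fix n x w assume a: "x\<in>pts F (FM n)" "length w = n" "set w \<subseteq> carrier W"
    note l = lmap_lin[OF m a(3,2)]
    have b: "bas T F W (n, x, w) = fmap (cover T F) (FM n) W (lmap W w) (bas T F (FM n) (n, x, gens n))"
      using cover_map_bas[OF l FM_left_module m a(1) gens_closed(2,1)] map_lmap_gens[OF m a(3,2)] by simp
    show "\<eta> W (bas T F W (n, x, w)) = \<theta> W (bas T F W (n, x, w))"
      unfolding b nat_hom_natural[OF assms(2) FM_fgp W l bas_closed]
        nat_hom_natural[OF assms(3) FM_fgp W l bas_closed] assms(4)[OF a(1)] ..
  qed
  then show "\<eta> W z = \<theta> W z" by simp
qed

text \<open>\<open>V\<close> is a retract of a finite free module. If \<open>g\<close> is the
  section belonging to generators \<open>w\<close>, then \<open>z\<close> is the operation defined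
  by its image under \<open>g\<close>, evaluated at \<open>w\<close>.\<close>

lemma cover_surj:
  assumes F: "pointed_functor R T F" and V: "V\<in>Proj"
  shows "cover_lift T F F (\<lambda>n x. x) V ` pts (cover T F) V = pts F V"
proof
  show "cover_lift T F F (\<lambda>n x. x) V ` pts (cover T F) V \<subseteq> pts F V"
    using lin_homD(1)[OF cover_lift_lin[OF F _ V]] by auto
  show "pts F V \<subseteq> cover_lift T F F (\<lambda>n x. x) V ` pts (cover T F) V"
  proof
    fix z assume z: "z\<in>pts F V"
    obtain w g where w: "set w \<subseteq> carrier V" and g: "g\<in>lin_hom R V (FM (length w))"
      and e: "compose (carrier V) (lmap V w) g = (\<lambda>x\<in>carrier V. x)"
      using fgp_retract[OF V] .
    let ?n = "length w" and ?x = "fmap F V (FM (length w)) g z"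
    have x: "?x\<in>pts F (FM ?n)"
      by (rule lin_homD(1)[OF functor_map[OF F V FM_fgp g] z])
    have "op F ?x V w = z"
      using functor_map_comp[OF F V FM_fgp V g lmap_lin[OF fgp_module[OF V] w refl] z]
        functor_map_id[OF F V z] e by (simp add: op_def)
    then have "cover_lift T F F (\<lambda>n x. x) V (bas T F V (?n, ?x, w)) = z"
      using cover_lift_bas[OF F _ V x refl w, of "\<lambda>n x. x"] by simp
    then show "z\<in>cover_lift T F F (\<lambda>n x. x) V ` pts (cover T F) V"
      using bas_closed by (metis imageI)
  qed
qed

lemma cover_lepoll:
  assumes "carrier T \<lesssim> (UNIV :: 'u set)" "(UNIV :: 'x set) \<lesssim> (UNIV :: 'u set)"
  shows "pts (cover T F) W \<lesssim> (UNIV :: 'u set)"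
proof -
  have "(UNIV :: nat set) \<lesssim> (UNIV :: 'u set)" using inf by (simp add: infinite_le_lepoll)
  moreover have "(UNIV :: 'u list set) \<lesssim> (UNIV :: 'u set)"
    using lists_lepoll_infinite[OF inf lepoll_refl] by simp
  ultimately have "(UNIV :: nat set) \<times> (UNIV :: 'x set) \<times> (UNIV :: 'u list set) \<lesssim> (UNIV :: 'u set)"
    by (intro times_lepoll_infinite[OF inf] assms(2))
  then have "gidx F W \<lesssim> (UNIV :: 'u set)"
    by (rule lepoll_trans[OF subset_imp_lepoll, rotated]) auto
  then show ?thesis unfolding fobj_cover by (rule free_module_lepoll[OF inf _ assms(1)])
qed

end

definition enc :: "('r, 'u, 't, 'x) pfunctor \<Rightarrow> ('r, 'u) module \<Rightarrow> 'x \<Rightarrow> 'u" where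
  "enc F W = (SOME e. inj_on e (pts F W))"

lemma enc_inj:
  assumes "pts F W \<lesssim> (UNIV :: 'u set)"
  shows "inj_on (enc F W) (pts F W)"
proof -
  have "\<exists>e :: _ \<Rightarrow> 'u. inj_on e (pts F W)" using assms unfolding lepoll_def by blast
  then show ?thesis unfolding enc_def by (rule someI_ex)
qed

text \<open>\<open>projective_functor\<close> tests lifting against functors with the same type of
  values as the functor itself. The cover is therefore copied into the universe, where the values of
  the relevant functors are.\<close>

definition ucover :: "'t ring \<Rightarrow> ('r, 'u, 't, 'x) pfunctor \<Rightarrow> ('r, 'u, 't, 'u) pfunctor" where
  "ucover T F = transport_functor (enc (cover T F)) (cover T F)"

context
  fixes T :: "'t ring" and F :: "('r, 'u, 't, 'u) pfunctor"
  assumes T: "ring T" and small_T: "carrier T \<lesssim> (UNIV :: 'u set)"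
begin

lemma enc_cover: "V\<in>Proj \<Longrightarrow> inj_on (enc (cover T F) V) (pts (cover T F) V)"
  by (rule enc_inj[OF cover_lepoll[OF T small_T lepoll_refl]])

lemma ucover_pointed: "pointed_functor R T (ucover T F)"
  unfolding ucover_def by (rule transport_functor_pointed[OF cover_pointed[OF T] enc_cover])

lemmas to_ucover = transport_to[OF cover_pointed[OF T] enc_cover, folded ucover_def]
lemmas from_ucover = transport_from[OF cover_pointed[OF T] enc_cover, folded ucover_def]

lemma ucover_E:
  assumes "z\<in>pts (ucover T F) V" "V\<in>Proj"
  obtains y where "y\<in>pts (cover T F) V" "z = enc (cover T F) V y"
  using assms transport_carrier[OF cover_pointed[OF T] enc_cover, folded ucover_def] by auto

text \<open>Lift the images of the universal basis elements through \<open>\<pi>\<close> at the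
  modules \<open>FM n\<close> and extend by Yoneda; the composite with \<open>\<pi>\<close> is then
  right on these elements and hence everywhere.\<close>

lemma ucover_projective: "projective_functor R T (ucover T F)"
  unfolding projective_functor_def
proof (intro conjI allI impI ballI)
  show "pointed_functor R T (ucover T F)" by (rule ucover_pointed)
  fix G H :: "('r, 'u, 't, 'u) pfunctor" and \<pi> \<phi>
  assume "pointed_functor R T G \<and> pointed_functor R T H"
    and \<pi>: "\<pi>\<in>nat_hom R T G H" and surj: "\<forall>V\<in>Proj. \<pi> V ` pts G V = pts H V"
    and \<phi>: "\<phi>\<in>nat_hom R T (ucover T F) H"
  then have G: "pointed_functor R T G" and H: "pointed_functor R T H" by auto
  note P = cover_pointed[OF T, of F]
  define \<phi>' where "\<phi>' = nat_restrict R (cover T F) (\<lambda>V x. \<phi> V (nat_restrict R (cover T F) (enc (cover T F)) V x))"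
  have \<phi>': "\<phi>'\<in>nat_hom R T (cover T F) H"
    unfolding \<phi>'_def by (rule nat_hom_compose[OF to_ucover \<phi> P])
  \<comment> \<open>For \<open>x\<close> outside the value of \<open>F\<close> the element
    \<open>bas\<close> is zero, so that a choice exists for all arguments.\<close>
  define y where "y n x = (SOME y. y\<in>pts G (FM n) \<and>
      \<pi> (FM n) y = \<phi>' (FM n) (bas T F (FM n) (n, x, gens n)))" for n x
  have y: "y n x\<in>pts G (FM n) \<and> \<pi> (FM n) (y n x) = \<phi>' (FM n) (bas T F (FM n) (n, x, gens n))" for n x
  proof -
    have "\<phi>' (FM n) (bas T F (FM n) (n, x, gens n))\<in>pts H (FM n)"
      by (rule lin_homD(1)[OF nat_hom_lin[OF \<phi>' FM_fgp] bas_closed[OF T]])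
    then have "\<phi>' (FM n) (bas T F (FM n) (n, x, gens n))\<in>\<pi> (FM n) ` pts G (FM n)"
      unfolding bspec[OF surj FM_fgp] .
    then obtain z where "z\<in>pts G (FM n) \<and> \<pi> (FM n) z = \<phi>' (FM n) (bas T F (FM n) (n, x, gens n))"
      by auto
    then show ?thesis unfolding y_def by (rule someI)
  qed
  define \<psi>' where "\<psi>' = cover_lift T F G y"
  have \<psi>': "\<psi>'\<in>nat_hom R T (cover T F) G"
    unfolding \<psi>'_def using y by (intro cover_lift_nat_hom[OF T G]) auto
  have "nat_restrict R (cover T F) (\<lambda>V x. \<pi> V (\<psi>' V x)) = \<phi>'"
  proof (rule cover_nat_hom_eq[OF T H nat_hom_compose[OF \<psi>' \<pi> P] \<phi>'])
    fix n x assume x: "x\<in>pts F (FM n)"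
    have "\<psi>' (FM n) (bas T F (FM n) (n, x, gens n)) = op G (y n x) (FM n) (gens n)"
      unfolding \<psi>'_def using y by (intro cover_lift_bas[OF T G _ FM_fgp x gens_closed(2,1)]) auto
    also have "\<dots> = y n x" using y[of n x] by (intro op_gens[OF G]) auto
    finally show "nat_restrict R (cover T F) (\<lambda>V x. \<pi> V (\<psi>' V x)) (FM n) (bas T F (FM n) (n, x, gens n)) =
        \<phi>' (FM n) (bas T F (FM n) (n, x, gens n))"
      using y[of n x] by (simp add: FM_fgp bas_closed[OF T])
  qed
  then have e: "\<pi> V (\<psi>' V x) = \<phi> V (enc (cover T F) V x)" if "V\<in>Proj" "x\<in>pts (cover T F) V" for V x
  proof -
    have "\<pi> V (\<psi>' V x) = nat_restrict R (cover T F) (\<lambda>V x. \<pi> V (\<psi>' V x)) V x" using that by simp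
    also have "\<dots> = \<phi>' V x" by (simp only: \<open>nat_restrict R (cover T F) (\<lambda>V x. \<pi> V (\<psi>' V x)) = \<phi>'\<close>)
    also have "\<dots> = \<phi> V (enc (cover T F) V x)" using that by (simp add: \<phi>'_def)
    finally show ?thesis .
  qed
  show "\<exists>\<psi>\<in>nat_hom R T (ucover T F) G. \<forall>V\<in>Proj. \<forall>x\<in>pts (ucover T F) V. \<pi> V (\<psi> V x) = \<phi> V x"
  proof (intro bexI ballI)
    show "nat_restrict R (ucover T F) (\<lambda>V x. \<psi>' V (nat_restrict R (ucover T F) (untransport (cover T F) (enc (cover T F))) V x))\<in>nat_hom R T (ucover T F) G"
      by (rule nat_hom_compose[OF from_ucover \<psi>' ucover_pointed])
    fix V z assume V: "V\<in>Proj" and z: "z\<in>pts (ucover T F) V"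
    obtain x where "x\<in>pts (cover T F) V" "z = enc (cover T F) V x" using z V by (rule ucover_E)
    then show "\<pi> V (nat_restrict R (ucover T F) (\<lambda>V x. \<psi>' V (nat_restrict R (ucover T F) (untransport (cover T F) (enc (cover T F))) V x)) V z) = \<phi> V z"
      using V z e by (simp add: untransport_e[OF P enc_cover])
  qed
qed

lemma ucover_onto:
  assumes F: "pointed_functor R T F"
  shows "\<exists>\<pi>\<in>nat_hom R T (ucover T F) F. \<forall>V\<in>Proj. \<pi> V ` pts (ucover T F) V = pts F V"
proof (intro bexI ballI)
  note P = cover_pointed[OF T, of F]
  have l: "cover_lift T F F (\<lambda>n x. x)\<in>nat_hom R T (cover T F) F"
    by (rule cover_lift_nat_hom[OF T F])
  let ?f = "nat_restrict R (ucover T F) (\<lambda>V x. cover_lift T F F (\<lambda>n x. x) V (nat_restrict R (ucover T F) (untransport (cover T F) (enc (cover T F))) V x))"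
  show f: "?f\<in>nat_hom R T (ucover T F) F"
    by (rule nat_hom_compose[OF from_ucover l ucover_pointed])
  fix V assume V: "V\<in>Proj"
  have "?f V ` pts (ucover T F) V = cover_lift T F F (\<lambda>n x. x) V ` pts (cover T F) V"
  proof -
    have c: "pts (ucover T F) V = enc (cover T F) V ` pts (cover T F) V"
      unfolding ucover_def by (rule transport_carrier[OF P enc_cover V])
    have "?f V (enc (cover T F) V x) = cover_lift T F F (\<lambda>n x. x) V x" if "x\<in>pts (cover T F) V" for x
      using V that c by (simp add: untransport_e[OF P enc_cover])
    then show ?thesis unfolding c image_image by (rule image_cong[OF refl])
  qed
  then show "?f V ` pts (ucover T F) V = pts F V"
    using cover_surj[OF T F V] by simp
qed

end

section \<open>Resolution by iterated covers\<close>

definition aug :: "'t ring \<Rightarrow> ('r, 'u, 't, 'u) pfunctor \<Rightarrow> ('r, 'u) module \<Rightarrow> 'u \<Rightarrow> 'u" where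
  "aug T F = (SOME \<pi>. \<pi>\<in>nat_hom R T (ucover T F) F \<and>
     (\<forall>V\<in>Proj. \<pi> V ` pts (ucover T F) V = pts F V))"

text \<open>The kernel is kept as a subfunctor of the cover and not replaced by a copy. So the
  augmentation of the next cover is at the same time the differential of the resolution, with the
  cover as its target.\<close>

primrec syz :: "'t ring \<Rightarrow> ('r, 'u, 't, 'u) pfunctor \<Rightarrow> nat \<Rightarrow> ('r, 'u, 't, 'u) pfunctor" where
  "syz T F 0 = F"
| "syz T F (Suc n) = subfunctor (ucover T (syz T F n))
     (\<lambda>V. a_kernel (fobj (ucover T (syz T F n)) V) (fobj (syz T F n) V) (aug T (syz T F n) V))"

lemma kernel_subfunctor:
  fixes S :: "'s ring" and F :: "('s, 'w, 't, 'x) pfunctor"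
  assumes F: "pointed_functor S T F" and G: "pointed_functor S T G" and n: "\<eta>\<in>nat_hom S T F G"
  shows "pointed_functor S T (subfunctor F (\<lambda>V. a_kernel (fobj F V) (fobj G V) (\<eta> V)))"
proof (rule subfunctor_pointed[OF F])
  fix V :: "('s, 'w) module" assume V: "V\<in>fgp S"
  interpret \<eta>: add_hom "fobj F V" "fobj G V" "\<eta> V" by (rule nat_hom_hom[OF n F G V])
  show "submodule_of T (fobj F V) (a_kernel (fobj F V) (fobj G V) (\<eta> V))"
    unfolding submodule_of_def
  proof (intro conjI ballI)
    fix r x assume r: "r\<in>carrier T" and x: "x\<in>a_kernel (fobj F V) (fobj G V) (\<eta> V)"
    have c: "x\<in>pts F V" and z: "\<eta> V x = \<zero>[fobj G V]"
      using x unfolding in_a_kernel by auto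
    have "\<eta> V (r \<odot>[fobj F V] x) = r \<odot>[fobj G V] \<eta> V x"
      by (rule lin_homD(4)[OF nat_hom_lin[OF n V] r c])
    also have "\<dots> = \<zero>[fobj G V]"
      unfolding z by (rule lm_smult_zero[OF functor_obj[OF G V] r])
    finally show "r \<odot>[fobj F V] x\<in>a_kernel (fobj F V) (fobj G V) (\<eta> V)"
      unfolding in_a_kernel using left_module.smult_closed[OF functor_obj[OF F V] r c] by blast
  qed (auto simp: in_a_kernel)
next
  fix V W :: "('s, 'w) module" and f x assume V: "V\<in>fgp S" and W: "W\<in>fgp S" and f: "f\<in>lin_hom S V W"
    and x: "x\<in>a_kernel (fobj F V) (fobj G V) (\<eta> V)"
  show "fmap F V W f x\<in>a_kernel (fobj F W) (fobj G W) (\<eta> W)"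
    using x lin_homD(1)[OF functor_map[OF F V W f]] add_hom.hom_zero[OF functor_map_hom[OF G V W f]]
    by (simp add: in_a_kernel nat_hom_natural[OF n V W f])
qed

theorem projective_resolution_exists:
  fixes T :: "'t ring" and F :: "('r, 'u, 't, 'u) pfunctor"
  assumes T: "ring T" and small_T: "carrier T \<lesssim> (UNIV :: 'u set)" and F: "pointed_functor R T F"
  shows "\<exists>P :: ('r, 'u, 't, 'u, 'u) resolution. projective_resolution R T F P"
proof -
  have a: "aug T G\<in>nat_hom R T (ucover T G) G"
    "V\<in>Proj \<Longrightarrow> aug T G V ` pts (ucover T G) V = pts G V"
    if "pointed_functor R T G" for G V
    using someI_ex[OF ucover_onto[OF T small_T that, unfolded bex_simps Bex_def]] unfolding aug_def by blast+
  have s: "pointed_functor R T (syz T F n)" for n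
  proof (induction n)
    case (Suc n)
    then show ?case using kernel_subfunctor[OF ucover_pointed[OF T small_T] Suc a(1)[OF Suc]] by simp
  qed (simp add: F)
  have m: "aug T (syz T F (Suc n))\<in>nat_hom R T (ucover T (syz T F (Suc n))) (ucover T (syz T F n))" for n
  proof (rule nat_homI)
    note n = a(1)[OF s, of "Suc n"]
    fix V assume V: "V\<in>Proj"
    note l = nat_hom_lin[OF n V]
    show "aug T (syz T F (Suc n)) V\<in>lin_hom T (fobj (ucover T (syz T F (Suc n))) V) (fobj (ucover T (syz T F n)) V)"
    proof (rule lin_homI)
      fix x assume "x\<in>carrier (fobj (ucover T (syz T F (Suc n))) V)"
      then show "aug T (syz T F (Suc n)) V x\<in>pts (ucover T (syz T F n)) V"
        using lin_homD(1)[OF l, of x] by (simp add: in_a_kernel)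
    next
      fix x assume "x \<notin> carrier (fobj (ucover T (syz T F (Suc n))) V)"
      then show "aug T (syz T F (Suc n)) V x = undefined" by (rule lin_homD(2)[OF l])
    qed (use lin_homD(3,4)[OF l] in simp_all)
    { fix W f x assume W: "W\<in>Proj" and f: "f\<in>lin_hom R V W"
      and x: "x\<in>carrier (fobj (ucover T (syz T F (Suc n))) V)"
    show "aug T (syz T F (Suc n)) W (fmap (ucover T (syz T F (Suc n))) V W f x) =
        fmap (ucover T (syz T F n)) V W f (aug T (syz T F (Suc n)) V x)"
      using nat_hom_natural[OF n V W f x] lin_homD(1)[OF l x] by simp }
  qed (rule nat_hom_undefined[OF a(1)[OF s]])
  let ?P = "\<lparr>rP = (\<lambda>n. ucover T (syz T F n)), rd = (\<lambda>n. aug T (syz T F (Suc n))), raug = aug T F\<rparr>"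
  have "projective_resolution R T F ?P"
    unfolding projective_resolution_def
  proof (intro conjI allI ballI)
    show "projective_functor R T (rP ?P n)" for n
      by (simp add: ucover_projective[OF T small_T])
    show "rd ?P n\<in>nat_hom R T (rP ?P (Suc n)) (rP ?P n)" for n
      using m[of n] by simp
    show "raug ?P\<in>nat_hom R T (rP ?P 0) F"
      using a(1)[OF F] by simp
    fix V assume V: "V\<in>Proj"
    show "raug ?P V ` pts (rP ?P 0) V = pts F V"
      using a(2)[OF F V] by simp
    show "rd ?P 0 V ` pts (rP ?P 1) V = a_kernel (fobj (rP ?P 0) V) (fobj F V) (raug ?P V)"
      using a(2)[OF s[of "Suc 0"] V] by simp
    show "rd ?P (Suc n) V ` carrier (fobj (rP ?P (Suc (Suc n))) V) =
        a_kernel (fobj (rP ?P (Suc n)) V) (fobj (rP ?P n) V) (rd ?P n V)" for n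
    proof -
      have "rd ?P (Suc n) V ` carrier (fobj (rP ?P (Suc (Suc n))) V) = carrier (fobj (syz T F (Suc (Suc n))) V)"
        using a(2)[OF s[of "Suc (Suc n)"] V] by simp
      also have "\<dots> = a_kernel (fobj (rP ?P (Suc n)) V) (fobj (rP ?P n) V) (rd ?P n V)"
        by (auto simp: in_a_kernel)
      finally show ?thesis .
    qed
  qed
  then show ?thesis by blast
qed

end

subsection \<open>Additivity of \<^term>\<open>I_functor R M\<close> and rigidity of natural operations\<close>

locale bimodule_universe = universe R u
  for R :: "'r ring" and u :: "'u itself" +
  fixes M :: "('r, 'r, 'm) bimodule"
  assumes bimod: "bimodule R R M"
begin

sublocale R: ring R by (rule ring)
sublocale M: bimodule R R M by (rule bimod)

abbreviation I :: "('r, 'u, 'r, ('m, 'u) tens) pfunctor" where "I \<equiv> I_functor R M"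

abbreviation splits :: "('r, 'u, 'r, 'u, ('m, 'u) tens, 'x, 'y) el_ext \<Rightarrow> ('r, 'u, int, 'x, 'y, 'z) splitting \<Rightarrow> bool" where
  "splits E D \<equiv> is_splitting R \<Z> (forget R I) (forget_ext R E) D"

abbreviation gen1 :: 'u where "gen1 \<equiv> gen (Suc 0) 0"

lemma taut_pointed: "pointed_functor R R (taut_functor :: ('r, 'u, 'r, 'u) pfunctor)"
  by (rule pointed_functorI) (auto simp: taut_functor_def compose_eq intro: fgp_module)

lemma I_pointed: "pointed_functor R R I"
  unfolding I_functor_def by (rule tensor_functor_pointed[OF bimod taut_pointed])

lemma I_obj: "fobj I V = tensor R M V"
  by (simp add: I_functor_def tensor_functor_def taut_functor_def)

lemma tensor_product_M: "left_module R V \<Longrightarrow> tensor_product R R M V"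
  using bimod by (rule tensor_product.intro)

lemma tensor_M: "V\<in>Proj \<Longrightarrow> tensor_product R R M V"
  using fgp_module by (rule tensor_product_M)

lemma I_carrier: "pts I V = carrier (tensor_group R M V)"
  by (simp add: I_obj tensor_def)

lemma I_map_tens:
  assumes "V\<in>Proj" "W\<in>Proj" "f\<in>lin_hom R V W" "m\<in>carrier M" "v\<in>carrier V"
  shows "fmap I V W f (tens R M V m v) = tens R M W m (f v)"
  using tensor_functor_map_tens[OF bimod taut_pointed assms(1-4), of v] assms(5)
  by (simp add: I_functor_def taut_functor_def)

text \<open>This is where additivity of \<open>I\<close> enters, a property that \<open>C0\<close>,
  \<open>C1\<close> and \<open>C01\<close> need not share. Both sides are additive in
  \<open>t\<close>, so pure tensors suffice.\<close>

lemma I_map_add: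
  assumes V: "V\<in>Proj" and W: "W\<in>Proj"
    and f: "f\<in>lin_hom R V W" and g: "g\<in>lin_hom R V W" and h: "h\<in>lin_hom R V W"
    and e: "\<And>v. v\<in>carrier V \<Longrightarrow> h v = f v \<oplus>[W] g v" and t: "t\<in>pts I V"
  shows "fmap I V W h t = fmap I V W f t \<oplus>[fobj I W] fmap I V W g t"
proof -
  interpret V: tensor_product R R M V by (rule tensor_M[OF V])
  interpret W: tensor_product R R M W by (rule tensor_M[OF W])
  interpret f: add_hom "fobj I V" "fobj I W" "fmap I V W f" by (rule functor_map_hom[OF I_pointed V W f])
  interpret g: add_hom "fobj I V" "fobj I W" "fmap I V W g" by (rule functor_map_hom[OF I_pointed V W g])
  interpret h: add_hom "fobj I V" "fobj I W" "fmap I V W h" by (rule functor_map_hom[OF I_pointed V W h])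
  have "t\<in>carrier V.TG" using t by (simp add: I_carrier)
  then show ?thesis
  proof (induction rule: V.TG_induct)
    case (tens m v)
    then show ?case
      using lin_homD(1)[OF f] lin_homD(1)[OF g]
      by (simp add: I_map_tens V W f g h e W.tens_add_right I_obj)
  next
    case (add X Y)
    then have c: "X\<in>pts I V" "Y\<in>pts I V" by (simp_all add: I_carrier)
    have "X \<oplus>[V.TG] Y = X \<oplus>[fobj I V] Y" by (simp add: I_obj)
    then show ?case using add c by (simp add: abelian_group.group_simps[OF functor_abelian[OF I_pointed W]])
  qed
qed

section \<open>Coordinates on the free module of rank one\<close>

definition coef :: "'u \<Rightarrow> 'r" where
  "coef v = the_inv_into (carrier (free_module R {..<Suc 0})) (code (Suc 0)) v 0"

lemma coef_code: "f\<in>carrier (free_module R {..<Suc 0}) \<Longrightarrow> coef (code (Suc 0) f) = f 0"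
  by (simp add: coef_def the_inv_into_f_f[OF code_inj])

interpretation F1: free_over R "{..<Suc 0}" by (rule free_over)

lemma FM1_E:
  assumes "v\<in>carrier F1"
  obtains f where "f\<in>carrier (free_module R {..<Suc 0})" "v = code (Suc 0) f"
  using assms by (auto simp: FM_simps)

lemma coef_closed: "v\<in>carrier F1 \<Longrightarrow> coef v\<in>carrier R"
  by (elim FM1_E) (auto simp: coef_code intro: F1.free_coeff)

lemma coef_add: "\<lbrakk>v\<in>carrier F1; w\<in>carrier F1\<rbrakk> \<Longrightarrow> coef (v \<oplus>[F1] w) = coef v \<oplus>[R] coef w"
  by (elim FM1_E) (simp add: FM_simps coef_code F1.free_add_closed, simp add: F1.free_simps)

lemma coef_smult: "\<lbrakk>r\<in>carrier R; v\<in>carrier F1\<rbrakk> \<Longrightarrow> coef (r \<odot>[F1] v) = r \<otimes>[R] coef v"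
  by (elim FM1_E) (simp add: FM_simps coef_code F1.free_smult_closed, simp add: F1.free_simps)

lemma coef_gen1: "coef gen1 = \<one>[R]"
  by (simp add: gen_def coef_code F1.free_basis_closed, simp add: free_basis_def)

lemma FM1_span: "v\<in>carrier F1 \<Longrightarrow> v = coef v \<odot>[F1] gen1"
proof (elim FM1_E)
  fix f assume f: "f\<in>carrier (free_module R {..<Suc 0})" and v: "v = code (Suc 0) f"
  have "f 0\<in>carrier R" using f by (rule F1.free_coeff) simp
  then have e: "f = f 0 \<odot>[free_module R {..<Suc 0}] free_basis R {..<Suc 0} 0"
    by (intro F1.free_eqI f F1.free_smult_closed F1.free_basis_closed) (auto simp: F1.free_simps free_basis_def)
  have "v = code (Suc 0) (f 0 \<odot>[free_module R {..<Suc 0}] free_basis R {..<Suc 0} 0)"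
    using arg_cong[OF e, of "code (Suc 0)"] unfolding v .
  also have "\<dots> = f 0 \<odot>[F1] gen1"
    by (simp add: FM_simps gen_def F1.free_basis_closed)
  finally show ?thesis unfolding v coef_code[OF f] .
qed

lemma smult_gen1_inj:
  assumes "r\<in>carrier R" "s\<in>carrier R" "r \<odot>[F1] gen1 = s \<odot>[F1] gen1"
  shows "r = s"
proof -
  have "coef (k \<odot>[F1] gen1) = k" if "k\<in>carrier R" for k
    using coef_smult[OF that gen_closed] that by (simp add: coef_gen1)
  from this[OF assms(1), unfolded assms(3)] this[OF assms(2)] show ?thesis by (rule trans[OF sym])
qed

lemma tens_gen1_surj:
  assumes "t\<in>pts I F1"
  shows "\<exists>m\<in>carrier M. t = tens R M F1 m gen1"
proof -
  interpret V: tensor_product R R M "F1" by (rule tensor_product_M[OF FM_left_module])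
  have "t\<in>carrier V.TG" using assms by (simp add: I_carrier)
  then show ?thesis
  proof (induction rule: V.TG_induct)
    case (tens m v)
    then have "V.pt m v = V.pt (ract M m (coef v)) gen1"
      using FM1_span[of v] by (simp add: V.tens_ract coef_closed gen_closed)
    then show ?case using tens by (auto intro: M.ract_closed coef_closed)
  next
    case (add X Y)
    then show ?case by (auto simp: V.tens_add_left gen_closed intro!: bexI[of _ "_ \<oplus>[M] _"] simp flip: V.tens_add_left)
  qed
qed

text \<open>The balanced map \<open>ract M m (coef v)\<close> induces an inverse of
  \<open>m \<mapsto> m \<otimes> gen1\<close>. Together with \<open>tens_gen1_surj\<close> this
  recovers \<open>M\<close> from the value of \<open>I\<close> at the free module of rank
  one.\<close>

lemma tens_gen1_inj:
  assumes "m\<in>carrier M" "n\<in>carrier M" "tens R M F1 m gen1 = tens R M F1 n gen1"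
  shows "m = n"
proof -
  interpret V: tensor_product R R M "F1" by (rule tensor_product_M[OF FM_left_module])
  have b: "balanced R M F1 M (\<lambda>m v. ract M m (coef v))"
    by (rule balancedI) (simp_all add: M.ract_closed coef_closed M.ract_l_distr M.ract_r_distr coef_add coef_smult M.ract_assoc)
  have "tensor_lift R M F1 M (\<lambda>m v. ract M m (coef v)) (tens R M F1 k gen1) = k" if "k\<in>carrier M" for k
    using V.tensor_lift_tens[OF M.M.abelian_group_axioms b that gen_closed] that by (simp add: coef_gen1 M.ract_one)
  then show ?thesis using assms by metis
qed

text \<open>An additive functor has no second cross-effect, so a natural operation with values in the
  image of \<^term>\<open>I_functor R M\<close> is determined by its restrictions to the two summands.\<close>

lemma natural_operation_rigid:
  fixes F :: "('r, 'u, 't, 'z) pfunctor" and \<beta> :: "('r, 'u) module \<Rightarrow> ('m, 'u) tens \<Rightarrow> 'z"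
  assumes F: "pointed_functor R T F"
    and \<beta>: "\<And>V. V\<in>Proj \<Longrightarrow> add_hom (fobj I V) (fobj F V) (\<beta> V)"
    and \<beta>nat: "\<And>V W f t. \<lbrakk>V\<in>Proj; W\<in>Proj; f\<in>lin_hom R V W; t\<in>pts I V\<rbrakk> \<Longrightarrow>
      \<beta> W (fmap I V W f t) = fmap F V W f (\<beta> V t)"
    and p: "\<And>V w. \<lbrakk>V\<in>Proj; set w \<subseteq> carrier V; length w = Suc n\<rbrakk> \<Longrightarrow> p V w\<in>pts F V"
    and q: "\<And>V w. \<lbrakk>V\<in>Proj; set w \<subseteq> carrier V; length w = Suc n\<rbrakk> \<Longrightarrow> q V w\<in>pts F V"
    and pnat: "\<And>V W f w. \<lbrakk>V\<in>Proj; W\<in>Proj; f\<in>lin_hom R V W; set w \<subseteq> carrier V;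
      length w = Suc n\<rbrakk> \<Longrightarrow> fmap F V W f (p V w) = p W (map f w)"
    and qnat: "\<And>V W f w. \<lbrakk>V\<in>Proj; W\<in>Proj; f\<in>lin_hom R V W; set w \<subseteq> carrier V;
      length w = Suc n\<rbrakk> \<Longrightarrow> fmap F V W f (q V w) = q W (map f w)"
    and diff: "\<And>V w. \<lbrakk>V\<in>Proj; set w \<subseteq> carrier V; length w = Suc n\<rbrakk> \<Longrightarrow>
      \<exists>t\<in>pts I V. p V w \<ominus>[fobj F V] q V w = \<beta> V t"
    and left: "\<And>V v. \<lbrakk>V\<in>Proj; v\<in>carrier V\<rbrakk> \<Longrightarrow>
      p V (v # replicate n \<zero>[V]) = q V (v # replicate n \<zero>[V])"
    and right: "\<And>V w. \<lbrakk>V\<in>Proj; set w \<subseteq> carrier V; length w = n\<rbrakk> \<Longrightarrow> p V (\<zero>[V] # w) = q V (\<zero>[V] # w)"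
    and V: "V\<in>Proj" and v: "v\<in>carrier V" and w: "set w \<subseteq> carrier V" "length w = n"
  shows "p V (v # w) = q V (v # w)"
proof -
  let ?N = "Suc n" and ?g = "gens (Suc n)"
  note m = fgp_module[OF V]
  interpret V: abelian_group V using m by (rule lm_abelian)
  interpret FV: abelian_group "fobj F V" by (rule functor_abelian[OF F V])
  interpret \<beta>: add_hom "fobj I V" "fobj F V" "\<beta> V" by (rule \<beta>[OF V])
  note g = gens_closed[of ?N]
  \<comment> \<open>By naturality every instance comes from this one, at the generators of the free
    module of rank \<open>n + 1\<close>.\<close>
  obtain t where t: "t\<in>pts I (FM ?N)" "p (FM ?N) ?g \<ominus>[fobj F (FM ?N)] q (FM ?N) ?g = \<beta> (FM ?N) t"
    using diff[OF FM_fgp g] by blast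
  have *: "p V u \<ominus>[fobj F V] q V u = \<beta> V (fmap I (FM ?N) V (lmap V u) t)"
    if u: "set u \<subseteq> carrier V" "length u = ?N" for u
  proof -
    note l = lmap_lin[OF m u]
    interpret l: add_hom "fobj F (FM ?N)" "fobj F V" "fmap F (FM ?N) V (lmap V u)"
      by (rule functor_map_hom[OF F FM_fgp V l])
    have "fmap F (FM ?N) V (lmap V u) (p (FM ?N) ?g \<ominus>[fobj F (FM ?N)] q (FM ?N) ?g) = p V u \<ominus>[fobj F V] q V u"
      using p[OF FM_fgp g] q[OF FM_fgp g]
      by (simp add: l.hom_minus pnat[OF FM_fgp V l g] qnat[OF FM_fgp V l g] map_lmap_gens[OF m u])
    then show ?thesis using \<beta>nat[OF FM_fgp V l t(1)] t(2) by simp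
  qed
  let ?u = "v # w" and ?u1 = "v # replicate n \<zero>[V]" and ?u2 = "\<zero>[V] # w"
  have u: "set ?u \<subseteq> carrier V" "length ?u = ?N" using v w by auto
  have u1: "set ?u1 \<subseteq> carrier V" "length ?u1 = ?N" using v by auto
  have u2: "set ?u2 \<subseteq> carrier V" "length ?u2 = ?N" using w by auto
  have "map2 (\<oplus>\<^bsub>V\<^esub>) (replicate n \<zero>[V]) w = w"
    using w by (intro nth_equalityI) (auto simp: subset_iff)
  \<comment> \<open>The tuple is the sum of its parts in the first coordinate and in the remaining
    ones. Since \<open>I\<close> is additive on morphisms, the difference of \<open>p\<close> and
    \<open>q\<close> is the sum of its values at the two parts, and both are zero.\<close>
  then have s: "map2 (\<oplus>\<^bsub>V\<^esub>) ?u1 ?u2 = ?u" using v by simp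
  have "fmap I (FM ?N) V (lmap V ?u) t =
      fmap I (FM ?N) V (lmap V ?u1) t \<oplus>[fobj I V] fmap I (FM ?N) V (lmap V ?u2) t"
    using lmap_add[OF m u2 u1, unfolded s]
    by (intro I_map_add[OF FM_fgp V lmap_lin[OF m u1] lmap_lin[OF m u2] lmap_lin[OF m u]] t)
  moreover have "fmap I (FM ?N) V (lmap V ?u1) t\<in>pts I V" "fmap I (FM ?N) V (lmap V ?u2) t\<in>pts I V"
    using lin_homD(1)[OF functor_map[OF I_pointed FM_fgp V lmap_lin[OF m u1]] t(1)]
      lin_homD(1)[OF functor_map[OF I_pointed FM_fgp V lmap_lin[OF m u2]] t(1)] .
  ultimately have "p V ?u \<ominus>[fobj F V] q V ?u = (p V ?u1 \<ominus>[fobj F V] q V ?u1) \<oplus>[fobj F V] (p V ?u2 \<ominus>[fobj F V] q V ?u2)"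
    using *[OF u] *[OF u1] *[OF u2] by simp
  also have "\<dots> = \<zero>[fobj F V]"
    using left[OF V v] right[OF V w] q[OF V u1] q[OF V u2] by (simp add: FV.minus_eq FV.r_neg)
  finally show ?thesis using p[OF V u] q[OF V u] by (simp add: FV.diff_zero_iff)
qed

end

subsection \<open>Elementary extensions with a splitting\<close>

locale elementary = bimodule_universe R u M
  for R :: "'r ring" and u :: "'u itself" and M :: "('r, 'r, 'm) bimodule" +
  fixes E :: "('r, 'u, 'r, 'u, ('m, 'u) tens, 'x, 'y) el_ext"
  assumes E: "el_ext_of R M E"
begin

abbreviation "E0 V \<equiv> fobj (C0 E) V"
abbreviation "E1 V \<equiv> fobj (C1 E) V"
abbreviation "d \<equiv> ediff E"
abbreviation "a \<equiv> ea E"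
abbreviation "b \<equiv> eb E"

lemma C0_pointed: "pointed_functor R R (C0 E)" and C1_pointed: "pointed_functor R R (C1 E)"
  and d_nat: "d\<in>nat_hom R R (C1 E) (C0 E)" and a_nat: "a\<in>nat_hom R R (C0 E) taut_functor"
  and b_nat: "b\<in>nat_hom R R I (C1 E)"
  using E by (auto simp: is_el_ext_def)

context
  fixes V :: "('r, 'u) module" assumes V: "V\<in>Proj"
begin

lemma E0_abelian: "abelian_group (E0 V)" and E1_abelian: "abelian_group (E1 V)"
  and V_abelian: "abelian_group V"
  using functor_abelian[OF C0_pointed V] functor_abelian[OF C1_pointed V]
    lm_abelian[OF fgp_module[OF V]] by auto

lemma d_hom: "add_hom (E1 V) (E0 V) (d V)"
  by (rule nat_hom_hom[OF d_nat C1_pointed C0_pointed V])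

lemma a_lin: "a V\<in>lin_hom R (E0 V) V"
  using nat_hom_lin[OF a_nat V] by (simp add: taut_functor_def)

lemma a_hom: "add_hom (E0 V) V (a V)"
  by (rule lin_add_hom[OF a_lin functor_obj[OF C0_pointed V] fgp_module[OF V]])

lemma b_hom: "add_hom (fobj I V) (E1 V) (b V)"
  by (rule nat_hom_hom[OF b_nat I_pointed C1_pointed V])

lemma b_inj: "\<lbrakk>t\<in>pts I V; t'\<in>pts I V; b V t = b V t'\<rbrakk> \<Longrightarrow> t = t'"
  using E V by (auto simp: is_el_ext_def dest: inj_onD)

lemma b_image: "b V ` pts I V = a_kernel (E1 V) (E0 V) (d V)"
  and d_image: "d V ` carrier (E1 V) = a_kernel (E0 V) V (a V)"
  and a_image: "a V ` carrier (E0 V) = carrier V"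
  using E V by (auto simp: is_el_ext_def taut_functor_def)

lemma d_b: "t\<in>pts I V \<Longrightarrow> d V (b V t) = \<zero>[E0 V]"
  using imageI[of t "pts I V" "b V", unfolded b_image] by (simp add: in_a_kernel)

lemma a_d: "x\<in>carrier (E1 V) \<Longrightarrow> a V (d V x) = \<zero>[V]"
  using imageI[of x "carrier (E1 V)" "d V", unfolded d_image] by (simp add: in_a_kernel)

lemma d_kernel: "\<lbrakk>x\<in>carrier (E1 V); d V x = \<zero>[E0 V]\<rbrakk> \<Longrightarrow> \<exists>t\<in>pts I V. x = b V t"
  using b_image by (auto simp: set_eq_iff in_a_kernel image_iff)

lemma a_kernel: "\<lbrakk>y\<in>carrier (E0 V); a V y = \<zero>[V]\<rbrakk> \<Longrightarrow> \<exists>x\<in>carrier (E1 V). y = d V x"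
  using d_image by (auto simp: set_eq_iff in_a_kernel image_iff)

end

lemma a_natural: "\<lbrakk>V\<in>Proj; W\<in>Proj; f\<in>lin_hom R V W; x\<in>carrier (E0 V)\<rbrakk> \<Longrightarrow>
    a W (fmap (C0 E) V W f x) = f (a V x)"
  using nat_hom_natural[OF a_nat] by (simp add: taut_functor_def)

end

lemma forget_ext_simps [simp]:
  "C0 (forget_ext R E) = forget R (C0 E)" "C1 (forget_ext R E) = forget R (C1 E)"
  "ediff (forget_ext R E) = ediff E" "ea (forget_ext R E) = ea E" "eb (forget_ext R E) = eb E"
  by (simp_all add: forget_ext_def)

text \<open>Forgetting scalars changes the record but not the addition, and \<open>add_hom\<close>
  depends only on the latter.\<close>

lemma hom_forget_left:
  "\<lbrakk>abelian_group (fobj F V); add_hom (fobj (forget R F) V) H f\<rbrakk> \<Longrightarrow> add_hom (fobj F V) H f"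
  unfolding add_hom_def abelian_group_hom_def abelian_group_hom_axioms_def group_hom_def group_hom_axioms_def hom_def
  using abelian_group.a_group by auto

lemma hom_forget_right:
  "\<lbrakk>abelian_group (fobj F V); add_hom H (fobj (forget R F) V) f\<rbrakk> \<Longrightarrow> add_hom H (fobj F V) f"
  unfolding add_hom_def abelian_group_hom_def abelian_group_hom_axioms_def group_hom_def group_hom_axioms_def hom_def
  using abelian_group.a_group by auto

text \<open>By the Yoneda lemma, a lift \<open>\<sigma>\<close> to \<open>C\<^sub>0\<^sub>1\<close> of the generator of the free module of rank one
  defines a natural section of \<open>C\<^sub>0\<^sub>1 \<rightarrow> V\<close>, which is in general not additive.\<close>

locale split_elementary = elementary R u M E
  for R :: "'r ring" and u :: "'u itself" and M :: "('r, 'r, 'm) bimodule"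
    and E :: "('r, 'u, 'r, 'u, ('m, 'u) tens, 'x, 'y) el_ext" +
  fixes D :: "('r, 'u, int, 'x, 'y, 'z) splitting" and \<sigma> :: 'z
  assumes D: "splits E D"
    and \<sigma>: "\<sigma>\<in>pts (C01 D) F1" "a F1 (sc0 D F1 \<sigma>) = gen1"
begin

abbreviation "Z V \<equiv> fobj (C01 D) V"
abbreviation "c0 \<equiv> sc0 D"
abbreviation "c1 \<equiv> sc1 D"

lemma Z_pointed: "pointed_functor R \<Z> (C01 D)"
  and c1_nat: "c1\<in>nat_hom R \<Z> (forget R (C1 E)) (C01 D)"
  and c0_nat: "c0\<in>nat_hom R \<Z> (C01 D) (forget R (C0 E))"
  using D by (auto simp: is_splitting_def)

context
  fixes V :: "('r, 'u) module" assumes V: "V\<in>Proj"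
begin

lemma Z_abelian: "abelian_group (Z V)"
  by (rule functor_abelian[OF Z_pointed V])

lemma c1_hom: "add_hom (E1 V) (Z V) (c1 V)"
  using nat_hom_hom[OF c1_nat forget_pointed[OF ring C1_pointed] Z_pointed V]
  by (rule hom_forget_left[OF E1_abelian[OF V]])

lemma c0_hom: "add_hom (Z V) (E0 V) (c0 V)"
  using nat_hom_hom[OF c0_nat Z_pointed forget_pointed[OF ring C0_pointed] V]
  by (rule hom_forget_right[OF E0_abelian[OF V]])

lemma c1_inj: "\<lbrakk>x\<in>carrier (E1 V); x'\<in>carrier (E1 V); c1 V x = c1 V x'\<rbrakk> \<Longrightarrow> x = x'"
  using D V by (auto simp: is_splitting_def dest: inj_onD)

lemma c0_image: "c0 V ` carrier (Z V) = carrier (E0 V)"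
  and c0_c1: "x\<in>carrier (E1 V) \<Longrightarrow> c0 V (c1 V x) = d V x"
  and c0_kernel_image: "a_kernel (Z V) (fobj (forget R (C0 E)) V) (c0 V) = c1 V ` b V ` pts I V"
  using D V by (auto simp: is_splitting_def)

lemma c0_kernel: "\<lbrakk>z\<in>carrier (Z V); c0 V z = \<zero>[E0 V]\<rbrakk> \<Longrightarrow> \<exists>t\<in>pts I V. z = c1 V (b V t)"
  using c0_kernel_image by (auto simp: set_eq_iff in_a_kernel image_iff)

lemma ac0_hom: "add_hom (Z V) V (\<lambda>z. a V (c0 V z))"
  by (rule add_hom_comp[OF c0_hom a_hom[OF V]])

lemma c1b_hom: "add_hom (fobj I V) (Z V) (\<lambda>t. c1 V (b V t))"
  by (rule add_hom_comp[OF b_hom[OF V] c1_hom])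

text \<open>Exactness at \<open>C0\<close> gives \<open>x\<close> with \<open>d x = c0 z\<close>;
  then \<open>z - c1 x\<close> is in the kernel of \<open>c0\<close>, which comes from
  \<open>I\<close> through \<open>c1\<close> and \<open>b\<close>. Thus \<open>C01\<close> is an
  extension of \<open>V\<close> by \<open>C1\<close>.\<close>

lemma ac0_kernel:
  assumes z: "z\<in>carrier (Z V)" and "a V (c0 V z) = \<zero>[V]"
  shows "\<exists>x\<in>carrier (E1 V). z = c1 V x"
proof -
  interpret c1: add_hom "E1 V" "Z V" "c1 V" by (rule c1_hom)
  interpret c0: add_hom "Z V" "E0 V" "c0 V" by (rule c0_hom)
  interpret b: add_hom "fobj I V" "E1 V" "b V" by (rule b_hom[OF V])
  obtain x where x: "x\<in>carrier (E1 V)" "c0 V z = d V x" using a_kernel[OF V c0.hom_closed[OF z]] assms(2) by auto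
  then have "c0 V (z \<ominus>[Z V] c1 V x) = \<zero>[E0 V]"
    using z by (simp add: c0.hom_minus c0_c1 abelian_group.group_simps[OF E0_abelian[OF V]] flip: x(2))
  then obtain t where t: "t\<in>pts I V" "z \<ominus>[Z V] c1 V x = c1 V (b V t)"
    using c0_kernel[of "z \<ominus>[Z V] c1 V x"] z x by auto
  then have "z = c1 V (x \<oplus>[E1 V] b V t)"
    using z x by (simp add: abelian_group.group_simps[OF Z_abelian] flip: t(2))
  then show ?thesis by (rule bexI) (use x t in simp)
qed

end

lemma c1_natural: "\<lbrakk>V\<in>Proj; W\<in>Proj; f\<in>lin_hom R V W; x\<in>carrier (E1 V)\<rbrakk> \<Longrightarrow>
    c1 W (fmap (C1 E) V W f x) = fmap (C01 D) V W f (c1 V x)"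
  using nat_hom_natural[OF c1_nat] by simp

lemma c0_natural: "\<lbrakk>V\<in>Proj; W\<in>Proj; f\<in>lin_hom R V W; z\<in>carrier (Z V)\<rbrakk> \<Longrightarrow>
    c0 W (fmap (C01 D) V W f z) = fmap (C0 E) V W f (c0 V z)"
  using nat_hom_natural[OF c0_nat] by simp

definition "sec V v = op (C01 D) \<sigma> V [v]"

lemma sec_closed: "\<lbrakk>V\<in>Proj; v\<in>carrier V\<rbrakk> \<Longrightarrow> sec V v\<in>carrier (Z V)"
  unfolding sec_def by (rule op_closed[OF Z_pointed, where n = "Suc 0"]) (auto intro: \<sigma>)

lemma sec_natural: "\<lbrakk>V\<in>Proj; W\<in>Proj; f\<in>lin_hom R V W; v\<in>carrier V\<rbrakk> \<Longrightarrow>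
    fmap (C01 D) V W f (sec V v) = sec W (f v)"
  unfolding sec_def by (subst op_natural[OF Z_pointed, where n = "Suc 0"]) (auto intro: \<sigma>)

lemma sec_zero: "V\<in>Proj \<Longrightarrow> sec V \<zero>[V] = \<zero>[Z V]"
  unfolding sec_def by (rule op_zero[OF Z_pointed, where n = "Suc 0"]) (auto intro: \<sigma>)

lemma sec_gen1: "sec F1 gen1 = \<sigma>"
  using op_gens[OF Z_pointed \<sigma>(1)] by (simp add: sec_def gens_def)

lemma ac0_sec:
  assumes V: "V\<in>Proj" and v: "v\<in>carrier V"
  shows "a V (c0 V (sec V v)) = v"
proof -
  note m = fgp_module[OF V]
  have l: "lmap V [v]\<in>lin_hom R F1 V" using v by (intro lmap_lin[OF m]) auto
  have "a V (c0 V (sec V v)) = lmap V [v] (a F1 (c0 F1 \<sigma>))"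
    using add_hom.hom_closed[OF c0_hom[OF FM_fgp] \<sigma>(1)]
    by (simp add: sec_def op_def c0_natural[OF FM_fgp V l \<sigma>(1)] a_natural[OF FM_fgp V l])
  also have "\<dots> = v" using lmap_gen[OF m, of "[v]" "Suc 0" 0] v by (simp add: \<sigma>(2))
  finally show ?thesis .
qed

lemma Z_decomp:
  assumes V: "V\<in>Proj" and z: "z\<in>carrier (Z V)"
  obtains x v where "x\<in>carrier (E1 V)" "v\<in>carrier V" "z = c1 V x \<oplus>[Z V] sec V v" "v = a V (c0 V z)"
proof -
  interpret ac0: add_hom "Z V" V "\<lambda>z. a V (c0 V z)" by (rule ac0_hom[OF V])
  let ?v = "a V (c0 V z)"
  have v: "?v\<in>carrier V" using ac0.hom_closed[OF z] .
  note s = sec_closed[OF V v]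
  have "a V (c0 V (z \<ominus>[Z V] sec V ?v)) = \<zero>[V]"
    using ac0.hom_minus[OF z s] by (simp add: ac0_sec[OF V v] abelian_group.group_simps[OF V_abelian[OF V]] v)
  then obtain x where "x\<in>carrier (E1 V)" "z \<ominus>[Z V] sec V ?v = c1 V x"
    using ac0_kernel[OF V] z s by blast
  then have "z = c1 V x \<oplus>[Z V] sec V ?v"
    using z s by (simp add: abelian_group.group_simps[OF Z_abelian[OF V]] flip: \<open>_ = c1 V x\<close>)
  then show thesis using that \<open>x\<in>_\<close> v by blast
qed

lemma ac0_decomp:
  assumes V: "V\<in>Proj" and x: "x\<in>carrier (E1 V)" and v: "v\<in>carrier V"
  shows "a V (c0 V (c1 V x \<oplus>[Z V] sec V v)) = v"
proof -
  interpret ac0: add_hom "Z V" V "\<lambda>z. a V (c0 V z)" by (rule ac0_hom[OF V])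
  interpret c1: add_hom "E1 V" "Z V" "c1 V" by (rule c1_hom[OF V])
  show ?thesis
    using x v ac0.hom_add[of "c1 V x" "sec V v"] by (simp add: sec_closed[OF V] ac0_sec[OF V] c0_c1[OF V] a_d[OF V])
qed

text \<open>Every element of \<open>C01\<close> is of the form \<open>c1 x + sec v\<close>, and
  \<open>sec v\<close> is the image of \<open>\<sigma>\<close> under the map classified by
  \<open>v\<close>.\<close>

lemma Z_nat_hom_eqI:
  assumes G: "pointed_functor R \<Z> G" and \<eta>: "\<eta>\<in>nat_hom R \<Z> (C01 D) G" and \<theta>: "\<theta>\<in>nat_hom R \<Z> (C01 D) G"
    and c: "\<And>V x. \<lbrakk>V\<in>Proj; x\<in>carrier (E1 V)\<rbrakk> \<Longrightarrow> \<eta> V (c1 V x) = \<theta> V (c1 V x)"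
    and s: "\<eta> F1 \<sigma> = \<theta> F1 \<sigma>"
  shows "\<eta> = \<theta>"
proof (rule nat_hom_eqI[OF \<eta> \<theta>])
  fix V z assume V: "V\<in>Proj" and z: "z\<in>carrier (Z V)"
  obtain x v where xv: "x\<in>carrier (E1 V)" "v\<in>carrier V" "z = c1 V x \<oplus>[Z V] sec V v"
    using Z_decomp[OF V z] by blast
  have "\<eta> V (sec V v) = \<theta> V (sec V v)"
    unfolding sec_def using xv(2)
    by (simp add: op_nat[OF \<eta> V, where n = "Suc 0"] op_nat[OF \<theta> V, where n = "Suc 0"] \<sigma> s)
  then show "\<eta> V z = \<theta> V z"
    using xv c[OF V xv(1)] add_hom.hom_closed[OF c1_hom[OF V] xv(1)] sec_closed[OF V xv(2)]
      lin_homD(3)[OF nat_hom_lin[OF \<eta> V]] lin_homD(3)[OF nat_hom_lin[OF \<theta> V]] by simp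
qed

text \<open>The cocycle of the extension \<open>C01\<close> of \<open>V\<close> by \<open>C1\<close>
  with respect to the section \<open>sec\<close>; it is well defined since \<open>c1\<close> is
  injective.\<close>

definition "tau V v w = (THE x. x\<in>carrier (E1 V) \<and> sec V (v \<oplus>[V] w) = c1 V x \<oplus>[Z V] (sec V v \<oplus>[Z V] sec V w))"

context
  fixes V :: "('r, 'u) module" assumes V: "V\<in>Proj"
begin

interpretation V: abelian_group V by (rule V_abelian[OF V])
interpretation ac0: add_hom "Z V" V "\<lambda>z. a V (c0 V z)" by (rule ac0_hom[OF V])
interpretation c1: add_hom "E1 V" "Z V" "c1 V" by (rule c1_hom[OF V])

lemma tau:
  assumes v: "v\<in>carrier V" and w: "w\<in>carrier V"
  shows "tau V v w\<in>carrier (E1 V)"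
    "sec V (v \<oplus>[V] w) = c1 V (tau V v w) \<oplus>[Z V] (sec V v \<oplus>[Z V] sec V w)"
proof -
  note c = sec_closed[OF V v] sec_closed[OF V w] sec_closed[OF V V.a_closed[OF v w]]
  have "a V (c0 V (sec V (v \<oplus>[V] w) \<ominus>[Z V] (sec V v \<oplus>[Z V] sec V w))) = \<zero>[V]"
    using ac0.hom_minus[OF c(3) ac0.G.a_closed[OF c(1,2)]] ac0.hom_add[OF c(1,2)] v w
    by (simp add: ac0_sec[OF V] V.minus_eq V.r_neg)
  then obtain x where x: "x\<in>carrier (E1 V)" "sec V (v \<oplus>[V] w) \<ominus>[Z V] (sec V v \<oplus>[Z V] sec V w) = c1 V x"
    using ac0_kernel[OF V] c by (meson ac0.G.a_closed ac0.G.minus_closed)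
  then have e: "sec V (v \<oplus>[V] w) = c1 V x \<oplus>[Z V] (sec V v \<oplus>[Z V] sec V w)"
    using c by (simp add: abelian_group.group_simps[OF Z_abelian[OF V]] flip: x(2))
  have "tau V v w\<in>carrier (E1 V) \<and> sec V (v \<oplus>[V] w) = c1 V (tau V v w) \<oplus>[Z V] (sec V v \<oplus>[Z V] sec V w)"
    unfolding tau_def
  proof (rule theI)
    show "x\<in>carrier (E1 V) \<and> sec V (v \<oplus>[V] w) = c1 V x \<oplus>[Z V] (sec V v \<oplus>[Z V] sec V w)" using x e by simp
    fix x' assume "x'\<in>carrier (E1 V) \<and> sec V (v \<oplus>[V] w) = c1 V x' \<oplus>[Z V] (sec V v \<oplus>[Z V] sec V w)"
    then show "x' = x"
      using e c x(1) by (intro c1_inj[OF V]) (metis ac0.G.a_closed group.right_cancel[OF abelian_group.a_group[OF Z_abelian[OF V]], simplified] c1.hom_closed)+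
  qed
  then show "tau V v w\<in>carrier (E1 V)" "sec V (v \<oplus>[V] w) = c1 V (tau V v w) \<oplus>[Z V] (sec V v \<oplus>[Z V] sec V w)"
    by auto
qed

lemma tau_eqI:
  assumes "v\<in>carrier V" "w\<in>carrier V" "x\<in>carrier (E1 V)"
    "sec V (v \<oplus>[V] w) = c1 V x \<oplus>[Z V] (sec V v \<oplus>[Z V] sec V w)"
  shows "tau V v w = x"
  using assms tau[OF assms(1,2)] sec_closed[OF V assms(1)] sec_closed[OF V assms(2)]
  by (intro c1_inj[OF V]) (metis ac0.G.a_closed group.right_cancel[OF abelian_group.a_group[OF Z_abelian[OF V]], simplified] c1.hom_closed)+

lemma tau_zero_right: "v\<in>carrier V \<Longrightarrow> tau V v \<zero>[V] = \<zero>[E1 V]"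
  by (rule tau_eqI) (simp_all add: sec_zero[OF V] sec_closed[OF V])

lemma tau_zero_left: "v\<in>carrier V \<Longrightarrow> tau V \<zero>[V] v = \<zero>[E1 V]"
  by (rule tau_eqI) (simp_all add: sec_zero[OF V] sec_closed[OF V])

end

lemma tau_natural:
  assumes V: "V\<in>Proj" and W: "W\<in>Proj" and f: "f\<in>lin_hom R V W"
    and v: "v\<in>carrier V" "w\<in>carrier V"
  shows "fmap (C1 E) V W f (tau V v w) = tau W (f v) (f w)"
proof -
  interpret fZ: add_hom "Z V" "Z W" "fmap (C01 D) V W f" by (rule functor_map_hom[OF Z_pointed V W f])
  interpret c1: add_hom "E1 V" "Z V" "c1 V" by (rule c1_hom[OF V])
  interpret V: abelian_group V by (rule V_abelian[OF V])
  note t = tau[OF V v]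
  have "sec W (f v \<oplus>[W] f w) = fmap (C01 D) V W f (sec V (v \<oplus>[V] w))"
    using v by (simp add: sec_natural[OF V W f] lin_homD(3)[OF f])
  also have "\<dots> = c1 W (fmap (C1 E) V W f (tau V v w)) \<oplus>[Z W] (sec W (f v) \<oplus>[Z W] sec W (f w))"
    using v t by (simp add: sec_closed[OF V] sec_natural[OF V W f] c1_natural[OF V W f])
  finally have "tau W (f v) (f w) = fmap (C1 E) V W f (tau V v w)"
    using v t lin_homD(1)[OF f] by (intro tau_eqI[OF W] lin_homD(1)[OF functor_map[OF C1_pointed V W f]])
  then show ?thesis by simp
qed

end

text \<open>A map of complexes between elementary extensions, linear only over \<open>\<Z>\<close>, extends to the splittings
  once the image of \<open>\<sigma>\<close> is chosen.\<close>

locale split_pair = A: split_elementary R u M E D \<sigma> + B: split_elementary R u M E' D' \<sigma>'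
  for R :: "'r ring" and u :: "'u itself" and M :: "('r, 'r, 'm) bimodule"
    and E :: "('r, 'u, 'r, 'u, ('m, 'u) tens, 'x, 'y) el_ext" and D :: "('r, 'u, int, 'x, 'y, 'z) splitting" and \<sigma>
    and E' :: "('r, 'u, 'r, 'u, ('m, 'u) tens, 'x2, 'y2) el_ext"
    and D' :: "('r, 'u, int, 'x2, 'y2, 'z2) splitting" and \<sigma>' +
  fixes f0 f1 and h :: 'z2
  assumes f0: "f0\<in>nat_hom R \<Z> (forget R (C0 E)) (forget R (C0 E'))"
    and f1: "f1\<in>nat_hom R \<Z> (forget R (C1 E)) (forget R (C1 E'))"
    and f0_d: "\<And>V x. \<lbrakk>V\<in>fgp R; x\<in>pts (C1 E) V\<rbrakk> \<Longrightarrow> f0 V (ediff E V x) = ediff E' V (f1 V x)"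
    and h: "h\<in>pts (C01 D') (A.F1)"
    and c0_h: "sc0 D' (A.F1) h = f0 (A.F1) (sc0 D (A.F1) \<sigma>)"
begin

abbreviation "hsec V v \<equiv> A.op (C01 D') h V [v]"

lemma f0_hom: "V\<in>A.Proj \<Longrightarrow> add_hom (A.E0 V) (B.E0 V) (f0 V)"
  using nat_hom_hom[OF f0 forget_pointed[OF A.ring A.C0_pointed] forget_pointed[OF A.ring B.C0_pointed], of V]
    hom_forget_left[OF A.E0_abelian] hom_forget_right[OF B.E0_abelian] by blast

lemma f1_hom: "V\<in>A.Proj \<Longrightarrow> add_hom (A.E1 V) (B.E1 V) (f1 V)"
  using nat_hom_hom[OF f1 forget_pointed[OF A.ring A.C1_pointed] forget_pointed[OF A.ring B.C1_pointed], of V]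
    hom_forget_left[OF A.E1_abelian] hom_forget_right[OF B.E1_abelian] by blast

lemma f1_natural: "\<lbrakk>V\<in>A.Proj; W\<in>A.Proj; f\<in>lin_hom R V W; x\<in>carrier (A.E1 V)\<rbrakk> \<Longrightarrow>
    f1 W (fmap (C1 E) V W f x) = fmap (C1 E') V W f (f1 V x)"
  using nat_hom_natural[OF f1] by simp

lemma hsec_closed: "\<lbrakk>V\<in>A.Proj; v\<in>carrier V\<rbrakk> \<Longrightarrow> hsec V v\<in>carrier (B.Z V)"
  by (rule A.op_closed[OF B.Z_pointed, where n = "Suc 0"]) (auto intro: h)

lemma hsec_natural: "\<lbrakk>V\<in>A.Proj; W\<in>A.Proj; f\<in>lin_hom R V W; v\<in>carrier V\<rbrakk> \<Longrightarrow>
    fmap (C01 D') V W f (hsec V v) = hsec W (f v)"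
  by (subst A.op_natural[OF B.Z_pointed, where n = "Suc 0"]) (auto intro: h)

lemma hsec_zero: "V\<in>A.Proj \<Longrightarrow> hsec V \<zero>[V] = \<zero>[B.Z V]"
  by (rule A.op_zero[OF B.Z_pointed, where n = "Suc 0"]) (auto intro: h)

text \<open>Both sides are operations in one variable, and \<open>c0_h\<close> says that the
  elements defining them agree.\<close>

lemma c0_hsec:
  assumes V: "V\<in>A.Proj" and v: "v\<in>carrier V"
  shows "B.c0 V (hsec V v) = f0 V (A.c0 V (A.sec V v))"
proof -
  have s: "set [v] \<subseteq> carrier V" "length [v] = Suc 0" using v by auto
  have "B.c0 V (hsec V v) = A.op (forget R (C0 E')) (f0 (A.F1) (A.c0 (A.F1) \<sigma>)) V [v]"
    using A.op_nat[OF B.c0_nat V s h] c0_h by simp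
  also have "\<dots> = f0 V (A.op (forget R (C0 E)) (A.c0 (A.F1) \<sigma>) V [v])"
    using add_hom.hom_closed[OF A.c0_hom[OF A.FM_fgp] A.\<sigma>(1)]
    by (intro A.op_nat[OF f0 V s, symmetric]) simp
  also have "\<dots> = f0 V (A.c0 V (A.sec V v))"
    using A.op_nat[OF A.c0_nat V s A.\<sigma>(1)] by (simp add: A.sec_def)
  finally show ?thesis .
qed

text \<open>The two sides are natural in \<open>(v, w)\<close> and have the same image under
  \<open>c0\<close>, so their difference lies in \<open>M \<otimes> V\<close>. They coincide when
  \<open>v\<close> or \<open>w\<close> is zero, and rigidity finishes the argument. In other words,
  \<open>f1\<close> carries the cocycle of \<open>sec\<close> to that of
  \<open>hsec\<close>.\<close>

lemma hsec_add:
  assumes V: "V\<in>A.Proj" and v: "v\<in>carrier V" and w: "w\<in>carrier V"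
  shows "hsec V (v \<oplus>[V] w) = B.c1 V (f1 V (A.tau V v w)) \<oplus>[B.Z V] (hsec V v \<oplus>[B.Z V] hsec V w)"
proof -
  let ?p = "\<lambda>V l. hsec V (l ! 0 \<oplus>[V] l ! Suc 0)"
  let ?q = "\<lambda>V l. B.c1 V (f1 V (A.tau V (l ! 0) (l ! Suc 0))) \<oplus>[B.Z V] (hsec V (l ! 0) \<oplus>[B.Z V] hsec V (l ! Suc 0))"
  have l2: "l ! 0\<in>carrier V \<and> l ! Suc 0\<in>carrier V" if "set l \<subseteq> carrier V" "length l = Suc (Suc 0)" for l and V :: "('r, 'u) module"
    using that by (auto simp: subset_iff)
  have V': "v \<oplus>[V] w\<in>carrier V" if "V\<in>A.Proj" "v\<in>carrier V" "w\<in>carrier V" for V :: "('r, 'u) module" and v w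
    by (rule abelian_groupE(1)[OF A.V_abelian[OF that(1)] that(2,3)])
  have c: "B.c1 V (f1 V (A.tau V v w))\<in>carrier (B.Z V)" if "V\<in>A.Proj" "v\<in>carrier V" "w\<in>carrier V" for V v w
    by (rule add_hom.hom_closed[OF B.c1_hom[OF that(1)] add_hom.hom_closed[OF f1_hom[OF that(1)] A.tau(1)[OF that]]])
  have a: "x \<oplus>[B.Z V] y\<in>carrier (B.Z V)" if "V\<in>A.Proj" "x\<in>carrier (B.Z V)" "y\<in>carrier (B.Z V)" for V x y
    by (rule abelian_groupE(1)[OF B.Z_abelian[OF that(1)] that(2,3)])
  have "?p V (v # [w]) = ?q V (v # [w])"
  proof (rule A.natural_operation_rigid[where n = "Suc 0" and \<beta> = "\<lambda>V t. B.c1 V (B.b V t)" and F = "C01 D'" and p = ?p and q = ?q])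
    show "pointed_functor R \<Z> (C01 D')" by (rule B.Z_pointed)
    show "V\<in>A.Proj \<Longrightarrow> add_hom (fobj A.I V) (B.Z V) (\<lambda>t. B.c1 V (B.b V t))" for V
      by (rule B.c1b_hom)
  next
    fix V W f t
    assume "V\<in>A.Proj" "W\<in>A.Proj" "f\<in>lin_hom R V W" "t\<in>pts A.I V"
    then show "B.c1 W (B.b W (fmap A.I V W f t)) = fmap (C01 D') V W f (B.c1 V (B.b V t))"
      using add_hom.hom_closed[OF B.b_hom] by (simp add: nat_hom_natural[OF B.b_nat] B.c1_natural)
  next
    fix V :: "('r, 'u) module" and l :: "'u list"
    assume V: "V\<in>A.Proj" and "set l \<subseteq> carrier V" "length l = Suc (Suc 0)"
    then have l: "l ! 0\<in>carrier V" "l ! Suc 0\<in>carrier V" using l2 by auto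
    show p: "?p V l\<in>carrier (B.Z V)" by (intro hsec_closed V' V l)
    show q: "?q V l\<in>carrier (B.Z V)" by (intro a c hsec_closed V l)
    interpret c0: add_hom "B.Z V" "B.E0 V" "B.c0 V" by (rule B.c0_hom[OF V])
    interpret f0: add_hom "A.E0 V" "B.E0 V" "f0 V" by (rule f0_hom[OF V])
    interpret f1: add_hom "A.E1 V" "B.E1 V" "f1 V" by (rule f1_hom[OF V])
    interpret c0': add_hom "A.Z V" "A.E0 V" "A.c0 V" by (rule A.c0_hom[OF V])
    interpret c1: add_hom "A.E1 V" "A.Z V" "A.c1 V" by (rule A.c1_hom[OF V])
    interpret d: add_hom "A.E1 V" "A.E0 V" "A.d V" by (rule A.d_hom[OF V])
    \<comment> \<open>Applied to the right side, \<open>c0\<close> gives \<open>f0\<close> of the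
      same decomposition in the first splitting, because \<open>f0\<close> and \<open>f1\<close>
      commute with the differentials.\<close>
    have "B.c0 V (?q V l) = f0 V (A.c0 V (A.c1 V (A.tau V (l ! 0) (l ! Suc 0)) \<oplus>[A.Z V] (A.sec V (l ! 0) \<oplus>[A.Z V] A.sec V (l ! Suc 0))))"
      using l c[OF V l] hsec_closed[OF V l(1)] hsec_closed[OF V l(2)] A.tau(1)[OF V l] A.sec_closed[OF V l(1)] A.sec_closed[OF V l(2)]
      by (simp add: B.c0_c1[OF V] c0_hsec[OF V] A.c0_c1[OF V] f0_d[OF V])
    also have "\<dots> = B.c0 V (?p V l)"
      using A.tau(2)[OF V l] c0_hsec[OF V V'[OF V l]] by simp
    finally have "B.c0 V (?p V l \<ominus>[B.Z V] ?q V l) = \<zero>[B.E0 V]"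
      using p q c0.hom_closed[OF p] by (simp add: c0.hom_minus abelian_group.group_simps[OF B.E0_abelian[OF V]])
    then show "\<exists>t\<in>pts A.I V. ?p V l \<ominus>[B.Z V] ?q V l = B.c1 V (B.b V t)"
      using B.c0_kernel[OF V] p q by simp
  next
    fix V W :: "('r, 'u) module" and f and l :: "'u list"
    assume V: "V\<in>A.Proj" and W: "W\<in>A.Proj" and f: "f\<in>lin_hom R V W"
      and s: "set l \<subseteq> carrier V" "length l = Suc (Suc 0)"
    then have l: "l ! 0\<in>carrier V" "l ! Suc 0\<in>carrier V" using l2 by auto
    have mp: "map f l ! 0 = f (l ! 0)" "map f l ! Suc 0 = f (l ! Suc 0)" using s by auto
    show "fmap (C01 D') V W f (?p V l) = ?p W (map f l)"
      unfolding mp hsec_natural[OF V W f V'[OF V l]] lin_homD(3)[OF f l] ..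
    interpret f: add_hom "B.Z V" "B.Z W" "fmap (C01 D') V W f" by (rule functor_map_hom[OF B.Z_pointed V W f])
    note t = A.tau(1)[OF V l] and ft = add_hom.hom_closed[OF f1_hom[OF V] A.tau(1)[OF V l]]
    show "fmap (C01 D') V W f (?q V l) = ?q W (map f l)"
      unfolding mp using c[OF V l] hsec_closed[OF V l(1)] hsec_closed[OF V l(2)]
      by (simp add: hsec_natural[OF V W f] l B.c1_natural[OF V W f ft, symmetric]
        f1_natural[OF V W f t, symmetric] A.tau_natural[OF V W f l])
  next
    fix V v assume V: "V\<in>A.Proj" and v: "v\<in>carrier V"
    interpret V: abelian_group V by (rule A.V_abelian[OF V])
    interpret Z: abelian_group "B.Z V" by (rule B.Z_abelian[OF V])
    show "?p V (v # replicate (Suc 0) \<zero>[V]) = ?q V (v # replicate (Suc 0) \<zero>[V])"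
      using v add_hom.hom_zero[OF f1_hom[OF V]] add_hom.hom_zero[OF B.c1_hom[OF V]]
      by (simp add: A.tau_zero_right[OF V] hsec_zero[OF V] hsec_closed[OF V])
  next
    fix V :: "('r, 'u) module" and l :: "'u list" assume V: "V\<in>A.Proj" and s: "set l \<subseteq> carrier V" "length l = Suc 0"
    then obtain v where v: "l = [v]" "v\<in>carrier V" by (auto simp: length_Suc_conv)
    interpret V: abelian_group V by (rule A.V_abelian[OF V])
    interpret Z: abelian_group "B.Z V" by (rule B.Z_abelian[OF V])
    show "?p V (\<zero>[V] # l) = ?q V (\<zero>[V] # l)"
      using v add_hom.hom_zero[OF f1_hom[OF V]] add_hom.hom_zero[OF B.c1_hom[OF V]]
      by (simp add: A.tau_zero_left[OF V] hsec_zero[OF V] hsec_closed[OF V])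
  qed (use V v w in auto)
  then show ?thesis by simp
qed

text \<open>On \<open>c1 x + sec v\<close> this is \<open>c1 (f1 x) + hsec v\<close>. The component
  \<open>v\<close> is recovered by \<open>a\<close> and \<open>c0\<close>, and then \<open>x\<close>
  by injectivity of \<open>c1\<close>.\<close>

definition "ext V z = B.c1 V (f1 V (the_inv_into (carrier (A.E1 V)) (A.c1 V) (z \<ominus>[A.Z V] A.sec V (A.a V (A.c0 V z)))))
    \<oplus>[B.Z V] hsec V (A.a V (A.c0 V z))"

lemma ext_decomp:
  assumes V: "V\<in>A.Proj" and x: "x\<in>carrier (A.E1 V)" and v: "v\<in>carrier V"
  shows "ext V (A.c1 V x \<oplus>[A.Z V] A.sec V v) = B.c1 V (f1 V x) \<oplus>[B.Z V] hsec V v"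
proof -
  interpret c1: add_hom "A.E1 V" "A.Z V" "A.c1 V" by (rule A.c1_hom[OF V])
  have i: "inj_on (A.c1 V) (carrier (A.E1 V))" by (intro inj_onI A.c1_inj[OF V])
  have "A.c1 V x \<oplus>[A.Z V] A.sec V v \<ominus>[A.Z V] A.sec V v = A.c1 V x"
    using x A.sec_closed[OF V v] by (simp add: abelian_group.group_simps[OF A.Z_abelian[OF V]])
  then show ?thesis
    unfolding ext_def A.ac0_decomp[OF V x v] by (simp add: the_inv_into_f_f[OF i] x)
qed

abbreviation "Ext \<equiv> nat_restrict R (C01 D) ext"

text \<open>Additivity is the substance here: adding two decomposed elements produces the cocycle
  \<open>tau\<close> in the first splitting, and \<open>hsec_add\<close> produces its image under
  \<open>f1\<close> in the second.\<close>

lemma Ext_nat: "Ext\<in>nat_hom R \<Z> (C01 D) (C01 D')"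
proof (rule nat_hom_intI[OF A.Z_pointed B.Z_pointed])
  fix V z assume V: "V\<in>A.Proj" and z: "z\<in>carrier (A.Z V)"
  interpret c1: add_hom "A.E1 V" "A.Z V" "A.c1 V" by (rule A.c1_hom[OF V])
  interpret c1': add_hom "B.E1 V" "B.Z V" "B.c1 V" by (rule B.c1_hom[OF V])
  interpret f1: add_hom "A.E1 V" "B.E1 V" "f1 V" by (rule f1_hom[OF V])
  interpret V: abelian_group V by (rule A.V_abelian[OF V])
  obtain x v where xv: "x\<in>carrier (A.E1 V)" "v\<in>carrier V" "z = A.c1 V x \<oplus>[A.Z V] A.sec V v"
    using A.Z_decomp[OF V z] by blast
  show "ext V z\<in>carrier (B.Z V)"
    unfolding xv(3) ext_decomp[OF V xv(1,2)] using xv hsec_closed[OF V xv(2)] by simp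
  { fix z' assume z': "z'\<in>carrier (A.Z V)"
    obtain x' v' where xv': "x'\<in>carrier (A.E1 V)" "v'\<in>carrier V" "z' = A.c1 V x' \<oplus>[A.Z V] A.sec V v'"
      using A.Z_decomp[OF V z'] by blast
    let ?t = "A.tau V v v'"
    note t = A.tau[OF V xv(2) xv'(2)]
    note sc = A.sec_closed[OF V xv(2)] A.sec_closed[OF V xv'(2)]
    note hc = hsec_closed[OF V xv(2)] hsec_closed[OF V xv'(2)]
    have "z \<oplus>[A.Z V] z' = A.c1 V (x \<oplus>[A.E1 V] x' \<ominus>[A.E1 V] ?t) \<oplus>[A.Z V] A.sec V (v \<oplus>[V] v')"
      using xv xv' t sc by (simp add: c1.hom_minus abelian_group.group_simps[OF A.Z_abelian[OF V]])
    then have "ext V (z \<oplus>[A.Z V] z') = B.c1 V (f1 V (x \<oplus>[A.E1 V] x' \<ominus>[A.E1 V] ?t)) \<oplus>[B.Z V] hsec V (v \<oplus>[V] v')"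
      using xv(1,2) xv'(1,2) t(1) by (simp add: ext_decomp[OF V])
    also have "\<dots> = (B.c1 V (f1 V x) \<oplus>[B.Z V] hsec V v) \<oplus>[B.Z V] (B.c1 V (f1 V x') \<oplus>[B.Z V] hsec V v')"
      using xv xv' t hc by (simp add: hsec_add[OF V] f1.hom_minus c1'.hom_minus abelian_group.group_simps[OF B.Z_abelian[OF V]])
    finally show "ext V (z \<oplus>[A.Z V] z') = ext V z \<oplus>[B.Z V] ext V z'"
      using xv xv' by (simp add: ext_decomp[OF V]) }
  { fix W f assume W: "W\<in>A.Proj" and f: "f\<in>lin_hom R V W"
    interpret fZ: add_hom "A.Z V" "A.Z W" "fmap (C01 D) V W f" by (rule functor_map_hom[OF A.Z_pointed V W f])
    interpret fZ': add_hom "B.Z V" "B.Z W" "fmap (C01 D') V W f" by (rule functor_map_hom[OF B.Z_pointed V W f])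
    have fx: "fmap (C1 E) V W f x\<in>carrier (A.E1 W)" by (rule lin_homD(1)[OF functor_map[OF A.C1_pointed V W f] xv(1)])
    have "fmap (C01 D) V W f z = A.c1 W (fmap (C1 E) V W f x) \<oplus>[A.Z W] A.sec W (f v)"
      using xv A.sec_closed[OF V xv(2)] by (simp add: A.c1_natural[OF V W f] A.sec_natural[OF V W f])
    then show "ext W (fmap (C01 D) V W f z) = fmap (C01 D') V W f (ext V z)"
      using xv fx lin_homD(1)[OF f xv(2)] hsec_closed[OF V xv(2)]
      by (simp add: ext_decomp[OF V] ext_decomp[OF W] hsec_natural[OF V W f] f1_natural[OF V W f] B.c1_natural[OF V W f, symmetric]) }
qed

lemma Ext_c1:
  assumes V: "V\<in>A.Proj" and x: "x\<in>carrier (A.E1 V)"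
  shows "Ext V (A.c1 V x) = B.c1 V (f1 V x)"
proof -
  interpret c1: add_hom "A.E1 V" "A.Z V" "A.c1 V" by (rule A.c1_hom[OF V])
  interpret c1': add_hom "B.E1 V" "B.Z V" "B.c1 V" by (rule B.c1_hom[OF V])
  interpret f1: add_hom "A.E1 V" "B.E1 V" "f1 V" by (rule f1_hom[OF V])
  interpret V: abelian_group V by (rule A.V_abelian[OF V])
  show ?thesis
    using ext_decomp[OF V x V.zero_closed] x V by (simp add: A.sec_zero[OF V] hsec_zero[OF V])
qed

lemma Ext_\<sigma>: "Ext (A.F1) \<sigma> = h"
proof -
  interpret c1: add_hom "A.E1 (A.F1)" "A.Z (A.F1)" "A.c1 (A.F1)" by (rule A.c1_hom[OF A.FM_fgp])
  interpret c1': add_hom "B.E1 (A.F1)" "B.Z (A.F1)" "B.c1 (A.F1)" by (rule B.c1_hom[OF A.FM_fgp])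
  interpret f1: add_hom "A.E1 (A.F1)" "B.E1 (A.F1)" "f1 (A.F1)" by (rule f1_hom[OF A.FM_fgp])
  have "hsec (A.F1) A.gen1 = h" using A.op_gens[OF B.Z_pointed h] by (simp add: A.gens_def)
  then show ?thesis
    using ext_decomp[OF A.FM_fgp c1.G.zero_closed A.gen_closed[of "Suc 0" 0]] A.\<sigma>(1) A.FM_fgp h
    by (simp add: A.sec_gen1)
qed

lemma c0_Ext:
  assumes V: "V\<in>A.Proj" and z: "z\<in>carrier (A.Z V)"
  shows "B.c0 V (Ext V z) = f0 V (A.c0 V z)"
proof -
  interpret c1: add_hom "A.E1 V" "A.Z V" "A.c1 V" by (rule A.c1_hom[OF V])
  interpret c1': add_hom "B.E1 V" "B.Z V" "B.c1 V" by (rule B.c1_hom[OF V])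
  interpret f1: add_hom "A.E1 V" "B.E1 V" "f1 V" by (rule f1_hom[OF V])
  interpret f0: add_hom "A.E0 V" "B.E0 V" "f0 V" by (rule f0_hom[OF V])
  interpret c0: add_hom "A.Z V" "A.E0 V" "A.c0 V" by (rule A.c0_hom[OF V])
  interpret c0': add_hom "B.Z V" "B.E0 V" "B.c0 V" by (rule B.c0_hom[OF V])
  obtain x v where xv: "x\<in>carrier (A.E1 V)" "v\<in>carrier V" "z = A.c1 V x \<oplus>[A.Z V] A.sec V v"
    using A.Z_decomp[OF V z] by blast
  have "Ext V z = B.c1 V (f1 V x) \<oplus>[B.Z V] hsec V v"
    using z V ext_decomp[OF V xv(1,2)] xv(3) by simp
  then show ?thesis
    using xv hsec_closed[OF V xv(2)] A.sec_closed[OF V xv(2)] add_hom.hom_closed[OF A.d_hom[OF V] xv(1)]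
    by (simp add: B.c0_c1[OF V] A.c0_c1[OF V] c0_hsec[OF V] f0_d[OF V])
qed

end

subsection \<open>The ring of regular endomorphisms\<close>

text \<open>Over a noncommutative ring, multiplication by a scalar is in general only additive; it
  is a transformation of the underlying functors to abelian groups.\<close>

lemma (in universe) scalar_nat:
  fixes F :: "('r, 'u, 't, 'x) pfunctor"
  assumes F: "pointed_functor R T F" and r: "r\<in>carrier T"
  shows "nat_restrict R F (\<lambda>V x. r \<odot>[fobj F V] x)\<in>nat_hom R \<Z> (forget T F) (forget T F)"
proof -
  note FZ = forget_pointed[OF lm_ring[OF functor_obj[OF F FM_fgp]] F]
  have "nat_restrict R (forget T F) (\<lambda>V x. r \<odot>[fobj F V] x)\<in>nat_hom R \<Z> (forget T F) (forget T F)"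
    using r by (intro nat_hom_intI[OF FZ FZ])
      (simp_all add: left_module.smult_closed[OF functor_obj[OF F]] left_module.smult_r_distr[OF functor_obj[OF F]]
        lin_homD(4)[OF functor_map[OF F]])
  then show ?thesis by (simp add: nat_restrict_def)
qed

lemma nat_hom_add:
  assumes F: "pointed_functor S \<Z> F" and \<eta>: "\<eta>\<in>nat_hom S \<Z> F F" and \<theta>: "\<theta>\<in>nat_hom S \<Z> F F"
  shows "nat_restrict S F (\<lambda>V x. \<eta> V x \<oplus>[fobj F V] \<theta> V x)\<in>nat_hom S \<Z> F F"
proof (rule nat_hom_intI[OF F F])
  fix V x assume V: "V\<in>fgp S" and x: "x\<in>pts F V"
  interpret V: abelian_group "fobj F V" by (rule functor_abelian[OF F V])
  note h = lin_homD(1,3)[OF nat_hom_lin[OF \<eta> V]] lin_homD(1,3)[OF nat_hom_lin[OF \<theta> V]]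
  show "\<eta> V x \<oplus>[fobj F V] \<theta> V x\<in>pts F V" using x by (simp add: h)
  show "\<eta> V (x \<oplus>[fobj F V] y) \<oplus>[fobj F V] \<theta> V (x \<oplus>[fobj F V] y) =
      \<eta> V x \<oplus>[fobj F V] \<theta> V x \<oplus>[fobj F V] (\<eta> V y \<oplus>[fobj F V] \<theta> V y)" if "y\<in>pts F V" for y
    using x that by (simp add: h V.a_ac)
  show "\<eta> W (fmap F V W f x) \<oplus>[fobj F W] \<theta> W (fmap F V W f x) = fmap F V W f (\<eta> V x \<oplus>[fobj F V] \<theta> V x)"
    if "W\<in>fgp S" "f\<in>lin_hom S V W" for W f
    using x that by (simp add: nat_hom_natural[OF \<eta> V] nat_hom_natural[OF \<theta> V] lin_homD(3)[OF functor_map[OF F V]] h)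
qed

lemma nat_hom_neg:
  assumes F: "pointed_functor S \<Z> F" and \<eta>: "\<eta>\<in>nat_hom S \<Z> F F"
  shows "nat_restrict S F (\<lambda>V x. \<ominus>[fobj F V] \<eta> V x)\<in>nat_hom S \<Z> F F"
proof (rule nat_hom_intI[OF F F])
  fix V x assume V: "V\<in>fgp S" and x: "x\<in>pts F V"
  interpret V: abelian_group "fobj F V" by (rule functor_abelian[OF F V])
  note h = lin_homD(1,3)[OF nat_hom_lin[OF \<eta> V]]
  show "\<ominus>[fobj F V] \<eta> V x\<in>pts F V" using x by (simp add: h)
  show "\<ominus>[fobj F V] \<eta> V (x \<oplus>[fobj F V] y) = \<ominus>[fobj F V] \<eta> V x \<oplus>[fobj F V] \<ominus>[fobj F V] \<eta> V y"
    if "y\<in>pts F V" for y using x that by (simp add: h V.minus_add V.a_ac)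
  show "\<ominus>[fobj F W] \<eta> W (fmap F V W f x) = fmap F V W f (\<ominus>[fobj F V] \<eta> V x)"
    if "W\<in>fgp S" "f\<in>lin_hom S V W" for W f
    using x that add_hom.hom_a_inv[OF functor_map_hom[OF F V that]] by (simp add: nat_hom_natural[OF \<eta> V] h)
qed

lemma nat_hom_zero:
  fixes S :: "'s ring" and F :: "('s, 'u, int, 'x) pfunctor"
  assumes F: "pointed_functor S \<Z> F"
  shows "nat_restrict S F (\<lambda>V x. \<zero>[fobj F V])\<in>nat_hom S \<Z> F F"
proof (rule nat_hom_intI[OF F F])
  fix V :: "('s, 'u) module" and x assume V: "V\<in>fgp S"
  interpret V: abelian_group "fobj F V" by (rule functor_abelian[OF F V])
  show "\<zero>[fobj F V]\<in>pts F V" "\<zero>[fobj F V] = \<zero>[fobj F V] \<oplus>[fobj F V] \<zero>[fobj F V]" by simp_all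
  show "\<zero>[fobj F W] = fmap F V W f \<zero>[fobj F V]" if "W\<in>fgp S" "f\<in>lin_hom S V W" for W f
    using add_hom.hom_zero[OF functor_map_hom[OF F V that]] by simp
qed

context split_elementary begin

definition "reg \<eta> r \<longleftrightarrow> \<eta>\<in>nat_hom R \<Z> (C01 D) (C01 D) \<and> regular_via R E D \<eta> r"

lemma regD:
  assumes "reg \<eta> r"
  shows "\<eta>\<in>nat_hom R \<Z> (C01 D) (C01 D)" "r\<in>carrier R"
    "\<lbrakk>V\<in>Proj; x\<in>carrier (Z V)\<rbrakk> \<Longrightarrow> c0 V (\<eta> V x) = r \<odot>[E0 V] c0 V x"
    "\<lbrakk>V\<in>Proj; y\<in>carrier (E1 V)\<rbrakk> \<Longrightarrow> \<eta> V (c1 V y) = c1 V (r \<odot>[E1 V] y)"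
  using assms by (auto simp: reg_def regular_via_def)

lemma regI:
  assumes "\<eta>\<in>nat_hom R \<Z> (C01 D) (C01 D)" "r\<in>carrier R"
    "\<And>V x. \<lbrakk>V\<in>Proj; x\<in>carrier (Z V)\<rbrakk> \<Longrightarrow> c0 V (\<eta> V x) = r \<odot>[E0 V] c0 V x"
    "\<And>V y. \<lbrakk>V\<in>Proj; y\<in>carrier (E1 V)\<rbrakk> \<Longrightarrow> \<eta> V (c1 V y) = c1 V (r \<odot>[E1 V] y)"
  shows "reg \<eta> r"
  using assms by (auto simp: reg_def regular_via_def)

lemma reg_closed: "\<lbrakk>reg \<eta> r; V\<in>Proj; x\<in>carrier (Z V)\<rbrakk> \<Longrightarrow> \<eta> V x\<in>carrier (Z V)"
  using lin_homD(1)[OF nat_hom_lin[OF regD(1)]] .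

lemma c0_closed: "\<lbrakk>V\<in>Proj; x\<in>carrier (Z V)\<rbrakk> \<Longrightarrow> c0 V x\<in>carrier (E0 V)"
  using add_hom.hom_closed[OF c0_hom] .

lemma c1_closed: "\<lbrakk>V\<in>Proj; x\<in>carrier (E1 V)\<rbrakk> \<Longrightarrow> c1 V x\<in>carrier (Z V)"
  using add_hom.hom_closed[OF c1_hom] .

lemma a_closed: "\<lbrakk>V\<in>Proj; x\<in>carrier (E0 V)\<rbrakk> \<Longrightarrow> a V x\<in>carrier V"
  using add_hom.hom_closed[OF a_hom] .

lemma b_closed: "\<lbrakk>V\<in>Proj; t\<in>pts I V\<rbrakk> \<Longrightarrow> b V t\<in>carrier (E1 V)"
  using add_hom.hom_closed[OF b_hom] .

lemma tens_in_I: "\<lbrakk>V\<in>Proj; m\<in>carrier M; v\<in>carrier V\<rbrakk> \<Longrightarrow> tens R M V m v\<in>pts I V"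
  using tensor_product.tens_closed[OF tensor_product_M[OF fgp_module]] by (simp add: I_carrier)

lemmas smult0 = left_module.smult_closed[OF functor_obj[OF C0_pointed]]
lemmas smult1 = left_module.smult_closed[OF functor_obj[OF C1_pointed]]

lemma reg_ac0: "\<lbrakk>reg \<eta> r; V\<in>Proj; x\<in>carrier (Z V)\<rbrakk> \<Longrightarrow> a V (c0 V (\<eta> V x)) = r \<odot>[V] a V (c0 V x)"
  by (simp add: regD(3) lin_homD(4)[OF a_lin] regD(2) c0_closed)

text \<open>After applying \<open>a\<close> and \<open>c0\<close> to the value at
  \<open>\<sigma>\<close>, the scalar is seen as the coefficient of the free generator.\<close>

lemma reg_scalar_unique:
  assumes "reg \<eta> r" "reg \<eta> s" shows "r = s"
  using reg_ac0[OF assms(1) FM_fgp \<sigma>(1)] reg_ac0[OF assms(2) FM_fgp \<sigma>(1)]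
  by (intro smult_gen1_inj regD(2)[OF assms(1)] regD(2)[OF assms(2)]) (simp add: \<sigma>(2))

lemma reg_eqI: "\<lbrakk>reg \<eta> r; reg \<theta> r; \<eta> F1 \<sigma> = \<theta> F1 \<sigma>\<rbrakk> \<Longrightarrow> \<eta> = \<theta>"
  by (rule Z_nat_hom_eqI[OF Z_pointed regD(1) regD(1)]) (simp_all add: regD(4))

text \<open>Multiplication by \<open>r\<close> on \<open>C0\<close> and \<open>C1\<close> is a map
  of complexes of functors to abelian groups, so it extends to \<open>C01\<close>. Any lift
  \<open>\<rho>\<close> of \<open>r c0(\<sigma>)\<close> can be prescribed as the image of
  \<open>\<sigma>\<close>.\<close>

lemma reg_exists:
  assumes r: "r\<in>carrier R" and \<rho>: "\<rho>\<in>carrier (Z F1)" "c0 F1 \<rho> = r \<odot>[E0 F1] c0 F1 \<sigma>"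
  obtains \<eta> where "reg \<eta> r" "\<eta> F1 \<sigma> = \<rho>"
proof -
  interpret P: split_pair R u M E D \<sigma> E D \<sigma> "nat_restrict R (C0 E) (\<lambda>V x. r \<odot>[E0 V] x)" "nat_restrict R (C1 E) (\<lambda>V x. r \<odot>[E1 V] x)" \<rho>
  proof (intro split_pair.intro split_elementary_axioms split_pair_axioms.intro scalar_nat C0_pointed C1_pointed r \<rho>(1))
    show "c0 F1 \<rho> = nat_restrict R (C0 E) (\<lambda>V x. r \<odot>[E0 V] x) F1 (c0 F1 \<sigma>)"
      using \<rho>(2) c0_closed[OF FM_fgp \<sigma>(1)] by (simp add: FM_fgp)
    show "nat_restrict R (C0 E) (\<lambda>V x. r \<odot>[E0 V] x) V (d V x) = d V (nat_restrict R (C1 E) (\<lambda>V x. r \<odot>[E1 V] x) V x)"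
      if "V\<in>Proj" "x\<in>carrier (E1 V)" for V x
      using that add_hom.hom_closed[OF d_hom[OF that(1)] that(2)] by (simp add: lin_homD(4)[OF nat_hom_lin[OF d_nat] r])
  qed
  have "reg P.Ext r"
    by (rule regI[OF P.Ext_nat r]) (simp_all add: P.c0_Ext P.Ext_c1 c0_closed del: nat_restrict_apply, simp_all add: c0_closed)
  then show thesis using that P.Ext_\<sigma> by blast
qed

abbreviation "RR \<equiv> regular_ring R E D"

lemma RR_carrier: "\<eta>\<in>carrier RR \<longleftrightarrow> (\<exists>r. reg \<eta> r)"
  by (auto simp: regular_ring_def reg_def)

lemma RR_ops: "\<eta> \<otimes>[RR] \<theta> = nat_restrict R (C01 D) (\<lambda>V x. \<eta> V (\<theta> V x))"
  "\<eta> \<oplus>[RR] \<theta> = nat_restrict R (C01 D) (\<lambda>V x. \<eta> V x \<oplus>[Z V] \<theta> V x)"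
  "\<one>[RR] = nat_restrict R (C01 D) (\<lambda>V x. x)" "\<zero>[RR] = nat_restrict R (C01 D) (\<lambda>V x. \<zero>[Z V])"
  by (simp_all add: regular_ring_def nat_restrict_def compose_def)

lemma reg_add:
  assumes "reg \<eta> r" "reg \<theta> s" shows "reg (\<eta> \<oplus>[RR] \<theta>) (r \<oplus>[R] s)"
  unfolding RR_ops
proof (rule regI[OF nat_hom_add[OF Z_pointed regD(1)[OF assms(1)] regD(1)[OF assms(2)]]])
  note rs = regD(2)[OF assms(1)] regD(2)[OF assms(2)]
  show "r \<oplus>[R] s\<in>carrier R" using rs by simp
  show "c0 V (nat_restrict R (C01 D) (\<lambda>V x. \<eta> V x \<oplus>[Z V] \<theta> V x) V x) = (r \<oplus>[R] s) \<odot>[E0 V] c0 V x"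
    if "V\<in>Proj" "x\<in>carrier (Z V)" for V x
    using that add_hom.hom_add[OF c0_hom[OF that(1)]] rs
    by (simp add: reg_closed[OF assms(1)] reg_closed[OF assms(2)] regD(3)[OF assms(1)] regD(3)[OF assms(2)]
      left_module.smult_l_distr[OF functor_obj[OF C0_pointed]] c0_closed)
  show "nat_restrict R (C01 D) (\<lambda>V x. \<eta> V x \<oplus>[Z V] \<theta> V x) V (c1 V y) = c1 V ((r \<oplus>[R] s) \<odot>[E1 V] y)"
    if "V\<in>Proj" "y\<in>carrier (E1 V)" for V y
    using that add_hom.hom_add[OF c1_hom[OF that(1)]] rs
    by (simp add: c1_closed regD(4)[OF assms(1)] regD(4)[OF assms(2)] smult1
      left_module.smult_l_distr[OF functor_obj[OF C1_pointed]])
qed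

lemma reg_neg:
  assumes "reg \<eta> r" shows "reg (nat_restrict R (C01 D) (\<lambda>V x. \<ominus>[Z V] \<eta> V x)) (\<ominus>[R] r)"
proof (rule regI[OF nat_hom_neg[OF Z_pointed regD(1)[OF assms(1)]]])
  note r = regD(2)[OF assms(1)]
  show "\<ominus>[R] r\<in>carrier R" using r by simp
  show "c0 V (nat_restrict R (C01 D) (\<lambda>V x. \<ominus>[Z V] \<eta> V x) V x) = (\<ominus>[R] r) \<odot>[E0 V] c0 V x"
    if "V\<in>Proj" "x\<in>carrier (Z V)" for V x
    using that add_hom.hom_a_inv[OF c0_hom[OF that(1)]] r
      add_hom.hom_a_inv[OF lm_scalar_hom[OF functor_obj[OF C0_pointed that(1)] c0_closed[OF that]] r]
    by (simp add: reg_closed[OF assms(1)] regD(3)[OF assms(1)])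
  show "nat_restrict R (C01 D) (\<lambda>V x. \<ominus>[Z V] \<eta> V x) V (c1 V y) = c1 V ((\<ominus>[R] r) \<odot>[E1 V] y)"
    if "V\<in>Proj" "y\<in>carrier (E1 V)" for V y
    using that add_hom.hom_a_inv[OF c1_hom[OF that(1)]] r
      add_hom.hom_a_inv[OF lm_scalar_hom[OF functor_obj[OF C1_pointed that(1)] that(2)] r]
    by (simp add: c1_closed regD(4)[OF assms(1)] smult1)
qed

lemma reg_mult:
  assumes "reg \<eta> r" "reg \<theta> s" shows "reg (\<eta> \<otimes>[RR] \<theta>) (r \<otimes>[R] s)"
  unfolding RR_ops
proof (rule regI[OF nat_hom_compose[OF regD(1)[OF assms(2)] regD(1)[OF assms(1)] Z_pointed]])
  note rs = regD(2)[OF assms(1)] regD(2)[OF assms(2)]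
  show "r \<otimes>[R] s\<in>carrier R" using rs by simp
  show "c0 V (nat_restrict R (C01 D) (\<lambda>V x. \<eta> V (\<theta> V x)) V x) = (r \<otimes>[R] s) \<odot>[E0 V] c0 V x"
    if "V\<in>Proj" "x\<in>carrier (Z V)" for V x
    using that rs by (simp add: reg_closed[OF assms(2)] regD(3)[OF assms(1)] regD(3)[OF assms(2)]
      left_module.smult_assoc[OF functor_obj[OF C0_pointed]] c0_closed)
  show "nat_restrict R (C01 D) (\<lambda>V x. \<eta> V (\<theta> V x)) V (c1 V y) = c1 V ((r \<otimes>[R] s) \<odot>[E1 V] y)"
    if "V\<in>Proj" "y\<in>carrier (E1 V)" for V y
    using that rs by (simp add: c1_closed regD(4)[OF assms(1)] regD(4)[OF assms(2)] smult1
      left_module.smult_assoc[OF functor_obj[OF C1_pointed]])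
qed

lemma reg_one: "reg \<one>[RR] \<one>[R]"
  unfolding RR_ops
  by (rule regI[OF nat_hom_id[OF Z_pointed]])
    (simp_all add: c0_closed c1_closed left_module.smult_one[OF functor_obj[OF C0_pointed]] left_module.smult_one[OF functor_obj[OF C1_pointed]])

lemma reg_zero: "reg \<zero>[RR] \<zero>[R]"
  unfolding RR_ops
  by (rule regI[OF nat_hom_zero[OF Z_pointed]])
    (simp_all add: c0_closed c1_closed lm_zero_smult[OF functor_obj[OF C0_pointed]] lm_zero_smult[OF functor_obj[OF C1_pointed]]
      add_hom.hom_zero[OF c0_hom] add_hom.hom_zero[OF c1_hom])

lemma reg_ext:
  assumes "reg \<eta> r" "reg \<theta> s" "\<And>V x. \<lbrakk>V\<in>Proj; x\<in>carrier (Z V)\<rbrakk> \<Longrightarrow> \<eta> V x = \<theta> V x"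
  shows "\<eta> = \<theta>"
  by (rule nat_hom_eqI[OF regD(1)[OF assms(1)] regD(1)[OF assms(2)] assms(3)])

lemma RR_ring: "ring RR"
proof -
  have Zc: "x \<oplus>[Z V] y\<in>carrier (Z V)" "x \<oplus>[Z V] y = y \<oplus>[Z V] x"
    if "V\<in>Proj" "x\<in>carrier (Z V)" "y\<in>carrier (Z V)" for V x y
    using abelian_group.group_simps(2)[OF Z_abelian] abelian_groupE(1)[OF Z_abelian] that by auto
  have "abelian_group RR"
  proof (rule abelian_groupI)
    fix \<eta> \<theta> \<kappa> assume "\<eta>\<in>carrier RR" "\<theta>\<in>carrier RR" "\<kappa>\<in>carrier RR"
    then obtain r s t where r: "reg \<eta> r" and s: "reg \<theta> s" and t: "reg \<kappa> t" by (auto simp: RR_carrier)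
    show "\<eta> \<oplus>[RR] \<theta> \<oplus>[RR] \<kappa> = \<eta> \<oplus>[RR] (\<theta> \<oplus>[RR] \<kappa>)"
      by (rule reg_ext[OF reg_add[OF reg_add[OF r s] t] reg_add[OF r reg_add[OF s t]]])
        (simp add: RR_ops reg_closed[OF r] reg_closed[OF s] reg_closed[OF t] abelian_groupE(3)[OF Z_abelian])
  next
    fix \<eta> \<theta> assume "\<eta>\<in>carrier RR" "\<theta>\<in>carrier RR"
    then obtain r s where r: "reg \<eta> r" and s: "reg \<theta> s" by (auto simp: RR_carrier)
    show "\<eta> \<oplus>[RR] \<theta>\<in>carrier RR" using reg_add[OF r s] by (auto simp: RR_carrier)
    show "\<eta> \<oplus>[RR] \<theta> = \<theta> \<oplus>[RR] \<eta>"
      by (rule reg_ext[OF reg_add[OF r s] reg_add[OF s r]])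
        (simp add: RR_ops Zc(2)[OF _ reg_closed[OF r] reg_closed[OF s]])
  next
    show "\<zero>[RR]\<in>carrier RR" using reg_zero by (auto simp: RR_carrier)
  next
    fix \<eta> assume "\<eta>\<in>carrier RR"
    then obtain r where r: "reg \<eta> r" by (auto simp: RR_carrier)
    show "\<zero>[RR] \<oplus>[RR] \<eta> = \<eta>"
      by (rule reg_ext[OF reg_add[OF reg_zero r] r])
        (simp add: RR_ops reg_closed[OF r] abelian_groupE(5)[OF Z_abelian])
    have "nat_restrict R (C01 D) (\<lambda>V x. \<ominus>[Z V] \<eta> V x) \<oplus>[RR] \<eta> = \<zero>[RR]"
      by (rule reg_ext[OF reg_add[OF reg_neg[OF r] r] reg_zero])
        (simp add: RR_ops reg_closed[OF r] abelian_group.l_neg[OF Z_abelian])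
    moreover have "nat_restrict R (C01 D) (\<lambda>V x. \<ominus>[Z V] \<eta> V x)\<in>carrier RR"
      using reg_neg[OF r] by (auto simp: RR_carrier)
    ultimately show "\<exists>\<theta>\<in>carrier RR. \<theta> \<oplus>[RR] \<eta> = \<zero>[RR]"
      by (rule bexI[where P = "\<lambda>\<theta>. \<theta> \<oplus>[RR] \<eta> = \<zero>[RR]"])
  qed
  moreover have "monoid RR"
  proof
    fix \<eta> \<theta> \<kappa> assume "\<eta>\<in>carrier RR" "\<theta>\<in>carrier RR" "\<kappa>\<in>carrier RR"
    then obtain r s t where r: "reg \<eta> r" and s: "reg \<theta> s" and t: "reg \<kappa> t" by (auto simp: RR_carrier)
    show "\<eta> \<otimes>[RR] \<theta> \<otimes>[RR] \<kappa> = \<eta> \<otimes>[RR] (\<theta> \<otimes>[RR] \<kappa>)"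
      by (rule reg_ext[OF reg_mult[OF reg_mult[OF r s] t] reg_mult[OF r reg_mult[OF s t]]])
        (simp add: RR_ops reg_closed[OF s] reg_closed[OF t])
  next
    fix \<eta> \<theta> assume "\<eta>\<in>carrier RR" "\<theta>\<in>carrier RR"
    then obtain r s where r: "reg \<eta> r" and s: "reg \<theta> s" by (auto simp: RR_carrier)
    show "\<eta> \<otimes>[RR] \<theta>\<in>carrier RR" using reg_mult[OF r s] by (auto simp: RR_carrier)
  next
    show "\<one>[RR]\<in>carrier RR" using reg_one by (auto simp: RR_carrier)
  next
    fix \<eta> assume "\<eta>\<in>carrier RR"
    then obtain r where r: "reg \<eta> r" by (auto simp: RR_carrier)
    show "\<one>[RR] \<otimes>[RR] \<eta> = \<eta>"
      by (rule reg_ext[OF reg_mult[OF reg_one r] r]) (simp add: RR_ops reg_closed[OF r])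
    show "\<eta> \<otimes>[RR] \<one>[RR] = \<eta>"
      by (rule reg_ext[OF reg_mult[OF r reg_one] r]) (simp add: RR_ops reg_closed[OF r])
  qed
  ultimately show ?thesis
  proof (rule ringI)
    fix \<eta> \<theta> \<kappa> assume "\<eta>\<in>carrier RR" "\<theta>\<in>carrier RR" "\<kappa>\<in>carrier RR"
    then obtain r s t where r: "reg \<eta> r" and s: "reg \<theta> s" and t: "reg \<kappa> t" by (auto simp: RR_carrier)
    show "(\<eta> \<oplus>[RR] \<theta>) \<otimes>[RR] \<kappa> = \<eta> \<otimes>[RR] \<kappa> \<oplus>[RR] \<theta> \<otimes>[RR] \<kappa>"
      by (rule reg_ext[OF reg_mult[OF reg_add[OF r s] t] reg_add[OF reg_mult[OF r t] reg_mult[OF s t]]])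
        (simp add: RR_ops reg_closed[OF t])
    show "\<kappa> \<otimes>[RR] (\<eta> \<oplus>[RR] \<theta>) = \<kappa> \<otimes>[RR] \<eta> \<oplus>[RR] \<kappa> \<otimes>[RR] \<theta>"
      by (rule reg_ext[OF reg_mult[OF t reg_add[OF r s]] reg_add[OF reg_mult[OF t r] reg_mult[OF t s]]])
        (simp add: RR_ops reg_closed[OF r] reg_closed[OF s] Zc(1) lin_homD(3)[OF nat_hom_lin[OF regD(1)[OF t]]])
  qed
qed

section \<open>The square-zero extension formed by regular endomorphisms\<close>

abbreviation "RX \<equiv> regular_ext R M E D"

lemma RX_simps: "sq_ring RX = RR"
  "sq_i RX m = nat_restrict R (C01 D) (\<lambda>V x. c1 V (b V (tens R M V m (a V (c0 V x)))))"
  by (simp_all add: regular_ext_def nat_restrict_def)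

lemma RX_q: "reg \<eta> r \<Longrightarrow> sq_q RX \<eta> = r"
  unfolding regular_ext_def using reg_scalar_unique by (auto simp: reg_def intro!: the_equality)

lemma c1bt_closed:
  assumes "V\<in>Proj" "x\<in>carrier (Z V)" "m\<in>carrier M"
  shows "tens R M V m (a V (c0 V x))\<in>pts I V" "b V (tens R M V m (a V (c0 V x)))\<in>carrier (E1 V)"
    "c1 V (b V (tens R M V m (a V (c0 V x))))\<in>carrier (Z V)"
  using assms by (auto intro!: c1_closed b_closed tens_in_I a_closed c0_closed)

lemma i_apply: "\<lbrakk>V\<in>Proj; x\<in>carrier (Z V)\<rbrakk> \<Longrightarrow> sq_i RX m V x = c1 V (b V (tens R M V m (a V (c0 V x))))"
  by (simp add: RX_simps)

text \<open>The endomorphism factors through \<open>a c0\<close> and has values in the image of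
  \<open>c1 b\<close>. Since \<open>c0 c1 b = d b = 0\<close> and \<open>a c0 c1 = a d = 0\<close>,
  both conditions hold with scalar zero.\<close>

lemma reg_i:
  assumes m: "m\<in>carrier M" shows "reg (sq_i RX m) \<zero>[R]"
  unfolding RX_simps
proof (rule regI[OF nat_hom_intI[OF Z_pointed Z_pointed]])
  fix V x assume V: "V\<in>Proj" and x: "x\<in>carrier (Z V)"
  interpret T: tensor_product R R M V by (rule tensor_M[OF V])
  interpret ac0: add_hom "Z V" V "\<lambda>z. a V (c0 V z)" by (rule ac0_hom[OF V])
  interpret c1b: add_hom "fobj I V" "Z V" "\<lambda>t. c1 V (b V t)" by (rule c1b_hom[OF V])
  note tI = c1bt_closed[OF V _ m]
  show "c1 V (b V (tens R M V m (a V (c0 V x))))\<in>carrier (Z V)" by (rule tI(3)[OF x])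
  show "c0 V (nat_restrict R (C01 D) (\<lambda>V x. c1 V (b V (tens R M V m (a V (c0 V x))))) V x) = \<zero>[R] \<odot>[E0 V] c0 V x"
    using V x by (simp add: c0_c1 tI d_b lm_zero_smult[OF functor_obj[OF C0_pointed V]] c0_closed)
  { fix y assume y: "y\<in>carrier (Z V)"
    have "tens R M V m (a V (c0 V (x \<oplus>[Z V] y))) = tens R M V m (a V (c0 V x)) \<oplus>[fobj I V] tens R M V m (a V (c0 V y))"
      using ac0.hom_add[OF x y] T.tens_add_right[OF m ac0.hom_closed[OF x] ac0.hom_closed[OF y]] by (simp add: I_obj)
    then show "c1 V (b V (tens R M V m (a V (c0 V (x \<oplus>[Z V] y))))) =
        c1 V (b V (tens R M V m (a V (c0 V x)))) \<oplus>[Z V] c1 V (b V (tens R M V m (a V (c0 V y))))"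
      using c1b.hom_add[OF tI(1)[OF x] tI(1)[OF y]] by simp }
  { fix W f assume W: "W\<in>Proj" and f: "f\<in>lin_hom R V W"
    show "c1 W (b W (tens R M W m (a W (c0 W (fmap (C01 D) V W f x))))) =
        fmap (C01 D) V W f (c1 V (b V (tens R M V m (a V (c0 V x)))))"
      using x by (simp add: c0_natural[OF V W f] a_natural[OF V W f] c0_closed[OF V] tI c1_natural[OF V W f, symmetric]
        nat_hom_natural[OF b_nat V W f, symmetric] I_map_tens[OF V W f m ac0.hom_closed]) }
next
  fix V y assume V: "V\<in>Proj" and y: "y\<in>carrier (E1 V)"
  interpret T: tensor_product R R M V by (rule tensor_M[OF V])
  have "c1 V (b V (tens R M V m (a V (c0 V (c1 V y))))) = \<zero>[Z V]"
    using add_hom.hom_zero[OF c1b_hom[OF V]] y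
    by (simp add: c0_c1[OF V] a_d[OF V] T.tens_zero_right[OF m] I_obj)
  then show "nat_restrict R (C01 D) (\<lambda>V x. c1 V (b V (tens R M V m (a V (c0 V x))))) V (c1 V y) = c1 V (\<zero>[R] \<odot>[E1 V] y)"
    using V y by (simp add: c1_closed lm_zero_smult[OF functor_obj[OF C1_pointed V]] add_hom.hom_zero[OF c1_hom[OF V]])
qed simp

lemma i_\<sigma>: "sq_i RX m F1 \<sigma> = c1 F1 (b F1 (tens R M F1 m gen1))"
  by (simp add: i_apply FM_fgp \<sigma>)

lemma RX_sq_ext: "is_sq_ext R M RX"
  unfolding is_sq_ext_def RX_simps(1)
proof (intro conjI ballI)
  show "ring RR" by (rule RR_ring)
  show "sq_i RX\<in>hom (add_monoid M) (add_monoid RR)"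
  proof (rule homI)
    fix m assume "m\<in>carrier (add_monoid M)"
    then show "sq_i RX m\<in>carrier (add_monoid RR)" using reg_i by (auto simp: RR_carrier)
    fix n assume n: "n\<in>carrier (add_monoid M)"
    have mn: "m\<in>carrier M" "n\<in>carrier M" "m \<oplus>[M] n\<in>carrier M" using \<open>m\<in>_\<close> n by auto
    have "sq_i RX (m \<oplus>[M] n) = sq_i RX m \<oplus>[RR] sq_i RX n"
    proof (rule reg_ext[OF reg_i[OF mn(3)] reg_add[OF reg_i[OF mn(1)] reg_i[OF mn(2)]]])
      fix V x assume V: "V\<in>Proj" and x: "x\<in>carrier (Z V)"
      interpret T: tensor_product R R M V by (rule tensor_M[OF V])
      show "sq_i RX (m \<oplus>[M] n) V x = (sq_i RX m \<oplus>[RR] sq_i RX n) V x"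
        using V x add_hom.hom_add[OF c1b_hom[OF V] c1bt_closed(1)[OF V x mn(1)] c1bt_closed(1)[OF V x mn(2)]]
          T.tens_add_left[OF mn(1,2) a_closed[OF V c0_closed[OF V x]]]
        by (simp add: RR_ops i_apply I_obj)
    qed
    then show "sq_i RX (m \<otimes>[add_monoid M] n) = sq_i RX m \<otimes>[add_monoid RR] sq_i RX n" by simp
  qed
  show "sq_q RX\<in>ring_hom RR R"
  proof (rule ring_hom_memI)
    fix \<eta> \<theta> assume "\<eta>\<in>carrier RR" "\<theta>\<in>carrier RR"
    then obtain r s where r: "reg \<eta> r" and s: "reg \<theta> s" by (auto simp: RR_carrier)
    show "sq_q RX (\<eta> \<otimes>[RR] \<theta>) = sq_q RX \<eta> \<otimes>[R] sq_q RX \<theta>"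
      unfolding RX_q[OF r] RX_q[OF s] by (rule RX_q[OF reg_mult[OF r s]])
    show "sq_q RX (\<eta> \<oplus>[RR] \<theta>) = sq_q RX \<eta> \<oplus>[R] sq_q RX \<theta>"
      unfolding RX_q[OF r] RX_q[OF s] by (rule RX_q[OF reg_add[OF r s]])
  qed (auto simp: RR_carrier RX_q regD(2) RX_q[OF reg_one])
  show "inj_on (sq_i RX) (carrier M)"
  proof (rule inj_onI)
    fix m n assume mn: "m\<in>carrier M" "n\<in>carrier M" "sq_i RX m = sq_i RX n"
    have t: "tens R M F1 k gen1\<in>pts I F1" if "k\<in>carrier M" for k
      using tens_in_I[OF FM_fgp that gen_closed] .
    note F = FM_fgp[of "Suc 0"]
    have "c1 F1 (b F1 (tens R M F1 m gen1)) =
        c1 F1 (b F1 (tens R M F1 n gen1))"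
      using i_\<sigma>[of m] i_\<sigma>[of n] mn(3) by simp
    then have "tens R M F1 m gen1 = tens R M F1 n gen1"
      using t[OF mn(1)] t[OF mn(2)] by (intro b_inj[OF F] c1_inj[OF F] b_closed[OF F])
    then show "m = n" by (rule tens_gen1_inj[OF mn(1,2)])
  qed
  show "sq_q RX ` carrier RR = carrier R"
  proof (rule antisym; rule subsetI)
    fix r assume r: "r\<in>carrier R"
    \<comment> \<open>Surjectivity of the map to \<open>R\<close>: a lift of
      \<open>r c0(\<sigma>)\<close> exists because \<open>c0\<close> is onto, and
      \<open>reg_exists\<close> extends it to an endomorphism.\<close>
    have "r \<odot>[E0 F1] c0 F1 \<sigma>\<in>c0 F1 ` carrier (Z F1)"
      unfolding c0_image[OF FM_fgp] by (intro smult0 r c0_closed FM_fgp \<sigma>(1))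
    then obtain \<rho> where "\<rho>\<in>carrier (Z F1)" "c0 F1 \<rho> = r \<odot>[E0 F1] c0 F1 \<sigma>" by auto
    then obtain \<eta> where "reg \<eta> r" using reg_exists[OF r] by metis
    then have "\<eta>\<in>carrier RR" "r = sq_q RX \<eta>" by (auto simp: RR_carrier RX_q)
    then show "r\<in>sq_q RX ` carrier RR" using imageI[of \<eta> "carrier RR" "sq_q RX"] by simp
  qed (auto simp: RR_carrier RX_q regD(2))
  show "sq_i RX ` carrier M = a_kernel RR R (sq_q RX)"
  proof (rule antisym; rule subsetI)
    fix \<eta> assume "\<eta>\<in>sq_i RX ` carrier M"
    then show "\<eta>\<in>a_kernel RR R (sq_q RX)" using reg_i by (auto simp: in_a_kernel RR_carrier RX_q)
  next
    fix \<eta> assume "\<eta>\<in>a_kernel RR R (sq_q RX)"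
    then have \<eta>: "reg \<eta> \<zero>[R]" by (auto simp: in_a_kernel RR_carrier RX_q)
    note F = FM_fgp[of "Suc 0"]
    \<comment> \<open>An endomorphism with scalar zero sends \<open>\<sigma>\<close> into the kernel
      of \<open>c0\<close>, which at rank one consists of the elements
      \<open>c1 (b (m \<otimes> gen1))\<close>. Agreement at \<open>\<sigma>\<close> then identifies
      it with the one given by \<open>m\<close>.\<close>
    have "c0 F1 (\<eta> F1 \<sigma>) = \<zero>[E0 F1]"
      using regD(3)[OF \<eta> F \<sigma>(1)] lm_zero_smult[OF functor_obj[OF C0_pointed F] c0_closed[OF F \<sigma>(1)]] by simp
    then obtain t where t: "t\<in>pts I F1" "\<eta> F1 \<sigma> = c1 F1 (b F1 t)"
      using c0_kernel[OF F reg_closed[OF \<eta> F \<sigma>(1)]] by auto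
    obtain m where m: "m\<in>carrier M" "t = tens R M F1 m gen1" using tens_gen1_surj[OF t(1)] by auto
    have "\<eta> = sq_i RX m" by (rule reg_eqI[OF \<eta> reg_i[OF m(1)]]) (simp add: t(2) m(2) i_\<sigma>)
    then show "\<eta>\<in>sq_i RX ` carrier M" using m(1) by simp
  qed
next
  fix m \<eta> assume m: "m\<in>carrier M" and "\<eta>\<in>carrier RR"
  then obtain r where \<eta>: "reg \<eta> r" by (auto simp: RR_carrier)
  note r = regD(2)[OF \<eta>]
  have mr: "ract M m r\<in>carrier M" "r \<odot>[M] m\<in>carrier M" using m r by (auto intro: M.ract_closed M.smult_closed)
  have z: "reg (sq_i RX m \<otimes>[RR] \<eta>) \<zero>[R]" "reg (\<eta> \<otimes>[RR] sq_i RX m) \<zero>[R]"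
    using reg_mult[OF reg_i[OF m] \<eta>] reg_mult[OF \<eta> reg_i[OF m]] r by simp_all
  show "sq_i RX m \<otimes>[RR] \<eta> = sq_i RX (ract M m (sq_q RX \<eta>))"
    unfolding RX_q[OF \<eta>]
  proof (rule reg_ext[OF z(1) reg_i[OF mr(1)]])
    fix V x assume V: "V\<in>Proj" and x: "x\<in>carrier (Z V)"
    interpret T: tensor_product R R M V by (rule tensor_M[OF V])
    show "(sq_i RX m \<otimes>[RR] \<eta>) V x = sq_i RX (ract M m r) V x"
      using V x m r by (simp add: RR_ops i_apply reg_closed[OF \<eta>] reg_ac0[OF \<eta>] T.tens_ract a_closed c0_closed)
  qed
  show "\<eta> \<otimes>[RR] sq_i RX m = sq_i RX (sq_q RX \<eta> \<odot>[M] m)"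
    unfolding RX_q[OF \<eta>]
  proof (rule reg_ext[OF z(2) reg_i[OF mr(2)]])
    fix V x assume V: "V\<in>Proj" and x: "x\<in>carrier (Z V)"
    interpret T: tensor_product R R M V by (rule tensor_M[OF V])
    have "b V (tens R M V (r \<odot>[M] m) (a V (c0 V x))) = r \<odot>[E1 V] b V (tens R M V m (a V (c0 V x)))"
      using lin_homD(4)[OF nat_hom_lin[OF b_nat V] r c1bt_closed(1)[OF V x m]]
        T.tensor_smult_tens[OF r m a_closed[OF V c0_closed[OF V x]]] by (simp add: I_obj)
    then show "(\<eta> \<otimes>[RR] sq_i RX m) V x = sq_i RX (r \<odot>[M] m) V x"
      using V x m r by (simp add: RR_ops i_apply regD(4)[OF \<eta>] c1bt_closed)
  qed
next
  fix m n assume m: "m\<in>carrier M" and n: "n\<in>carrier M"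
  show "sq_i RX m \<otimes>[RR] sq_i RX n = \<zero>[RR]"
  proof (rule reg_ext[OF reg_mult[OF reg_i[OF m] reg_i[OF n]] reg_zero])
    fix V x assume V: "V\<in>Proj" and x: "x\<in>carrier (Z V)"
    interpret T: tensor_product R R M V by (rule tensor_M[OF V])
    show "(sq_i RX m \<otimes>[RR] sq_i RX n) V x = \<zero>[RR] V x"
      using V x add_hom.hom_zero[OF c1b_hom[OF V]]
      by (simp add: RR_ops i_apply c1bt_closed n c0_c1 a_d T.tens_zero_right m I_obj)
  qed
qed

end

subsection \<open>Morphisms of square-zero extensions\<close>

text \<open>The five lemma for the two extensions of \<open>R\<close> by \<open>M\<close>.\<close>

lemma square_zero_morphism_iso:
  fixes R :: "'r ring" and M :: "('r, 'r, 'm) bimodule"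
  assumes X: "is_sq_ext R M X" and Y: "is_sq_ext R M Y" and M: "abelian_group M" and R: "ring R"
    and \<phi>: "\<phi>\<in>ring_hom (sq_ring X) (sq_ring Y)"
    and i: "\<And>m. m\<in>carrier M \<Longrightarrow> \<phi> (sq_i X m) = sq_i Y m"
    and q: "\<And>x. x\<in>carrier (sq_ring X) \<Longrightarrow> sq_q Y (\<phi> x) = sq_q X x"
  shows "sq_iso M X Y"
proof -
  interpret SX: ring "sq_ring X" using X by (simp add: is_sq_ext_def)
  interpret SY: ring "sq_ring Y" using Y by (simp add: is_sq_ext_def)
  interpret R: ring R by (rule R)
  interpret M: abelian_group M by (rule M)
  interpret \<phi>: add_hom "sq_ring X" "sq_ring Y" \<phi>
    by (rule add_homI) (use SX.is_abelian_group SY.is_abelian_group ring_hom_memE[OF \<phi>] in auto)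
  have "add_hom M (sq_ring Z) (sq_i Z)" "add_hom (sq_ring Z) R (sq_q Z)" if "is_sq_ext R M Z" for Z :: "('r, 'm, 'z) sq_ext"
    using that ring_hom_memE[of "sq_q Z" "sq_ring Z" R] R.is_abelian_group M ring.is_abelian_group[of "sq_ring Z"]
    by (auto intro!: add_homI simp: is_sq_ext_def hom_def)
  note hom = this
  interpret iX: add_hom M "sq_ring X" "sq_i X" by (rule hom(1)[OF X])
  interpret iY: add_hom M "sq_ring Y" "sq_i Y" by (rule hom(1)[OF Y])
  interpret qX: add_hom "sq_ring X" R "sq_q X" by (rule hom(2)[OF X])
  interpret qY: add_hom "sq_ring Y" R "sq_q Y" by (rule hom(2)[OF Y])
  have inj: "inj_on \<phi> (carrier (sq_ring X))"
    unfolding \<phi>.inj_on_iff_kernel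
  proof (intro ballI impI)
    fix x assume x: "x\<in>carrier (sq_ring X)" and z: "\<phi> x = \<zero>[sq_ring Y]"
    have "sq_q X x = \<zero>[R]" using q[OF x] z by simp
    then have "x\<in>sq_i X ` carrier M" using X x by (simp add: is_sq_ext_def in_a_kernel)
    then obtain m where m: "m\<in>carrier M" "x = sq_i X m" by blast
    then have "sq_i Y m = \<zero>[sq_ring Y]" using i z by simp
    moreover have "inj_on (sq_i Y) (carrier M)" using Y by (simp add: is_sq_ext_def)
    ultimately have "m = \<zero>[M]" using m by (simp add: iY.inj_on_iff_kernel)
    then show "x = \<zero>[sq_ring X]" using m by simp
  qed
  have surj: "\<phi> ` carrier (sq_ring X) = carrier (sq_ring Y)"
  proof (rule antisym; rule subsetI)
    fix y assume y: "y\<in>carrier (sq_ring Y)"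
    have "sq_q Y y\<in>sq_q X ` carrier (sq_ring X)" using X qY.hom_closed[OF y] by (simp add: is_sq_ext_def)
    then obtain x where x: "x\<in>carrier (sq_ring X)" "sq_q Y y = sq_q X x" by auto
    then have "y \<ominus>[sq_ring Y] \<phi> x\<in>sq_i Y ` carrier M"
      using Y y by (simp add: is_sq_ext_def in_a_kernel qY.hom_minus q R.minus_eq R.r_neg)
    then obtain m where m: "m\<in>carrier M" "y \<ominus>[sq_ring Y] \<phi> x = sq_i Y m" by auto
    have "\<phi> (x \<oplus>[sq_ring X] sq_i X m) = y"
      using x y m(1) by (simp add: i SY.group_simps flip: m(2))
    then show "y\<in>\<phi> ` carrier (sq_ring X)" using x m by (metis SX.add.m_closed iX.hom_closed imageI)
  qed auto
  show ?thesis
    unfolding sq_iso_def ring_iso_def using \<phi> inj surj i q by (auto simp: bij_betw_def)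
qed

section \<open>Isomorphism of square-zero extensions is an equivalence relation\<close>

lemma sq_iso_trans:
  assumes "is_sq_ext R M X" "sq_iso M X Y" "sq_iso M Y Z"
  shows "sq_iso M X Z"
proof -
  obtain \<phi> where \<phi>: "\<phi>\<in>ring_iso (sq_ring X) (sq_ring Y)" "\<forall>m\<in>carrier M. \<phi> (sq_i X m) = sq_i Y m"
    "\<forall>x\<in>carrier (sq_ring X). sq_q Y (\<phi> x) = sq_q X x" using assms(2) by (auto simp: sq_iso_def)
  obtain \<psi> where \<psi>: "\<psi>\<in>ring_iso (sq_ring Y) (sq_ring Z)" "\<forall>m\<in>carrier M. \<psi> (sq_i Y m) = sq_i Z m"
    "\<forall>x\<in>carrier (sq_ring Y). sq_q Z (\<psi> x) = sq_q Y x" using assms(3) by (auto simp: sq_iso_def)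
  have "\<psi> \<circ> \<phi>\<in>ring_iso (sq_ring X) (sq_ring Z)" using \<phi>(1) \<psi>(1) by (rule ring_iso_set_trans)
  moreover have "\<phi> x\<in>carrier (sq_ring Y)" if "x\<in>carrier (sq_ring X)" for x
    using ring_iso_memE(1)[OF \<phi>(1)] that by blast
  ultimately show ?thesis unfolding sq_iso_def using \<phi>(2,3) \<psi>(2,3) by (auto intro!: bexI[of _ "\<psi> \<circ> \<phi>"])
qed

lemma sq_iso_sym:
  assumes X: "is_sq_ext R M X" and "sq_iso M X Y"
  shows "sq_iso M Y X"
proof -
  obtain \<phi> where \<phi>: "\<phi>\<in>ring_iso (sq_ring X) (sq_ring Y)" "\<forall>m\<in>carrier M. \<phi> (sq_i X m) = sq_i Y m"
    "\<forall>x\<in>carrier (sq_ring X). sq_q Y (\<phi> x) = sq_q X x" using assms(2) by (auto simp: sq_iso_def)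
  let ?\<psi> = "inv_into (carrier (sq_ring X)) \<phi>"
  have b: "bij_betw \<phi> (carrier (sq_ring X)) (carrier (sq_ring Y))" using \<phi>(1) by (simp add: ring_iso_def)
  have "?\<psi>\<in>ring_iso (sq_ring Y) (sq_ring X)"
    using X \<phi>(1) by (intro ring_iso_set_sym) (auto simp: is_sq_ext_def)
  moreover have "?\<psi> (sq_i Y m) = sq_i X m" if "m\<in>carrier M" for m
  proof -
    have "sq_i X m\<in>carrier (sq_ring X)" using X that by (auto simp: is_sq_ext_def hom_def)
    then show ?thesis using \<phi>(2) that bij_betw_inv_into_left[OF b] by metis
  qed
  moreover have "sq_q X (?\<psi> y) = sq_q Y y" if "y\<in>carrier (sq_ring Y)" for y
    using \<phi>(3) that bij_betw_inv_into_right[OF b] bij_betw_apply[OF bij_betw_inv_into[OF b]] by metis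
  ultimately show ?thesis unfolding sq_iso_def by blast
qed

lemma sq_iso_refl: "sq_iso M X X"
  unfolding sq_iso_def by (rule bexI[OF _ ring_iso_set_refl]) auto

subsection \<open>Invariance of the ring of regular endomorphisms\<close>

context elementary begin

lemma exists_generator_lift:
  assumes "splits E D"
  shows "\<exists>\<sigma>. split_elementary R M E D \<sigma>"
proof -
  note F = FM_fgp[of "Suc 0"]
  obtain s where s: "s\<in>carrier (E0 F1)" "a F1 s = gen1"
    using gen_closed[of "Suc 0" 0] unfolding a_image[OF F, symmetric] by auto
  have "sc0 D F1 ` pts (C01 D) F1 = carrier (E0 F1)"
    using assms F by (auto simp: is_splitting_def)
  then have "s\<in>sc0 D F1 ` pts (C01 D) F1" using s(1) by simp
  then obtain \<sigma> where "\<sigma>\<in>pts (C01 D) F1" "sc0 D F1 \<sigma> = s" by auto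
  then show ?thesis
    using assms s(2) by (intro exI[of _ \<sigma>] split_elementary.intro split_elementary_axioms.intro elementary_axioms) auto
qed

end

context bimodule_universe begin

lemma elementaryI:
  fixes E :: "('r, 'u, 'r, 'u, ('m, 'u) tens, 'x, 'y) el_ext"
  shows "el_ext_of R M E \<Longrightarrow> elementary R M E"
  by (intro elementary.intro elementary_axioms.intro bimodule_universe_axioms)

text \<open>The two splittings may differ even if \<open>E\<close> and \<open>E'\<close> agree and
  the morphism is the identity; this case gives independence of the choice of a splitting.\<close>

theorem regular_ext_iso:
  fixes E :: "('r, 'u, 'r, 'u, ('m, 'u) tens, 'x, 'y) el_ext"
    and E' :: "('r, 'u, 'r, 'u, ('m, 'u) tens, 'x2, 'y2) el_ext"
  assumes E: "el_ext_of R M E" and E': "el_ext_of R M E'" and mor: "el_mor R R I E E' f0 f1"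
    and D: "splits E D"
    and D': "splits E' D'"
  shows "sq_iso M (regular_ext R M E D) (regular_ext R M E' D')"
proof -
  let ?F = "F1"
  note F = FM_fgp[of "Suc 0"]
  have el: "elementary R M E" "elementary R M E'"
    using E E' by (auto intro: elementaryI)
  obtain \<sigma> where "split_elementary R M E D \<sigma>" using elementary.exists_generator_lift[OF el(1) D] by blast
  then interpret A: split_elementary R u M E D \<sigma> .
  interpret E': elementary R u M E' by (rule el(2))
  have f: "f0\<in>nat_hom R R (C0 E) (C0 E')" "f1\<in>nat_hom R R (C1 E) (C1 E')"
    and fd: "\<And>V y. \<lbrakk>V\<in>Proj; y\<in>carrier (A.E1 V)\<rbrakk> \<Longrightarrow> f0 V (A.d V y) = E'.d V (f1 V y)"
    and fa: "\<And>V x. \<lbrakk>V\<in>Proj; x\<in>carrier (A.E0 V)\<rbrakk> \<Longrightarrow> E'.a V (f0 V x) = A.a V x"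
    and fb: "\<And>V t. \<lbrakk>V\<in>Proj; t\<in>pts I V\<rbrakk> \<Longrightarrow> f1 V (A.b V t) = E'.b V t"
    using mor by (auto simp: el_mor_def)
  have "f0 ?F (A.c0 ?F \<sigma>)\<in>carrier (E'.E0 ?F)"
    by (rule lin_homD(1)[OF nat_hom_lin[OF f(1) F] A.c0_closed[OF F A.\<sigma>(1)]])
  moreover have "sc0 D' ?F ` pts (C01 D') ?F = carrier (E'.E0 ?F)"
    using D' F by (auto simp: is_splitting_def)
  ultimately have "f0 ?F (A.c0 ?F \<sigma>)\<in>sc0 D' ?F ` pts (C01 D') ?F" by simp
  then obtain h where h: "h\<in>pts (C01 D') ?F" "sc0 D' ?F h = f0 ?F (A.c0 ?F \<sigma>)" by auto
  \<comment> \<open>Since \<open>f0\<close> commutes with \<open>a\<close>, the element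
    \<open>h\<close> is also a lift of the generator in the second splitting. With it
    \<open>Ext\<close> takes one section to the other.\<close>
  interpret B: split_elementary R u M E' D' h
    using h D' fa[OF F A.c0_closed[OF F A.\<sigma>(1)]] A.\<sigma>(2)
    by (intro split_elementary.intro split_elementary_axioms.intro el(2)) auto
  interpret P: split_pair R u M E D \<sigma> E' D' h f0 f1 h
    using h fd f by (intro split_pair.intro split_pair_axioms.intro A.split_elementary_axioms B.split_elementary_axioms
      nat_hom_forget[OF ring]) auto
  have Ext_closed: "P.Ext V x\<in>carrier (B.Z V)" if "V\<in>Proj" "x\<in>carrier (A.Z V)" for V x
    using lin_homD(1)[OF nat_hom_lin[OF P.Ext_nat that(1)] that(2)] .
  \<comment> \<open>A regular endomorphism is determined by its scalar and its value at the lifted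
    generator. So \<open>rel\<close> is the graph of a map, which keeps the scalar and transports
    the value along \<open>Ext\<close>.\<close>
  define rel where "rel \<eta> \<kappa> \<longleftrightarrow> (\<exists>r. A.reg \<eta> r \<and> B.reg \<kappa> r \<and> \<kappa> ?F h = P.Ext ?F (\<eta> ?F \<sigma>))" for \<eta> \<kappa>
  have ex: "\<exists>\<kappa>. rel \<eta> \<kappa>" if reg\<eta>: "A.reg \<eta> r" for \<eta> r
  proof -
    let ?\<rho> = "P.Ext ?F (\<eta> ?F \<sigma>)"
    have c: "?\<rho>\<in>carrier (B.Z ?F)" by (rule Ext_closed[OF F A.reg_closed[OF reg\<eta> F A.\<sigma>(1)]])
    have "B.c0 ?F ?\<rho> = r \<odot>[E'.E0 ?F] B.c0 ?F h"
      using P.c0_Ext[OF F A.reg_closed[OF reg\<eta> F A.\<sigma>(1)]] A.regD(3)[OF reg\<eta> F A.\<sigma>(1)]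
        lin_homD(4)[OF nat_hom_lin[OF f(1) F] A.regD(2)[OF reg\<eta>] A.c0_closed[OF F A.\<sigma>(1)]] h(2) by simp
    then obtain \<kappa> where "B.reg \<kappa> r" "\<kappa> ?F h = ?\<rho>" using B.reg_exists[OF A.regD(2)[OF reg\<eta>] c] by metis
    then show ?thesis using reg\<eta> rel_def by blast
  qed
  define \<phi> where "\<phi> \<eta> = (SOME \<kappa>. rel \<eta> \<kappa>)" for \<eta>
  have \<phi>: "\<phi> \<eta> = \<kappa>" if "rel \<eta> \<kappa>" for \<eta> \<kappa>
  proof -
    have "rel \<eta> (\<phi> \<eta>)" unfolding \<phi>_def by (rule someI[where P = "rel \<eta>", OF that])
    then show ?thesis using that A.reg_scalar_unique B.reg_eqI by (metis rel_def)
  qed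
  have \<phi>rel: "rel \<eta> (\<phi> \<eta>)" if "A.reg \<eta> r" for \<eta> r using ex[OF that] \<phi> by blast
  have reg: "B.reg (\<phi> \<eta>) r" "\<phi> \<eta> ?F h = P.Ext ?F (\<eta> ?F \<sigma>)" if "A.reg \<eta> r" for \<eta> r
    using \<phi>rel[OF that] that A.reg_scalar_unique by (metis rel_def)+
  \<comment> \<open>Both composites agree on the image of \<open>c1\<close> and at
    \<open>\<sigma>\<close>. From this multiplicativity follows: \<open>\<phi> \<eta>\<close> can be
    moved past \<open>Ext\<close> when applied to the value of \<open>\<phi> \<theta>\<close> at
    \<open>h\<close>.\<close>
  have inter: "\<phi> \<eta> V (P.Ext V x) = P.Ext V (\<eta> V x)"
    if \<eta>: "A.reg \<eta> r" and V: "V\<in>Proj" and x: "x\<in>carrier (A.Z V)" for \<eta> r V x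
  proof -
    let ?l = "nat_restrict R (C01 D) (\<lambda>V x. \<phi> \<eta> V (P.Ext V x))" and ?r = "nat_restrict R (C01 D) (\<lambda>V x. P.Ext V (\<eta> V x))"
    have "?l = ?r"
    proof (rule A.Z_nat_hom_eqI[OF B.Z_pointed nat_hom_compose[OF P.Ext_nat B.regD(1)[OF reg(1)[OF \<eta>]] A.Z_pointed]
        nat_hom_compose[OF A.regD(1)[OF \<eta>] P.Ext_nat A.Z_pointed]])
      show "?l ?F \<sigma> = ?r ?F \<sigma>" using reg(2)[OF \<eta>] P.Ext_\<sigma> F A.\<sigma>(1) by simp
      fix W y assume W: "W\<in>Proj" and y: "y\<in>carrier (A.E1 W)"
      have "\<phi> \<eta> W (P.Ext W (A.c1 W y)) = P.Ext W (\<eta> W (A.c1 W y))"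
        using lin_homD(1)[OF nat_hom_lin[OF f(2) W] y]
        unfolding P.Ext_c1[OF W y] A.regD(4)[OF \<eta> W y] P.Ext_c1[OF W A.smult1[OF W A.regD(2)[OF \<eta>] y]]
        by (simp add: B.regD(4)[OF reg(1)[OF \<eta>] W] lin_homD(4)[OF nat_hom_lin[OF f(2) W] A.regD(2)[OF \<eta>] y])
      then show "?l W (A.c1 W y) = ?r W (A.c1 W y)" using W A.c1_closed[OF W y] by simp
    qed
    then have "?l V x = ?r V x" by simp
    then show ?thesis using V x by (simp del: nat_restrict_apply add: nat_restrict_apply[of V R x "C01 D" "\<lambda>V x. \<phi> \<eta> V (P.Ext V x)"]
        nat_restrict_apply[of V R x "C01 D" "\<lambda>V x. P.Ext V (\<eta> V x)"])
  qed
  show ?thesis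
  proof (rule square_zero_morphism_iso[OF A.RX_sq_ext B.RX_sq_ext M.M.abelian_group_axioms ring])
    show "\<phi>\<in>ring_hom (sq_ring A.RX) (sq_ring B.RX)"
      unfolding A.RX_simps(1) B.RX_simps(1)
    proof (rule ring_hom_memI)
      fix \<eta> \<theta> assume "\<eta>\<in>carrier A.RR" "\<theta>\<in>carrier A.RR"
      then obtain r s where r: "A.reg \<eta> r" and s: "A.reg \<theta> s" by (auto simp: A.RR_carrier)
      show "\<phi> \<eta>\<in>carrier B.RR" using reg(1)[OF r] by (auto simp: B.RR_carrier)
      note m = A.reg_closed[OF r F A.\<sigma>(1)] A.reg_closed[OF s F A.\<sigma>(1)]
      have "(\<phi> \<eta> \<otimes>[B.RR] \<phi> \<theta>) ?F h = P.Ext ?F ((\<eta> \<otimes>[A.RR] \<theta>) ?F \<sigma>)"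
        using F A.\<sigma>(1) h(1) by (simp add: A.RR_ops B.RR_ops reg(2)[OF s] inter[OF r F m(2)] del: nat_restrict_apply)
          (simp add: reg(2)[OF s] inter[OF r F m(2), simplified])
      then show "\<phi> (\<eta> \<otimes>[A.RR] \<theta>) = \<phi> \<eta> \<otimes>[B.RR] \<phi> \<theta>"
        using A.reg_mult[OF r s] B.reg_mult[OF reg(1)[OF r] reg(1)[OF s]] by (intro \<phi>) (auto simp: rel_def)
      have "(\<phi> \<eta> \<oplus>[B.RR] \<phi> \<theta>) ?F h = P.Ext ?F ((\<eta> \<oplus>[A.RR] \<theta>) ?F \<sigma>)"
        using F A.\<sigma>(1) h(1) lin_homD(3)[OF nat_hom_lin[OF P.Ext_nat F] m]
        by (simp add: A.RR_ops B.RR_ops reg(2)[OF s] reg(2)[OF r])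
      then show "\<phi> (\<eta> \<oplus>[A.RR] \<theta>) = \<phi> \<eta> \<oplus>[B.RR] \<phi> \<theta>"
        using A.reg_add[OF r s] B.reg_add[OF reg(1)[OF r] reg(1)[OF s]] by (intro \<phi>) (auto simp: rel_def)
    next
      have "\<one>[B.RR] ?F h = P.Ext ?F (\<one>[A.RR] ?F \<sigma>)"
        using F A.\<sigma>(1) h(1) P.Ext_\<sigma> by (simp add: A.RR_ops B.RR_ops)
      then show "\<phi> \<one>[A.RR] = \<one>[B.RR]"
        using A.reg_one B.reg_one by (intro \<phi>) (auto simp: rel_def)
    qed
    show "\<phi> (sq_i A.RX m) = sq_i B.RX m" if m: "m\<in>carrier M" for m
    proof (rule \<phi>)
      have t: "tens R M ?F m gen1\<in>pts I ?F" by (rule A.tens_in_I[OF F m gen_closed])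
      have "sq_i B.RX m ?F h = P.Ext ?F (sq_i A.RX m ?F \<sigma>)"
        unfolding A.i_\<sigma> B.i_\<sigma> P.Ext_c1[OF F A.b_closed[OF F t]] fb[OF F t] ..
      then show "rel (sq_i A.RX m) (sq_i B.RX m)" using A.reg_i[OF m] B.reg_i[OF m] by (auto simp: rel_def)
    qed
    show "sq_q B.RX (\<phi> \<eta>) = sq_q A.RX \<eta>" if "\<eta>\<in>carrier (sq_ring A.RX)" for \<eta>
      using that reg(1) by (auto simp: A.RX_simps A.RR_carrier A.RX_q B.RX_q)
  qed
qed

end

subsection \<open>Existence of a splitting\<close>

lemma int_module:
  fixes G :: "'a ring"
  assumes "abelian_group G"
  shows "left_module \<Z> \<lparr>carrier = carrier G, monoid.mult = undefined, monoid.one = undefined,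
    ring.zero = \<zero>[G], ring.add = (\<lambda>x y. x \<oplus>[G] y), smult = (\<lambda>n x. [n] \<cdot>\<^bsub>G\<^esub> x)\<rparr>" (is "left_module \<Z> ?H")
proof (rule left_moduleI[OF int.ring_axioms])
  interpret G: abelian_group G by fact
  show "abelian_group ?H" by (rule abelian_group_cong[OF assms]) simp_all
  show "(r \<oplus>[\<Z>] s) \<odot>[?H] x = r \<odot>[?H] x \<oplus>[?H] s \<odot>[?H] x" if "x\<in>carrier ?H" for r s x
    using that by (simp add: G.add.int_pow_mult)
  show "(r \<otimes>[\<Z>] s) \<odot>[?H] x = r \<odot>[?H] (s \<odot>[?H] x)" if "x\<in>carrier ?H" for r s x
    using that G.add.int_pow_pow[of x r s] by (simp add: mult.commute)
  show "r \<odot>[?H] (x \<oplus>[?H] y) = r \<odot>[?H] x \<oplus>[?H] r \<odot>[?H] y" if "x\<in>carrier ?H" "y\<in>carrier ?H" for r x y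
    using that by (simp add: G.add.int_pow_distrib)
  show "r \<odot>[?H] x\<in>carrier ?H" if "x\<in>carrier ?H" for r x using that by (simp add: G.add.int_pow_closed)
  show "\<one>[\<Z>] \<odot>[?H] x = x" if "x\<in>carrier ?H" for x using that by (simp add: G.add.int_pow_1)
qed

context elementary begin

text \<open>If \<open>d\<close> identifies \<open>p\<close> and \<open>q\<close>, their difference
  comes from \<open>I\<close> through \<open>b\<close>, and rigidity applies.\<close>

lemma C1_rigid:
  assumes p: "\<And>V w. \<lbrakk>V\<in>Proj; set w \<subseteq> carrier V; length w = Suc n\<rbrakk> \<Longrightarrow> p V w\<in>carrier (E1 V)"
    and q: "\<And>V w. \<lbrakk>V\<in>Proj; set w \<subseteq> carrier V; length w = Suc n\<rbrakk> \<Longrightarrow> q V w\<in>carrier (E1 V)"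
    and pnat: "\<And>V W f w. \<lbrakk>V\<in>Proj; W\<in>Proj; f\<in>lin_hom R V W; set w \<subseteq> carrier V;
      length w = Suc n\<rbrakk> \<Longrightarrow> fmap (C1 E) V W f (p V w) = p W (map f w)"
    and qnat: "\<And>V W f w. \<lbrakk>V\<in>Proj; W\<in>Proj; f\<in>lin_hom R V W; set w \<subseteq> carrier V;
      length w = Suc n\<rbrakk> \<Longrightarrow> fmap (C1 E) V W f (q V w) = q W (map f w)"
    and dpq: "\<And>V w. \<lbrakk>V\<in>Proj; set w \<subseteq> carrier V; length w = Suc n\<rbrakk> \<Longrightarrow> d V (p V w) = d V (q V w)"
    and left: "\<And>V v. \<lbrakk>V\<in>Proj; v\<in>carrier V\<rbrakk> \<Longrightarrow>
      p V (v # replicate n \<zero>[V]) = q V (v # replicate n \<zero>[V])"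
    and right: "\<And>V w. \<lbrakk>V\<in>Proj; set w \<subseteq> carrier V; length w = n\<rbrakk> \<Longrightarrow> p V (\<zero>[V] # w) = q V (\<zero>[V] # w)"
    and V: "V\<in>Proj" and v: "v\<in>carrier V" and w: "set w \<subseteq> carrier V" "length w = n"
  shows "p V (v # w) = q V (v # w)"
proof (rule natural_operation_rigid[OF C1_pointed b_hom nat_hom_natural[OF b_nat] p q pnat qnat _ left right V v w])
  fix V w assume a: "V\<in>Proj" "set w \<subseteq> carrier V" "length w = Suc n"
  interpret d: add_hom "E1 V" "E0 V" "d V" by (rule d_hom[OF a(1)])
  have "d V (p V w \<ominus>[E1 V] q V w) = \<zero>[E0 V]"
    using p[OF a] q[OF a] dpq[OF a]
    by (simp add: d.hom_minus abelian_group.group_simps[OF E0_abelian[OF a(1)]])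
  then show "\<exists>t\<in>pts I V. p V w \<ominus>[E1 V] q V w = b V t"
    using d_kernel[OF a(1)] p[OF a] q[OF a] by simp
qed

end

text \<open>The section \<^term>\<open>s\<close> of \<^term>\<open>ea E\<close> at the generator and the element \<^term>\<open>t\<close> measuring its failure to
  be additive give a symmetric cocycle \<open>V \<times> V \<rightarrow> C\<^sub>1(V)\<close>; the splitting is the corresponding extension of
  \<open>V\<close> by \<open>C\<^sub>1(V)\<close>.\<close>

locale additive_cocycle = elementary R u M E
  for R :: "'r ring" and u :: "'u itself" and M :: "('r, 'r, 'm) bimodule"
    and E :: "('r, 'u, 'r, 'u, ('m, 'u) tens, 'x, 'y) el_ext" +
  fixes s :: 'x and t :: 'y
  assumes s: "s\<in>pts (C0 E) F1" "a F1 s = gen1"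
    and t: "t\<in>carrier (fobj (C1 E) (FM (Suc (Suc 0))))"
    "d (FM (Suc (Suc 0))) t \<oplus>[fobj (C0 E) (FM (Suc (Suc 0)))] (op (C0 E) s (FM (Suc (Suc 0))) [gen (Suc (Suc 0)) 0]
        \<oplus>[fobj (C0 E) (FM (Suc (Suc 0)))] op (C0 E) s (FM (Suc (Suc 0))) [gen (Suc (Suc 0)) (Suc 0)]) =
      op (C0 E) s (FM (Suc (Suc 0))) [gen (Suc (Suc 0)) 0 \<oplus>[FM (Suc (Suc 0))] gen (Suc (Suc 0)) (Suc 0)]"
begin

definition "sv V v = op (C0 E) s V [v]"
text \<open>The operation given by \<open>t\<close>, normalised to vanish when one argument is zero,
  as rigidity will require. Its image under \<open>d\<close> is unchanged, because \<open>d\<close>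
  kills the subtracted values.\<close>

definition "tt V v w = op (C1 E) t V [v, w] \<ominus>[E1 V] (op (C1 E) t V [v, \<zero>[V]] \<oplus>[E1 V] op (C1 E) t V [\<zero>[V], w])"

lemma sv_closed: "\<lbrakk>V\<in>Proj; v\<in>carrier V\<rbrakk> \<Longrightarrow> sv V v\<in>carrier (E0 V)"
  unfolding sv_def by (rule op_closed[OF C0_pointed, where n = "Suc 0"]) (auto intro: s)

lemma sv_natural: "\<lbrakk>V\<in>Proj; W\<in>Proj; f\<in>lin_hom R V W; v\<in>carrier V\<rbrakk> \<Longrightarrow>
    fmap (C0 E) V W f (sv V v) = sv W (f v)"
  unfolding sv_def by (subst op_natural[OF C0_pointed, where n = "Suc 0"]) (auto intro: s)

lemma sv_zero: "V\<in>Proj \<Longrightarrow> sv V \<zero>[V] = \<zero>[E0 V]"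
  unfolding sv_def by (rule op_zero[OF C0_pointed, where n = "Suc 0"]) (auto intro: s)

lemma a_sv:
  assumes V: "V\<in>Proj" and v: "v\<in>carrier V"
  shows "a V (sv V v) = v"
proof -
  note m = fgp_module[OF V]
  have l: "lmap V [v]\<in>lin_hom R F1 V" using v by (intro lmap_lin[OF m]) auto
  show ?thesis
    using lmap_gen[OF m, of "[v]" "Suc 0" 0] v s
    by (simp add: sv_def op_def a_natural[OF FM_fgp V l])
qed

lemma op_t_closed: "\<lbrakk>V\<in>Proj; v\<in>carrier V; w\<in>carrier V\<rbrakk> \<Longrightarrow> op (C1 E) t V [v, w]\<in>carrier (E1 V)"
  by (rule op_closed[OF C1_pointed, where n = "Suc (Suc 0)"]) (auto intro: t)

lemma op_t_natural: "\<lbrakk>V\<in>Proj; W\<in>Proj; f\<in>lin_hom R V W; v\<in>carrier V; w\<in>carrier V\<rbrakk> \<Longrightarrow>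
    fmap (C1 E) V W f (op (C1 E) t V [v, w]) = op (C1 E) t W [f v, f w]"
  by (subst op_natural[OF C1_pointed, where n = "Suc (Suc 0)"]) (auto intro: t)

text \<open>The image of the relation assumed for \<open>t\<close> at rank two under the map
  classified by \<open>(v, w)\<close>.\<close>

lemma d_op_t:
  assumes V: "V\<in>Proj" and v: "v\<in>carrier V" and w: "w\<in>carrier V"
  shows "d V (op (C1 E) t V [v, w]) \<oplus>[E0 V] (sv V v \<oplus>[E0 V] sv V w) = sv V (v \<oplus>[V] w)"
proof -
  let ?F = "FM (Suc (Suc 0))" and ?l = "[v, w]"
  note m = fgp_module[OF V]
  have l: "set ?l \<subseteq> carrier V" "length ?l = Suc (Suc 0)" using v w by auto
  note F = FM_fgp[of "Suc (Suc 0)"]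
  note ll = lmap_lin[OF m l]
  interpret f: add_hom "E0 ?F" "E0 V" "fmap (C0 E) ?F V (lmap V ?l)" by (rule functor_map_hom[OF C0_pointed F V ll])
  interpret FF: abelian_group ?F by (rule V_abelian[OF F])
  have g: "lmap V ?l (gen (Suc (Suc 0)) 0) = v" "lmap V ?l (gen (Suc (Suc 0)) (Suc 0)) = w"
    using lmap_gen[OF m l] by auto
  have "fmap (C0 E) ?F V (lmap V ?l) (d ?F t) = d V (op (C1 E) t V ?l)"
    by (simp add: op_def nat_hom_natural[OF d_nat F V ll t(1)])
  then show ?thesis
    using arg_cong[OF t(2), of "fmap (C0 E) ?F V (lmap V ?l)"] lin_homD(1)[OF nat_hom_lin[OF d_nat F] t(1)]
    by (simp add: sv_closed[OF F gen_closed] sv_natural[OF F V ll] gen_closed g lin_homD(3)[OF ll] flip: sv_def)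
qed

context
  fixes V :: "('r, 'u) module" assumes V: "V\<in>Proj"
begin

interpretation V: abelian_group V by (rule V_abelian[OF V])
interpretation E0: abelian_group "E0 V" by (rule E0_abelian[OF V])
interpretation E1: abelian_group "E1 V" by (rule E1_abelian[OF V])
interpretation d: add_hom "E1 V" "E0 V" "d V" by (rule d_hom[OF V])

lemma tt_closed: "\<lbrakk>v\<in>carrier V; w\<in>carrier V\<rbrakk> \<Longrightarrow> tt V v w\<in>carrier (E1 V)"
  unfolding tt_def by (simp add: op_t_closed[OF V])

lemma op_t_zero: "op (C1 E) t V [\<zero>[V], \<zero>[V]] = \<zero>[E1 V]"
  by (rule op_zero[OF C1_pointed V, where n = "Suc (Suc 0)"]) (auto intro: t)

lemma tt_zero: "v\<in>carrier V \<Longrightarrow> tt V v \<zero>[V] = \<zero>[E1 V]" "v\<in>carrier V \<Longrightarrow> tt V \<zero>[V] v = \<zero>[E1 V]"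
  unfolding tt_def by (simp_all add: op_t_closed[OF V] op_t_zero E1.group_simps)

lemma d_tt:
  assumes v: "v\<in>carrier V" and w: "w\<in>carrier V"
  shows "d V (tt V v w) \<oplus>[E0 V] (sv V v \<oplus>[E0 V] sv V w) = sv V (v \<oplus>[V] w)"
proof -
  note c = sv_closed[OF V v] sv_closed[OF V w]
  note oc = d.hom_closed[OF op_t_closed[OF V v V.zero_closed]] d.hom_closed[OF op_t_closed[OF V V.zero_closed w]]
  have "d V (op (C1 E) t V [v, \<zero>[V]]) \<oplus>[E0 V] sv V v = sv V v" "d V (op (C1 E) t V [\<zero>[V], w]) \<oplus>[E0 V] sv V w = sv V w"
    using d_op_t[OF V v V.zero_closed] d_op_t[OF V V.zero_closed w] v w c by (simp_all add: sv_zero[OF V])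
  then have "d V (op (C1 E) t V [v, \<zero>[V]]) = \<zero>[E0 V]" "d V (op (C1 E) t V [\<zero>[V], w]) = \<zero>[E0 V]"
    using oc c by (metis E0.add.right_cancel E0.l_zero E0.zero_closed)+
  then show ?thesis
    using d_op_t[OF V v w] v w op_t_closed[OF V v w] d.hom_closed[OF op_t_closed[OF V v w]]
    by (simp add: tt_def d.hom_minus op_t_closed[OF V] E0.minus_eq E0.neg_zero)
qed

end

lemma tt_natural:
  assumes V: "V\<in>Proj" and W: "W\<in>Proj" and f: "f\<in>lin_hom R V W"
    and v: "v\<in>carrier V" "w\<in>carrier V"
  shows "fmap (C1 E) V W f (tt V v w) = tt W (f v) (f w)"
proof -
  interpret V: abelian_group V by (rule V_abelian[OF V])
  interpret f: add_hom "E1 V" "E1 W" "fmap (C1 E) V W f" by (rule functor_map_hom[OF C1_pointed V W f])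
  have "f \<zero>[V] = \<zero>[W]"
    by (rule add_hom.hom_zero[OF lin_add_hom[OF f fgp_module[OF V] fgp_module[OF W]]])
  then show ?thesis
    using v by (simp add: tt_def f.hom_minus op_t_closed[OF V] op_t_natural[OF V W f])
qed

text \<open>Both sides have the same image under \<open>d\<close>, since
  \<open>sv V (v \<oplus>[V] w)\<close> is symmetric in \<open>v\<close> and \<open>w\<close>, and
  both vanish when an argument is zero; \<open>C1_rigid\<close> does the rest.\<close>

lemma tt_sym:
  assumes V: "V\<in>Proj" and v: "v\<in>carrier V" "w\<in>carrier V"
  shows "tt V v w = tt V w v"
proof -
  have l2: "l ! 0\<in>carrier V" "l ! Suc 0\<in>carrier V" if "set l \<subseteq> carrier V" "length l = Suc (Suc 0)"
    for l and V :: "('r, 'u) module" using that by (auto simp: subset_iff)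
  let ?p = "\<lambda>V l. tt V (l ! 0) (l ! Suc 0)" and ?q = "\<lambda>V l. tt V (l ! Suc 0) (l ! 0)"
  have "?p V (v # [w]) = ?q V (v # [w])"
  proof (rule C1_rigid[where n = "Suc 0" and p = ?p and q = ?q])
    fix V l assume V: "V\<in>Proj" and s: "set l \<subseteq> carrier V" "length l = Suc (Suc 0)"
    note l = l2[OF s]
    interpret V: abelian_group V by (rule V_abelian[OF V])
    interpret E0: abelian_group "E0 V" by (rule E0_abelian[OF V])
    note c = tt_closed[OF V l] tt_closed[OF V l(2,1)]
    show "?p V l\<in>carrier (E1 V)" "?q V l\<in>carrier (E1 V)" using c .
    note dc = add_hom.hom_closed[OF d_hom[OF V] c(1)] add_hom.hom_closed[OF d_hom[OF V] c(2)]
    note sc = sv_closed[OF V l(1)] sv_closed[OF V l(2)]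
    have "d V (?p V l) \<oplus>[E0 V] (sv V (l ! 0) \<oplus>[E0 V] sv V (l ! Suc 0)) =
        d V (?q V l) \<oplus>[E0 V] (sv V (l ! 0) \<oplus>[E0 V] sv V (l ! Suc 0))"
      using d_tt[OF V l] d_tt[OF V l(2,1)] V.a_comm[OF l] E0.a_comm[OF sc] by simp
    then show "d V (?p V l) = d V (?q V l)" using dc sc by (simp add: E0.add.right_cancel)
    { fix W f assume W: "W\<in>Proj" and f: "f\<in>lin_hom R V W"
      show "fmap (C1 E) V W f (?p V l) = ?p W (map f l)" "fmap (C1 E) V W f (?q V l) = ?q W (map f l)"
        using s by (simp_all add: tt_natural[OF V W f] l) }
  next
    fix V v assume V: "V\<in>Proj" and v: "v\<in>carrier V"
    then show "?p V (v # replicate (Suc 0) \<zero>[V]) = ?q V (v # replicate (Suc 0) \<zero>[V])" by (simp add: tt_zero)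
  next
    fix V :: "('r, 'u) module" and l :: "'u list" assume V: "V\<in>Proj" and s: "set l \<subseteq> carrier V" "length l = Suc 0"
    then obtain v where v: "l = [v]" "v\<in>carrier V" by (auto simp: length_Suc_conv)
    then show "?p V (\<zero>[V] # l) = ?q V (\<zero>[V] # l)" using V by (simp add: tt_zero)
  qed (use V v in auto)
  then show ?thesis by simp
qed

text \<open>Rigidity in three variables, split as one and two. Applying \<open>d\<close> to either
  side and adding the three values of \<open>sv\<close> gives the value of \<open>sv\<close> at the
  triple sum, so the images under \<open>d\<close> agree. For \<open>v\<close> zero both sides
  reduce to \<open>tt V w z\<close>, for \<open>w\<close> and \<open>z\<close> zero they
  vanish.\<close>

lemma tt_cocycle:
  assumes V: "V\<in>Proj" and v: "v\<in>carrier V" "w\<in>carrier V" "z\<in>carrier V"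
  shows "tt V v w \<oplus>[E1 V] tt V (v \<oplus>[V] w) z = tt V w z \<oplus>[E1 V] tt V v (w \<oplus>[V] z)"
proof -
  have l3: "l ! 0\<in>carrier V" "l ! Suc 0\<in>carrier V" "l ! Suc (Suc 0)\<in>carrier V"
    if "set l \<subseteq> carrier V" "length l = Suc (Suc (Suc 0))" for l and V :: "('r, 'u) module"
    using that by (auto simp: subset_iff)
  let ?p = "\<lambda>V l. tt V (l ! 0) (l ! Suc 0) \<oplus>[E1 V] tt V (l ! 0 \<oplus>[V] l ! Suc 0) (l ! Suc (Suc 0))"
  let ?q = "\<lambda>V l. tt V (l ! Suc 0) (l ! Suc (Suc 0)) \<oplus>[E1 V] tt V (l ! 0) (l ! Suc 0 \<oplus>[V] l ! Suc (Suc 0))"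
  have "?p V (v # [w, z]) = ?q V (v # [w, z])"
  proof (rule C1_rigid[where n = "Suc (Suc 0)" and p = ?p and q = ?q])
    fix V l assume V: "V\<in>Proj" and sl: "set l \<subseteq> carrier V" "length l = Suc (Suc (Suc 0))"
    note l = l3[OF sl]
    interpret V: abelian_group V by (rule V_abelian[OF V])
    interpret E0: abelian_group "E0 V" by (rule E0_abelian[OF V])
    interpret E1: abelian_group "E1 V" by (rule E1_abelian[OF V])
    interpret d: add_hom "E1 V" "E0 V" "d V" by (rule d_hom[OF V])
    let ?v = "l ! 0" and ?w = "l ! Suc 0" and ?z = "l ! Suc (Suc 0)"
    note lc = V.a_closed[OF l(1,2)] V.a_closed[OF l(2,3)]
    note c = tt_closed[OF V l(1,2)] tt_closed[OF V lc(1) l(3)] tt_closed[OF V l(2,3)] tt_closed[OF V l(1) lc(2)]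
    show pq: "?p V l\<in>carrier (E1 V)" "?q V l\<in>carrier (E1 V)" using c by auto
    note dc = d.hom_closed[OF c(1)] d.hom_closed[OF c(2)] d.hom_closed[OF c(3)] d.hom_closed[OF c(4)]
    note sc = sv_closed[OF V l(1)] sv_closed[OF V l(2)] sv_closed[OF V l(3)] sv_closed[OF V lc(1)] sv_closed[OF V lc(2)]
    let ?S = "sv V ?v \<oplus>[E0 V] (sv V ?w \<oplus>[E0 V] sv V ?z)"
    have "d V (?p V l) \<oplus>[E0 V] ?S = d V (tt V (?v \<oplus>[V] ?w) ?z) \<oplus>[E0 V] ((d V (tt V ?v ?w) \<oplus>[E0 V] (sv V ?v \<oplus>[E0 V] sv V ?w)) \<oplus>[E0 V] sv V ?z)"
      using c dc sc by (simp add: E0.a_ac)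
    also have "\<dots> = sv V (?v \<oplus>[V] ?w \<oplus>[V] ?z)"
      unfolding d_tt[OF V l(1,2)] by (rule d_tt[OF V lc(1) l(3)])
    also have "\<dots> = sv V (?v \<oplus>[V] (?w \<oplus>[V] ?z))" using l by (simp add: V.a_assoc)
    also have "\<dots> = d V (tt V ?v (?w \<oplus>[V] ?z)) \<oplus>[E0 V] (sv V ?v \<oplus>[E0 V] (d V (tt V ?w ?z) \<oplus>[E0 V] (sv V ?w \<oplus>[E0 V] sv V ?z)))"
      unfolding d_tt[OF V l(2,3)] by (rule d_tt[OF V l(1) lc(2), symmetric])
    also have "\<dots> = d V (?q V l) \<oplus>[E0 V] ?S"
      using c dc sc by (simp add: E0.a_ac)
    finally show "d V (?p V l) = d V (?q V l)"
      using d.hom_closed[OF pq(1)] d.hom_closed[OF pq(2)] sc by (simp only: E0.add.right_cancel E0.a_closed)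
    { fix W f assume W: "W\<in>Proj" and f: "f\<in>lin_hom R V W"
      show "fmap (C1 E) V W f (?p V l) = ?p W (map f l)" "fmap (C1 E) V W f (?q V l) = ?q W (map f l)"
        using sl c by (simp_all add: tt_natural[OF V W f] l lin_homD(3)[OF f] lin_homD(3)[OF functor_map[OF C1_pointed V W f]]) }
  next
    fix V v assume V: "V\<in>Proj" and v: "v\<in>carrier V"
    interpret V: abelian_group V by (rule V_abelian[OF V])
    show "?p V (v # replicate (Suc (Suc 0)) \<zero>[V]) = ?q V (v # replicate (Suc (Suc 0)) \<zero>[V])" using v by (simp add: tt_zero[OF V])
  next
    fix V :: "('r, 'u) module" and l :: "'u list" assume V: "V\<in>Proj" and sl: "set l \<subseteq> carrier V" "length l = Suc (Suc 0)"
    then obtain v w where v: "l = [v, w]" "v\<in>carrier V" "w\<in>carrier V" by (auto simp: length_Suc_conv)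
    interpret V: abelian_group V by (rule V_abelian[OF V])
    interpret E1: abelian_group "E1 V" by (rule E1_abelian[OF V])
    show "?p V (\<zero>[V] # l) = ?q V (\<zero>[V] # l)" using v by (simp add: tt_zero[OF V] tt_closed[OF V])
  qed (use V v in auto)
  then show ?thesis by simp
qed

text \<open>The extension of \<open>V\<close> by the value of \<open>C1\<close> with cocycle minus
  \<open>tt\<close>. The sign is the one for which \<open>(x, v) \<mapsto> d x + sv v\<close> is
  additive.\<close>

definition CG :: "('r, 'u) module \<Rightarrow> ('y \<times> 'u) ring" where
  "CG V = \<lparr>carrier = carrier (E1 V) \<times> carrier V, monoid.mult = undefined, monoid.one = undefined,
     ring.zero = (\<zero>[E1 V], \<zero>[V]),
     ring.add = (\<lambda>p q. (fst p \<oplus>[E1 V] fst q \<ominus>[E1 V] tt V (snd p) (snd q), snd p \<oplus>[V] snd q))\<rparr>"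

lemma CG_simps: "carrier (CG V) = carrier (E1 V) \<times> carrier V" "\<zero>[CG V] = (\<zero>[E1 V], \<zero>[V])"
  "(x, v) \<oplus>[CG V] (y, w) = (x \<oplus>[E1 V] y \<ominus>[E1 V] tt V v w, v \<oplus>[V] w)"
  by (simp_all add: CG_def)

text \<open>Associativity is \<open>tt_cocycle\<close>, commutativity is \<open>tt_sym\<close>, and
  the neutral element comes from \<open>tt_zero\<close>.\<close>

lemma CG_abelian:
  assumes V: "V\<in>Proj" shows "abelian_group (CG V)"
proof -
  interpret V: abelian_group V by (rule V_abelian[OF V])
  interpret E1: abelian_group "E1 V" by (rule E1_abelian[OF V])
  note c = tt_closed[OF V]
  show ?thesis
  proof (rule abelian_groupI)
    fix p q r assume "p\<in>carrier (CG V)" "q\<in>carrier (CG V)" "r\<in>carrier (CG V)"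
    then obtain x v y w z k where p: "p = (x, v)" "x\<in>carrier (E1 V)" "v\<in>carrier V" "q = (y, w)" "y\<in>carrier (E1 V)" "w\<in>carrier V"
      "r = (z, k)" "z\<in>carrier (E1 V)" "k\<in>carrier V" by (auto simp: CG_simps)
    have "x \<oplus>[E1 V] y \<ominus>[E1 V] tt V v w \<oplus>[E1 V] z \<ominus>[E1 V] tt V (v \<oplus>[V] w) k =
        x \<oplus>[E1 V] y \<oplus>[E1 V] z \<ominus>[E1 V] (tt V v w \<oplus>[E1 V] tt V (v \<oplus>[V] w) k)"
      using p by (simp add: c E1.group_simps)
    also have "\<dots> = x \<oplus>[E1 V] (y \<oplus>[E1 V] z \<ominus>[E1 V] tt V w k) \<ominus>[E1 V] tt V v (w \<oplus>[V] k)"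
      unfolding tt_cocycle[OF V p(3,6,9)] using p by (simp add: c E1.group_simps)
    finally show "p \<oplus>[CG V] q \<oplus>[CG V] r = p \<oplus>[CG V] (q \<oplus>[CG V] r)"
      using p by (simp add: CG_simps V.a_assoc)
  next
    fix p q assume "p\<in>carrier (CG V)" "q\<in>carrier (CG V)"
    then show "p \<oplus>[CG V] q\<in>carrier (CG V)" "p \<oplus>[CG V] q = q \<oplus>[CG V] p"
      using tt_sym[OF V] by (auto simp: CG_simps c E1.a_comm V.a_comm)
  next
    fix p assume "p\<in>carrier (CG V)"
    then obtain x v where p: "p = (x, v)" "x\<in>carrier (E1 V)" "v\<in>carrier V" by (auto simp: CG_simps)
    then show "\<zero>[CG V] \<oplus>[CG V] p = p" by (simp add: CG_simps tt_zero[OF V] E1.group_simps)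
    show "\<exists>q\<in>carrier (CG V). q \<oplus>[CG V] p = \<zero>[CG V]"
      \<comment> \<open>The first component of the inverse compensates the cocycle at the pair of
        the negative of \<open>v\<close> and \<open>v\<close>.\<close>
      using p by (intro bexI[of _ "(tt V (\<ominus>[V] v) v \<ominus>[E1 V] x, \<ominus>[V] v)"]) (auto simp: CG_simps c E1.group_simps V.l_neg)
  qed (auto simp: CG_simps)
qed

text \<open>Abelian groups are encoded as modules over the integers, so the group is equipped with
  its integer multiples.\<close>

definition CM :: "('r, 'u) module \<Rightarrow> (int, 'y \<times> 'u) module" where
  "CM V = \<lparr>carrier = carrier (CG V), monoid.mult = undefined, monoid.one = undefined,
    ring.zero = \<zero>[CG V], ring.add = (\<lambda>x y. x \<oplus>[CG V] y), smult = (\<lambda>n x. [n] \<cdot>\<^bsub>CG V\<^esub> x)\<rparr>"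

lemma CM_simps: "carrier (CM V) = carrier (E1 V) \<times> carrier V" "\<zero>[CM V] = (\<zero>[E1 V], \<zero>[V])"
  "(x, v) \<oplus>[CM V] (y, w) = (x \<oplus>[E1 V] y \<ominus>[E1 V] tt V v w, v \<oplus>[V] w)"
  by (simp_all add: CM_def CG_simps)

lemma CM_module: "V\<in>Proj \<Longrightarrow> left_module \<Z> (CM V)"
  unfolding CM_def by (rule int_module[OF CG_abelian])

definition CF :: "('r, 'u, int, 'y \<times> 'u) pfunctor" where
  "CF = \<lparr>fobj = CM, fmap = (\<lambda>V W f. \<lambda>p\<in>carrier (CM V). (fmap (C1 E) V W f (fst p), f (snd p)))\<rparr>"

lemma CF_map: "\<lbrakk>x\<in>carrier (E1 V); v\<in>carrier V\<rbrakk> \<Longrightarrow> fmap CF V W f (x, v) = (fmap (C1 E) V W f x, f v)"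
  and CF_obj: "fobj CF V = CM V"
  by (simp_all add: CF_def CM_simps)

lemma CF_pointed: "pointed_functor R \<Z> CF"
proof (rule pointed_functorI)
  fix V assume V: "V\<in>Proj"
  interpret V: abelian_group V by (rule V_abelian[OF V])
  interpret E1: abelian_group "E1 V" by (rule E1_abelian[OF V])
  show mV: "left_module \<Z> (fobj CF V)" unfolding CF_obj by (rule CM_module[OF V])
  { fix W f assume W: "W\<in>Proj" and f: "f\<in>lin_hom R V W"
    note fE = functor_map[OF C1_pointed V W f]
    interpret fh: add_hom "E1 V" "E1 W" "fmap (C1 E) V W f" by (rule functor_map_hom[OF C1_pointed V W f])
    have h: "add_hom (CM V) (CM W) (fmap CF V W f)"
      by (rule add_homI[OF lm_abelian[OF CM_module[OF V]] lm_abelian[OF CM_module[OF W]]])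
        (auto simp: CM_simps CF_map lin_homD(1,3)[OF f] lin_homD(1,3)[OF fE] fh.hom_minus tt_closed[OF V] tt_natural[OF V W f])
    show "fmap CF V W f\<in>lin_hom \<Z> (fobj CF V) (fobj CF W)"
      unfolding CF_obj
      by (rule lin_homI, rule add_hom.hom_closed[OF h], simp, simp add: CF_def,
          rule add_hom.hom_add[OF h], simp, simp,
          rule additive_int_linear[OF CM_module[OF V] CM_module[OF W] h], simp) }
  show "fmap CF V V (\<lambda>x\<in>carrier V. x) p = p" if "p\<in>pts CF V" for p
    using that by (auto simp: CF_obj CM_simps CF_map functor_map_id[OF C1_pointed V])
  { fix W U f g p assume W: "W\<in>Proj" and U: "U\<in>Proj"
      and f: "f\<in>lin_hom R V W" and g: "g\<in>lin_hom R W U" and p: "p\<in>pts CF V"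
    show "fmap CF V U (compose (carrier V) g f) p = fmap CF W U g (fmap CF V W f p)"
      using p by (auto simp: CF_obj CM_simps CF_map lin_homD(1)[OF f] lin_homD(1)[OF functor_map[OF C1_pointed V W f]]
        functor_map_comp[OF C1_pointed V W U f g] compose_eq) }
  show "pts CF V \<subseteq> {\<zero>[fobj CF V]}" if "carrier V = {\<zero>[V]}"
    using functor_zero[OF C1_pointed V that] that by (auto simp: CF_obj CM_simps)
qed

definition SD :: "('r, 'u, int, 'x, 'y, 'y \<times> 'u) splitting" where
  "SD = \<lparr>C01 = CF, sc1 = nat_restrict R (C1 E) (\<lambda>V x. (x, \<zero>[V])),
     sc0 = nat_restrict R CF (\<lambda>V p. d V (fst p) \<oplus>[E0 V] sv V (snd p))\<rparr>"

lemma SD_splitting: "splits E SD"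
proof -
  note FC1 = forget_pointed[OF ring C1_pointed] and FC0 = forget_pointed[OF ring C0_pointed]
  have "nat_restrict R (forget R (C1 E)) (\<lambda>V x. (x, \<zero>[V]))\<in>nat_hom R \<Z> (forget R (C1 E)) CF"
  proof (rule nat_hom_intI[OF FC1 CF_pointed])
    fix V x assume V: "V\<in>Proj" and x: "x\<in>pts (forget R (C1 E)) V"
    interpret V: abelian_group V by (rule V_abelian[OF V])
    interpret E1: abelian_group "E1 V" by (rule E1_abelian[OF V])
    show "(x, \<zero>[V])\<in>pts CF V" using x by (simp add: CF_obj CM_simps)
    show "(x \<oplus>[fobj (forget R (C1 E)) V] y, \<zero>[V]) = (x, \<zero>[V]) \<oplus>[fobj CF V] (y, \<zero>[V])" if "y\<in>pts (forget R (C1 E)) V" for y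
      using x that by (simp add: CF_obj CM_simps tt_zero[OF V] E1.group_simps)
    show "(fmap (forget R (C1 E)) V W f x, \<zero>[W]) = fmap CF V W f (x, \<zero>[V])" if "W\<in>Proj" "f\<in>lin_hom R V W" for W f
      using x add_hom.hom_zero[OF lin_add_hom[OF that(2) fgp_module[OF V] fgp_module[OF that(1)]]]
      by (simp add: CF_map)
  qed
  then have c1: "sc1 SD\<in>nat_hom R \<Z> (forget R (C1 E)) CF" by (simp add: SD_def nat_restrict_def)
  have c0: "sc0 SD\<in>nat_hom R \<Z> CF (forget R (C0 E))"
    unfolding SD_def splitting.simps
  proof (rule nat_hom_intI[OF CF_pointed FC0])
    fix V p assume V: "V\<in>Proj" and "p\<in>pts CF V"
    then obtain x v where p: "p = (x, v)" "x\<in>carrier (E1 V)" "v\<in>carrier V" by (auto simp: CF_obj CM_simps)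
    interpret V: abelian_group V by (rule V_abelian[OF V])
    interpret E0: abelian_group "E0 V" by (rule E0_abelian[OF V])
    interpret d: add_hom "E1 V" "E0 V" "d V" by (rule d_hom[OF V])
    show "d V (fst p) \<oplus>[E0 V] sv V (snd p)\<in>pts (forget R (C0 E)) V" using p by (simp add: sv_closed[OF V])
    { fix q assume "q\<in>pts CF V"
      then obtain y w where q: "q = (y, w)" "y\<in>carrier (E1 V)" "w\<in>carrier V" by (auto simp: CF_obj CM_simps)
      show "d V (fst (p \<oplus>[fobj CF V] q)) \<oplus>[E0 V] sv V (snd (p \<oplus>[fobj CF V] q)) =
          d V (fst p) \<oplus>[E0 V] sv V (snd p) \<oplus>[fobj (forget R (C0 E)) V] (d V (fst q) \<oplus>[E0 V] sv V (snd q))"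
        using p q tt_closed[OF V p(3) q(3)] sv_closed[OF V p(3)] sv_closed[OF V q(3)]
        by (simp add: CF_obj CM_simps d.hom_minus d_tt[OF V p(3) q(3), symmetric] E0.group_simps) }
    { fix W f assume W: "W\<in>Proj" and f: "f\<in>lin_hom R V W"
      show "d W (fst (fmap CF V W f p)) \<oplus>[E0 W] sv W (snd (fmap CF V W f p)) =
          fmap (forget R (C0 E)) V W f (d V (fst p) \<oplus>[E0 V] sv V (snd p))"
        using p sv_closed[OF V p(3)] by (simp add: CF_map nat_hom_natural[OF d_nat V W f] sv_natural[OF V W f]
          lin_homD(3)[OF functor_map[OF C0_pointed V W f]]) }
  qed
  have "inj_on (sc1 SD V) (carrier (E1 V)) \<and> sc0 SD V ` pts CF V = carrier (E0 V) \<and>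
      (\<forall>y\<in>carrier (E1 V). sc0 SD V (sc1 SD V y) = d V y) \<and>
      a_kernel (fobj CF V) (fobj (forget R (C0 E)) V) (sc0 SD V) = sc1 SD V ` b V ` pts I V"
    if V: "V\<in>Proj" for V
  proof (intro conjI)
    interpret V: abelian_group V by (rule V_abelian[OF V])
    interpret E0: abelian_group "E0 V" by (rule E0_abelian[OF V])
    interpret d: add_hom "E1 V" "E0 V" "d V" by (rule d_hom[OF V])
    interpret a: add_hom "E0 V" V "a V" by (rule a_hom[OF V])
    have e1: "sc1 SD V x = (x, \<zero>[V])" if "x\<in>carrier (E1 V)" for x using that V by (simp add: SD_def)
    have e0: "sc0 SD V (x, v) = d V x \<oplus>[E0 V] sv V v" if "x\<in>carrier (E1 V)" "v\<in>carrier V" for x v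
      using that V by (simp add: SD_def CF_obj CM_simps)
    show "inj_on (sc1 SD V) (carrier (E1 V))" by (auto simp: inj_on_def e1)
    show "\<forall>y\<in>carrier (E1 V). sc0 SD V (sc1 SD V y) = d V y" by (auto simp: e1 e0 sv_zero[OF V])
    show "sc0 SD V ` pts CF V = carrier (E0 V)"
    proof (rule antisym; rule subsetI)
      fix y assume y: "y\<in>carrier (E0 V)"
      have "a V (y \<ominus>[E0 V] sv V (a V y)) = \<zero>[V]"
        using y by (simp add: a.hom_minus sv_closed[OF V] a_sv[OF V] V.group_simps)
      then obtain x where x: "x\<in>carrier (E1 V)" "y \<ominus>[E0 V] sv V (a V y) = d V x"
        using a_kernel[OF V, of "y \<ominus>[E0 V] sv V (a V y)"] y sv_closed[OF V] by auto
      then have "sc0 SD V (x, a V y) = y"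
        using y sv_closed[OF V a.hom_closed[OF y]] by (simp add: e0 E0.group_simps flip: x(2))
      moreover have "(x, a V y)\<in>pts CF V" using x y by (simp add: CF_obj CM_simps)
      ultimately show "y\<in>sc0 SD V ` pts CF V" using imageI[of "(x, a V y)" "pts CF V" "sc0 SD V"] by simp
    qed (auto simp: CF_obj CM_simps e0 sv_closed[OF V])
    show "a_kernel (fobj CF V) (fobj (forget R (C0 E)) V) (sc0 SD V) = sc1 SD V ` b V ` pts I V"
    proof (rule antisym; rule subsetI)
      fix p assume "p\<in>a_kernel (fobj CF V) (fobj (forget R (C0 E)) V) (sc0 SD V)"
      then obtain x v where p: "p = (x, v)" "x\<in>carrier (E1 V)" "v\<in>carrier V" "d V x \<oplus>[E0 V] sv V v = \<zero>[E0 V]"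
        by (auto simp: in_a_kernel CF_obj CM_simps e0)
      have "a V (d V x \<oplus>[E0 V] sv V v) = v"
        using p(2,3) by (simp add: sv_closed[OF V] a_d[OF V] a_sv[OF V])
      then have v: "v = \<zero>[V]" using p(4) by simp
      then have "d V x = \<zero>[E0 V]" using p(2,4) by (simp add: sv_zero[OF V])
      then obtain t where t: "t\<in>pts I V" "x = b V t" using d_kernel[OF V p(2)] by auto
      have "p = sc1 SD V (b V t)" using p(1) v e1[OF p(2)] t(2) by simp
      then show "p\<in>sc1 SD V ` b V ` pts I V" using t(1) by (simp only: imageI)
    next
      fix p assume "p\<in>sc1 SD V ` b V ` pts I V"
      then obtain t where t: "t\<in>pts I V" "p = sc1 SD V (b V t)" by auto
      have "b V t\<in>carrier (E1 V)" by (rule add_hom.hom_closed[OF b_hom[OF V] t(1)])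
      then show "p\<in>a_kernel (fobj CF V) (fobj (forget R (C0 E)) V) (sc0 SD V)"
        using t by (simp add: in_a_kernel CF_obj CM_simps e1 e0 sv_zero[OF V] d_b[OF V])
    qed
  qed
  then show ?thesis
    unfolding is_splitting_def using CF_pointed c1 c0 by (auto simp: SD_def)
qed

end

text \<open>Let \<open>e\<close> and \<open>e'\<close> be the generators at rank two. The element
  \<open>s(e + e') - s(e) - s(e')\<close> is killed by \<open>a\<close>, hence equals
  \<open>d t\<close> for some \<open>t\<close>, and this \<open>t\<close> yields the cocycle at all
  modules.\<close>

lemma (in elementary) splitting_exists:
  "\<exists>D :: ('r, 'u, int, 'x, 'y, 'y \<times> 'u) splitting. splits E D"
proof -
  let ?F1 = "F1" and ?F2 = "FM (Suc (Suc 0))" and ?e = "gen (Suc (Suc 0)) 0" and ?e' = "gen (Suc (Suc 0)) (Suc 0)"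
  note F1 = FM_fgp[of "Suc 0"] and F2 = FM_fgp[of "Suc (Suc 0)"]
  obtain s where s: "s\<in>carrier (E0 ?F1)" "a ?F1 s = gen1"
    using gen_closed[of "Suc 0" 0] unfolding a_image[OF F1, symmetric] by auto
  let ?s = "\<lambda>v. op (C0 E) s ?F2 [v]"
  interpret F: abelian_group ?F2 by (rule V_abelian[OF F2])
  interpret E0: abelian_group "E0 ?F2" by (rule E0_abelian[OF F2])
  interpret a: add_hom "E0 ?F2" ?F2 "a ?F2" by (rule a_hom[OF F2])
  have c: "?s v\<in>carrier (E0 ?F2)" if "v\<in>carrier ?F2" for v
    using that s by (intro op_closed[OF C0_pointed F2, where n = "Suc 0"]) auto
  have as: "a ?F2 (?s v) = v" if v: "v\<in>carrier ?F2" for v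
  proof -
    have l: "lmap ?F2 [v]\<in>lin_hom R F1 ?F2" using v by (intro lmap_lin[OF FM_left_module]) auto
    show ?thesis
      using lmap_gen[OF FM_left_module, of "[v]" "Suc (Suc 0)" "Suc 0" 0] v s by (simp add: op_def a_natural[OF F1 F2 l])
  qed
  note g = gen_closed[of "Suc (Suc 0)" 0] gen_closed[of "Suc (Suc 0)" "Suc 0"]
  have "a ?F2 (?s (?e \<oplus>[?F2] ?e') \<ominus>[E0 ?F2] (?s ?e \<oplus>[E0 ?F2] ?s ?e')) = \<zero>[?F2]"
    using g by (simp add: a.hom_minus c as F.group_simps)
  then obtain t where t: "t\<in>carrier (E1 ?F2)" "?s (?e \<oplus>[?F2] ?e') \<ominus>[E0 ?F2] (?s ?e \<oplus>[E0 ?F2] ?s ?e') = d ?F2 t"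
    using a_kernel[OF F2, of "?s (?e \<oplus>[?F2] ?e') \<ominus>[E0 ?F2] (?s ?e \<oplus>[E0 ?F2] ?s ?e')"] g c by auto
  have "d ?F2 t \<oplus>[E0 ?F2] (?s ?e \<oplus>[E0 ?F2] ?s ?e') = ?s (?e \<oplus>[?F2] ?e')"
    using g by (simp add: c E0.group_simps flip: t(2))
  then interpret additive_cocycle R u M E s t
    using s t(1) by (intro additive_cocycle.intro additive_cocycle_axioms.intro elementary_axioms)
  show ?thesis using SD_splitting by blast
qed

subsection \<open>Transport to the universe\<close>

context bimodule_universe begin

lemma el_mor_trans:
  assumes "el_mor R R I E1 E2 f0 f1" "el_mor R R I E2 E3 g0 g1" and E1: "el_ext_of R M E1"
  shows "el_mor R R I E1 E3 (nat_restrict R (C0 E1) (\<lambda>V x. g0 V (f0 V x))) (nat_restrict R (C1 E1) (\<lambda>V x. g1 V (f1 V x)))"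
proof -
  have p: "pointed_functor R R (C0 E1)" "pointed_functor R R (C1 E1)" and n: "ediff E1\<in>nat_hom R R (C1 E1) (C0 E1)"
    "eb E1\<in>nat_hom R R I (C1 E1)"
    using E1 by (auto simp: is_el_ext_def)
  have f: "f0\<in>nat_hom R R (C0 E1) (C0 E2)" "f1\<in>nat_hom R R (C1 E1) (C1 E2)"
    and g: "g0\<in>nat_hom R R (C0 E2) (C0 E3)" "g1\<in>nat_hom R R (C1 E2) (C1 E3)"
    using assms(1,2) by (auto simp: el_mor_def)
  show ?thesis
    unfolding el_mor_def
    using nat_hom_compose[OF f(1) g(1) p(1)] nat_hom_compose[OF f(2) g(2) p(2)] assms(1,2)
      lin_homD(1)[OF nat_hom_lin[OF f(1)]] lin_homD(1)[OF nat_hom_lin[OF f(2)]]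
      lin_homD(1)[OF nat_hom_lin[OF n(1)]] lin_homD(1)[OF nat_hom_lin[OF n(2)]]
    by (simp add: el_mor_def)
qed

lemma functor_copy:
  fixes F :: "('r, 'u, 't, 'x) pfunctor"
  assumes F: "pointed_functor R T F" and small: "\<And>V. V\<in>Proj \<Longrightarrow> pts F V \<lesssim> (UNIV :: 'u set)"
  obtains G :: "('r, 'u, 't, 'u) pfunctor" and j k where "pointed_functor R T G"
    "j\<in>nat_hom R T G F" "k\<in>nat_hom R T F G"
    "\<And>V. V\<in>Proj \<Longrightarrow> bij_betw (j V) (pts G V) (pts F V)"
    "\<And>V x. \<lbrakk>V\<in>Proj; x\<in>pts F V\<rbrakk> \<Longrightarrow> j V (k V x) = x"
    "\<And>V x. \<lbrakk>V\<in>Proj; x\<in>pts G V\<rbrakk> \<Longrightarrow> k V (j V x) = x"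
proof -
  note e = enc_inj[OF small]
  let ?G = "transport_functor (enc F) F :: ('r, 'u, 't, 'u) pfunctor"
  have G: "pointed_functor R T ?G" by (rule transport_functor_pointed[OF F e])
  note k = transport_to[OF F e] and j = transport_from[OF F e]
  let ?j = "nat_restrict R ?G (untransport F (enc F))" and ?k = "nat_restrict R F (enc F)"
  have cG: "pts ?G V = enc F V ` pts F V" if "V\<in>Proj" for V
    by (rule transport_carrier[OF F e that])
  have jk: "?j V (?k V x) = x" if "V\<in>Proj" "x\<in>pts F V" for V x
    using that cG by (simp add: untransport_e[OF F e])
  have kj: "?k V (?j V y) = y" if "V\<in>Proj" "y\<in>pts ?G V" for V y
    using that cG by (auto simp: untransport_e[OF F e])
  have "bij_betw (?j V) (pts ?G V) (pts F V)" if V: "V\<in>Proj" for V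
    by (rule bij_betwI[where g = "?k V"])
      (use jk[OF V] kj[OF V] lin_homD(1)[OF nat_hom_lin[OF j V]] lin_homD(1)[OF nat_hom_lin[OF k V]] in auto)
  then show thesis using that[OF G j k] jk kj by blast
qed

text \<open>\<open>El\<close> only contains extensions with values in the universe, whereas the
  terms of a truncated complex consist of classes of formal sums.\<close>

theorem el_ext_copy:
  fixes E :: "('r, 'u, 'r, 'u, ('m, 'u) tens, 'x, 'y) el_ext"
  assumes E: "el_ext_of R M E"
    and small: "\<And>V. V\<in>Proj \<Longrightarrow> pts (C0 E) V \<lesssim> (UNIV :: 'u set)"
      "\<And>V. V\<in>Proj \<Longrightarrow> pts (C1 E) V \<lesssim> (UNIV :: 'u set)"
  shows "\<exists>E' :: ('r, 'u, 'r, 'u, ('m, 'u) tens, 'u, 'u) el_ext. el_ext_of R M E' \<and> el_iso R R I E' E"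
proof -
  interpret elementary R u M E
    using E by (rule elementaryI)
  obtain G0 :: "('r, 'u, 'r, 'u) pfunctor" and j0 k0 where G0: "pointed_functor R R G0"
    and j0: "j0\<in>nat_hom R R G0 (C0 E)" and k0: "k0\<in>nat_hom R R (C0 E) G0"
    and b0: "\<And>V. V\<in>Proj \<Longrightarrow> bij_betw (j0 V) (pts G0 V) (carrier (E0 V))"
    and jk0: "\<And>V x. \<lbrakk>V\<in>Proj; x\<in>carrier (E0 V)\<rbrakk> \<Longrightarrow> j0 V (k0 V x) = x"
    and kj0: "\<And>V x. \<lbrakk>V\<in>Proj; x\<in>pts G0 V\<rbrakk> \<Longrightarrow> k0 V (j0 V x) = x"
    using functor_copy[OF C0_pointed small(1)] by metis
  obtain G1 :: "('r, 'u, 'r, 'u) pfunctor" and j1 k1 where G1: "pointed_functor R R G1"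
    and j1: "j1\<in>nat_hom R R G1 (C1 E)" and k1: "k1\<in>nat_hom R R (C1 E) G1"
    and b1: "\<And>V. V\<in>Proj \<Longrightarrow> bij_betw (j1 V) (pts G1 V) (carrier (E1 V))"
    and jk1: "\<And>V x. \<lbrakk>V\<in>Proj; x\<in>carrier (E1 V)\<rbrakk> \<Longrightarrow> j1 V (k1 V x) = x"
    and kj1: "\<And>V x. \<lbrakk>V\<in>Proj; x\<in>pts G1 V\<rbrakk> \<Longrightarrow> k1 V (j1 V x) = x"
    using functor_copy[OF C1_pointed small(2)] by metis
  let ?dj = "nat_restrict R G1 (\<lambda>V x. d V (j1 V x))"
  let ?d = "nat_restrict R G1 (\<lambda>V x. k0 V (?dj V x))"
  let ?a = "nat_restrict R G0 (\<lambda>V x. a V (j0 V x))"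
  let ?b = "nat_restrict R I (\<lambda>V x. k1 V (b V x))"
  let ?E = "\<lparr>C0 = G0, C1 = G1, ediff = ?d, ea = ?a, eb = ?b\<rparr>"
  have dj: "?dj\<in>nat_hom R R G1 (C0 E)" by (rule nat_hom_compose[OF j1 d_nat G1])
  have nat: "?d\<in>nat_hom R R G1 G0" "?a\<in>nat_hom R R G0 taut_functor" "?b\<in>nat_hom R R I G1"
    by (rule nat_hom_compose[OF dj k0 G1] nat_hom_compose[OF j0 a_nat G0] nat_hom_compose[OF b_nat k1 I_pointed])+
  note c0 = lin_homD(1)[OF nat_hom_lin[OF j0]] and c1 = lin_homD(1)[OF nat_hom_lin[OF j1]]
    and c0' = lin_homD(1)[OF nat_hom_lin[OF k0]] and c1' = lin_homD(1)[OF nat_hom_lin[OF k1]]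
    and cd = add_hom.hom_closed[OF d_hom] and cb = add_hom.hom_closed[OF b_hom]
  have E': "el_ext_of R M ?E"
    unfolding is_el_ext_def el_ext.simps
  proof (intro conjI ballI G0 G1 nat)
    fix V assume V: "V\<in>Proj"
    have z0: "k0 V x = \<zero>[fobj G0 V] \<longleftrightarrow> x = \<zero>[E0 V]" if "x\<in>carrier (E0 V)" for x
      using add_hom.hom_zero[OF nat_hom_hom[OF k0 C0_pointed G0 V]] add_hom.hom_zero[OF nat_hom_hom[OF j0 G0 C0_pointed V]]
        jk0[OF V that] by metis
    show "inj_on (?b V) (pts I V)"
    proof (rule inj_onI)
      fix s t assume st: "s\<in>pts I V" "t\<in>pts I V" "?b V s = ?b V t"
      then have "k1 V (b V s) = k1 V (b V t)" using V by simp
      from arg_cong[OF this, of "j1 V"] have "b V s = b V t"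
        unfolding jk1[OF V cb[OF V st(1)]] jk1[OF V cb[OF V st(2)]] .
      then show "s = t" by (rule b_inj[OF V st(1,2)])
    qed
    show "?b V ` pts I V = a_kernel (fobj G1 V) (fobj G0 V) (?d V)"
    proof (rule antisym; rule subsetI)
      fix y assume "y\<in>?b V ` pts I V"
      then obtain t where t: "t\<in>pts I V" "y = k1 V (b V t)" using V by auto
      then show "y\<in>a_kernel (fobj G1 V) (fobj G0 V) (?d V)"
        using V by (simp add: in_a_kernel c1' cb jk1 d_b z0 abelian_groupE(2)[OF E0_abelian])
    next
      fix y assume "y\<in>a_kernel (fobj G1 V) (fobj G0 V) (?d V)"
      then have y: "y\<in>pts G1 V" "d V (j1 V y) = \<zero>[E0 V]" using V by (auto simp: in_a_kernel z0 c1 cd)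
      obtain t where t: "t\<in>pts I V" "j1 V y = b V t" using d_kernel[OF V c1[OF V y(1)] y(2)] by auto
      then have "y = ?b V t" using V kj1[OF V y(1)] by simp
      then show "y\<in>?b V ` pts I V" using t(1) by (simp only: imageI)
    qed
    show "?d V ` pts G1 V = a_kernel (fobj G0 V) (fobj taut_functor V) (?a V)"
    proof (rule antisym; rule subsetI)
      fix y assume "y\<in>?d V ` pts G1 V"
      then obtain x where x: "x\<in>pts G1 V" "y = k0 V (d V (j1 V x))" using V by auto
      then show "y\<in>a_kernel (fobj G0 V) (fobj taut_functor V) (?a V)"
        using V by (simp add: in_a_kernel taut_functor_def c0' cd c1 jk0 a_d)
    next
      fix y assume "y\<in>a_kernel (fobj G0 V) (fobj taut_functor V) (?a V)"
      then have y: "y\<in>pts G0 V" "a V (j0 V y) = \<zero>[V]" using V by (auto simp: in_a_kernel taut_functor_def)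
      obtain x where x: "x\<in>carrier (E1 V)" "j0 V y = d V x" using a_kernel[OF V c0[OF V y(1)] y(2)] by auto
      then have "y = ?d V (k1 V x)" using V kj0[OF V y(1)] by (simp add: c1' jk1)
      moreover have "k1 V x\<in>pts G1 V" by (rule c1'[OF V x(1)])
      ultimately show "y\<in>?d V ` pts G1 V" by (simp only: imageI)
    qed
    show "?a V ` pts G0 V = pts taut_functor V"
    proof -
      have "?a V ` pts G0 V = a V ` j0 V ` pts G0 V" using V by (auto simp: image_iff)
      then show ?thesis using b0[OF V] a_image[OF V] by (simp add: bij_betw_def taut_functor_def)
    qed
  qed
  have "el_mor R R I ?E E j0 j1"
    unfolding el_mor_def using j0 j1 by (simp add: jk0 jk1 cd cb c1)
  then have "el_iso R R I ?E E" unfolding el_iso_def using b0 b1 by auto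
  then show ?thesis using E' by blast
qed

theorem splitting_copy:
  fixes E :: "('r, 'u, 'r, 'u, ('m, 'u) tens, 'x, 'y) el_ext" and D :: "('r, 'u, int, 'x, 'y, 'z) splitting"
  assumes E: "el_ext_of R M E" and D: "splits E D"
    and small: "\<And>V. V\<in>Proj \<Longrightarrow> pts (C01 D) V \<lesssim> (UNIV :: 'u set)"
  shows "\<exists>D' :: ('r, 'u, int, 'x, 'y, 'u) splitting. splits E D'"
proof -
  have "elementary R M E"
    using E by (rule elementaryI)
  then obtain \<sigma> where "split_elementary R M E D \<sigma>" using elementary.exists_generator_lift D by blast
  then interpret split_elementary R u M E D \<sigma> .
  obtain G :: "('r, 'u, int, 'u) pfunctor" and j k where G: "pointed_functor R \<Z> G"
    and j: "j\<in>nat_hom R \<Z> G (C01 D)" and k: "k\<in>nat_hom R \<Z> (C01 D) G"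
    and b: "\<And>V. V\<in>Proj \<Longrightarrow> bij_betw (j V) (pts G V) (carrier (Z V))"
    and jk: "\<And>V x. \<lbrakk>V\<in>Proj; x\<in>carrier (Z V)\<rbrakk> \<Longrightarrow> j V (k V x) = x"
    and kj: "\<And>V x. \<lbrakk>V\<in>Proj; x\<in>pts G V\<rbrakk> \<Longrightarrow> k V (j V x) = x"
    using functor_copy[OF Z_pointed small] by metis
  let ?c1 = "nat_restrict R (forget R (C1 E)) (\<lambda>V x. k V (c1 V x))" and ?c0 = "nat_restrict R G (\<lambda>V x. c0 V (j V x))"
  have nat: "?c1\<in>nat_hom R \<Z> (forget R (C1 E)) G" "?c0\<in>nat_hom R \<Z> G (forget R (C0 E))"
    by (rule nat_hom_compose[OF c1_nat k forget_pointed[OF ring C1_pointed]] nat_hom_compose[OF j c0_nat G])+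
  note cj = lin_homD(1)[OF nat_hom_lin[OF j]] and ck = lin_homD(1)[OF nat_hom_lin[OF k]]
  have "is_splitting R \<Z> (forget R I) (forget_ext R E) \<lparr>C01 = G, sc1 = ?c1, sc0 = ?c0\<rparr>"
    unfolding is_splitting_def splitting.simps forget_ext_simps forget_simps
  proof (intro conjI ballI G nat)
    fix V assume V: "V\<in>Proj"
    show "inj_on (?c1 V) (carrier (E1 V))"
    proof (rule inj_onI)
      fix x y assume xy: "x\<in>carrier (E1 V)" "y\<in>carrier (E1 V)" "?c1 V x = ?c1 V y"
      then have "k V (c1 V x) = k V (c1 V y)" using V by simp
      from arg_cong[OF this, of "j V"] have "c1 V x = c1 V y"
        unfolding jk[OF V c1_closed[OF V xy(1)]] jk[OF V c1_closed[OF V xy(2)]] .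
      then show "x = y" by (rule c1_inj[OF V xy(1,2)])
    qed
    have "?c0 V ` pts G V = c0 V ` j V ` pts G V" using V by (auto simp: image_iff)
    then show "?c0 V ` pts G V = carrier (E0 V)" using b[OF V] c0_image[OF V] by (simp add: bij_betw_def)
    show "?c0 V (?c1 V y) = d V y" if "y\<in>carrier (E1 V)" for y
      using V that by (simp add: ck c1_closed jk c0_c1)
    show "a_kernel (fobj G V) (fobj (forget R (C0 E)) V) (?c0 V) = ?c1 V ` b V ` pts I V"
    proof (rule antisym; rule subsetI)
      fix y assume "y\<in>a_kernel (fobj G V) (fobj (forget R (C0 E)) V) (?c0 V)"
      then have y: "y\<in>pts G V" "c0 V (j V y) = \<zero>[E0 V]" using V by (auto simp: in_a_kernel)
      obtain t where t: "t\<in>pts I V" "j V y = c1 V (b V t)" using c0_kernel[OF V cj[OF V y(1)] y(2)] by auto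
      then have "y = ?c1 V (b V t)" using V kj[OF V y(1)] by (simp add: b_closed)
      then show "y\<in>?c1 V ` b V ` pts I V" using t(1) by (simp only: imageI)
    next
      fix y assume "y\<in>?c1 V ` b V ` pts I V"
      then obtain t where t: "t\<in>pts I V" "y = k V (c1 V (b V t))" using V by (auto simp: b_closed)
      then show "y\<in>a_kernel (fobj G V) (fobj (forget R (C0 E)) V) (?c0 V)"
        using V by (simp add: in_a_kernel ck c1_closed b_closed jk c0_c1 d_b)
    qed
  qed
  then show ?thesis by blast
qed

text \<open>The splitting built from a cocycle has pairs as elements; an infinite universe contains
  a copy of its own square.\<close>

theorem splitting_in_universe:
  fixes E :: "('r, 'u, 'r, 'u, ('m, 'u) tens, 'u, 'u) el_ext"
  assumes E: "el_ext_of R M E"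
  shows "\<exists>D :: ('r, 'u) u_split. splits E D"
proof -
  interpret el: elementary R u M E
    using E by (rule elementaryI)
  obtain D :: "('r, 'u, int, 'u, 'u, 'u \<times> 'u) splitting" where D: "splits E D"
    using el.splitting_exists by blast
  have "(UNIV :: 'u set) \<times> (UNIV :: 'u set) \<lesssim> (UNIV :: 'u set)" by (rule times_lepoll_infinite[OF inf]) auto
  then have "A \<lesssim> (UNIV :: 'u set)" for A :: "('u \<times> 'u) set"
    by (rule lepoll_trans[OF subset_imp_lepoll, rotated]) auto
  then show ?thesis by (intro splitting_copy[OF E D])
qed

text \<open>A set-theoretic section of \<open>q\<close> shows that the ring is no larger than the
  product of \<open>R\<close> and \<open>M\<close>, so that it embeds into the universe.\<close>

theorem sq_ext_copy:
  fixes X :: "('r, 'm, 'x) sq_ext"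
  assumes X: "is_sq_ext R M X" and small_M: "carrier M \<lesssim> (UNIV :: 'u set)"
  shows "\<exists>Y :: ('r, 'm, 'u) sq_ext. is_sq_ext R M Y \<and> sq_iso M Y X"
proof -
  interpret X: ring "sq_ring X" using X by (simp add: is_sq_ext_def)
  let ?X = "sq_ring X"
  have q: "sq_q X\<in>ring_hom ?X R" and qs: "sq_q X ` carrier ?X = carrier R"
    and ker: "sq_i X ` carrier M = a_kernel ?X R (sq_q X)"
    and i: "sq_i X\<in>hom (add_monoid M) (add_monoid ?X)" and i_inj: "inj_on (sq_i X) (carrier M)"
    and im: "\<And>m x. \<lbrakk>m\<in>carrier M; x\<in>carrier ?X\<rbrakk> \<Longrightarrow> sq_i X m \<otimes>[?X] x = sq_i X (ract M m (sq_q X x)) \<and>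
        x \<otimes>[?X] sq_i X m = sq_i X (sq_q X x \<odot>[M] m)"
    and ii: "\<And>m m'. \<lbrakk>m\<in>carrier M; m'\<in>carrier M\<rbrakk> \<Longrightarrow> sq_i X m \<otimes>[?X] sq_i X m' = \<zero>[?X]"
    using X by (auto simp: is_sq_ext_def)
  interpret q: add_hom ?X R "sq_q X"
    by (rule add_homI) (use X.is_abelian_group R.is_abelian_group ring_hom_memE[OF q] in auto)
  have ic: "sq_i X m\<in>carrier ?X" if "m\<in>carrier M" for m using i that by (auto simp: hom_def)
  have "carrier ?X \<lesssim> (UNIV :: 'u set)"
  proof -
    let ?s = "\<lambda>r. inv_into (carrier ?X) (sq_q X) r"
    have s: "?s r\<in>carrier ?X" "sq_q X (?s r) = r" if "r\<in>carrier R" for r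
      using that inv_into_into[of r "sq_q X" "carrier ?X"] f_inv_into_f[of r "sq_q X" "carrier ?X"] qs by auto
    have "carrier ?X \<subseteq> (\<lambda>(r, m). ?s r \<oplus>[?X] sq_i X m) ` (carrier R \<times> carrier M)"
    proof
      fix x assume x: "x\<in>carrier ?X"
      note sx = s[OF q.hom_closed[OF x]]
      have "x \<ominus>[?X] ?s (sq_q X x)\<in>sq_i X ` carrier M"
        unfolding ker in_a_kernel using x sx by (simp add: q.hom_minus R.minus_eq R.r_neg)
      then obtain m where m: "m\<in>carrier M" "x \<ominus>[?X] ?s (sq_q X x) = sq_i X m" by auto
      then have "x = ?s (sq_q X x) \<oplus>[?X] sq_i X m" using x sx by (simp add: X.group_simps flip: m(2))
      then show "x\<in>(\<lambda>(r, m). ?s r \<oplus>[?X] sq_i X m) ` (carrier R \<times> carrier M)"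
        using m(1) q.hom_closed[OF x] by (intro image_eqI[of _ _ "(sq_q X x, m)"]) auto
    qed
    then have "carrier ?X \<lesssim> carrier R \<times> carrier M" by (rule subset_image_lepoll)
    also have "carrier R \<times> carrier M \<lesssim> (UNIV :: 'u set)" by (rule times_lepoll_infinite[OF inf small small_M])
    finally show ?thesis .
  qed
  then obtain e :: "'x \<Rightarrow> 'u" where e: "inj_on e (carrier ?X)" unfolding lepoll_def by blast
  let ?e = "the_inv_into (carrier ?X) e"
  have l: "?e (e x) = x" if "x\<in>carrier ?X" for x using e that by (rule the_inv_into_f_f)
  let ?Y = "\<lparr>carrier = e ` carrier ?X, monoid.mult = (\<lambda>x y. e (?e x \<otimes>[?X] ?e y)), one = e \<one>[?X],
    ring.zero = e \<zero>[?X], ring.add = (\<lambda>x y. e (?e x \<oplus>[?X] ?e y))\<rparr>"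
  have eiso: "e\<in>ring_iso ?X ?Y"
    by (rule ring_iso_memI) (auto simp: l e bij_betw_def)
  then have ringY: "ring ?Y" using X.ring_iso_imp_img_ring[OF eiso] by simp
  let ?S = "\<lparr>sq_ring = ?Y, sq_i = (\<lambda>m. e (sq_i X m)), sq_q = (\<lambda>y. sq_q X (?e y))\<rparr>"
  have Y: "is_sq_ext R M ?S"
    unfolding is_sq_ext_def sq_ext.simps
  proof (intro conjI ballI ringY)
    show "(\<lambda>m. e (sq_i X m))\<in>hom (add_monoid M) (add_monoid ?Y)"
      using i ic by (auto simp: hom_def l)
    show "(\<lambda>y. sq_q X (?e y))\<in>ring_hom ?Y R"
      using ring_hom_memE[OF q] by (auto intro!: ring_hom_memI simp: l)
    show "inj_on (\<lambda>m. e (sq_i X m)) (carrier M)"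
      using i_inj e ic by (auto simp: inj_on_def)
    show "(\<lambda>y. sq_q X (?e y)) ` carrier ?Y = carrier R"
      unfolding qs[symmetric] by (auto simp: l image_iff)
    have "(\<lambda>m. e (sq_i X m)) ` carrier M = e ` a_kernel ?X R (sq_q X)"
      unfolding ker[symmetric] by auto
    then show "(\<lambda>m. e (sq_i X m)) ` carrier M = a_kernel ?Y R (\<lambda>y. sq_q X (?e y))"
      by (auto simp: in_a_kernel l)
  next
    fix m y assume m: "m\<in>carrier M" and "y\<in>carrier ?Y"
    then obtain x where x: "x\<in>carrier ?X" "y = e x" by auto
    show "e (sq_i X m) \<otimes>[?Y] y = e (sq_i X (ract M m (sq_q X (?e y))))"
      "y \<otimes>[?Y] e (sq_i X m) = e (sq_i X (sq_q X (?e y) \<odot>[M] m))"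
      using im[OF m x(1)] x ic[OF m] by (simp_all add: l)
  next
    fix m n assume "m\<in>carrier M" "n\<in>carrier M"
    then show "e (sq_i X m) \<otimes>[?Y] e (sq_i X n) = \<zero>[?Y]" using ii ic by (simp add: l)
  qed
  moreover have "sq_iso M X ?S"
    unfolding sq_iso_def using eiso by (intro bexI[of _ e]) (auto simp: l)
  then have "sq_iso M ?S X" by (rule sq_iso_sym[OF X])
  ultimately show ?thesis by blast
qed

end

subsection \<open>The truncated complex of a projective resolution\<close>

text \<open>The sums of products \<open>j h\<close>, with \<open>j\<close> in \<open>J\<close> and
  \<open>h\<close> in \<open>H\<close>. With the ideal \<open>i(M)\<close> for \<open>J\<close> this
  gives the submodules \<open>M N\<close> and \<open>M Ker \<epsilon>\<close>; the inductive form
  provides the induction over such sums.\<close>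

inductive_set mspan :: "('t, 'v) module \<Rightarrow> 't set \<Rightarrow> 'v set \<Rightarrow> 'v set"
  for N :: "('t, 'v) module" and J :: "'t set" and H :: "'v set" where
  zero: "\<zero>[N]\<in>mspan N J H"
| step: "\<lbrakk>y\<in>mspan N J H; j\<in>J; h\<in>H\<rbrakk> \<Longrightarrow> y \<oplus>[N] j \<odot>[N] h\<in>mspan N J H"

context
  fixes T :: "'t ring" and N :: "('t, 'v) module" and J :: "'t set" and H :: "'v set"
  assumes N: "left_module T N" and J: "J \<subseteq> carrier T" and H: "H \<subseteq> carrier N"
begin

interpretation N: abelian_group N using N by (rule lm_abelian)

lemma mspan_closed: "y\<in>mspan N J H \<Longrightarrow> y\<in>carrier N"
  by (induction rule: mspan.induct) (auto intro: left_module.smult_closed[OF N] subsetD[OF J] subsetD[OF H])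

lemma mspan_incl: "\<lbrakk>j\<in>J; h\<in>H\<rbrakk> \<Longrightarrow> j \<odot>[N] h\<in>mspan N J H"
  using mspan.step[OF mspan.zero, of j J h H N] left_module.smult_closed[OF N subsetD[OF J] subsetD[OF H], of j h] by simp

lemma mspan_add: "\<lbrakk>y\<in>mspan N J H; x\<in>mspan N J H\<rbrakk> \<Longrightarrow> x \<oplus>[N] y\<in>mspan N J H"
proof (induction rule: mspan.induct)
  case zero
  then show ?case by (simp add: mspan_closed)
next
  case (step y j h)
  then have "j \<odot>[N] h\<in>carrier N" using left_module.smult_closed[OF N subsetD[OF J] subsetD[OF H]] by simp
  then show ?case
    using mspan.step[OF step.IH[OF step.prems] step.hyps(2,3)] mspan_closed[OF step.prems] mspan_closed[OF step.hyps(1)]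
    by (simp add: N.a_assoc)
qed

lemma mspan_submodule:
  assumes "\<And>x j h. \<lbrakk>x\<in>carrier T; j\<in>J; h\<in>H\<rbrakk> \<Longrightarrow> x \<otimes>[T] j\<in>J"
  shows "submodule_of T N (mspan N J H)"
  unfolding submodule_of_def
proof (intro conjI ballI)
  show "mspan N J H \<subseteq> carrier N" using mspan_closed by blast
  fix r y assume r: "r\<in>carrier T" and "y\<in>mspan N J H"
  from this(2) show "r \<odot>[N] y\<in>mspan N J H"
  proof (induction rule: mspan.induct)
    case zero
    then show ?case using lm_smult_zero[OF N r] mspan.zero by metis
  next
    case (step y j h)
    have c: "j\<in>carrier T" "h\<in>carrier N" "j \<odot>[N] h\<in>carrier N"
      using step(2,3) left_module.smult_closed[OF N] subsetD[OF J] subsetD[OF H] by auto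
    have "r \<odot>[N] (y \<oplus>[N] j \<odot>[N] h) = r \<odot>[N] y \<oplus>[N] (r \<otimes>[T] j) \<odot>[N] h"
      using step r c mspan_closed by (simp add: left_module.smult_r_distr[OF N] left_module.smult_assoc[OF N])
    then show ?case using mspan.step[of "r \<odot>[N] y" N J H "r \<otimes>[T] j" h] step r assms by simp
  qed
qed (simp_all add: mspan.zero mspan_add)

end

section \<open>Modules over a square-zero extension and their reduction to \<open>R\<close>\<close>

locale square_zero = bimodule_universe R u M
  for R :: "'r ring" and u :: "'u itself" and M :: "('r, 'r, 'm) bimodule" +
  fixes X :: "('r, 'm, 'u) sq_ext"
  assumes X: "is_sq_ext R M X"
begin

abbreviation "T \<equiv> sq_ring X"
abbreviation "i \<equiv> sq_i X"
abbreviation "q \<equiv> sq_q X"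

lemma T_ring: "ring T" and q_ring_hom: "q\<in>ring_hom T R" and q_image: "q ` carrier T = carrier R"
  and i_image: "i ` carrier M = a_kernel T R q" and i_inj: "inj_on i (carrier M)"
  using X by (auto simp: is_sq_ext_def)

sublocale T: ring T by (rule T_ring)

lemma q_closed: "x\<in>carrier T \<Longrightarrow> q x\<in>carrier R" and q_mult: "\<lbrakk>x\<in>carrier T; y\<in>carrier T\<rbrakk> \<Longrightarrow> q (x \<otimes>[T] y) = q x \<otimes>[R] q y"
  and q_one: "q \<one>[T] = \<one>[R]" and q_add: "\<lbrakk>x\<in>carrier T; y\<in>carrier T\<rbrakk> \<Longrightarrow> q (x \<oplus>[T] y) = q x \<oplus>[R] q y"
  using ring_hom_memE[OF q_ring_hom] by auto

lemma q_hom: "add_hom T R q"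
  by (rule add_homI[OF T.is_abelian_group R.is_abelian_group]) (auto simp: q_closed q_add)

lemma i_hom: "add_hom M T i"
  by (rule add_homI[OF M.M.abelian_group_axioms T.is_abelian_group])
    (use X in \<open>auto simp: is_sq_ext_def hom_def\<close>)

lemma i_closed: "m\<in>carrier M \<Longrightarrow> i m\<in>carrier T"
  using add_hom.hom_closed[OF i_hom] .

lemma i_mult: "\<lbrakk>m\<in>carrier M; x\<in>carrier T\<rbrakk> \<Longrightarrow> i m \<otimes>[T] x = i (ract M m (q x))"
  "\<lbrakk>m\<in>carrier M; x\<in>carrier T\<rbrakk> \<Longrightarrow> x \<otimes>[T] i m = i (q x \<odot>[M] m)"
  using X by (auto simp: is_sq_ext_def)

lemma q_i: "m\<in>carrier M \<Longrightarrow> q (i m) = \<zero>[R]"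
  using imageI[of m "carrier M" i, unfolded i_image] by (simp add: in_a_kernel)

lemma q_lift: "r\<in>carrier R \<Longrightarrow> \<exists>x\<in>carrier T. q x = r"
  using q_image by (metis imageE)

lemma q_eq:
  assumes "x\<in>carrier T" "y\<in>carrier T" "q x = q y"
  obtains m where "m\<in>carrier M" "x \<ominus>[T] y = i m"
proof -
  have "x \<ominus>[T] y\<in>i ` carrier M"
    unfolding i_image in_a_kernel using assms add_hom.hom_minus[OF q_hom assms(1,2)]
    by (simp add: q_closed R.minus_eq R.r_neg)
  then show thesis using that by auto
qed

abbreviation "iM \<equiv> i ` carrier M"

lemma iM_ideal: "iM \<subseteq> carrier T" "\<lbrakk>x\<in>carrier T; j\<in>iM\<rbrakk> \<Longrightarrow> x \<otimes>[T] j\<in>iM"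
  by (auto simp: i_closed i_mult intro!: imageI M.smult_closed q_closed)

lemma R_via: "bimodule R T (R_via R X)"
  by (rule bimodule_restrict_right[OF T_ring q_ring_hom bimodule_self[OF ring]])

lemma M_via: "bimodule R T (M_via M X)"
  by (rule bimodule_restrict_right[OF T_ring q_ring_hom bimod])

lemma via_simps: "carrier (R_via R X) = carrier R" "ract (R_via R X) r x = r \<otimes>[R] q x" "s \<odot>[R_via R X] r = s \<otimes>[R] r"
  "x' \<oplus>[R_via R X] y' = x' \<oplus>[R] y'" "\<zero>[R_via R X] = \<zero>[R]"
  "carrier (M_via M X) = carrier M" "ract (M_via M X) m x = ract M m (q x)" "m \<oplus>[M_via M X] n = m \<oplus>[M] n"
  by (simp_all add: restrict_right_def self_bimodule_def)

context
  fixes N :: "('u, 'v) module" assumes N: "left_module T N"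
begin

interpretation N: abelian_group N using N by (rule lm_abelian)
interpretation RN: tensor_product R T "R_via R X" N using R_via N by (rule tensor_product.intro)

abbreviation unit_tens where "unit_tens \<equiv> tens T (R_via R X) N \<one>[R]"

lemma unit_tens_hom: "add_hom N RN.TG unit_tens"
  by (rule RN.tens_hom_right) (simp add: via_simps)

lemma unit_tens_scalar: "\<lbrakk>x\<in>carrier T; n\<in>carrier N\<rbrakk> \<Longrightarrow> tens T (R_via R X) N (q x) n = unit_tens (x \<odot>[N] n)"
  using RN.tens_ract[of "\<one>[R]" x n] by (simp add: via_simps q_closed)

lemma unit_tens_smult: "\<lbrakk>x\<in>carrier T; n\<in>carrier N\<rbrakk> \<Longrightarrow> q x \<odot>[RN.TM] unit_tens n = unit_tens (x \<odot>[N] n)"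
  using RN.tensor_smult_tens[of "q x" "\<one>[R]" n] by (simp add: via_simps q_closed unit_tens_scalar)

text \<open>For any \<open>x\<close> over \<open>r\<close> one has
  \<open>r \<otimes> n = 1 \<otimes> x n\<close>.\<close>

lemma unit_tens_surj: "unit_tens ` carrier N = carrier RN.TG"
proof (rule antisym; rule subsetI)
  fix Z assume "Z\<in>carrier RN.TG"
  then show "Z\<in>unit_tens ` carrier N"
  proof (induction rule: RN.TG_induct)
    case (tens r n)
    then obtain x where "x\<in>carrier T" "q x = r" using q_lift by (auto simp: via_simps)
    then show ?case using unit_tens_scalar[of x n] tens left_module.smult_closed[OF N] by auto
  next
    case (add Y Z)
    then show ?case using add_hom.hom_add[OF unit_tens_hom, symmetric] by auto
  qed
qed (use add_hom.hom_closed[OF unit_tens_hom] in auto)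

text \<open>This identifies \<open>R \<otimes> N\<close> with \<open>N / M N\<close>. For the harder
  direction a map from the tensor product to the quotient is constructed from lifts of
  scalars.\<close>

lemma unit_tens_kernel:
  assumes n: "n\<in>carrier N"
  shows "unit_tens n = \<zero>[RN.TG] \<longleftrightarrow> n\<in>mspan N iM (carrier N)"
proof
  assume "n\<in>mspan N iM (carrier N)"
  then show "unit_tens n = \<zero>[RN.TG]"
  proof (induction rule: mspan.induct)
    case zero
    show ?case by (rule add_hom.hom_zero[OF unit_tens_hom])
  next
    case (step y j h)
    then obtain m where m: "m\<in>carrier M" "j = i m" by auto
    have y: "y\<in>carrier N" using mspan_closed[OF N iM_ideal(1) subset_refl step(1)] .
    have z: "unit_tens (j \<odot>[N] h) = \<zero>[RN.TG]"
      using unit_tens_scalar[of "i m" h] RN.tens_zero_left[of h] m step(3) by (simp add: i_closed q_i via_simps)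
    show ?case
      using add_hom.hom_add[OF unit_tens_hom y, of "j \<odot>[N] h"] m step z left_module.smult_closed[OF N] i_closed by auto
  qed
next
  assume z: "unit_tens n = \<zero>[RN.TG]"
  let ?S = "mspan N iM (carrier N)"
  have "submodule_of T N ?S" by (rule mspan_submodule[OF N iM_ideal(1) subset_refl]) (rule iM_ideal(2))
  with N interpret Q: quotient_of T N ?S by (rule quotient_of.intro)
  \<comment> \<open>A section of \<open>q\<close> as a map of sets. By \<open>wd\<close> the choice
    of lift does not matter modulo \<open>M N\<close>, which is what makes the pairing
    balanced.\<close>
  obtain l where l: "\<And>r. r\<in>carrier R \<Longrightarrow> l r\<in>carrier T \<and> q (l r) = r" using q_lift by metis
  have sm: "x \<odot>[N] k\<in>carrier N" if "x\<in>carrier T" "k\<in>carrier N" for x k using left_module.smult_closed[OF N] that .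
  have wd: "Q.\<pi> (x \<odot>[N] k) = Q.\<pi> (y \<odot>[N] k)" if xy: "x\<in>carrier T" "y\<in>carrier T" "q x = q y" and k: "k\<in>carrier N" for x y k
  proof -
    obtain m where m: "m\<in>carrier M" "x \<ominus>[T] y = i m" using q_eq[OF xy] .
    have "x \<odot>[N] k \<ominus>[N] y \<odot>[N] k = i m \<odot>[N] k"
      using add_hom.hom_minus[OF lm_scalar_hom[OF N k] xy(1,2)] m by simp
    then show ?thesis using m k mspan_incl[OF N iM_ideal(1) subset_refl, of "i m" k] by (simp add: Q.proj_eq_iff sm xy)
  qed
  let ?\<beta> = "\<lambda>r k. Q.\<pi> (l r \<odot>[N] k)"
  have "balanced T (R_via R X) N Q.Q ?\<beta>"
  proof (rule balancedI; unfold via_simps)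
    fix r s k assume rs: "r\<in>carrier R" "s\<in>carrier R" and k: "k\<in>carrier N"
    have "Q.\<pi> (l (r \<oplus>[R] s) \<odot>[N] k) = Q.\<pi> ((l r \<oplus>[T] l s) \<odot>[N] k)"
      using l[OF rs(1)] l[OF rs(2)] l[of "r \<oplus>[R] s"] rs by (intro wd k) (auto simp: q_add)
    also have "\<dots> = ?\<beta> r k \<oplus>[Q.Q] ?\<beta> s k"
      using l[OF rs(1)] l[OF rs(2)] k by (simp add: left_module.smult_l_distr[OF N] Q.add_Q sm)
    finally show "?\<beta> (r \<oplus>[R] s) k = ?\<beta> r k \<oplus>[Q.Q] ?\<beta> s k" .
  next
    fix r x k assume r: "r\<in>carrier R" and x: "x\<in>carrier T" and k: "k\<in>carrier N"
    have "Q.\<pi> (l (r \<otimes>[R] q x) \<odot>[N] k) = Q.\<pi> ((l r \<otimes>[T] x) \<odot>[N] k)"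
      using l[OF r] l[of "r \<otimes>[R] q x"] r x by (intro wd k) (auto simp: q_mult q_closed)
    then show "?\<beta> (r \<otimes>[R] q x) k = ?\<beta> r (x \<odot>[N] k)" using l[OF r] x k by (simp add: left_module.smult_assoc[OF N])
  qed (use l in \<open>auto simp: Q.carrier_Q Q.add_Q sm left_module.smult_r_distr[OF N]\<close>)
  note lf = RN.tensor_lift_hom[OF Q.Q_abelian this] RN.tensor_lift_tens[OF Q.Q_abelian this, of "\<one>[R]" n]
  have "Q.\<pi> (l \<one>[R] \<odot>[N] n) = Q.\<pi> (\<one>[T] \<odot>[N] n)" using l[of "\<one>[R]"] by (intro wd n) (auto simp: q_one)
  then have "Q.\<pi> n = \<zero>[Q.Q]"
    using lf(2) z add_hom.hom_zero[OF lf(1)] n by (simp add: via_simps left_module.smult_one[OF N])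
  then show "n\<in>?S" using Q.proj_zero_iff[OF n] by simp
qed

end

end

section \<open>The start of a resolution and its connecting map\<close>

locale tau_complex = square_zero R u M X
  for R :: "'r ring" and u :: "'u itself" and M :: "('r, 'r, 'm) bimodule" and X :: "('r, 'm, 'u) sq_ext" +
  fixes P :: "('r, 'u) u_res"
  assumes P: "projective_resolution R T (q_star X taut_functor) P"
begin

abbreviation "P0 V \<equiv> fobj (rP P 0) V"
abbreviation "P1 V \<equiv> fobj (rP P (Suc 0)) V"
abbreviation "P2 V \<equiv> fobj (rP P 2) V"
abbreviation "\<epsilon> \<equiv> raug P"
abbreviation "d \<equiv> rd P 0"
abbreviation "d2 \<equiv> rd P (Suc 0)"

lemma P_projective: "projective_functor R T (rP P n)"
  using P by (simp add: projective_resolution_def)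

lemma P_pointed: "pointed_functor R T (rP P n)"
  using P_projective by (simp add: projective_functor_def)

lemma d_nat: "d\<in>nat_hom R T (rP P (Suc 0)) (rP P 0)" and d2_nat: "d2\<in>nat_hom R T (rP P 2) (rP P (Suc 0))"
  and \<epsilon>_nat: "\<epsilon>\<in>nat_hom R T (rP P 0) (q_star X taut_functor)"
  using P by (auto simp: projective_resolution_def numeral_2_eq_2)

lemma V_via: "V\<in>Proj \<Longrightarrow> left_module T (restrict_scalars q V)"
  by (rule lm_restrict[OF T_ring q_ring_hom fgp_module])

lemma \<epsilon>_natural: "\<lbrakk>V\<in>Proj; W\<in>Proj; f\<in>lin_hom R V W; p\<in>carrier (P0 V)\<rbrakk> \<Longrightarrow>
    \<epsilon> W (fmap (rP P 0) V W f p) = f (\<epsilon> V p)"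
  using nat_hom_natural[OF \<epsilon>_nat] by (simp add: q_star_def restrict_functor_def taut_functor_def)

text \<open>The inverse of \<open>b\<close> on boundaries: \<open>\<Sum> i(m) p\<close> corresponds to \<open>\<Sum> m \<otimes> \<epsilon>(p)\<close>.\<close>

inductive_set graph :: "('r, 'u) module \<Rightarrow> ('u \<times> ('m, 'u) tens) set" for V where
  zero: "(\<zero>[P0 V], \<zero>[tensor R M V])\<in>graph V"
| step: "\<lbrakk>(y, t)\<in>graph V; m\<in>carrier M; p\<in>carrier (P0 V)\<rbrakk> \<Longrightarrow>
    (y \<oplus>[P0 V] i m \<odot>[P0 V] p, t \<oplus>[tensor R M V] tens R M V m (\<epsilon> V p))\<in>graph V"

abbreviation "K V \<equiv> a_kernel (P0 V) V (\<epsilon> V)"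
abbreviation "MK V \<equiv> mspan (P0 V) iM (K V)"

context
  fixes V :: "('r, 'u) module" assumes V: "V\<in>Proj"
begin

lemma P_module: "left_module T (fobj (rP P n) V)" by (rule functor_obj[OF P_pointed V])
lemma P_abelian: "abelian_group (fobj (rP P n) V)" by (rule functor_abelian[OF P_pointed V])
lemma V_ab: "abelian_group V" by (rule lm_abelian[OF fgp_module[OF V]])

lemma d_hom: "add_hom (P1 V) (P0 V) (d V)" and d2_hom: "add_hom (P2 V) (P1 V) (d2 V)"
  using nat_hom_hom[OF d_nat P_pointed P_pointed V] nat_hom_hom[OF d2_nat P_pointed P_pointed V] .

lemma \<epsilon>_lin: "\<epsilon> V\<in>lin_hom T (P0 V) (restrict_scalars q V)"
  using nat_hom_lin[OF \<epsilon>_nat V] by (simp add: q_star_def restrict_functor_def taut_functor_def)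

lemma \<epsilon>_closed: "p\<in>carrier (P0 V) \<Longrightarrow> \<epsilon> V p\<in>carrier V"
  and \<epsilon>_smult: "\<lbrakk>x\<in>carrier T; p\<in>carrier (P0 V)\<rbrakk> \<Longrightarrow> \<epsilon> V (x \<odot>[P0 V] p) = q x \<odot>[V] \<epsilon> V p"
  using lin_homD(1,4)[OF \<epsilon>_lin] by simp_all

lemma \<epsilon>_hom: "add_hom (P0 V) V (\<epsilon> V)"
  by (rule add_homI[OF P_abelian V_ab]) (use lin_homD(1,3)[OF \<epsilon>_lin] in auto)

lemma \<epsilon>_image: "\<epsilon> V ` carrier (P0 V) = carrier V" and d_image: "d V ` carrier (P1 V) = K V"
  and d2_image: "d2 V ` carrier (P2 V) = a_kernel (P1 V) (P0 V) (d V)"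
  using P V by (auto simp: projective_resolution_def q_star_def restrict_functor_def taut_functor_def
    a_kernel_def' numeral_2_eq_2 dest!: bspec[of _ _ V])

interpretation V: abelian_group V by (rule V_ab)
interpretation P0: abelian_group "P0 V" by (rule P_abelian)
interpretation P1: abelian_group "P1 V" by (rule P_abelian)
interpretation d: add_hom "P1 V" "P0 V" "d V" by (rule d_hom)
interpretation d2: add_hom "P2 V" "P1 V" "d2 V" by (rule d2_hom)
interpretation \<epsilon>: add_hom "P0 V" V "\<epsilon> V" by (rule \<epsilon>_hom)
interpretation MV: tensor_product R R M V by (rule tensor_M[OF V])

lemma P_smult: "\<lbrakk>x\<in>carrier T; p\<in>pts (rP P n) V\<rbrakk> \<Longrightarrow> x \<odot>[fobj (rP P n) V] p\<in>pts (rP P n) V"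
  by (rule left_module.smult_closed[OF P_module])

lemma iM_smult: "\<lbrakk>m\<in>carrier M; p\<in>pts (rP P n) V\<rbrakk> \<Longrightarrow> i m \<odot>[fobj (rP P n) V] p\<in>pts (rP P n) V"
  by (rule P_smult[OF i_closed])

lemma \<epsilon>_iM: "\<lbrakk>m\<in>carrier M; p\<in>carrier (P0 V)\<rbrakk> \<Longrightarrow> \<epsilon> V (i m \<odot>[P0 V] p) = \<zero>[V]"
  by (simp add: \<epsilon>_smult i_closed q_i lm_zero_smult[OF fgp_module[OF V]] \<epsilon>_closed)

lemma K_sub: "K V \<subseteq> carrier (P0 V)"
  by (auto simp: in_a_kernel)

lemma MK_submodule: "submodule_of T (P0 V) (MK V)"
  by (rule mspan_submodule[OF P_module iM_ideal(1) K_sub]) (rule iM_ideal(2))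

lemma graph_closed: "(y, t)\<in>graph V \<Longrightarrow> y\<in>carrier (P0 V) \<and> t\<in>carrier MV.TG"
  by (induction rule: graph.induct) (auto simp: iM_smult MV.tens_closed \<epsilon>_closed)

lemma graph_gen: "\<lbrakk>m\<in>carrier M; p\<in>carrier (P0 V)\<rbrakk> \<Longrightarrow> (i m \<odot>[P0 V] p, tens R M V m (\<epsilon> V p))\<in>graph V"
  using graph.step[OF graph.zero, of m p V] by (simp add: iM_smult MV.tens_closed \<epsilon>_closed)

lemma graph_add: "\<lbrakk>(z, s)\<in>graph V; (y, t)\<in>graph V\<rbrakk> \<Longrightarrow> (y \<oplus>[P0 V] z, t \<oplus>[MV.TM] s)\<in>graph V"
proof (induction rule: graph.induct)
  case zero
  then show ?case using graph_closed[OF zero] by simp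
next
  case (step z s m p)
  then show ?case
    using graph.step[OF step.IH[OF step.prems] step.hyps(2,3)] graph_closed[OF step.prems] graph_closed[OF step.hyps(1)]
    by (simp add: iM_smult MV.tens_closed \<epsilon>_closed P0.a_assoc MV.TG.a_assoc)
qed

lemma graph_smult: "\<lbrakk>(y, t)\<in>graph V; x\<in>carrier T\<rbrakk> \<Longrightarrow> (x \<odot>[P0 V] y, q x \<odot>[MV.TM] t)\<in>graph V"
proof (induction rule: graph.induct)
  case zero
  then show ?case
    using graph.zero[of V] lm_smult_zero[OF P_module zero] lm_smult_zero[OF MV.tensor_left_module q_closed[OF zero]]
    by (simp add: MV.tensor_simps)
next
  case (step y t m p)
  have "(x \<odot>[P0 V] (i m \<odot>[P0 V] p), q x \<odot>[MV.TM] tens R M V m (\<epsilon> V p))\<in>graph V"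
    using graph_gen[of "q x \<odot>[M] m" p] step
    by (simp add: MV.tensor_smult_tens q_closed \<epsilon>_closed M.smult_closed i_mult(2)[symmetric] left_module.smult_assoc[OF P_module] i_closed)
  then show ?case
    using graph_add[OF _ step.IH[OF step.prems]] step graph_closed[OF step.hyps(1)] add_hom.hom_add[OF MV.tensor_smult_hom[OF q_closed]]
    by (simp add: left_module.smult_r_distr[OF P_module] iM_smult MV.tens_closed \<epsilon>_closed)
qed

lemma graph_neg: "(y, t)\<in>graph V \<Longrightarrow> (\<ominus>[P0 V] y, \<ominus>[MV.TG] t)\<in>graph V"
proof -
  assume g: "(y, t)\<in>graph V"
  note c = graph_closed[OF g]
  interpret qh: add_hom T R q by (rule q_hom)
  have "(\<ominus>[T] \<one>[T]) \<odot>[P0 V] y = \<ominus>[P0 V] y"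
    using add_hom.hom_a_inv[OF lm_scalar_hom[OF P_module], of y 0 "\<one>[T]"] c
    by (simp add: left_module.smult_one[OF P_module])
  moreover have "(\<ominus>[R] \<one>[R]) \<odot>[MV.TM] t = \<ominus>[MV.TM] t"
    using add_hom.hom_a_inv[OF lm_scalar_hom[OF MV.tensor_left_module], of t "\<one>[R]"] c
    by (simp add: left_module.smult_one[OF MV.tensor_left_module])
  moreover have "\<ominus>[MV.TM] t = \<ominus>[MV.TG] t"
    by (rule abelian_group.minus_equality[OF MV.tensor_abelian]) (use c in \<open>auto simp: MV.TG.l_neg\<close>)
  ultimately show ?thesis using graph_smult[OF g, of "\<ominus>[T] \<one>[T]"] by (simp add: q_one)
qed

lemma graph_total: "t\<in>carrier MV.TG \<Longrightarrow> \<exists>y. (y, t)\<in>graph V"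
proof (induction rule: MV.TG_induct)
  case (tens m v)
  then obtain p where "p\<in>carrier (P0 V)" "\<epsilon> V p = v" using \<epsilon>_image by (metis imageE)
  then show ?case using graph_gen[OF tens(1)] by blast
next
  case (add s t)
  then show ?case using graph_add by fastforce
qed

lemma graph_in_K: "(y, t)\<in>graph V \<Longrightarrow> y\<in>K V"
  by (induction rule: graph.induct) (auto simp: in_a_kernel iM_smult \<epsilon>_iM)

lemma graph_mspan: "y\<in>mspan (P0 V) iM (carrier (P0 V)) \<Longrightarrow> \<exists>t. (y, t)\<in>graph V"
  by (induction rule: mspan.induct) (auto intro: graph.intros)

lemma mspan_graph: "(y, t)\<in>graph V \<Longrightarrow> y\<in>mspan (P0 V) iM (carrier (P0 V))"
  by (induction rule: graph.induct) (auto intro: mspan.intros)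

lemma graph_MK: "y\<in>MK V \<Longrightarrow> (y, \<zero>[MV.TM])\<in>graph V"
proof (induction rule: mspan.induct)
  case (step y j h)
  then obtain m where m: "m\<in>carrier M" "j = i m" by auto
  have "(i m \<odot>[P0 V] h, \<zero>[MV.TM])\<in>graph V"
    using graph_gen[OF m(1), of h] step(3) MV.tens_zero_right[OF m(1)] by (simp add: in_a_kernel)
  then show ?case using graph_add[OF _ step.IH] m by fastforce
qed (rule graph.zero)

text \<open>With chosen preimages \<open>l v\<close> under \<open>\<epsilon>\<close>, the class of
  \<open>i m \<odot> l v\<close> modulo \<open>M Ker \<epsilon>\<close> is balanced in
  \<open>m\<close> and \<open>v\<close>. The induced map on \<open>M \<otimes> V\<close> recovers
  the first component of a pair in the graph from the second, up to
  \<open>M Ker \<epsilon>\<close>.\<close>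

lemma graph_zero_MK:
  assumes "(y, \<zero>[MV.TM])\<in>graph V"
  shows "y\<in>MK V"
proof -
  interpret Q: quotient_of T "P0 V" "MK V" by (rule quotient_of.intro[OF P_module MK_submodule])
  have "\<exists>p\<in>carrier (P0 V). \<epsilon> V p = v" if "v\<in>carrier V" for v using \<epsilon>_image that by (metis imageE)
  then obtain l where l: "\<And>v. v\<in>carrier V \<Longrightarrow> l v\<in>carrier (P0 V) \<and> \<epsilon> V (l v) = v" by metis
  \<comment> \<open>Another preimage changes \<open>i m \<odot> p\<close> by an element of
    \<open>M Ker \<epsilon>\<close>.\<close>
  have wd: "Q.\<pi> (i m \<odot>[P0 V] p) = Q.\<pi> (i m \<odot>[P0 V] p')"
    if m: "m\<in>carrier M" and p: "p\<in>carrier (P0 V)" "p'\<in>carrier (P0 V)" "\<epsilon> V p = \<epsilon> V p'" for m p p'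
  proof -
    have "p \<ominus>[P0 V] p'\<in>K V" using p by (simp add: in_a_kernel \<epsilon>.hom_minus V.minus_eq V.r_neg \<epsilon>_closed)
    then have "i m \<odot>[P0 V] (p \<ominus>[P0 V] p')\<in>MK V" using m by (intro mspan_incl[OF P_module iM_ideal(1) K_sub]) auto
    then show ?thesis
      using p m add_hom.hom_minus[OF lm_smult_hom[OF P_module i_closed[OF m]] p(1,2)]
      by (simp add: Q.proj_eq_iff iM_smult)
  qed
  let ?\<beta> = "\<lambda>m v. Q.\<pi> (i m \<odot>[P0 V] l v)"
  interpret ih: add_hom M T i by (rule i_hom)
  have "balanced R M V Q.Q ?\<beta>"
  proof (rule balancedI)
    fix m n v assume "m\<in>carrier M" "n\<in>carrier M" "v\<in>carrier V"
    then show "?\<beta> (m \<oplus>[M] n) v = ?\<beta> m v \<oplus>[Q.Q] ?\<beta> n v"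
      using l by (simp add: left_module.smult_l_distr[OF P_module] i_closed Q.add_Q iM_smult)
  next
    fix m v w assume m: "m\<in>carrier M" and vw: "v\<in>carrier V" "w\<in>carrier V"
    have "?\<beta> m (v \<oplus>[V] w) = Q.\<pi> (i m \<odot>[P0 V] (l v \<oplus>[P0 V] l w))"
      using m vw l[OF vw(1)] l[OF vw(2)] l[of "v \<oplus>[V] w"] by (intro wd) auto
    then show "?\<beta> m (v \<oplus>[V] w) = ?\<beta> m v \<oplus>[Q.Q] ?\<beta> m w"
      using m l[OF vw(1)] l[OF vw(2)] by (simp add: left_module.smult_r_distr[OF P_module] i_closed Q.add_Q iM_smult)
  next
    fix m r v assume m: "m\<in>carrier M" and r: "r\<in>carrier R" and v: "v\<in>carrier V"
    obtain x where x: "x\<in>carrier T" "q x = r" using q_lift[OF r] by auto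
    have rv: "r \<odot>[V] v\<in>carrier V" using left_module.smult_closed[OF fgp_module[OF V] r v] .
    have "?\<beta> m (r \<odot>[V] v) = Q.\<pi> (i m \<odot>[P0 V] (x \<odot>[P0 V] l v))"
      using m x l[OF v] l[OF rv] by (intro wd) (auto simp: P_smult \<epsilon>_smult)
    then show "?\<beta> (ract M m r) v = ?\<beta> m (r \<odot>[V] v)"
      using m x l[OF v] i_mult(1)[OF m x(1)] by (simp add: left_module.smult_assoc[OF P_module, symmetric] i_closed)
  qed (use l in \<open>auto simp: Q.carrier_Q iM_smult\<close>)
  note lf = MV.tensor_lift_hom[OF Q.Q_abelian this] MV.tensor_lift_tens[OF Q.Q_abelian this]
  interpret lh: add_hom MV.TG Q.Q "tensor_lift R M V Q.Q ?\<beta>" by (rule lf(1))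
  have "Q.\<pi> y = tensor_lift R M V Q.Q ?\<beta> t" if "(y, t)\<in>graph V" for y t
    using that
  proof (induction rule: graph.induct)
    case zero
    show ?case by (simp add: Q.zero_Q[symmetric])
  next
    case (step y t m p)
    have "Q.\<pi> (i m \<odot>[P0 V] p) = ?\<beta> m (\<epsilon> V p)" using step l[of "\<epsilon> V p"] \<epsilon>_closed by (intro wd) auto
    then show ?case
      using step graph_closed[OF step.hyps(1)] by (simp add: Q.add_Q[symmetric] iM_smult MV.tens_closed \<epsilon>_closed lf(2))
  qed
  from this[OF assms] show ?thesis using graph_closed[OF assms] by (simp add: Q.proj_zero_iff)
qed

end
end

context tau_complex
begin

context
  fixes V :: "('r, 'u) module" assumes V: "V\<in>Proj"
begin

interpretation V: abelian_group V by (rule V_ab[OF V])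
interpretation P0: abelian_group "P0 V" by (rule P_abelian[OF V])
interpretation P1: abelian_group "P1 V" by (rule P_abelian[OF V])
interpretation MV: tensor_product R R M V by (rule tensor_M[OF V])
interpretation ih: add_hom M T i by (rule i_hom)

text \<open>Along a map from \<open>P\<^sub>0\<close> to a free module, the second component of an element of the graph can be
  read off the coordinates of the first one.\<close>

lemma graph_free:
  assumes \<iota>: "\<iota>\<in>lin_hom T (P0 V) (free_module T J)" and \<kappa>: "\<kappa>\<in>lin_hom T (free_module T J) (restrict_scalars q V)"
    and \<kappa>\<iota>: "\<And>p. p\<in>carrier (P0 V) \<Longrightarrow> \<kappa> (\<iota> p) = \<epsilon> V p"
    and g: "(y, t)\<in>graph V" and y: "y = \<zero>[P0 V]"
  shows "t = \<zero>[MV.TG]"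
proof -
  interpret FO: free_over T J by (rule free_over.intro[OF T_ring])
  let ?W = "restrict_scalars q V"
  note W = V_via[OF V]
  define k where "k = inv_into (carrier M) i"
  define h where "h j = \<kappa> (free_basis T J j)" for j
  have k: "k (i m) = m" if "m\<in>carrier M" for m using i_inj that by (simp add: k_def)
  have h: "h j\<in>carrier V" for j using lin_homD(1)[OF \<kappa> FO.free_basis_closed] by (simp add: h_def)
  have \<kappa>e: "\<kappa> = free_lift T J ?W h"
    by (rule FO.free_hom_eq[OF W \<kappa> FO.free_lift_lin[OF W]])
      (simp_all add: h FO.free_lift_basis[OF W], simp add: h_def)
  have th: "add_hom ?W MV.TG (tens R M V m)" if "m\<in>carrier M" for m
    by (rule add_homI[OF lm_abelian[OF W] MV.TG_abelian])
      (use that in \<open>auto simp: MV.tens_closed MV.tens_add_right\<close>)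
  \<comment> \<open>Balancedness moves the coordinates of \<open>z\<close> from \<open>V\<close> to
    the factor \<open>M\<close>.\<close>
  have t\<kappa>: "tens R M V m (\<kappa> z) = finsum MV.TG (\<lambda>j. tens R M V (ract M m (q (z j))) (h j)) A"
    if m: "m\<in>carrier M" and z: "z\<in>carrier (free_module T J)"
      and A: "finite A" "A \<subseteq> J" "{j\<in>J. z j \<noteq> \<zero>[T]} \<subseteq> A" for m z A
  proof -
    have c: "q (z j) \<odot>[V] h j\<in>carrier V" if "j\<in>A" for j
      using that A FO.free_coeff[OF z] h left_module.smult_closed[OF fgp_module[OF V]] q_closed by auto
    have "\<kappa> z = finsum ?W (\<lambda>j. z j \<odot>[?W] h j) A"
      unfolding \<kappa>e by (rule FO.free_lift_mono[OF W _ z A]) (simp add: h)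
    then have "tens R M V m (\<kappa> z) = finsum MV.TG (\<lambda>j. tens R M V m (z j \<odot>[?W] h j)) A"
      using add_hom.hom_finsum[OF th[OF m], of "\<lambda>j. z j \<odot>[?W] h j" A] c by auto
    also have "\<dots> = finsum MV.TG (\<lambda>j. tens R M V (ract M m (q (z j))) (h j)) A"
      using A FO.free_coeff[OF z]
      by (intro MV.TG.finsum_cong') (auto simp: MV.tens_ract m q_closed h intro!: MV.tens_closed M.ract_closed)
    finally show ?thesis .
  qed
  let ?c = "\<lambda>y j. tens R M V (k (\<iota> y j)) (h j)"
  \<comment> \<open>The invariant: the coordinates of \<open>y\<close> lie in \<open>i(M)\<close>,
    and \<open>t\<close> is the sum of the corresponding elements of \<open>M\<close> tensored with
    \<open>h j\<close>. It is stated for all sufficiently large finite index sets, since supports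
    vary during the induction.\<close>
  have "(\<forall>j\<in>J. \<iota> y j\<in>iM) \<and> (\<exists>A. finite A \<and> A \<subseteq> J \<and> (\<forall>B. finite B \<longrightarrow> A \<subseteq> B \<longrightarrow> B \<subseteq> J \<longrightarrow> t = finsum MV.TG (?c y) B))"
    using g
  proof (induction rule: graph.induct)
    case zero
    have "\<iota> \<zero>[P0 V] = \<zero>[free_module T J]"
      by (rule add_hom.hom_zero[OF lin_add_hom[OF \<iota> P_module[OF V] FO.free_left_module]])
    then have z: "\<iota> \<zero>[P0 V] j = i \<zero>[M]" if "j\<in>J" for j using that by (simp add: FO.free_simps)
    have "finsum MV.TG (?c \<zero>[P0 V]) B = \<zero>[MV.TG]" if "B \<subseteq> J" for B
    proof -
      have "finsum MV.TG (?c \<zero>[P0 V]) B = finsum MV.TG (\<lambda>j. \<zero>[MV.TG]) B"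
        using that z k[OF M.zero_closed] h by (intro MV.TG.finsum_cong') (auto simp del: ih.hom_zero simp: MV.tens_zero_left subsetD)
      then show ?thesis by simp
    qed
    then show ?case using z by (auto intro!: exI[of _ "{}"] simp del: ih.hom_zero)
  next
    case (step y t m p)
    note m = step.hyps(2) and p = step.hyps(3)
    have yc: "y\<in>carrier (P0 V)" using graph_closed[OF V step.hyps(1)] by simp
    have z: "\<iota> p\<in>carrier (free_module T J)" using lin_homD(1)[OF \<iota> p] .
    let ?y = "y \<oplus>[P0 V] i m \<odot>[P0 V] p"
    have e: "\<iota> ?y = \<iota> y \<oplus>[free_module T J] i m \<odot>[free_module T J] \<iota> p"
      using lin_homD(3,4)[OF \<iota>] yc p m by (simp add: i_closed iM_smult[OF V])
    have ej: "\<iota> ?y j = \<iota> y j \<oplus>[T] i (ract M m (q (\<iota> p j)))" if "j\<in>J" for j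
      using that FO.free_coeff[OF z] m by (simp add: e FO.free_simps i_mult)
    have ky: "\<iota> y j\<in>iM" "k (\<iota> y j)\<in>carrier M" "i (k (\<iota> y j)) = \<iota> y j" if "j\<in>J" for j
      using step.IH that k by auto
    have mz: "ract M m (q (\<iota> p j))\<in>carrier M" if "j\<in>J" for j
      using that m FO.free_coeff[OF z] by (intro M.ract_closed q_closed)
    have ej': "\<iota> ?y j = i (k (\<iota> y j) \<oplus>[M] ract M m (q (\<iota> p j)))" if "j\<in>J" for j
      using ej[OF that] ky[OF that] mz[OF that] by simp
    have kj: "k (\<iota> ?y j) = k (\<iota> y j) \<oplus>[M] ract M m (q (\<iota> p j))" if "j\<in>J" for j
      unfolding ej'[OF that] using ky[OF that] mz[OF that] by (intro k) simp
    obtain A where A: "finite A" "A \<subseteq> J" "\<And>B. \<lbrakk>finite B; A \<subseteq> B; B \<subseteq> J\<rbrakk> \<Longrightarrow> t = finsum MV.TG (?c y) B"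
      using step.IH by blast
    let ?S = "{j\<in>J. \<iota> p j \<noteq> \<zero>[T]}"
    have S: "finite ?S" using z by (simp add: FO.free_carrier_iff)
    have AS: "t \<oplus>[MV.TM] tens R M V m (\<epsilon> V p) = finsum MV.TG (?c ?y) B"
      if B: "finite B" "A \<union> ?S \<subseteq> B" "B \<subseteq> J" for B
    proof -
      have "tens R M V m (\<epsilon> V p) = finsum MV.TG (\<lambda>j. tens R M V (ract M m (q (\<iota> p j))) (h j)) B"
        using t\<kappa>[OF m z B(1,3)] B \<kappa>\<iota>[OF p] by auto
      moreover have "t = finsum MV.TG (?c y) B" using A(3)[OF B(1) _ B(3)] B by auto
      moreover have "finsum MV.TG (?c ?y) B = finsum MV.TG (\<lambda>j. ?c y j \<oplus>[MV.TG] tens R M V (ract M m (q (\<iota> p j))) (h j)) B"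
        using B(3) by (intro MV.TG.finsum_cong') (auto simp: kj ky mz h MV.tens_add_left MV.tens_closed subsetD)
      ultimately show ?thesis
        using B(3) by (simp, subst MV.TG.finsum_addf) (auto simp: ky mz h MV.tens_closed subsetD)
    qed
    show ?case
    proof (intro conjI ballI exI[of _ "A \<union> ?S"] allI impI)
      show "\<iota> ?y j\<in>iM" if "j\<in>J" for j unfolding ej'[OF that] using ky[OF that] mz[OF that] by (intro imageI M.a_closed)
    qed (use AS A S in auto)
  qed
  then obtain A where A: "A \<subseteq> J" "t = finsum MV.TG (?c y) A" by blast
  have "\<iota> y = \<zero>[free_module T J]" unfolding y
    by (rule add_hom.hom_zero[OF lin_add_hom[OF \<iota> P_module[OF V] FO.free_left_module]])
  then have z: "\<iota> y j = i \<zero>[M]" if "j\<in>J" for j using that by (simp add: FO.free_simps)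
  have "finsum MV.TG (?c y) A = finsum MV.TG (\<lambda>j. \<zero>[MV.TG]) A"
    using A z k[OF M.zero_closed] h by (intro MV.TG.finsum_cong') (auto simp del: ih.hom_zero simp: MV.tens_zero_left subsetD)
  then show ?thesis using A(2) by simp
qed

text \<open>Injectivity of the map from \<open>M \<otimes> V\<close> is a vanishing statement about
  Tor, and here projectivity of \<open>P0\<close> enters: \<open>\<epsilon>\<close> lifts to the
  cover, whose values are free, and there \<open>graph_free\<close> applies.\<close>

lemma graph_zero: "(\<zero>[P0 V], t)\<in>graph V \<Longrightarrow> t = \<zero>[MV.TG]"
proof -
  assume g: "(\<zero>[P0 V], t)\<in>graph V"
  let ?F = "q_star X taut_functor :: ('r, 'u, 'u, 'u) pfunctor" and ?N = "nat_restrict R (ucover T (q_star X taut_functor)) (untransport (cover T (q_star X taut_functor)) (enc (cover T (q_star X taut_functor))))"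
  have F: "pointed_functor R T ?F"
    unfolding q_star_def by (rule restrict_functor_pointed[OF T_ring q_ring_hom taut_pointed])
  have sT: "carrier T \<lesssim> (UNIV :: 'u set)" by (rule subset_imp_lepoll) simp
  note U = ucover_pointed[OF T_ring sT, of ?F] and C = cover_pointed[OF T_ring, of ?F]
  obtain \<pi> where \<pi>: "\<pi>\<in>nat_hom R T (ucover T ?F) ?F" "\<forall>V\<in>Proj. \<pi> V ` pts (ucover T ?F) V = pts ?F V"
    using ucover_onto[OF T_ring sT F] by auto
  \<comment> \<open>The lift of the augmentation along the projection of the cover;
    \<open>\<iota>\<close> and \<open>\<kappa>\<close> below are this lift and that projection at
    \<open>V\<close>, read on the free module itself instead of its copy.\<close>
  obtain \<psi> where \<psi>: "\<psi>\<in>nat_hom R T (rP P 0) (ucover T ?F)" "\<forall>V\<in>Proj. \<forall>x\<in>carrier (P0 V). \<pi> V (\<psi> V x) = \<epsilon> V x"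
    using P_projective[of 0, unfolded projective_functor_def] conjI[OF U F] \<pi> \<epsilon>_nat by blast
  note t1 = to_ucover[OF T_ring sT, of ?F] and t2 = from_ucover[OF T_ring sT, of ?F]
  define \<iota> where "\<iota> = compose (carrier (P0 V)) (?N V) (\<psi> V)"
  define \<kappa> where "\<kappa> = compose (pts (cover T ?F) V) (\<pi> V) (nat_restrict R (cover T ?F) (enc (cover T ?F)) V)"
  have \<iota>: "\<iota>\<in>lin_hom T (P0 V) (free_module T (gidx ?F V))"
    using lin_hom_compose[OF nat_hom_lin[OF \<psi>(1) V] nat_hom_lin[OF t2 V] P_module[OF V]] by (simp add: \<iota>_def fobj_cover[OF T_ring])
  have \<kappa>: "\<kappa>\<in>lin_hom T (free_module T (gidx ?F V)) (restrict_scalars q V)"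
    using lin_hom_compose[OF nat_hom_lin[OF t1 V] nat_hom_lin[OF \<pi>(1) V] cover_left_module[OF T_ring]]
    by (simp add: \<kappa>_def fobj_cover[OF T_ring] q_star_def restrict_functor_def taut_functor_def)
  have "\<kappa> (\<iota> p) = \<epsilon> V p" if p: "p\<in>carrier (P0 V)" for p
  proof -
    have u: "\<psi> V p\<in>pts (ucover T ?F) V" using lin_homD(1)[OF nat_hom_lin[OF \<psi>(1) V] p] .
    obtain x where x: "x\<in>pts (cover T ?F) V" "\<psi> V p = enc (cover T ?F) V x"
      using ucover_E[OF T_ring sT u V] by blast
    then show ?thesis using u p V bspec[OF bspec[OF \<psi>(2) V] p] untransport_e[OF C enc_cover[OF T_ring sT] V x(1)]
      by (auto simp: \<kappa>_def \<iota>_def compose_eq)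
  qed
  from graph_free[OF \<iota> \<kappa> this g refl] show ?thesis .
qed

text \<open>Subtracting the pair with second component zero supplied by \<open>graph_MK\<close>
  reduces the claim to \<open>graph_zero\<close>.\<close>

lemma graph_fun: "\<lbrakk>y\<in>MK V; (y, t)\<in>graph V\<rbrakk> \<Longrightarrow> t = \<zero>[MV.TG]"
proof -
  assume y: "y\<in>MK V" and g: "(y, t)\<in>graph V"
  note n = graph_neg[OF V graph_MK[OF V y]]
  note c = graph_closed[OF V g] graph_closed[OF V n]
  have "(y \<oplus>[P0 V] \<ominus>[P0 V] y, t \<oplus>[MV.TM] \<ominus>[MV.TG] \<zero>[MV.TG])\<in>graph V"
    using graph_add[OF V n g] by simp
  then show ?thesis using graph_zero[of t] c by (simp add: P0.r_neg MV.TG.neg_zero)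
qed

text \<open>The graph is the image of \<open>M \<otimes> P0\<close> under the two maps occurring in
  \<open>connecting\<close>. From here on that tensor product over the square-zero extension is no
  longer needed.\<close>

lemma connecting_iff: "connecting R M X P V z t \<longleftrightarrow>
    (\<exists>x\<in>carrier (P1 V). (d V x, t)\<in>graph V \<and>
      z = tau_boundaries R X P V +>\<^bsub>fobj (q_pull R X (rP P 1)) V\<^esub> unit_tens (P1 V) x)"
proof -
  interpret MP: tensor_product R T "M_via M X" "P0 V" by (rule tensor_product.intro[OF M_via P_module[OF V]])
  let ?\<beta> = "\<lambda>m p. i m \<odot>[P0 V] p" and ?\<gamma> = "\<lambda>m p. tens R M V m (\<epsilon> V p)"
  have "balanced T (M_via M X) (P0 V) (P0 V) ?\<beta>"
    by (rule balancedI; unfold via_simps)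
      (auto simp: iM_smult[OF V] left_module.smult_l_distr[OF P_module[OF V]] left_module.smult_r_distr[OF P_module[OF V]] i_closed
        left_module.smult_assoc[OF P_module[OF V], symmetric] i_mult)
  note \<beta> = MP.tensor_lift_hom[OF P_abelian[OF V] this] MP.tensor_lift_tens[OF P_abelian[OF V] this, unfolded via_simps]
  interpret \<epsilon>: add_hom "P0 V" V "\<epsilon> V" by (rule \<epsilon>_hom[OF V])
  have "balanced T (M_via M X) (P0 V) MV.TM ?\<gamma>"
    by (rule balancedI; unfold via_simps MV.tensor_simps)
      (auto simp: \<epsilon>_closed[OF V] MV.tens_closed MV.tens_add_left MV.tens_add_right \<epsilon>_smult[OF V] MV.tens_ract q_closed)
  note \<gamma> = MP.tensor_lift_hom[OF MV.tensor_abelian this] MP.tensor_lift_tens[OF MV.tensor_abelian this, unfolded via_simps]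
  let ?f = "tensor_lift T (M_via M X) (P0 V) (P0 V) ?\<beta>" and ?g = "tensor_lift T (M_via M X) (P0 V) MV.TM ?\<gamma>"
  have 1: "(?f \<mu>, ?g \<mu>)\<in>graph V" if "\<mu>\<in>carrier MP.TG" for \<mu>
    using that
  proof (induction rule: MP.TG_induct)
    case (tens m p)
    then show ?case using graph_gen[OF V, of m p] by (simp add: via_simps \<beta>(2) \<gamma>(2))
  next
    case (add \<mu> \<nu>)
    then show ?case using graph_add[OF V add(4,3)]
      by (simp add: add_hom.hom_add[OF \<beta>(1)] add_hom.hom_add[OF \<gamma>(1)])
  qed
  have 2: "\<exists>\<mu>\<in>carrier MP.TG. y = ?f \<mu> \<and> s = ?g \<mu>" if "(y, s)\<in>graph V" for y s
    using that
  proof (induction rule: graph.induct)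
    case zero
    show ?case using add_hom.hom_zero[OF \<beta>(1)] add_hom.hom_zero[OF \<gamma>(1)] by (intro bexI[of _ "\<zero>[MP.TG]"]) auto
  next
    case (step y s m p)
    then obtain \<mu> where \<mu>: "\<mu>\<in>carrier MP.TG" "y = ?f \<mu>" "s = ?g \<mu>" by auto
    have c: "tens T (M_via M X) (P0 V) m p\<in>carrier MP.TG" using step by (intro MP.tens_closed) (simp_all add: via_simps)
    show ?case
      using \<mu> c step(2,3) add_hom.hom_add[OF \<beta>(1) \<mu>(1) c] add_hom.hom_add[OF \<gamma>(1) \<mu>(1) c]
      by (intro bexI[of _ "\<mu> \<oplus>[MP.TG] tens T (M_via M X) (P0 V) m p"]) (simp_all add: \<beta>(2) \<gamma>(2))
  qed
  show ?thesis unfolding connecting_def One_nat_def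
  proof (intro bex_cong refl iffI conjI; (elim bexE conjE)?)
    fix x \<mu> assume "d V x = ?f \<mu>" "t = ?g \<mu>" "\<mu>\<in>carrier MP.TG"
    then show "(d V x, t)\<in>graph V" using 1 by simp
  next
    fix x assume "(d V x, t)\<in>graph V" and z: "z = tau_boundaries R X P V +>\<^bsub>fobj (q_pull R X (rP P (Suc 0))) V\<^esub> unit_tens (P1 V) x"
    from 2[OF this(1)] obtain \<mu> where \<mu>: "\<mu>\<in>carrier MP.TG" and e: "d V x = ?f \<mu>" "t = ?g \<mu>" by auto
    show "\<exists>\<mu>\<in>carrier MP.TG. z = tau_boundaries R X P V +>\<^bsub>fobj (q_pull R X (rP P (Suc 0))) V\<^esub> unit_tens (P1 V) x \<and> d V x = ?f \<mu> \<and> t = ?g \<mu>"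
      by (rule bexI[OF _ \<mu>]) (intro conjI z e)
  qed
qed

end
end

subsection \<open>The truncated complex as an elementary extension\<close>

text \<open>The maps of the truncated complex are known on representatives \<open>c V a\<close>. The
  source \<open>A\<close> enters only additively because its scalars belong to the square-zero
  extension and those of \<open>G\<close> to \<open>R\<close>; the scalar condition asks for one
  suitable representative.\<close>

lemma nat_hom_surjI:
  fixes S :: "'s ring" and G :: "('s, 'u, 't, 'x) pfunctor" and A :: "('s, 'u) module \<Rightarrow> ('a, 'z) module"
  assumes G: "pointed_functor S T G" and H: "pointed_functor S T H"
    and c: "\<And>V. V\<in>fgp S \<Longrightarrow> add_hom (A V) (fobj G V) (c V)"
      "\<And>V. V\<in>fgp S \<Longrightarrow> c V ` carrier (A V) = pts G V"
    and g: "\<And>V. V\<in>fgp S \<Longrightarrow> add_hom (A V) (fobj H V) (g V)"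
    and e: "\<And>V a. \<lbrakk>V\<in>fgp S; a\<in>carrier (A V)\<rbrakk> \<Longrightarrow> \<eta> V (c V a) = g V a"
    and un: "\<And>V x. \<lbrakk>V\<in>fgp S; x \<notin> pts G V\<rbrakk> \<Longrightarrow> \<eta> V x = undefined"
      "\<And>V. V \<notin> fgp S \<Longrightarrow> \<eta> V = undefined"
    and sm: "\<And>V r a. \<lbrakk>V\<in>fgp S; r\<in>carrier T; a\<in>carrier (A V)\<rbrakk> \<Longrightarrow>
      \<exists>a'\<in>carrier (A V). c V a' = r \<odot>[fobj G V] c V a \<and> g V a' = r \<odot>[fobj H V] g V a"
    and nt: "\<And>V W f a. \<lbrakk>V\<in>fgp S; W\<in>fgp S; f\<in>lin_hom S V W; a\<in>carrier (A V)\<rbrakk> \<Longrightarrow>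
      \<exists>a'\<in>carrier (A W). c W a' = fmap G V W f (c V a) \<and> g W a' = fmap H V W f (g V a)"
  shows "\<eta>\<in>nat_hom S T G H"
proof (rule nat_homI)
  fix V :: "('s, 'u) module" assume V: "V\<in>fgp S"
  interpret c: add_hom "A V" "fobj G V" "c V" by (rule c(1)[OF V])
  interpret g: add_hom "A V" "fobj H V" "g V" by (rule g[OF V])
  have ex: "\<exists>a\<in>carrier (A V). x = c V a" if "x\<in>pts G V" for x
    using that unfolding c(2)[OF V, symmetric] by auto
  show "\<eta> V\<in>lin_hom T (fobj G V) (fobj H V)"
  proof (rule lin_homI)
    fix x y assume "x\<in>pts G V" "y\<in>pts G V"
    then obtain a b where ab: "a\<in>carrier (A V)" "x = c V a" "b\<in>carrier (A V)" "y = c V b" using ex by meson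
    then have "\<eta> V (c V (a \<oplus>[A V] b)) = \<eta> V x \<oplus>[fobj H V] \<eta> V y"
      by (simp add: e[OF V] del: c.hom_add)
    then show "\<eta> V (x \<oplus>[fobj G V] y) = \<eta> V x \<oplus>[fobj H V] \<eta> V y" using ab by simp
  next
    fix r x assume r: "r\<in>carrier T" and "x\<in>pts G V"
    then obtain a where a: "a\<in>carrier (A V)" "x = c V a" using ex by meson
    from sm[OF V r a(1)] obtain a' where "a'\<in>carrier (A V)" "c V a' = r \<odot>[fobj G V] x" "g V a' = r \<odot>[fobj H V] g V a"
      using a by auto
    then show "\<eta> V (r \<odot>[fobj G V] x) = r \<odot>[fobj H V] \<eta> V x" using a e[OF V] by metis
  next
    fix x assume "x\<in>pts G V"
    then show "\<eta> V x\<in>pts H V" using ex[of x] e[OF V] g.hom_closed by auto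
  qed (rule un(1)[OF V])
  fix W :: "('s, 'u) module" and f x
  assume W: "W\<in>fgp S" and f: "f\<in>lin_hom S V W" and "x\<in>pts G V"
  then obtain a where a: "a\<in>carrier (A V)" "x = c V a" using ex by meson
  from nt[OF V W f a(1)] obtain a' where "a'\<in>carrier (A W)" "c W a' = fmap G V W f x" "g W a' = fmap H V W f (g V a)"
    using a by auto
  then show "\<eta> W (fmap G V W f x) = fmap H V W f (\<eta> V x)" using a e[OF V] e[OF W] by metis
qed (rule un(2))

context tau_complex
begin

abbreviation "KK n \<equiv> q_pull R X (rP P n)"
abbreviation "K1 \<equiv> quotient_functor (KK (Suc 0)) (tau_boundaries R X P)"
abbreviation "E \<equiv> tau_ext R M X P"
abbreviation "un n V \<equiv> unit_tens (fobj (rP P n) V)"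

text \<open>Every element of the degree one term is the class of some \<open>1 \<otimes> x\<close>,
  so computations there are made with representatives in \<open>P1\<close>.\<close>

definition u1 :: "('r, 'u) module \<Rightarrow> 'u \<Rightarrow> ('r, 'u) tens set" where
  "u1 V x = tau_boundaries R X P V +>\<^bsub>fobj (KK (Suc 0)) V\<^esub> un (Suc 0) V x"

lemma KK_pointed: "pointed_functor R R (KK n)"
  unfolding q_pull_def by (rule tensor_functor_pointed[OF R_via P_pointed])

lemma KK_obj: "fobj (KK n) V = tensor T (R_via R X) (fobj (rP P n) V)"
  by (simp add: q_pull_def tensor_functor_def)

lemma rd_nat: "rd P n\<in>nat_hom R T (rP P (Suc n)) (rP P n)"
  using P by (simp add: projective_resolution_def)

context
  fixes V :: "('r, 'u) module" assumes V: "V\<in>Proj"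
begin

interpretation RP: tensor_product R T "R_via R X" "fobj (rP P n) V" for n
  by (rule tensor_product.intro[OF R_via P_module[OF V]])

lemma un_hom: "add_hom (fobj (rP P n) V) (fobj (KK n) V) (un n V)"
proof -
  interpret h: add_hom "fobj (rP P n) V" "RP.TG n" "un n V" by (rule unit_tens_hom[OF P_module[OF V]])
  show ?thesis
    by (rule add_homI[OF P_abelian[OF V] functor_abelian[OF KK_pointed V]]) (simp_all add: KK_obj)
qed

lemma un_surj: "un n V ` pts (rP P n) V = pts (KK n) V"
  using unit_tens_surj[OF P_module[OF V, of n]] by (simp add: KK_obj)

lemma un_E: assumes "z\<in>pts (KK n) V" obtains x where "x\<in>pts (rP P n) V" "z = un n V x"
  using assms unfolding un_surj[symmetric] by auto

lemma un_smult: "\<lbrakk>x\<in>carrier T; p\<in>pts (rP P n) V\<rbrakk> \<Longrightarrow>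
    q x \<odot>[fobj (KK n) V] un n V p = un n V (x \<odot>[fobj (rP P n) V] p)"
  using unit_tens_smult[OF P_module[OF V, of n], of x p] by (simp add: KK_obj)

lemma un_zero_iff: "p\<in>pts (rP P n) V \<Longrightarrow>
    un n V p = \<zero>[fobj (KK n) V] \<longleftrightarrow> p\<in>mspan (fobj (rP P n) V) iM (pts (rP P n) V)"
  using unit_tens_kernel[OF P_module[OF V, of n], of p] by (simp add: KK_obj)

lemma un_natural: "\<lbrakk>W\<in>Proj; f\<in>lin_hom R V W; p\<in>pts (rP P n) V\<rbrakk> \<Longrightarrow>
    fmap (KK n) V W f (un n V p) = un n W (fmap (rP P n) V W f p)"
  using tensor_functor_map_tens[OF R_via P_pointed V, of W f "\<one>[R]" p] by (simp add: q_pull_def via_simps)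

lemma un_rd: "x\<in>pts (rP P (Suc n)) V \<Longrightarrow>
    tensor_nat R T (R_via R X) (rP P (Suc n)) (rP P n) (rd P n) V (un (Suc n) V x) = un n V (rd P n V x)"
  using tensor_nat_tens[OF R_via P_pointed P_pointed rd_nat V, of "\<one>[R]" x] by (simp add: via_simps)

lemma boundaries: "tau_boundaries R X P V = (\<lambda>y. un (Suc 0) V (d2 V y)) ` carrier (P2 V)"
proof -
  have "tau_boundaries R X P V = (\<lambda>y. tensor_nat R T (R_via R X) (P2' ) (rP P (Suc 0)) d2 V (un 2 V y)) ` carrier (P2 V)"
    if "P2' = rP P 2" for P2'
    unfolding tau_boundaries_def un_surj[symmetric] that image_image One_nat_def ..
  then show ?thesis using un_rd[of _ "Suc 0"] by (simp add: numeral_2_eq_2)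
qed

end

lemma boundaries_quotient: "quotient_functor_of R R (KK (Suc 0)) (tau_boundaries R X P)"
proof
  show "pointed_functor R R (KK (Suc 0))" by (rule KK_pointed)
  fix V assume V: "V\<in>Proj"
  interpret d2: add_hom "P2 V" "P1 V" "d2 V" by (rule d2_hom[OF V])
  interpret un: add_hom "P1 V" "fobj (KK (Suc 0)) V" "un (Suc 0) V" by (rule un_hom[OF V])
  show "submodule_of R (fobj (KK (Suc 0)) V) (tau_boundaries R X P V)"
    unfolding submodule_of_def boundaries[OF V]
  proof (intro conjI ballI)
    show "\<zero>[fobj (KK (Suc 0)) V]\<in>(\<lambda>y. un (Suc 0) V (d2 V y)) ` carrier (P2 V)"
      by (rule image_eqI[of _ _ "\<zero>[P2 V]"]) simp_all
    fix x y assume "x\<in>(\<lambda>y. un (Suc 0) V (d2 V y)) ` carrier (P2 V)" "y\<in>(\<lambda>y. un (Suc 0) V (d2 V y)) ` carrier (P2 V)"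
    then obtain a b where "a\<in>carrier (P2 V)" "x = un (Suc 0) V (d2 V a)" "b\<in>carrier (P2 V)" "y = un (Suc 0) V (d2 V b)" by auto
    then show "x \<oplus>[fobj (KK (Suc 0)) V] y\<in>(\<lambda>y. un (Suc 0) V (d2 V y)) ` carrier (P2 V)"
      by (intro image_eqI[of _ _ "a \<oplus>[P2 V] b"]) simp_all
  next
    fix r x assume "r\<in>carrier R" "x\<in>(\<lambda>y. un (Suc 0) V (d2 V y)) ` carrier (P2 V)"
    moreover then obtain s where "s\<in>carrier T" "q s = r" using q_lift by blast
    ultimately obtain s a where a: "a\<in>carrier (P2 V)" "x = un (Suc 0) V (d2 V a)" "s\<in>carrier T" "q s = r" by auto
    then show "r \<odot>[fobj (KK (Suc 0)) V] x\<in>(\<lambda>y. un (Suc 0) V (d2 V y)) ` carrier (P2 V)"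
      using un_smult[OF V a(3), of "d2 V a" "Suc 0"] lin_homD(4)[OF nat_hom_lin[OF d2_nat V] a(3,1)] P_smult[OF V a(3,1)]
      by (intro image_eqI[of _ _ "s \<odot>[P2 V] a"]) simp_all
  qed (auto)
next
  fix V W f z
  assume V: "V\<in>Proj" and W: "W\<in>Proj" and f: "f\<in>lin_hom R V W" and "z\<in>tau_boundaries R X P V"
  then obtain a where a: "a\<in>carrier (P2 V)" "z = un (Suc 0) V (d2 V a)" by (auto simp: boundaries)
  have "d2 V a\<in>carrier (P1 V)" using add_hom.hom_closed[OF d2_hom[OF V] a(1)] .
  then have "fmap (KK (Suc 0)) V W f z = un (Suc 0) W (d2 W (fmap (rP P 2) V W f a))"
    using a nat_hom_natural[OF d2_nat V W f a(1)] by (simp add: un_natural[OF V W f])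
  then show "fmap (KK (Suc 0)) V W f z\<in>tau_boundaries R X P W"
    using lin_homD(1)[OF functor_map[OF P_pointed V W f] a(1)] by (simp add: boundaries[OF W])
qed

sublocale B: quotient_functor_of R R "KK (Suc 0)" "tau_boundaries R X P"
  by (rule boundaries_quotient)

lemma tau_simps: "C0 E = KK 0" "C1 E = K1"
  "ediff E = (\<lambda>V\<in>Proj. \<lambda>Y\<in>pts K1 V.
     the_elem (tensor_nat R T (R_via R X) (rP P (Suc 0)) (rP P 0) d V ` Y))"
  "ea E = (\<lambda>V\<in>Proj. tensor_lift T (R_via R X) (P0 V) V (\<lambda>r p. r \<odot>[V] \<epsilon> V p))"
  "eb E = (\<lambda>V\<in>Proj. \<lambda>t\<in>carrier (tensor R M V). THE z. connecting R M X P V z t)"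
  by (simp_all add: tau_ext_def Let_def)

context
  fixes V :: "('r, 'u) module" assumes V: "V\<in>Proj"
begin

interpretation V: abelian_group V by (rule V_ab[OF V])
interpretation P0: abelian_group "P0 V" by (rule P_abelian[OF V])
interpretation P1: abelian_group "P1 V" by (rule P_abelian[OF V])
interpretation d: add_hom "P1 V" "P0 V" "d V" by (rule d_hom[OF V])
interpretation d2: add_hom "P2 V" "P1 V" "d2 V" by (rule d2_hom[OF V])
interpretation \<epsilon>: add_hom "P0 V" V "\<epsilon> V" by (rule \<epsilon>_hom[OF V])
interpretation MV: tensor_product R R M V by (rule tensor_M[OF V])
interpretation RP: tensor_product R T "R_via R X" "P0 V" by (rule tensor_product.intro[OF R_via P_module[OF V]])
interpretation BV: quotient_of R "fobj (KK (Suc 0)) V" "tau_boundaries R X P V" by (rule B.quotient[OF V])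
interpretation un: add_hom "P1 V" "fobj (KK (Suc 0)) V" "un (Suc 0) V" by (rule un_hom[OF V])
interpretation u0: add_hom "P0 V" "fobj (KK 0) V" "un 0 V" by (rule un_hom[OF V])

lemma K1_obj: "fobj K1 V = quotient_module (fobj (KK (Suc 0)) V) (tau_boundaries R X P V)"
  by (rule B.fobj_QF)

lemma u1_hom: "add_hom (P1 V) (fobj K1 V) (u1 V)"
  unfolding K1_obj u1_def[abs_def] by (rule add_hom_comp[OF un_hom[OF V] BV.proj_hom])

lemma u1_surj: "u1 V ` carrier (P1 V) = pts K1 V"
  unfolding K1_obj BV.carrier_Q un_surj[OF V, symmetric] image_image u1_def[abs_def] ..

lemma u1_E: assumes "z\<in>pts K1 V" obtains x where "x\<in>carrier (P1 V)" "z = u1 V x"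
  using assms unfolding u1_surj[symmetric] by auto

lemma u1_smult: "\<lbrakk>x\<in>carrier T; p\<in>carrier (P1 V)\<rbrakk> \<Longrightarrow> q x \<odot>[fobj K1 V] u1 V p = u1 V (x \<odot>[P1 V] p)"
  by (simp add: K1_obj u1_def BV.smult_Q q_closed un_smult[OF V])

interpretation u1: add_hom "P1 V" "fobj K1 V" "u1 V" by (rule u1_hom)

lemma d_smult: "\<lbrakk>x\<in>carrier T; p\<in>carrier (P1 V)\<rbrakk> \<Longrightarrow> d V (x \<odot>[P1 V] p) = x \<odot>[P0 V] d V p"
  by (rule lin_homD(4)[OF nat_hom_lin[OF d_nat V]])

lemma d_K: "x\<in>carrier (P1 V) \<Longrightarrow> d V x\<in>K V"
  using d_image[OF V] by auto

lemma K_d: assumes "y\<in>K V" obtains x where "x\<in>carrier (P1 V)" "y = d V x"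
  using assms unfolding d_image[OF V, symmetric] by auto

lemma d_mspan: "x\<in>mspan (P1 V) iM (carrier (P1 V)) \<Longrightarrow> d V x\<in>MK V"
proof (induction rule: mspan.induct)
  case (step y j h)
  have y: "y\<in>carrier (P1 V)" using mspan_closed[OF P_module[OF V] iM_ideal(1) subset_refl step.hyps(1)] .
  have j: "j\<in>carrier T" using step iM_ideal(1) by blast
  have "d V (y \<oplus>[P1 V] j \<odot>[P1 V] h) = d V y \<oplus>[P0 V] j \<odot>[P0 V] d V h"
    using y j step.hyps(3) by (simp add: P_smult[OF V] d_smult)
  then show ?case using mspan.step[OF step.IH step.hyps(2) d_K[OF step.hyps(3)]] by simp
qed (simp add: mspan.zero)

text \<open>\<open>d\<close> maps \<open>P1\<close> onto \<open>Ker \<epsilon>\<close>, hence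
  \<open>M P1\<close> onto \<open>M Ker \<epsilon>\<close>.\<close>

lemma MK_lift: "y\<in>MK V \<Longrightarrow> \<exists>x\<in>mspan (P1 V) iM (carrier (P1 V)). d V x = y"
proof (induction rule: mspan.induct)
  case zero
  then show ?case by (intro bexI[OF _ mspan.zero]) simp
next
  case (step y j h)
  then obtain x where x: "x\<in>mspan (P1 V) iM (carrier (P1 V))" "d V x = y" by auto
  obtain k where k: "k\<in>carrier (P1 V)" "h = d V k" using K_d[OF step.hyps(3)] .
  have xc: "x\<in>carrier (P1 V)" using mspan_closed[OF P_module[OF V] iM_ideal(1) subset_refl x(1)] .
  have j: "j\<in>carrier T" using step iM_ideal(1) by blast
  show ?case
    by (rule bexI[OF _ mspan.step[OF x(1) step.hyps(2) k(1)]])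
      (use xc k x(2) j in \<open>simp add: P_smult[OF V] d_smult\<close>)
qed

text \<open>The degree one term is \<open>P1\<close> modulo boundaries and \<open>M P1\<close>. By
  exactness at \<open>P1\<close> and \<open>MK_lift\<close>, the differential identifies it with
  \<open>Ker \<epsilon> / M Ker \<epsilon>\<close>.\<close>

lemma u1_zero_iff:
  assumes x: "x\<in>carrier (P1 V)"
  shows "u1 V x = \<zero>[fobj K1 V] \<longleftrightarrow> d V x\<in>MK V"
proof -
  have dd: "d V (d2 V y) = \<zero>[P0 V]" if "y\<in>carrier (P2 V)" for y
    using that d2_image[OF V] by (auto simp: in_a_kernel set_eq_iff)
  have "u1 V x = \<zero>[fobj K1 V] \<longleftrightarrow> (\<exists>y\<in>carrier (P2 V). un (Suc 0) V x = un (Suc 0) V (d2 V y))"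
  proof -
    have "u1 V x = \<zero>[fobj K1 V] \<longleftrightarrow> un (Suc 0) V x\<in>tau_boundaries R X P V"
      using x by (simp add: u1_def K1_obj BV.proj_zero_iff)
    then show ?thesis by (auto simp: boundaries[OF V])
  qed
  also have "\<dots> \<longleftrightarrow> (\<exists>y\<in>carrier (P2 V). x \<ominus>[P1 V] d2 V y\<in>mspan (P1 V) iM (carrier (P1 V)))"
    using x by (intro bex_cong refl)
      (simp add: un_zero_iff[OF V, symmetric] un.hom_minus abelian_group.diff_zero_iff[OF functor_abelian[OF KK_pointed V]])
  also have "\<dots> \<longleftrightarrow> d V x\<in>MK V"
  proof
    assume "\<exists>y\<in>carrier (P2 V). x \<ominus>[P1 V] d2 V y\<in>mspan (P1 V) iM (carrier (P1 V))"
    then obtain y where y: "y\<in>carrier (P2 V)" and m: "x \<ominus>[P1 V] d2 V y\<in>mspan (P1 V) iM (carrier (P1 V))" by auto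
    show "d V x\<in>MK V" using d_mspan[OF m] x y dd[OF y] by (simp add: d.hom_minus P0.minus_eq P0.neg_zero)
  next
    assume "d V x\<in>MK V"
    from MK_lift[OF this] obtain w where w: "w\<in>mspan (P1 V) iM (carrier (P1 V))" "d V w = d V x" by auto
    have wc: "w\<in>carrier (P1 V)" using mspan_closed[OF P_module[OF V] iM_ideal(1) subset_refl w(1)] .
    \<comment> \<open>The lift \<open>w\<close> in \<open>M P1\<close> has the same differential as
      \<open>x\<close>, so the two differ by a boundary.\<close>
    have "x \<ominus>[P1 V] w\<in>d2 V ` carrier (P2 V)"
      unfolding d2_image[OF V] in_a_kernel using x wc w(2) by (simp add: d.hom_minus P0.minus_eq P0.r_neg)
    then obtain y where y: "y\<in>carrier (P2 V)" "x \<ominus>[P1 V] w = d2 V y" by auto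
    have "x \<ominus>[P1 V] d2 V y = w" unfolding y(2)[symmetric] using x wc by (simp add: P1.group_simps)
    then show "\<exists>y\<in>carrier (P2 V). x \<ominus>[P1 V] d2 V y\<in>mspan (P1 V) iM (carrier (P1 V))" using y(1) w(1) by auto
  qed
  finally show ?thesis .
qed

lemma u1_eq_iff: "\<lbrakk>x\<in>carrier (P1 V); y\<in>carrier (P1 V)\<rbrakk> \<Longrightarrow> u1 V x = u1 V y \<longleftrightarrow> d V x \<ominus>[P0 V] d V y\<in>MK V"
  using u1_zero_iff[of "x \<ominus>[P1 V] y"] by (simp add: u1.hom_minus d.hom_minus abelian_group.diff_zero_iff[OF functor_abelian[OF B.QF_pointed V]])

lemma MK_sub: "y\<in>MK V \<Longrightarrow> y\<in>mspan (P0 V) iM (carrier (P0 V))"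
  using graph_MK[OF V] mspan_graph[OF V] by blast

text \<open>The definition takes \<open>the_elem\<close> of the image of a coset. The differentials
  of two representatives differ by an element of \<open>M Ker \<epsilon>\<close>, which dies in
  \<open>R \<otimes> P0\<close>.\<close>

lemma tau_d:
  assumes x: "x\<in>carrier (P1 V)"
  shows "ediff E V (u1 V x) = un 0 V (d V x)"
proof -
  let ?\<delta> = "tensor_nat R T (R_via R X) (rP P (Suc 0)) (rP P 0) d V"
  have "?\<delta> z = un 0 V (d V x)" if "z\<in>u1 V x" for z
  proof -
    have "z\<in>pts (KK (Suc 0)) V" and e: "BV.\<pi> z = u1 V x"
      using BV.mem_proj[OF _ that[unfolded u1_def]] x by (auto simp: u1_def)
    then obtain y where y: "y\<in>carrier (P1 V)" "z = un (Suc 0) V y" using un_E[OF V] by blast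
    then have "d V y \<ominus>[P0 V] d V x\<in>MK V" using e u1_eq_iff[OF y(1) x] by (simp add: u1_def)
    then have "un 0 V (d V y \<ominus>[P0 V] d V x) = \<zero>[fobj (KK 0) V]" using MK_sub x y by (subst un_zero_iff[OF V]) auto
    then show ?thesis using y x by (simp add: un_rd[OF V] u0.hom_minus abelian_group.diff_zero_iff[OF functor_abelian[OF KK_pointed V]])
  qed
  moreover have "un (Suc 0) V x\<in>u1 V x" unfolding u1_def using x by (intro BV.H.a_rcos_self) simp
  ultimately have "?\<delta> ` u1 V x = {un 0 V (d V x)}" by force
  then show ?thesis using V x by (simp add: tau_simps del: restrict_apply) (simp add: u1.hom_closed)
qed

lemma tau_a:
  assumes p: "p\<in>carrier (P0 V)"
  shows "ea E V (un 0 V p) = \<epsilon> V p"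
proof -
  note lV = fgp_module[OF V]
  have "balanced T (R_via R X) (P0 V) V (\<lambda>r p. r \<odot>[V] \<epsilon> V p)"
    by (rule balancedI; unfold via_simps)
      (auto simp: left_module.smult_closed[OF lV] left_module.smult_l_distr[OF lV] left_module.smult_r_distr[OF lV]
        left_module.smult_assoc[OF lV] \<epsilon>_smult[OF V] q_closed)
  note h = RP.tensor_lift_tens[OF V.abelian_group_axioms this, of "\<one>[R]" p]
  show ?thesis using h p V by (simp add: tau_simps via_simps left_module.smult_one[OF lV])
qed

lemma tau_b_exists: assumes "t\<in>carrier MV.TG" obtains x where "x\<in>carrier (P1 V)" "(d V x, t)\<in>graph V"
proof -
  obtain y where y: "(y, t)\<in>graph V" using graph_total[OF V assms] by auto
  show thesis using K_d[OF graph_in_K[OF V y]] y that by metis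
qed

text \<open>The definite description is proper: for two candidates the difference of the
  differentials is paired with zero in the graph, hence lies in \<open>M Ker \<epsilon>\<close>, and
  \<open>u1\<close> does not distinguish them.\<close>

lemma tau_b:
  assumes x: "x\<in>carrier (P1 V)" and g: "(d V x, t)\<in>graph V"
  shows "eb E V t = u1 V x"
proof -
  have "(THE z. connecting R M X P V z t) = u1 V x"
  proof (rule the_equality)
    show "connecting R M X P V (u1 V x) t" unfolding connecting_iff[OF V] u1_def One_nat_def using x g by blast
  next
    fix z assume "connecting R M X P V z t"
    then obtain y where y: "y\<in>carrier (P1 V)" "(d V y, t)\<in>graph V" "z = u1 V y"
      unfolding connecting_iff[OF V] u1_def One_nat_def by blast
    have "(d V y \<oplus>[P0 V] \<ominus>[P0 V] d V x, t \<oplus>[MV.TM] \<ominus>[MV.TG] t)\<in>graph V"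
      by (rule graph_add[OF V graph_neg[OF V g] y(2)])
    then have "(d V y \<ominus>[P0 V] d V x, \<zero>[MV.TM])\<in>graph V"
      using graph_closed[OF V g] by (simp add: P0.minus_eq MV.TG.r_neg)
    then show "z = u1 V x" using graph_zero_MK[OF V] y x by (simp add: u1_eq_iff)
  qed
  then show ?thesis using V graph_closed[OF V g] by (simp add: tau_simps)
qed

end
end

text \<open>The map induced by \<open>g\<close> on the quotient \<open>c\<close>, by means of a
  chosen preimage. By \<open>descend_eq\<close> the choice is immaterial if \<open>g\<close>
  vanishes on the kernel of \<open>c\<close>.\<close>

definition descend :: "'s ring \<Rightarrow> (('s, 'u) module \<Rightarrow> ('a, 'z) module) \<Rightarrow> ('s, 'u, 't, 'x) pfunctor \<Rightarrow>
    (('s, 'u) module \<Rightarrow> 'z \<Rightarrow> 'x) \<Rightarrow> (('s, 'u) module \<Rightarrow> 'z \<Rightarrow> 'y) \<Rightarrow> ('s, 'u) module \<Rightarrow> 'x \<Rightarrow> 'y" where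
  "descend S A G c g = nat_restrict S G (\<lambda>V x. g V (inv_into (carrier (A V)) (c V) x))"

lemma descend_eq:
  fixes S :: "'s ring" and G :: "('s, 'u, 't, 'x) pfunctor" and A :: "('s, 'u) module \<Rightarrow> ('a, 'z) module"
    and K :: "('t2, 'y) module"
  assumes V: "V\<in>fgp S" and c: "add_hom (A V) (fobj G V) (c V)"
    and g: "add_hom (A V) K (g V)" and a: "a\<in>carrier (A V)"
    and ker: "\<And>a. \<lbrakk>a\<in>carrier (A V); c V a = \<zero>[fobj G V]\<rbrakk> \<Longrightarrow> g V a = \<zero>[K]"
  shows "descend S A G c g V (c V a) = g V a"
proof -
  interpret c: add_hom "A V" "fobj G V" "c V" by (rule c)
  interpret g: add_hom "A V" K "g V" by (rule g)
  let ?b = "inv_into (carrier (A V)) (c V) (c V a)"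
  have b: "?b\<in>carrier (A V)" "c V ?b = c V a" using a by (simp_all add: inv_into_into f_inv_into_f)
  then have "c V (?b \<ominus>[A V] a) = \<zero>[fobj G V]" using a by (simp add: c.hom_minus abelian_group.diff_zero_iff[OF c.H.abelian_group_axioms])
  then have "g V (?b \<ominus>[A V] a) = \<zero>[K]" using a b(1) by (intro ker) simp_all
  then have "g V ?b = g V a" using a b(1) by (simp add: g.hom_minus abelian_group.diff_zero_iff[OF g.H.abelian_group_axioms])
  then show ?thesis using V a by (simp add: descend_def c.hom_closed)
qed

lemma descend_forget:
  fixes S :: "'s ring" and G :: "('s, 'u, 't, 'x) pfunctor" and H :: "('s, 'u, 't2, 'y) pfunctor"
    and A :: "('s, 'u) module \<Rightarrow> ('a, 'z) module"
  assumes T: "ring T" "ring T'" and G: "pointed_functor S T G" and H: "pointed_functor S T' H"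
    and c: "\<And>V. V\<in>fgp S \<Longrightarrow> add_hom (A V) (fobj G V) (c V)"
      "\<And>V. V\<in>fgp S \<Longrightarrow> c V ` carrier (A V) = pts G V"
    and g: "\<And>V. V\<in>fgp S \<Longrightarrow> add_hom (A V) (fobj H V) (g V)"
    and e: "\<And>V a. \<lbrakk>V\<in>fgp S; a\<in>carrier (A V)\<rbrakk> \<Longrightarrow> descend S A G c g V (c V a) = g V a"
    and nt: "\<And>V W f a. \<lbrakk>V\<in>fgp S; W\<in>fgp S; f\<in>lin_hom S V W; a\<in>carrier (A V)\<rbrakk> \<Longrightarrow>
      \<exists>a'\<in>carrier (A W). c W a' = fmap G V W f (c V a) \<and> g W a' = fmap H V W f (g V a)"
  shows "descend S A G c g\<in>nat_hom S \<Z> (forget T G) (forget T' H)"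
proof -
  let ?\<eta> = "descend S A G c g"
  have ex: "\<exists>a\<in>carrier (A V). x = c V a" if "V\<in>fgp S" "x\<in>pts G V" for V x
    using that(2) unfolding c(2)[OF that(1), symmetric] by auto
  have "nat_restrict S (forget T G) ?\<eta>\<in>nat_hom S \<Z> (forget T G) (forget T' H)"
  proof (rule nat_hom_intI[OF forget_pointed[OF T(1) G] forget_pointed[OF T(2) H]]; unfold forget_simps)
    fix V :: "('s, 'u) module" and x assume V: "V\<in>fgp S" and x: "x\<in>pts G V"
    interpret c: add_hom "A V" "fobj G V" "c V" by (rule c(1)[OF V])
    interpret g: add_hom "A V" "fobj H V" "g V" by (rule g[OF V])
    obtain a where a: "a\<in>carrier (A V)" "x = c V a" using ex[OF V x] by auto
    show "?\<eta> V x\<in>pts H V" using a by (simp add: e[OF V])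
    { fix y assume "y\<in>pts G V"
      then obtain b where b: "b\<in>carrier (A V)" "y = c V b" using ex[OF V] by meson
      have "?\<eta> V (c V (a \<oplus>[A V] b)) = ?\<eta> V x \<oplus>[fobj H V] ?\<eta> V y" using a b by (simp add: e[OF V] del: c.hom_add)
      then show "?\<eta> V (x \<oplus>[fobj G V] y) = ?\<eta> V x \<oplus>[fobj H V] ?\<eta> V y" using a b by simp }
    { fix W :: "('s, 'u) module" and f assume W: "W\<in>fgp S" and f: "f\<in>lin_hom S V W"
      from nt[OF V W f a(1)] obtain a' where "a'\<in>carrier (A W)" "c W a' = fmap G V W f x" "g W a' = fmap H V W f (g V a)"
        using a by auto
      then show "?\<eta> W (fmap G V W f x) = fmap H V W f (?\<eta> V x)" using a e[OF V] e[OF W] by metis }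
  qed
  moreover have "nat_restrict S (forget T G) ?\<eta> = ?\<eta>" by (auto simp: descend_def nat_restrict_def fun_eq_iff)
  ultimately show ?thesis by simp
qed

context tau_complex
begin

lemma u1_natural:
  assumes V: "V\<in>Proj" and W: "W\<in>Proj" and f: "f\<in>lin_hom R V W" and x: "x\<in>carrier (P1 V)"
  shows "fmap K1 V W f (u1 V x) = u1 W (fmap (rP P (Suc 0)) V W f x)"
  using B.fmap_proj[OF V W f, of "un (Suc 0) V x"] add_hom.hom_closed[OF un_hom[OF V], of x "Suc 0"] x
  by (simp add: u1_def un_natural[OF V W f])

lemma graph_natural:
  assumes V: "V\<in>Proj" and W: "W\<in>Proj" and f: "f\<in>lin_hom R V W" and g: "(y, t)\<in>graph V"
  shows "(fmap (rP P 0) V W f y, fmap I V W f t)\<in>graph W"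
  using g
proof (induction rule: graph.induct)
  interpret F: add_hom "P0 V" "P0 W" "fmap (rP P 0) V W f" by (rule functor_map_hom[OF P_pointed V W f])
  interpret J: add_hom "fobj I V" "fobj I W" "fmap I V W f" by (rule functor_map_hom[OF I_pointed V W f])
  { case zero
    show ?case using graph.zero[of W] J.hom_zero F.hom_zero by (simp add: I_obj) }
  case (step y t m p)
  interpret MV: tensor_product R R M V by (rule tensor_M[OF V])
  have c: "y\<in>carrier (P0 V)" "t\<in>pts I V" using graph_closed[OF V step.hyps(1)] by (simp_all add: I_carrier)
  have m: "tens R M V m (\<epsilon> V p)\<in>pts I V"
    using step MV.tens_closed[of m "\<epsilon> V p"] \<epsilon>_closed[OF V] by (simp add: I_carrier)
  have "fmap I V W f (t \<oplus>[fobj I V] tens R M V m (\<epsilon> V p)) = fmap I V W f t \<oplus>[fobj I W] tens R M W m (\<epsilon> W (fmap (rP P 0) V W f p))"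
    using c m step by (simp add: I_map_tens[OF V W f] \<epsilon>_closed[OF V] \<epsilon>_natural[OF V W f])
  moreover have "fmap (rP P 0) V W f (y \<oplus>[P0 V] i m \<odot>[P0 V] p) = fmap (rP P 0) V W f y \<oplus>[P0 W] i m \<odot>[P0 W] fmap (rP P 0) V W f p"
    using c step lin_homD(4)[OF functor_map[OF P_pointed V W f]] by (simp add: iM_smult[OF V] i_closed)
  ultimately show ?case using graph.step[OF step.IH step.hyps(2), of "fmap (rP P 0) V W f p"] step.hyps(3) by (simp add: I_obj)
qed

text \<open>Degree zero is \<open>P0 / M P0\<close> and degree one is
  \<open>Ker \<epsilon> / M Ker \<epsilon>\<close>. So the kernel of the differential is
  \<open>M P0 / M Ker \<epsilon>\<close>, which the graph identifies with
  \<open>M \<otimes> V\<close>, and its cokernel is \<open>P0 / Ker \<epsilon>\<close>, that is,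
  \<open>V\<close>.\<close>

theorem tau_el_ext: "el_ext_of R M E"
  unfolding is_el_ext_def
proof (intro conjI ballI)
  show p: "pointed_functor R R (C0 E)" "pointed_functor R R (C1 E)"
    by (simp_all add: tau_simps KK_pointed B.QF_pointed)
  show "ediff E\<in>nat_hom R R (C1 E) (C0 E)"
    unfolding tau_simps(1,2)
  proof (rule nat_hom_surjI[OF B.QF_pointed KK_pointed u1_hom u1_surj])
    show "add_hom (P1 V) (fobj (KK 0) V) (\<lambda>x. un 0 V (d V x))" if "V\<in>Proj" for V
      by (rule add_hom_comp[OF d_hom[OF that] un_hom[OF that]])
    show "\<exists>a'\<in>carrier (P1 V). u1 V a' = r \<odot>[fobj K1 V] u1 V a \<and> un 0 V (d V a') = r \<odot>[fobj (KK 0) V] un 0 V (d V a)"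
      if V: "V\<in>Proj" and r: "r\<in>carrier R" and a: "a\<in>carrier (P1 V)" for V r a
    proof -
      obtain s where s: "s\<in>carrier T" "q s = r" using q_lift[OF r] by auto
      have "d V a\<in>carrier (P0 V)" using add_hom.hom_closed[OF d_hom[OF V] a] .
      then show ?thesis
        using s a by (intro bexI[of _ "s \<odot>[P1 V] a"]) (auto simp: u1_smult[OF V, symmetric] d_smult[OF V] un_smult[OF V, symmetric] P_smult[OF V])
    qed
    show "\<exists>a'\<in>carrier (P1 W). u1 W a' = fmap K1 V W f (u1 V a) \<and> un 0 W (d W a') = fmap (KK 0) V W f (un 0 V (d V a))"
      if V: "V\<in>Proj" and W: "W\<in>Proj" and f: "f\<in>lin_hom R V W" and a: "a\<in>carrier (P1 V)" for V W f a
    proof -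
      have "d V a\<in>carrier (P0 V)" using add_hom.hom_closed[OF d_hom[OF V] a] .
      then show ?thesis using a lin_homD(1)[OF functor_map[OF P_pointed V W f] a] nat_hom_natural[OF d_nat V W f a]
        by (intro bexI[of _ "fmap (rP P (Suc 0)) V W f a"]) (auto simp: u1_natural[OF V W f] un_natural[OF V W f])
    qed
  qed (simp_all add: tau_d, simp_all add: tau_simps)
  show "ea E\<in>nat_hom R R (C0 E) taut_functor"
    unfolding tau_simps(1)
  proof (rule nat_hom_surjI[OF KK_pointed taut_pointed un_hom un_surj])
    show "add_hom (P0 V) (fobj taut_functor V) (\<epsilon> V)" if "V\<in>Proj" for V
      using \<epsilon>_hom[OF that] by (simp add: taut_functor_def)
    show "\<exists>a'\<in>carrier (P0 V). un 0 V a' = r \<odot>[fobj (KK 0) V] un 0 V a \<and> \<epsilon> V a' = r \<odot>[fobj taut_functor V] \<epsilon> V a"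
      if V: "V\<in>Proj" and r: "r\<in>carrier R" and a: "a\<in>carrier (P0 V)" for V r a
    proof -
      obtain s where s: "s\<in>carrier T" "q s = r" using q_lift[OF r] by auto
      then show ?thesis
        using a by (intro bexI[of _ "s \<odot>[P0 V] a"]) (auto simp: \<epsilon>_smult[OF V] un_smult[OF V, symmetric] P_smult[OF V] taut_functor_def)
    qed
    show "\<exists>a'\<in>carrier (P0 W). un 0 W a' = fmap (KK 0) V W f (un 0 V a) \<and> \<epsilon> W a' = fmap taut_functor V W f (\<epsilon> V a)"
      if V: "V\<in>Proj" and W: "W\<in>Proj" and f: "f\<in>lin_hom R V W" and a: "a\<in>carrier (P0 V)" for V W f a
      using a lin_homD(1)[OF functor_map[OF P_pointed V W f] a]
      by (intro bexI[of _ "fmap (rP P 0) V W f a"]) (auto simp: un_natural[OF V W f] \<epsilon>_natural[OF V W f] taut_functor_def)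
    show "ea E V x = undefined" if "V\<in>Proj" "x \<notin> pts (KK 0) V" for V x
      using that by (simp add: tau_simps tensor_lift_def KK_obj tensor_def)
  qed (simp_all add: tau_a, simp_all add: tau_simps)
  show "eb E\<in>nat_hom R R I (C1 E)"
    unfolding tau_simps(2)
  proof (rule nat_homI)
    fix V assume V: "V\<in>Proj"
    interpret MV: tensor_product R R M V by (rule tensor_M[OF V])
    interpret u1: add_hom "P1 V" "fobj K1 V" "u1 V" by (rule u1_hom[OF V])
    interpret d: add_hom "P1 V" "P0 V" "d V" by (rule d_hom[OF V])
    show "eb E V\<in>lin_hom R (fobj I V) (fobj K1 V)"
    proof (rule lin_homI; unfold I_obj MV.tensor_simps)
      fix t assume "t\<in>carrier MV.TG"
      then obtain x where "x\<in>carrier (P1 V)" "(d V x, t)\<in>graph V" using tau_b_exists[OF V] by blast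
      then show "eb E V t\<in>pts K1 V" by (simp add: tau_b[OF V])
    next
      fix t assume "t \<notin> carrier MV.TG"
      then show "eb E V t = undefined" using V by (simp add: tau_simps)
    next
      fix t s assume "t\<in>carrier MV.TG" "s\<in>carrier MV.TG"
      then obtain x y where x: "x\<in>carrier (P1 V)" "(d V x, t)\<in>graph V" and y: "y\<in>carrier (P1 V)" "(d V y, s)\<in>graph V"
        using tau_b_exists[OF V] by metis
      have "(d V (x \<oplus>[P1 V] y), t \<oplus>[MV.TG] s)\<in>graph V" using graph_add[OF V y(2) x(2)] x y by simp
      then show "eb E V (t \<oplus>[MV.TG] s) = eb E V t \<oplus>[fobj K1 V] eb E V s"
        using x y tau_b[OF V, of "x \<oplus>[P1 V] y"] by (simp add: tau_b[OF V x] tau_b[OF V y])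
    next
      fix r t assume r: "r\<in>carrier R" and "t\<in>carrier MV.TG"
      then obtain x where x: "x\<in>carrier (P1 V)" "(d V x, t)\<in>graph V" using tau_b_exists[OF V] by metis
      obtain s where s: "s\<in>carrier T" "q s = r" using q_lift[OF r] by auto
      have "(d V (s \<odot>[P1 V] x), r \<odot>[MV.TM] t)\<in>graph V"
        using graph_smult[OF V x(2) s(1)] x(1) s by (simp add: d_smult[OF V])
      then show "eb E V (r \<odot>[MV.TM] t) = r \<odot>[fobj K1 V] eb E V t"
        using x s by (simp add: tau_b[OF V x] tau_b[OF V P_smult[OF V]] u1_smult[OF V, symmetric])
    qed
    fix W f t
    assume W: "W\<in>Proj" and f: "f\<in>lin_hom R V W" and "t\<in>pts I V"
    then obtain x where x: "x\<in>carrier (P1 V)" "(d V x, t)\<in>graph V" using tau_b_exists[OF V] by (metis I_carrier)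
    let ?x = "fmap (rP P (Suc 0)) V W f x"
    have "(d W ?x, fmap I V W f t)\<in>graph W" "?x\<in>carrier (P1 W)"
      using graph_natural[OF V W f x(2)] nat_hom_natural[OF d_nat V W f x(1)] lin_homD(1)[OF functor_map[OF P_pointed V W f] x(1)] by simp_all
    then show "eb E W (fmap I V W f t) = fmap K1 V W f (eb E V t)"
      by (simp add: tau_b[OF V x] tau_b[OF W] u1_natural[OF V W f x(1)])
  qed (simp add: tau_simps)
  fix V assume V: "V\<in>Proj"
  interpret MV: tensor_product R R M V by (rule tensor_M[OF V])
  interpret P0: abelian_group "P0 V" by (rule P_abelian[OF V])
  interpret d: add_hom "P1 V" "P0 V" "d V" by (rule d_hom[OF V])
  have I: "pts I V = carrier MV.TG" by (rule I_carrier)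
  have dx: "d V x\<in>carrier (P0 V)" if "x\<in>carrier (P1 V)" for x using d.hom_closed[OF that] .
  show "inj_on (eb E V) (pts I V)"
    unfolding I
  proof (rule inj_onI)
    fix s t assume "s\<in>carrier MV.TG" "t\<in>carrier MV.TG" and e: "eb E V s = eb E V t"
    then obtain x y where x: "x\<in>carrier (P1 V)" "(d V x, t)\<in>graph V" and y: "y\<in>carrier (P1 V)" "(d V y, s)\<in>graph V"
      using tau_b_exists[OF V] by metis
    \<comment> \<open>Equal classes have differentials that differ by an element of
      \<open>M Ker \<epsilon>\<close>, and there the second component of the graph is zero by
      \<open>graph_fun\<close>.\<close>
    have k: "d V y \<ominus>[P0 V] d V x\<in>MK V" using e u1_eq_iff[OF V y(1) x(1)] by (simp add: tau_b[OF V x] tau_b[OF V y])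
    have "(d V y \<oplus>[P0 V] \<ominus>[P0 V] d V x, s \<oplus>[MV.TM] \<ominus>[MV.TG] t)\<in>graph V"
      by (rule graph_add[OF V graph_neg[OF V x(2)] y(2)])
    then have "s \<ominus>[MV.TG] t = \<zero>[MV.TG]" using graph_fun[OF V k] by (simp add: P0.minus_eq MV.TG.minus_eq)
    then show "s = t" using graph_closed[OF V x(2)] graph_closed[OF V y(2)] by (simp add: MV.TG.diff_zero_iff)
  qed
  show "eb E V ` pts I V = a_kernel (fobj (C1 E) V) (fobj (C0 E) V) (ediff E V)"
    unfolding I tau_simps(1,2)
  proof (intro equalityI subsetI)
    fix z assume "z\<in>eb E V ` carrier MV.TG"
    then obtain t where t: "t\<in>carrier MV.TG" "z = eb E V t" by auto
    obtain x where x: "x\<in>carrier (P1 V)" "(d V x, t)\<in>graph V" using tau_b_exists[OF V t(1)] by metis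
    show "z\<in>a_kernel (fobj K1 V) (fobj (KK 0) V) (ediff E V)"
      using x t mspan_graph[OF V x(2)] add_hom.hom_closed[OF u1_hom[OF V] x(1)]
      by (simp add: in_a_kernel tau_b[OF V x] tau_d[OF V] un_zero_iff[OF V] dx)
  next
    fix z assume "z\<in>a_kernel (fobj K1 V) (fobj (KK 0) V) (ediff E V)"
    then have z: "z\<in>pts K1 V" "ediff E V z = \<zero>[fobj (KK 0) V]" by (simp_all add: in_a_kernel)
    obtain x where x: "x\<in>carrier (P1 V)" "z = u1 V x" using u1_E[OF V z(1)] .
    then have "d V x\<in>mspan (P0 V) iM (carrier (P0 V))" using z by (simp add: tau_d[OF V] un_zero_iff[OF V] dx)
    then obtain t where t: "(d V x, t)\<in>graph V" using graph_mspan[OF V] by auto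
    show "z\<in>eb E V ` carrier MV.TG"
      by (rule image_eqI[of _ _ t]) (use x t graph_closed[OF V t] in \<open>simp_all add: tau_b[OF V x(1) t]\<close>)
  qed
  show "ediff E V ` pts (C1 E) V = a_kernel (fobj (C0 E) V) (fobj taut_functor V) (ea E V)"
    unfolding tau_simps(1,2)
  proof (intro equalityI subsetI)
    fix z assume "z\<in>ediff E V ` pts K1 V"
    then obtain w where w: "w\<in>pts K1 V" "z = ediff E V w" by auto
    obtain x where "x\<in>carrier (P1 V)" "w = u1 V x" using u1_E[OF V w(1)] .
    then have x: "x\<in>carrier (P1 V)" "z = un 0 V (d V x)" using w(2) by (simp_all add: tau_d[OF V])
    then show "z\<in>a_kernel (fobj (KK 0) V) (fobj taut_functor V) (ea E V)"
      using d_K[OF V x(1)] add_hom.hom_closed[OF un_hom[OF V] dx[OF x(1)]]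
      by (simp add: in_a_kernel tau_a[OF V] taut_functor_def)
  next
    fix z assume "z\<in>a_kernel (fobj (KK 0) V) (fobj taut_functor V) (ea E V)"
    then have z: "z\<in>pts (KK 0) V" "ea E V z = \<zero>[V]" by (simp_all add: in_a_kernel taut_functor_def)
    obtain p where p: "p\<in>carrier (P0 V)" "z = un 0 V p" using un_E[OF V z(1)] .
    then have "p\<in>K V" using z by (simp add: in_a_kernel tau_a[OF V])
    then obtain x where x: "x\<in>carrier (P1 V)" "p = d V x" using K_d[OF V] by blast
    show "z\<in>ediff E V ` pts K1 V"
      by (rule image_eqI[of _ _ "u1 V x"]) (use x p add_hom.hom_closed[OF u1_hom[OF V]] in \<open>simp_all add: tau_d[OF V]\<close>)
  qed
  have "ea E V ` pts (C0 E) V = \<epsilon> V ` carrier (P0 V)"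
    unfolding tau_simps(1) un_surj[OF V, symmetric] image_image by (rule image_cong[OF refl]) (rule tau_a[OF V])
  then show "ea E V ` pts (C0 E) V = pts taut_functor V"
    by (simp add: \<epsilon>_image[OF V] taut_functor_def)
qed

section \<open>The splitting of the truncated complex\<close>

lemma MK_quotient: "quotient_functor_of R T (rP P 0) MK"
proof
  show "pointed_functor R T (rP P 0)" by (rule P_pointed)
  show "submodule_of T (P0 V) (MK V)" if "V\<in>Proj" for V by (rule MK_submodule[OF that])
  fix V W f y
  assume V: "V\<in>Proj" and W: "W\<in>Proj" and f: "f\<in>lin_hom R V W" and "y\<in>MK V"
  interpret F: add_hom "P0 V" "P0 W" "fmap (rP P 0) V W f" by (rule functor_map_hom[OF P_pointed V W f])
  interpret f: add_hom V W f by (rule lin_add_hom[OF f fgp_module[OF V] fgp_module[OF W]])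
  from \<open>y\<in>MK V\<close> show "fmap (rP P 0) V W f y\<in>MK W"
  proof (induction rule: mspan.induct)
    case zero
    show ?case using mspan.zero[of "P0 W" iM "K W"] by simp
  next
    case (step y j h)
    have c: "y\<in>carrier (P0 V)" "j\<in>carrier T" "h\<in>carrier (P0 V)" "\<epsilon> V h = \<zero>[V]"
      using mspan_closed[OF P_module[OF V] iM_ideal(1) K_sub[OF V] step.hyps(1)] step.hyps iM_ideal(1) by (auto simp: in_a_kernel)
    have "fmap (rP P 0) V W f (y \<oplus>[P0 V] j \<odot>[P0 V] h) = fmap (rP P 0) V W f y \<oplus>[P0 W] j \<odot>[P0 W] fmap (rP P 0) V W f h"
      using c lin_homD(4)[OF functor_map[OF P_pointed V W f]] by (simp add: P_smult[OF V])
    moreover have "fmap (rP P 0) V W f h\<in>K W" using c by (simp add: in_a_kernel \<epsilon>_natural[OF V W f])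
    ultimately show ?case using mspan.step[OF step.IH step.hyps(2)] by simp
  qed
qed

sublocale N: quotient_functor_of R T "rP P 0" MK
  by (rule MK_quotient)

text \<open>The splitting is \<open>P\<^sub>0 / M Ker \<epsilon>\<close>, on which the square-zero extension acts.\<close>

definition tau_splitting :: "('r, 'u, int, ('r, 'u) tens, ('r, 'u) tens set, 'u set) splitting" where
  "tau_splitting = \<lparr>C01 = forget T N.QF,
     sc1 = descend R (\<lambda>V. P1 V) K1 u1 (\<lambda>V x. N.proj V (d V x)),
     sc0 = descend R (\<lambda>V. P0 V) N.QF N.proj (un 0)\<rparr>"

context
  fixes V :: "('r, 'u) module" assumes V: "V\<in>Proj"
begin

interpretation NV: quotient_of T "P0 V" "MK V" by (rule N.quotient[OF V])

lemma N_obj: "fobj N.QF V = quotient_module (P0 V) (MK V)"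
  by (rule N.fobj_QF)

lemma proj_hom: "add_hom (P0 V) (fobj N.QF V) (N.proj V)"
  using NV.proj_hom by (simp add: N_obj)

lemma proj_surj: "N.proj V ` carrier (P0 V) = pts N.QF V"
  by (simp add: N_obj NV.carrier_Q)

lemma proj_d_hom: "add_hom (P1 V) (fobj N.QF V) (\<lambda>x. N.proj V (d V x))"
  by (rule add_hom_comp[OF d_hom[OF V] proj_hom])

lemma dx_closed: "x\<in>carrier (P1 V) \<Longrightarrow> d V x\<in>carrier (P0 V)"
  using add_hom.hom_closed[OF d_hom[OF V]] .

lemma tau_c1: "x\<in>carrier (P1 V) \<Longrightarrow> sc1 tau_splitting V (u1 V x) = N.proj V (d V x)"
  unfolding tau_splitting_def splitting.simps
  by (rule descend_eq[where A = "\<lambda>V. P1 V" and c = u1 and g = "\<lambda>V x. N.proj V (d V x)", OF V u1_hom[OF V] proj_d_hom]) (simp_all add: u1_zero_iff[OF V] N_obj NV.proj_zero_iff dx_closed)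

lemma tau_c0: "p\<in>carrier (P0 V) \<Longrightarrow> sc0 tau_splitting V (N.proj V p) = un 0 V p"
  unfolding tau_splitting_def splitting.simps
  by (rule descend_eq[where A = "\<lambda>V. P0 V" and c = N.proj and g = "un 0", OF V proj_hom un_hom[OF V]]) (simp_all add: un_zero_iff[OF V] N_obj NV.proj_zero_iff MK_sub[OF V])

end

text \<open>In terms of \<open>P0\<close> the maps are the inclusion of
  \<open>Ker \<epsilon> / M Ker \<epsilon>\<close> into \<open>P0 / M Ker \<epsilon>\<close> and the
  projection of the latter to \<open>P0 / M P0\<close>.\<close>

lemma tau_splitting: "splits E tau_splitting"
  unfolding is_splitting_def
proof (intro conjI ballI)
  show "pointed_functor R \<Z> (C01 tau_splitting)"
    using forget_pointed[OF T_ring N.QF_pointed] by (simp add: tau_splitting_def)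
  have e: "C1 (forget_ext R E) = forget R K1" "C0 (forget_ext R E) = forget R (KK 0)" "C01 tau_splitting = forget T N.QF"
    "ediff (forget_ext R E) = ediff E" "eb (forget_ext R E) = eb E"
    by (simp_all add: forget_ext_def tau_simps tau_splitting_def)
  show "sc1 tau_splitting\<in>nat_hom R \<Z> (C1 (forget_ext R E)) (C01 tau_splitting)"
    unfolding e tau_splitting_def splitting.simps
  proof (rule descend_forget[OF ring T_ring B.QF_pointed N.QF_pointed u1_hom u1_surj proj_d_hom])
    show "descend R (\<lambda>V. P1 V) K1 u1 (\<lambda>V x. N.proj V (d V x)) V (u1 V x) = N.proj V (d V x)"
      if "V\<in>Proj" "x\<in>carrier (P1 V)" for V x
      using tau_c1[OF that] by (simp add: tau_splitting_def)
    show "\<exists>a'\<in>carrier (P1 W). u1 W a' = fmap K1 V W f (u1 V x) \<and> N.proj W (d W a') = fmap N.QF V W f (N.proj V (d V x))"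
      if V: "V\<in>Proj" and W: "W\<in>Proj" and f: "f\<in>lin_hom R V W" and x: "x\<in>carrier (P1 V)" for V W f x
      using x lin_homD(1)[OF functor_map[OF P_pointed V W f] x] nat_hom_natural[OF d_nat V W f x]
      by (intro bexI[of _ "fmap (rP P (Suc 0)) V W f x"]) (simp_all add: u1_natural[OF V W f] N.fmap_proj[OF V W f] dx_closed[OF V])
  qed
  show "sc0 tau_splitting\<in>nat_hom R \<Z> (C01 tau_splitting) (C0 (forget_ext R E))"
    unfolding e tau_splitting_def splitting.simps
  proof (rule descend_forget[OF T_ring ring N.QF_pointed KK_pointed proj_hom proj_surj un_hom])
    show "descend R (\<lambda>V. P0 V) N.QF N.proj (un 0) V (N.proj V p) = un 0 V p"
      if "V\<in>Proj" "p\<in>carrier (P0 V)" for V p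
      using tau_c0[OF that] by (simp add: tau_splitting_def)
    show "\<exists>a'\<in>carrier (P0 W). N.proj W a' = fmap N.QF V W f (N.proj V p) \<and> un 0 W a' = fmap (KK 0) V W f (un 0 V p)"
      if V: "V\<in>Proj" and W: "W\<in>Proj" and f: "f\<in>lin_hom R V W" and p: "p\<in>carrier (P0 V)" for V W f p
      using p lin_homD(1)[OF functor_map[OF P_pointed V W f] p]
      by (intro bexI[of _ "fmap (rP P 0) V W f p"]) (simp_all add: un_natural[OF V W f] N.fmap_proj[OF V W f])
  qed
  fix V assume V: "V\<in>Proj"
  interpret NV: quotient_of T "P0 V" "MK V" by (rule N.quotient[OF V])
  show "inj_on (sc1 tau_splitting V) (pts (C1 (forget_ext R E)) V)"
    unfolding e forget_simps
  proof (rule inj_onI)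
    fix z w assume zw: "z\<in>pts K1 V" "w\<in>pts K1 V" and eq: "sc1 tau_splitting V z = sc1 tau_splitting V w"
    obtain x y where x: "x\<in>carrier (P1 V)" "z = u1 V x" and y: "y\<in>carrier (P1 V)" "w = u1 V y"
      using u1_E[OF V zw(1)] u1_E[OF V zw(2)] by metis
    then show "z = w" using eq by (simp add: tau_c1[OF V] u1_eq_iff[OF V] NV.proj_eq_iff dx_closed[OF V])
  qed
  have "sc0 tau_splitting V ` pts N.QF V = un 0 V ` carrier (P0 V)"
    unfolding proj_surj[OF V, symmetric] image_image by (rule image_cong[OF refl]) (rule tau_c0[OF V])
  then show "sc0 tau_splitting V ` pts (C01 tau_splitting) V = pts (C0 (forget_ext R E)) V"
    by (simp add: e tau_simps un_surj[OF V])
  { fix z assume "z\<in>pts (C1 (forget_ext R E)) V"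
    then have "z\<in>pts K1 V" by (simp add: e tau_simps)
    then obtain x where "x\<in>carrier (P1 V)" "z = u1 V x" using u1_E[OF V] by blast
    then show "sc0 tau_splitting V (sc1 tau_splitting V z) = ediff (forget_ext R E) V z"
      by (simp add: e tau_c1[OF V] tau_c0[OF V] dx_closed[OF V] tau_d[OF V]) }
  show "a_kernel (fobj (C01 tau_splitting) V) (fobj (C0 (forget_ext R E)) V) (sc0 tau_splitting V) =
      sc1 tau_splitting V ` eb (forget_ext R E) V ` pts (forget R I) V"
    unfolding e image_image forget_simps
  proof (intro equalityI subsetI)
    fix z assume "z\<in>a_kernel (fobj (forget T N.QF) V) (fobj (forget R (KK 0)) V) (sc0 tau_splitting V)"
    then have z: "z\<in>pts N.QF V" "sc0 tau_splitting V z = \<zero>[fobj (KK 0) V]" by (simp_all add: in_a_kernel)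
    then obtain p where p: "p\<in>carrier (P0 V)" "z = N.proj V p" unfolding proj_surj[OF V, symmetric] by auto
    then have "p\<in>mspan (P0 V) iM (carrier (P0 V))" using z by (simp add: tau_c0[OF V] un_zero_iff[OF V])
    then obtain t where t: "(p, t)\<in>graph V" using graph_mspan[OF V] by auto
    obtain x where x: "x\<in>carrier (P1 V)" "p = d V x" using K_d[OF V graph_in_K[OF V t]] .
    show "z\<in>(\<lambda>t. sc1 tau_splitting V (eb E V t)) ` pts I V"
      by (rule image_eqI[of _ _ t]) (use p x t graph_closed[OF V t] in \<open>simp_all add: I_carrier tau_b[OF V, of x] tau_c1[OF V]\<close>)
  next
    fix z assume "z\<in>(\<lambda>t. sc1 tau_splitting V (eb E V t)) ` pts I V"
    then obtain t where t: "t\<in>carrier (tensor_group R M V)" "z = sc1 tau_splitting V (eb E V t)" by (auto simp: I_carrier)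
    obtain x where x: "x\<in>carrier (P1 V)" "(d V x, t)\<in>graph V" using tau_b_exists[OF V t(1)] .
    then show "z\<in>a_kernel (fobj (forget T N.QF) V) (fobj (forget R (KK 0)) V) (sc0 tau_splitting V)"
      using t mspan_graph[OF V x(2)] add_hom.hom_closed[OF proj_d_hom[OF V] x(1)]
      by (simp add: in_a_kernel tau_b[OF V x] tau_c1[OF V] tau_c0[OF V] un_zero_iff[OF V] dx_closed[OF V])
  qed
qed

text \<open>The square-zero extension acts on \<open>P0 / M Ker \<epsilon>\<close> by scalars. On
  \<open>i(m)\<close> this is the endomorphism attached to \<open>m\<close>, because
  \<open>b\<close> sends \<open>m \<otimes> \<epsilon>(p)\<close> to the class belonging to
  \<open>i(m) p\<close>; then the five lemma applies.\<close>

theorem tau_regular_ext: "sq_iso M X (regular_ext R M E tau_splitting)"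
proof -
  interpret EE: elementary R u M E by (rule elementaryI[OF tau_el_ext])
  obtain \<sigma> where "split_elementary R M E tau_splitting \<sigma>" using EE.exists_generator_lift[OF tau_splitting] by auto
  then interpret S: split_elementary R u M E tau_splitting \<sigma> .
  define \<phi> where "\<phi> x = nat_restrict R N.QF (\<lambda>V Y. x \<odot>[fobj N.QF V] Y)" for x
  have Z: "carrier (S.Z V) = pts N.QF V" "\<And>x y. x \<oplus>[S.Z V] y = x \<oplus>[fobj N.QF V] y"
    "C01 tau_splitting = forget T N.QF" for V
    by (simp_all add: tau_splitting_def)
  have nr: "nat_restrict R (C01 tau_splitting) = nat_restrict R N.QF"
    by (simp add: nat_restrict_def fun_eq_iff Z)
  have \<phi>: "\<phi> x V (N.proj V p) = N.proj V (x \<odot>[P0 V] p)" if "x\<in>carrier T" "V\<in>Proj" "p\<in>carrier (P0 V)" for x V p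
  proof -
    interpret NV: quotient_of T "P0 V" "MK V" by (rule N.quotient[OF that(2)])
    show ?thesis using that add_hom.hom_closed[OF proj_hom[OF that(2)] that(3)] by (simp add: \<phi>_def N_obj NV.smult_Q)
  qed
  have E: "\<exists>p\<in>carrier (P0 V). Y = N.proj V p" if "V\<in>Proj" "Y\<in>pts N.QF V" for V Y
    using that(2) unfolding proj_surj[OF that(1), symmetric] by auto
  have reg: "S.reg (\<phi> x) (q x)" if x: "x\<in>carrier T" for x
  proof (rule S.regI)
    show "\<phi> x\<in>nat_hom R \<Z> (C01 tau_splitting) (C01 tau_splitting)"
      unfolding \<phi>_def Z by (rule scalar_nat[OF N.QF_pointed x])
    show "q x\<in>carrier R" using x by (rule q_closed)
    { fix V z assume V: "V\<in>Proj" and "z\<in>carrier (S.Z V)"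
      then obtain p where p: "p\<in>carrier (P0 V)" "z = N.proj V p" using E[OF V] by (auto simp: Z)
      then show "sc0 tau_splitting V (\<phi> x V z) = q x \<odot>[fobj (C0 E) V] sc0 tau_splitting V z"
        using x V by (simp add: \<phi> tau_c0[OF V] P_smult[OF V] tau_simps un_smult[OF V]) }
    { fix V z assume V: "V\<in>Proj" and "z\<in>pts (C1 E) V"
      then have "z\<in>pts K1 V" by (simp add: tau_simps)
      then obtain y where y: "y\<in>carrier (P1 V)" "z = u1 V y" using u1_E[OF V] by blast
      then show "\<phi> x V (sc1 tau_splitting V z) = sc1 tau_splitting V (q x \<odot>[fobj (C1 E) V] z)"
        using x V by (simp add: \<phi> tau_c1[OF V] P_smult[OF V] tau_simps u1_smult[OF V] dx_closed[OF V] d_smult[OF V]) }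
  qed
  have eq: "\<eta> = \<theta>" if r: "S.reg \<eta> r" "S.reg \<theta> s"
    and pw: "\<And>V p. \<lbrakk>V\<in>Proj; p\<in>carrier (P0 V)\<rbrakk> \<Longrightarrow> \<eta> V (N.proj V p) = \<theta> V (N.proj V p)" for \<eta> \<theta> r s
    by (rule S.reg_ext[OF r]) (use E pw in \<open>force simp: Z\<close>)
  have pc: "N.proj V p\<in>pts N.QF V" if "V\<in>Proj" "p\<in>carrier (P0 V)" for V p
    using add_hom.hom_closed[OF proj_hom[OF that(1)] that(2)] .
  have "\<phi>\<in>ring_hom T S.RR"
  proof (rule ring_hom_memI)
    show "\<phi> x\<in>carrier S.RR" if "x\<in>carrier T" for x using reg[OF that] by (auto simp: S.RR_carrier)
    fix x y assume x: "x\<in>carrier T" and y: "y\<in>carrier T"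
    show "\<phi> (x \<otimes>[T] y) = \<phi> x \<otimes>[S.RR] \<phi> y"
    proof (rule eq[OF reg S.reg_mult[OF reg[OF x] reg[OF y]]])
      show "\<phi> (x \<otimes>[T] y) V (N.proj V p) = (\<phi> x \<otimes>[S.RR] \<phi> y) V (N.proj V p)" if V: "V\<in>Proj" and p: "p\<in>carrier (P0 V)" for V p
        using x y p V by (simp add: \<phi> pc nr S.RR_ops left_module.smult_assoc[OF P_module[OF V]] P_smult[OF V])
    qed (use x y in simp)
    show "\<phi> (x \<oplus>[T] y) = \<phi> x \<oplus>[S.RR] \<phi> y"
    proof (rule eq[OF reg S.reg_add[OF reg[OF x] reg[OF y]]])
      show "\<phi> (x \<oplus>[T] y) V (N.proj V p) = (\<phi> x \<oplus>[S.RR] \<phi> y) V (N.proj V p)" if V: "V\<in>Proj" and p: "p\<in>carrier (P0 V)" for V p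
      proof -
        interpret h: add_hom "P0 V" "fobj N.QF V" "N.proj V" by (rule proj_hom[OF V])
        show ?thesis using x y p V by (simp add: \<phi> pc nr S.RR_ops Z(2) left_module.smult_l_distr[OF P_module[OF V]] P_smult[OF V])
      qed
    qed (use x y in simp)
  next
    show "\<phi> \<one>[T] = \<one>[S.RR]"
    proof (rule eq[OF reg S.reg_one])
      show "\<phi> \<one>[T] V (N.proj V p) = \<one>[S.RR] V (N.proj V p)" if V: "V\<in>Proj" and p: "p\<in>carrier (P0 V)" for V p
        using p V by (simp add: \<phi> pc nr S.RR_ops left_module.smult_one[OF P_module[OF V]])
    qed simp
  qed
  moreover have "\<phi> (i m) = sq_i S.RX m" if m: "m\<in>carrier M" for m
  proof (rule eq[OF reg S.reg_i[OF m]])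
    show "i m\<in>carrier T" using m by (rule i_closed)
    fix V p assume V: "V\<in>Proj" and p: "p\<in>carrier (P0 V)"
    have g: "(i m \<odot>[P0 V] p, tens R M V m (\<epsilon> V p))\<in>graph V" using graph_gen[OF V m p] .
    obtain x where x: "x\<in>carrier (P1 V)" "i m \<odot>[P0 V] p = d V x" using K_d[OF V graph_in_K[OF V g]] .
    have "sq_i S.RX m V (N.proj V p) = sc1 tau_splitting V (u1 V x)"
      using V p x g tau_b[OF V x(1)] by (simp add: S.i_apply Z pc tau_c0[OF V] tau_a[OF V])
    then show "\<phi> (i m) V (N.proj V p) = sq_i S.RX m V (N.proj V p)"
      using x m V p by (simp add: \<phi> i_closed tau_c1[OF V])
  qed
  ultimately show ?thesis
    using S.RX_q[OF reg] by (intro square_zero_morphism_iso[OF X S.RX_sq_ext M.M.abelian_group_axioms ring, of \<phi>]) (auto simp: S.RX_simps)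
qed

end

subsection \<open>Comparison with other elementary extensions\<close>

text \<open>Through \<open>\<phi>\<close> the functor \<open>C\<^sub>0\<^sub>1\<close> takes values in modules over the square-zero extension, so the
  augmentation \<open>P\<^sub>0 \<rightarrow> V\<close> lifts along \<open>C\<^sub>0\<^sub>1 \<rightarrow> V\<close>.\<close>

locale regular_action = split_elementary R u M E D \<sigma> + Q: tau_complex R u M X P
  for R :: "'r ring" and u :: "'u itself" and M :: "('r, 'r, 'm) bimodule"
    and E :: "('r, 'u, 'r, 'u, ('m, 'u) tens, 'u, 'u) el_ext" and D :: "('r, 'u) u_split" and \<sigma> :: 'u
    and X :: "('r, 'm, 'u) sq_ext" and P :: "('r, 'u) u_res" +
  fixes \<phi> :: "'u \<Rightarrow> ('r, 'u) module \<Rightarrow> 'u \<Rightarrow> 'u"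
  assumes \<phi>: "\<phi>\<in>ring_hom Q.T RR" and \<phi>_i: "\<And>m. m\<in>carrier M \<Longrightarrow> \<phi> (Q.i m) = sq_i RX m"
    and \<phi>_q: "\<And>x. x\<in>carrier Q.T \<Longrightarrow> sq_q RX (\<phi> x) = Q.q x"
begin

lemma \<phi>_reg: assumes "x\<in>carrier Q.T" shows "reg (\<phi> x) (Q.q x)"
proof -
  obtain r where "reg (\<phi> x) r" using ring_hom_closed[OF \<phi> assms] RR_carrier by auto
  then show ?thesis using RX_q \<phi>_q[OF assms] by metis
qed

definition ZT :: "('r, 'u, 'u, 'u) pfunctor" where
  "ZT = \<lparr>fobj = (\<lambda>V. \<lparr>carrier = carrier (Z V), monoid.mult = undefined, monoid.one = undefined,
     ring.zero = \<zero>[Z V], ring.add = (\<lambda>x y. x \<oplus>[Z V] y), smult = (\<lambda>x z. \<phi> x V z)\<rparr>), fmap = fmap (C01 D)\<rparr>"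

lemma ZT_simps: "pts ZT V = carrier (Z V)" "\<zero>[fobj ZT V] = \<zero>[Z V]"
  "x \<oplus>[fobj ZT V] y = x \<oplus>[Z V] y" "x \<odot>[fobj ZT V] z = \<phi> x V z" "fmap ZT = fmap (C01 D)"
  by (simp_all add: ZT_def)

lemma ZT_abelian: "V\<in>Proj \<Longrightarrow> abelian_group (fobj ZT V)"
  by (rule abelian_group_cong[OF Z_abelian]) (simp_all add: ZT_simps)

lemma \<phi>_nat: "x\<in>carrier Q.T \<Longrightarrow> \<phi> x\<in>nat_hom R \<Z> (C01 D) (C01 D)"
  using regD(1)[OF \<phi>_reg] .

lemma ZT_pointed: "pointed_functor R Q.T ZT"
proof (rule pointed_functorI)
  fix V assume V: "V\<in>Proj"
  show "left_module Q.T (fobj ZT V)"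
  proof (rule left_moduleI[OF Q.T_ring ZT_abelian[OF V]]; unfold ZT_simps)
    fix x y z assume x: "x\<in>carrier Q.T" and y: "y\<in>carrier Q.T" and z: "z\<in>carrier (Z V)"
    show "\<phi> (x \<oplus>[Q.T] y) V z = \<phi> x V z \<oplus>[Z V] \<phi> y V z" "\<phi> (x \<otimes>[Q.T] y) V z = \<phi> x V (\<phi> y V z)"
      using z V ring_hom_add[OF \<phi> x y] ring_hom_mult[OF \<phi> x y] by (simp_all add: RR_ops)
  qed (use V ring_hom_one[OF \<phi>] lin_homD(1,3)[OF nat_hom_lin[OF \<phi>_nat V]] in \<open>simp_all add: RR_ops\<close>)
  fix W f assume W: "W\<in>Proj" and f: "f\<in>lin_hom R V W"
  note F = functor_map[OF Z_pointed V W f]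
  show "fmap ZT V W f\<in>lin_hom Q.T (fobj ZT V) (fobj ZT W)"
    by (rule lin_homI) (auto simp: ZT_simps lin_homD(1,2,3)[OF F] nat_hom_natural[OF \<phi>_nat V W f])
next
  fix V W U f g z
  assume V: "V\<in>Proj"
  show "fmap ZT V V (\<lambda>x\<in>carrier V. x) z = z" if "z\<in>pts ZT V"
    using that functor_map_id[OF Z_pointed V] by (simp add: ZT_simps)
  show "pts ZT V \<subseteq> {\<zero>[fobj ZT V]}" if "carrier V = {\<zero>[V]}"
    using functor_zero[OF Z_pointed V that] by (simp add: ZT_simps)
  show "fmap ZT V U (compose (carrier V) g f) z = fmap ZT W U g (fmap ZT V W f z)"
    if "W\<in>Proj" "U\<in>Proj" "f\<in>lin_hom R V W" "g\<in>lin_hom R W U" "z\<in>pts ZT V"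
    using that functor_map_comp[OF Z_pointed V] by (simp add: ZT_simps)
qed

lemma lift_exists:
  obtains \<psi> where "\<psi>\<in>nat_hom R Q.T (rP P 0) ZT"
    "\<And>V p. \<lbrakk>V\<in>Proj; p\<in>carrier (Q.P0 V)\<rbrakk> \<Longrightarrow> a V (c0 V (\<psi> V p)) = Q.\<epsilon> V p"
proof -
  let ?F = "q_star X taut_functor :: ('r, 'u, 'u, 'u) pfunctor"
  define \<pi> where "\<pi> = nat_restrict R ZT (\<lambda>V z. a V (c0 V z))"
  have F: "pointed_functor R Q.T ?F"
    unfolding q_star_def by (rule restrict_functor_pointed[OF Q.T_ring Q.q_ring_hom taut_pointed])
  have Fs: "pts ?F V = carrier V" "x \<oplus>[fobj ?F V] y = x \<oplus>[V] y" "s \<odot>[fobj ?F V] x = Q.q s \<odot>[V] x" "fmap ?F V W f = f" for V W f x y s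
    by (simp_all add: q_star_def restrict_functor_def taut_functor_def)
  have \<pi>: "\<pi>\<in>nat_hom R Q.T ZT ?F"
    unfolding \<pi>_def
  proof (rule nat_restrictI[OF ZT_pointed]; unfold Fs ZT_simps)
    fix V z assume V: "V\<in>Proj" and z: "z\<in>carrier (Z V)"
    interpret ac: add_hom "Z V" V "\<lambda>z. a V (c0 V z)" by (rule ac0_hom[OF V])
    show "a V (c0 V z)\<in>carrier V" using z by simp
    show "a V (c0 V (z \<oplus>[Z V] w)) = a V (c0 V z) \<oplus>[V] a V (c0 V w)" if "w\<in>carrier (Z V)" for w using z that by simp
    show "a V (c0 V (\<phi> s V z)) = Q.q s \<odot>[V] a V (c0 V z)" if "s\<in>carrier Q.T" for s by (rule reg_ac0[OF \<phi>_reg[OF that] V z])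
    show "a W (c0 W (fmap (C01 D) V W f z)) = f (a V (c0 V z))" if "W\<in>Proj" "f\<in>lin_hom R V W" for W f
      using nat_hom_natural[OF c0_nat V that z] a_natural[OF V that c0_closed[OF V z]] by simp
  qed
  have "\<pi> V ` pts ZT V = pts ?F V" if V: "V\<in>Proj" for V
  proof -
    have "\<pi> V ` pts ZT V = a V ` c0 V ` carrier (Z V)"
      unfolding image_image using V by (intro image_cong) (simp_all add: \<pi>_def ZT_simps)
    then show ?thesis by (simp add: c0_image[OF V] a_image[OF V] Fs)
  qed
  then obtain \<psi> where \<psi>: "\<psi>\<in>nat_hom R Q.T (rP P 0) ZT" "\<forall>V\<in>Proj. \<forall>p\<in>carrier (Q.P0 V). \<pi> V (\<psi> V p) = Q.\<epsilon> V p"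
    using Q.P_projective[of 0, unfolded projective_functor_def] conjI[OF ZT_pointed F] \<pi> Q.\<epsilon>_nat by blast
  have "a V (c0 V (\<psi> V p)) = Q.\<epsilon> V p" if V: "V\<in>Proj" and p: "p\<in>carrier (Q.P0 V)" for V p
    using bspec[OF bspec[OF \<psi>(2) V] p] V lin_homD(1)[OF nat_hom_lin[OF \<psi>(1) V] p] by (simp add: \<pi>_def)
  with \<psi>(1) show thesis by (rule that)
qed

text \<open>The lift \<open>\<psi>\<close> takes a pair \<open>(y, t)\<close> of the graph to
  \<open>\<psi> y = c1 (b t)\<close>. Hence \<open>c0 \<psi>\<close> kills \<open>M P0\<close> and
  descends to degree zero, \<open>\<psi>\<close> kills \<open>M Ker \<epsilon>\<close>, and degree
  one is compatible with \<open>b\<close>.\<close>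

theorem tau_mor: "\<exists>f0 f1. el_mor R R I (tau_ext R M X P) E f0 f1"
proof -
  obtain \<psi> where \<psi>: "\<psi>\<in>nat_hom R Q.T (rP P 0) ZT"
    and a\<psi>: "\<And>V p. \<lbrakk>V\<in>Proj; p\<in>carrier (Q.P0 V)\<rbrakk> \<Longrightarrow> a V (c0 V (\<psi> V p)) = Q.\<epsilon> V p"
    by (rule lift_exists) blast
  have \<psi>h: "add_hom (Q.P0 V) (Z V) (\<psi> V)" if V: "V\<in>Proj" for V
    using lin_homD(1,3)[OF nat_hom_lin[OF \<psi> V]] by (intro add_homI Q.P_abelian[OF V] Z_abelian[OF V]) (simp_all add: ZT_simps)
  have \<psi>s: "\<psi> V (x \<odot>[Q.P0 V] p) = \<phi> x V (\<psi> V p)" if "V\<in>Proj" "x\<in>carrier Q.T" "p\<in>carrier (Q.P0 V)" for V x p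
    using lin_homD(4)[OF nat_hom_lin[OF \<psi> that(1)] that(2,3)] by (simp add: ZT_simps)
  have \<psi>c: "\<psi> V p\<in>carrier (Z V)" if "V\<in>Proj" "p\<in>carrier (Q.P0 V)" for V p
    using add_hom.hom_closed[OF \<psi>h[OF that(1)] that(2)] .
  have \<psi>n: "\<psi> W (fmap (rP P 0) V W f p) = fmap (C01 D) V W f (\<psi> V p)"
    if "V\<in>Proj" "W\<in>Proj" "f\<in>lin_hom R V W" "p\<in>carrier (Q.P0 V)" for V W f p
    using nat_hom_natural[OF \<psi> that] by (simp add: ZT_simps)
  \<comment> \<open>Here compatibility of \<open>\<phi>\<close> with the inclusions of
    \<open>M\<close> is used: \<open>i(m)\<close> acts on \<open>C01\<close> as the endomorphism
    attached to \<open>m\<close>.\<close>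
  have \<psi>g: "\<psi> V y = c1 V (b V t)" if V: "V\<in>Proj" and g: "(y, t)\<in>Q.graph V" for V y t
    using g
  proof (induction rule: Q.graph.induct)
    interpret MV: tensor_product R R M V by (rule tensor_M[OF V])
    interpret ps: add_hom "Q.P0 V" "Z V" "\<psi> V" by (rule \<psi>h[OF V])
    interpret cb: add_hom "fobj I V" "Z V" "\<lambda>t. c1 V (b V t)"
      by (rule add_hom_comp[OF b_hom[OF V] c1_hom[OF V]])
    { case zero
      show ?case using cb.hom_zero ps.hom_zero by (simp add: I_obj) }
    case (step y t m p)
    have c: "y\<in>carrier (Q.P0 V)" "t\<in>pts I V" using Q.graph_closed[OF V step.hyps(1)] by (simp_all add: I_carrier)
    have m: "tens R M V m (Q.\<epsilon> V p)\<in>pts I V"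
      using step MV.tens_closed[of m "Q.\<epsilon> V p"] Q.\<epsilon>_closed[OF V] by (simp add: I_carrier)
    have "\<psi> V (Q.i m \<odot>[Q.P0 V] p) = c1 V (b V (tens R M V m (Q.\<epsilon> V p)))"
      using step V by (simp add: \<psi>s Q.i_closed \<phi>_i i_apply \<psi>c a\<psi>)
    moreover have "c1 V (b V (t \<oplus>[fobj I V] tens R M V m (Q.\<epsilon> V p))) = c1 V (b V t) \<oplus>[Z V] c1 V (b V (tens R M V m (Q.\<epsilon> V p)))"
      using cb.hom_add[OF c(2) m] .
    ultimately show ?case using c step by (simp add: Q.iM_smult[OF V] I_obj)
  qed
  \<comment> \<open>The element \<open>\<psi> d x\<close> is killed by \<open>a c0\<close>, so it
    has a preimage under \<open>c1\<close>, unique by injectivity. The component in degree one is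
    therefore forced.\<close>
  define g where "g V x = inv_into (carrier (E1 V)) (c1 V) (\<psi> V (rd P 0 V x))" for V x
  let ?d = "rd P 0"
  have gx: "g V x\<in>carrier (E1 V) \<and> c1 V (g V x) = \<psi> V (?d V x)" if V: "V\<in>Proj" and x: "x\<in>carrier (Q.P1 V)" for V x
  proof -
    have "?d V x\<in>Q.K V" using Q.d_K[OF V x] .
    then have "a V (c0 V (\<psi> V (?d V x))) = \<zero>[V]" "\<psi> V (?d V x)\<in>carrier (Z V)" using a\<psi>[OF V] \<psi>c[OF V] by (auto simp: in_a_kernel)
    then have "\<psi> V (?d V x)\<in>c1 V ` carrier (E1 V)" using ac0_kernel[OF V] by (simp add: image_iff)
    then show ?thesis unfolding g_def by (simp add: inv_into_into f_inv_into_f)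
  qed
  have geq: "g V x = y" if "V\<in>Proj" "x\<in>carrier (Q.P1 V)" "y\<in>carrier (E1 V)" "\<psi> V (?d V x) = c1 V y" for V x y
    using gx[OF that(1,2)] that(3,4) c1_inj[OF that(1)] by (auto simp: inj_on_def)
  have gh: "add_hom (Q.P1 V) (E1 V) (g V)" if V: "V\<in>Proj" for V
  proof (rule add_homI[OF Q.P_abelian[OF V] E1_abelian[OF V]])
    interpret c: add_hom "E1 V" "Z V" "c1 V" by (rule c1_hom[OF V])
    interpret ps: add_hom "Q.P0 V" "Z V" "\<psi> V" by (rule \<psi>h[OF V])
    interpret dd: add_hom "Q.P1 V" "Q.P0 V" "?d V" by (rule Q.d_hom[OF V])
    show "g V x\<in>carrier (E1 V)" if "x\<in>carrier (Q.P1 V)" for x using gx[OF V that] by simp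
    show "g V (x \<oplus>[Q.P1 V] y) = g V x \<oplus>[E1 V] g V y" if "x\<in>carrier (Q.P1 V)" "y\<in>carrier (Q.P1 V)" for x y
      using gx[OF V that(1)] gx[OF V that(2)] that Q.dx_closed[OF V] by (intro geq[OF V]) simp_all
  qed
  define f0 where "f0 = descend R (\<lambda>V. Q.P0 V) (Q.KK 0) (Q.un 0) (\<lambda>V p. c0 V (\<psi> V p))"
  define f1 where "f1 = descend R (\<lambda>V. Q.P1 V) Q.K1 Q.u1 g"
  have c0h: "add_hom (Q.P0 V) (E0 V) (\<lambda>p. c0 V (\<psi> V p))" if V: "V\<in>Proj" for V
    by (rule add_hom_comp[OF \<psi>h[OF V] c0_hom[OF V]])
  have f0: "f0 V (Q.un 0 V p) = c0 V (\<psi> V p)" if V: "V\<in>Proj" and p: "p\<in>carrier (Q.P0 V)" for V p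
    unfolding f0_def
  proof (rule descend_eq[where A = "\<lambda>V. Q.P0 V" and c = "Q.un 0" and g = "\<lambda>V p. c0 V (\<psi> V p)", OF V Q.un_hom[OF V] c0h[OF V] p])
    fix p assume "p\<in>carrier (Q.P0 V)" "Q.un 0 V p = \<zero>[fobj (Q.KK 0) V]"
    then obtain t where t: "(p, t)\<in>Q.graph V" using Q.graph_mspan[OF V] by (auto simp: Q.un_zero_iff[OF V])
    have tc: "t\<in>pts I V" using Q.graph_closed[OF V t] by (simp add: I_carrier)
    then have "b V t\<in>carrier (E1 V)" using add_hom.hom_closed[OF b_hom[OF V]] by simp
    then show "c0 V (\<psi> V p) = \<zero>[E0 V]" using tc by (simp add: \<psi>g[OF V t] c0_c1[OF V] d_b[OF V])
  qed
  have f1: "f1 V (Q.u1 V x) = g V x" if V: "V\<in>Proj" and x: "x\<in>carrier (Q.P1 V)" for V x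
    unfolding f1_def
  proof (rule descend_eq[where A = "\<lambda>V. Q.P1 V" and c = Q.u1 and g = g, OF V Q.u1_hom[OF V] gh[OF V] x])
    fix x assume x: "x\<in>carrier (Q.P1 V)" "Q.u1 V x = \<zero>[fobj Q.K1 V]"
    have "\<psi> V (?d V x) = c1 V (b V \<zero>[tensor R M V])" using x by (intro \<psi>g[OF V Q.graph_MK[OF V]]) (simp add: Q.u1_zero_iff[OF V])
    also have "\<dots> = c1 V \<zero>[E1 V]" using add_hom.hom_zero[OF b_hom[OF V]] by (simp add: I_obj)
    finally show "g V x = \<zero>[E1 V]" by (rule geq[OF V x(1) abelian_groupE(2)[OF E1_abelian[OF V]]])
  qed
  have n0: "f0\<in>nat_hom R R (Q.KK 0) (C0 E)"
  proof (rule nat_hom_surjI[OF Q.KK_pointed C0_pointed Q.un_hom Q.un_surj c0h f0])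
    show "\<exists>p'\<in>carrier (Q.P0 V). Q.un 0 V p' = r \<odot>[fobj (Q.KK 0) V] Q.un 0 V p \<and> c0 V (\<psi> V p') = r \<odot>[E0 V] c0 V (\<psi> V p)"
      if V: "V\<in>Proj" and r: "r\<in>carrier R" and p: "p\<in>carrier (Q.P0 V)" for V r p
    proof -
      obtain s where s: "s\<in>carrier Q.T" "Q.q s = r" using Q.q_lift[OF r] by auto
      then show ?thesis using p V
        by (intro bexI[of _ "s \<odot>[Q.P0 V] p"]) (auto simp: Q.un_smult[OF V, symmetric] Q.P_smult[OF V] \<psi>s regD(3)[OF \<phi>_reg[OF s(1)]] \<psi>c)
    qed
    show "\<exists>p'\<in>carrier (Q.P0 W). Q.un 0 W p' = fmap (Q.KK 0) V W f (Q.un 0 V p) \<and> c0 W (\<psi> W p') = fmap (C0 E) V W f (c0 V (\<psi> V p))"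
      if V: "V\<in>Proj" and W: "W\<in>Proj" and f: "f\<in>lin_hom R V W" and p: "p\<in>carrier (Q.P0 V)" for V W f p
      using p lin_homD(1)[OF functor_map[OF Q.P_pointed V W f] p] nat_hom_natural[OF c0_nat V W f \<psi>c[OF V p]]
      by (intro bexI[of _ "fmap (rP P 0) V W f p"]) (simp_all add: Q.un_natural[OF V W f] \<psi>n[OF V W f])
  qed (simp_all add: f0_def descend_def nat_restrict_def)
  have n1: "f1\<in>nat_hom R R Q.K1 (C1 E)"
  proof (rule nat_hom_surjI[OF Q.B.QF_pointed C1_pointed Q.u1_hom Q.u1_surj gh f1])
    show "\<exists>x'\<in>carrier (Q.P1 V). Q.u1 V x' = r \<odot>[fobj Q.K1 V] Q.u1 V x \<and> g V x' = r \<odot>[E1 V] g V x"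
      if V: "V\<in>Proj" and r: "r\<in>carrier R" and x: "x\<in>carrier (Q.P1 V)" for V r x
    proof -
      obtain s where s: "s\<in>carrier Q.T" "Q.q s = r" using Q.q_lift[OF r] by auto
      have gc: "g V x\<in>carrier (E1 V)" "\<psi> V (?d V x) = c1 V (g V x)" using gx[OF V x] by simp_all
      have "\<psi> V (?d V (s \<odot>[Q.P1 V] x)) = c1 V (r \<odot>[E1 V] g V x)"
        using s x V gc regD(4)[OF \<phi>_reg[OF s(1)] V gc(1)] by (simp add: Q.d_smult[OF V] \<psi>s Q.dx_closed[OF V])
      then have "g V (s \<odot>[Q.P1 V] x) = r \<odot>[E1 V] g V x"
        using left_module.smult_closed[OF functor_obj[OF C1_pointed V] r gc(1)] by (intro geq[OF V Q.P_smult[OF V s(1) x]])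
      then show ?thesis using s x by (intro bexI[of _ "s \<odot>[Q.P1 V] x"]) (auto simp: Q.u1_smult[OF V, symmetric] Q.P_smult[OF V])
    qed
    show "\<exists>x'\<in>carrier (Q.P1 W). Q.u1 W x' = fmap Q.K1 V W f (Q.u1 V x) \<and> g W x' = fmap (C1 E) V W f (g V x)"
      if V: "V\<in>Proj" and W: "W\<in>Proj" and f: "f\<in>lin_hom R V W" and x: "x\<in>carrier (Q.P1 V)" for V W f x
    proof -
      let ?x = "fmap (rP P (Suc 0)) V W f x"
      have xc: "?x\<in>carrier (Q.P1 W)" using lin_homD(1)[OF functor_map[OF Q.P_pointed V W f] x] .
      have gc: "g V x\<in>carrier (E1 V)" "\<psi> V (?d V x) = c1 V (g V x)" using gx[OF V x] by simp_all
      have "\<psi> W (?d W ?x) = fmap (C01 D) V W f (c1 V (g V x))"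
        using nat_hom_natural[OF Q.d_nat V W f x] \<psi>n[OF V W f Q.dx_closed[OF V x]] gc(2) by simp
      then have "\<psi> W (?d W ?x) = c1 W (fmap (C1 E) V W f (g V x))"
        using nat_hom_natural[OF c1_nat V W f] gc(1) by simp
      then have "g W ?x = fmap (C1 E) V W f (g V x)"
        using lin_homD(1)[OF functor_map[OF C1_pointed V W f] gc(1)] by (intro geq[OF W xc])
      then show ?thesis using xc x by (intro bexI[of _ ?x]) (simp_all add: Q.u1_natural[OF V W f])
    qed
  qed (simp_all add: f1_def descend_def nat_restrict_def)
  show ?thesis
    unfolding el_mor_def Q.tau_simps(1,2)
  proof (intro exI conjI ballI)
    show "f0\<in>nat_hom R R (Q.KK 0) (C0 E)" by (rule n0)
    show "f1\<in>nat_hom R R Q.K1 (C1 E)" by (rule n1)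
    fix V assume V: "V\<in>Proj"
    { fix z assume "z\<in>pts Q.K1 V"
      then obtain x where x: "x\<in>carrier (Q.P1 V)" "z = Q.u1 V x" using Q.u1_E[OF V] by blast
      then show "f0 V (ediff (tau_ext R M X P) V z) = ediff E V (f1 V z)"
        using gx[OF V x(1)] c0_c1[OF V, of "g V x"] V by (simp add: Q.tau_d[OF V] f0 f1 Q.dx_closed[OF V]) }
    { fix z assume "z\<in>pts (Q.KK 0) V"
      then obtain p where "p\<in>carrier (Q.P0 V)" "z = Q.un 0 V p" using Q.un_E[OF V] by blast
      then show "a V (f0 V z) = ea (tau_ext R M X P) V z" using V by (simp add: f0 Q.tau_a[OF V] a\<psi>) }
    { fix t assume t: "t\<in>pts I V"
      then obtain x where x: "x\<in>carrier (Q.P1 V)" "(?d V x, t)\<in>Q.graph V" using Q.tau_b_exists[OF V] by (metis I_carrier)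
      then show "f1 V (eb (tau_ext R M X P) V t) = b V t"
        using V t add_hom.hom_closed[OF b_hom[OF V] t] by (simp add: Q.tau_b[OF V x] f1 geq \<psi>g[OF V x(2)]) }
  qed
qed

end

subsection \<open>The two maps are inverse to each other\<close>

lemma quotient_rep:
  assumes "equiv A r" "C\<in>A // r" "x\<in>C"
  shows "C = r `` {x}"
proof -
  obtain y where "C = r `` {y}" using assms(2) by (rule quotientE)
  then show ?thesis using assms(3) equiv_class_eq[OF assms(1), of y x] by auto
qed

context bimodule_universe
begin

type_synonym ('a, 'c, 'v) u_ext = "('a, 'v, 'a, 'v, ('c, 'v) tens, 'v, 'v) el_ext"

abbreviation resolves :: "('r, 'm, 'u) sq_ext \<Rightarrow> ('r, 'u) u_res \<Rightarrow> bool" where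
  "resolves X P \<equiv> projective_resolution R (sq_ring X) (q_star X taut_functor) P"

text \<open>On classes, both maps are given by this relation.\<close>

definition rel :: "('r, 'm, 'u) u_ext \<Rightarrow> ('r, 'm, 'u) sq_ext \<Rightarrow> bool" where
  "rel E Y \<longleftrightarrow> is_sq_ext R M Y \<and> (\<exists>D :: ('r, 'u) u_split.
     splits E D \<and> sq_iso M Y (regular_ext R M E D))"

lemma regular_ext_sq_ext:
  assumes E: "el_ext_of R M E" and D: "splits E D"
  shows "is_sq_ext R M (regular_ext R M E D)"
proof -
  have "elementary R M E" using E by (rule elementaryI)
  from elementary.exists_generator_lift[OF this D] obtain \<sigma> where "split_elementary R M E D \<sigma>" by blast
  then interpret split_elementary R u M E D \<sigma> .
  show ?thesis by (rule RX_sq_ext)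
qed

lemma el_mor_id: "el_ext_of R M E \<Longrightarrow> \<exists>f0 f1. el_mor R R I E E f0 f1"
  unfolding el_mor_def
  by (intro exI[of _ "nat_restrict R (C0 E) (\<lambda>V x. x)"] exI[of _ "nat_restrict R (C1 E) (\<lambda>V x. x)"])
    (auto simp: is_el_ext_def lin_homD(1)[OF nat_hom_lin] intro: nat_hom_id)

text \<open>The target and its splitting may have values outside the universe. This allows the
  comparison with a truncated complex and its explicit splitting, of which only the source
  \<open>E\<close> is a copy.\<close>

lemma rel_mor_iff:
  fixes E :: "('r, 'm, 'u) u_ext" and E' :: "('r, 'u, 'r, 'u, ('m, 'u) tens, 'x, 'y) el_ext"
  assumes E: "el_ext_of R M E" and E': "el_ext_of R M E'" and mor: "el_mor R R I E E' f0 f1"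
    and D': "splits E' D'"
  shows "rel E Y \<longleftrightarrow> is_sq_ext R M Y \<and> sq_iso M Y (regular_ext R M E' D')"
proof
  assume "rel E Y"
  then obtain D where Y: "is_sq_ext R M Y"
    and D: "splits E (D :: ('r, 'u) u_split)" "sq_iso M Y (regular_ext R M E D)"
    unfolding rel_def by blast
  show "is_sq_ext R M Y \<and> sq_iso M Y (regular_ext R M E' D')"
    using Y sq_iso_trans[OF Y D(2) regular_ext_iso[OF E E' mor D(1) D']] by simp
next
  assume Y: "is_sq_ext R M Y \<and> sq_iso M Y (regular_ext R M E' D')"
  obtain D where D: "splits E (D :: ('r, 'u) u_split)" using splitting_in_universe[OF E] by blast
  have "sq_iso M (regular_ext R M E' D') (regular_ext R M E D)"
    by (rule sq_iso_sym[OF regular_ext_sq_ext[OF E D] regular_ext_iso[OF E E' mor D D']])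
  then show "rel E Y" unfolding rel_def using Y D sq_iso_trans by blast
qed

lemma rel_iff:
  fixes E :: "('r, 'm, 'u) u_ext"
  assumes E: "el_ext_of R M E" and D: "splits E D"
  shows "rel E Y \<longleftrightarrow> is_sq_ext R M Y \<and> sq_iso M Y (regular_ext R M E D)"
  using el_mor_id[OF E] rel_mor_iff[OF E E _ D] by blast

lemma rel_mor:
  fixes E E' :: "('r, 'm, 'u) u_ext"
  assumes E: "el_ext_of R M E" and E': "el_ext_of R M E'" and mor: "el_mor R R I E E' f0 f1"
  shows "rel E Y \<longleftrightarrow> rel E' Y"
proof -
  obtain D where D: "splits E' (D :: ('r, 'u) u_split)" using splitting_in_universe[OF E'] by blast
  show ?thesis using rel_mor_iff[OF E E' mor D] rel_iff[OF E' D] by simp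
qed

lemma rel_connected:
  assumes "(E, E')\<in>el_connected R M"
  shows "rel E Y \<longleftrightarrow> rel E' Y"
proof -
  have "equivclp (\<lambda>D D'. el_ext_of R M D \<and> el_ext_of R M D' \<and> (\<exists>f0 f1. el_mor R R I D D' f0 f1)) E E'"
    using assms by (simp add: el_connected_def)
  then show ?thesis
  proof (induction rule: equivclp_induct)
    case (step y z)
    then show ?case using rel_mor by blast
  qed simp
qed

lemma connected_equiv: "equiv {E. el_ext_of R M E} (el_connected R M)"
  by (intro equivI refl_onI symI transI) (auto simp: el_connected_def intro: equivclp_sym equivclp_trans)

lemma sq_equiv: "equiv {X. is_sq_ext R M X} {(X, Y). is_sq_ext R M X \<and> is_sq_ext R M Y \<and> sq_iso M X Y}"
  by (intro equivI refl_onI symI transI) (auto intro: sq_iso_refl sq_iso_sym sq_iso_trans)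

lemma rel_iso:
  assumes E: "el_ext_of R M E" and X: "rel E X"
  shows "rel E Y \<longleftrightarrow> is_sq_ext R M Y \<and> sq_iso M X Y"
proof -
  obtain D where D: "splits E (D :: ('r, 'u) u_split)" using splitting_in_universe[OF E] by blast
  note r = rel_iff[OF E D]
  have X': "is_sq_ext R M X" "sq_iso M X (regular_ext R M E D)" using X r by auto
  show ?thesis unfolding r
    using sq_iso_trans[OF X'(1,2) sq_iso_sym] sq_iso_trans[OF _ sq_iso_sym[OF X'(1)] X'(2)] by blast
qed

lemma tau_comparison:
  fixes E :: "('r, 'm, 'u) u_ext" and X :: "('r, 'm, 'u) sq_ext" and P :: "('r, 'u) u_res"
  assumes P: "resolves X P" and E: "el_ext_of R M E" and rel: "rel E X"
  shows "\<exists>f0 f1. el_mor R R I (tau_ext R M X P) E f0 f1"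
proof -
  obtain D where X: "is_sq_ext R M X" and D: "splits E (D :: ('r, 'u) u_split)"
    and iso: "sq_iso M X (regular_ext R M E D)" using rel unfolding rel_def by blast
  have "elementary R M E" using E by (rule elementaryI)
  from elementary.exists_generator_lift[OF this D] obtain \<sigma> where "split_elementary R M E D \<sigma>" by blast
  then interpret S: split_elementary R u M E D \<sigma> .
  obtain \<phi> where "\<phi>\<in>ring_iso (sq_ring X) (sq_ring S.RX)" "\<forall>m\<in>carrier M. \<phi> (sq_i X m) = sq_i S.RX m"
    "\<forall>x\<in>carrier (sq_ring X). sq_q S.RX (\<phi> x) = sq_q X x" using iso unfolding sq_iso_def by blast
  then interpret regular_action R u M E D \<sigma> X P \<phi>
    by unfold_locales (use X P in \<open>auto simp: ring_iso_def S.RX_simps\<close>)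
  show ?thesis by (rule tau_mor)
qed

lemma tau_copy:
  fixes X :: "('r, 'm, 'u) sq_ext" and P :: "('r, 'u) u_res"
  assumes X: "is_sq_ext R M X" and P: "resolves X P"
  obtains E :: "('r, 'm, 'u) u_ext" where "el_ext_of R M E" "el_iso R R I E (tau_ext R M X P)"
proof -
  interpret tau_complex R u M X P by unfold_locales (use X P in auto)
  \<comment> \<open>Each term is a surjective image of a value of the resolution, which consists of
    elements of the universe.\<close>
  have "pts (KK 0) V \<lesssim> (UNIV :: 'u set)" if "V\<in>Proj" for V
    unfolding un_surj[OF that, symmetric] by (rule lepoll_trans[OF image_lepoll subset_imp_lepoll]) simp
  moreover have "pts K1 V \<lesssim> (UNIV :: 'u set)" if "V\<in>Proj" for V
    unfolding u1_surj[OF that, symmetric] by (rule lepoll_trans[OF image_lepoll subset_imp_lepoll]) simp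
  ultimately show thesis using el_ext_copy[OF tau_el_ext] that by (auto simp: tau_simps)
qed

lemma rel_tau:
  fixes E :: "('r, 'm, 'u) u_ext" and X :: "('r, 'm, 'u) sq_ext" and P :: "('r, 'u) u_res"
  assumes X: "is_sq_ext R M X" and P: "resolves X P"
    and E: "el_ext_of R M E" and iso: "el_iso R R I E (tau_ext R M X P)"
  shows "rel E X"
proof -
  interpret tau_complex R u M X P by unfold_locales (use X P in auto)
  obtain f0 f1 where "el_mor R R I E (tau_ext R M X P) f0 f1" using iso by (auto simp: el_iso_def)
  then show ?thesis using rel_mor_iff[OF E tau_el_ext _ tau_splitting] X tau_regular_ext by blast
qed

text \<open>An extension related to \<open>X\<close> receives a morphism from the truncated complex,
  hence from its copy in the universe; conversely \<open>rel\<close> is constant on components. The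
  right side does not mention the resolution.\<close>

lemma el_class_tau:
  fixes X :: "('r, 'm, 'u) sq_ext" and P :: "('r, 'u) u_res"
  assumes X: "is_sq_ext R M X" and P: "resolves X P"
  shows "el_class R M (tau_ext R M X P) = {E. el_ext_of R M E \<and> rel E X}"
proof (intro equalityI subsetI)
  fix E assume "E\<in>el_class R M (tau_ext R M X P)"
  then obtain D where D: "el_ext_of R M D" "el_iso R R I D (tau_ext R M X P)" "(D, E)\<in>el_connected R M"
    by (auto simp: el_class_def)
  then have "el_ext_of R M E" by (simp add: el_connected_def)
  then show "E\<in>{E. el_ext_of R M E \<and> rel E X}" using rel_tau[OF X P D(1,2)] rel_connected[OF D(3)] by simp
next
  fix E assume "E\<in>{E. el_ext_of R M E \<and> rel E X}"
  then have E: "el_ext_of R M E" "rel E X" by auto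
  obtain D :: "('r, 'm, 'u) u_ext" where D: "el_ext_of R M D" "el_iso R R I D (tau_ext R M X P)" using tau_copy[OF X P] .
  obtain f0 f1 where f: "el_mor R R I D (tau_ext R M X P) f0 f1" using D(2) by (auto simp: el_iso_def)
  obtain g0 g1 where g: "el_mor R R I (tau_ext R M X P) E g0 g1" using tau_comparison[OF P E] by blast
  have "(D, E)\<in>el_connected R M"
    using el_mor_trans[OF f g D(1)] D(1) E(1) unfolding el_connected_def by blast
  then show "E\<in>el_class R M (tau_ext R M X P)" using D by (auto simp: el_class_def)
qed

section \<open>The two maps on classes\<close>

lemma resolution_exists:
  fixes X :: "('r, 'm, 'u) sq_ext"
  assumes X: "is_sq_ext R M X"
  obtains P :: "('r, 'u) u_res" where "resolves X P"
proof -
  interpret square_zero R u M X by unfold_locales (rule X)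
  have "pointed_functor R T (q_star X taut_functor :: ('r, 'u, 'u, 'u) pfunctor)"
    unfolding q_star_def by (rule restrict_functor_pointed[OF T_ring q_ring_hom taut_pointed])
  then show thesis using projective_resolution_exists[OF T_ring subset_imp_lepoll] that by blast
qed

text \<open>By \<open>el_class_tau\<close> the value does not depend on the resolution, and by
  \<open>rel_iso\<close> not on the representative, so the definite description is proper.\<close>

lemma Phi_eq:
  assumes \<xi>: "\<xi>\<in>Sq R M" and X: "X\<in>\<xi>"
  shows "Phi R M \<xi> = {E. el_ext_of R M E \<and> rel E X}" "is_sq_ext R M X"
proof -
  have \<xi>X: "Y\<in>\<xi> \<longleftrightarrow> is_sq_ext R M X \<and> is_sq_ext R M Y \<and> sq_iso M X Y" for Y
    using quotient_rep[OF sq_equiv \<xi>[unfolded Sq_def] X] by auto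
  show "is_sq_ext R M X" using \<xi>X X by blast
  have e: "el_class R M (tau_ext R M Y P) = {E. el_ext_of R M E \<and> rel E X}"
    if Y: "Y\<in>\<xi>" and P: "resolves Y P" for Y and P :: "('r, 'u) u_res"
  proof -
    have y: "is_sq_ext R M X" "is_sq_ext R M Y" "sq_iso M X Y" using \<xi>X Y by auto
    have "rel E Y \<longleftrightarrow> rel E X" if "el_ext_of R M E" for E
      using rel_iso[OF that, of X Y] rel_iso[OF that, of Y X] y sq_iso_sym[OF y(1,3)] by blast
    then show ?thesis using el_class_tau[OF y(2) P] by auto
  qed
  obtain P :: "('r, 'u) u_res" where P: "resolves X P"
    using resolution_exists \<open>is_sq_ext R M X\<close> by blast
  show "Phi R M \<xi> = {E. el_ext_of R M E \<and> rel E X}"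
    unfolding Phi_def
  proof (rule the_equality)
    show "\<exists>X'\<in>\<xi>. \<exists>P :: ('r, 'u) u_res. resolves X' P \<and>
        {E. el_ext_of R M E \<and> rel E X} = el_class R M (tau_ext R M X' P)"
      using e[OF X P] P X by blast
  qed (use e in blast)
qed

text \<open>Any two extensions related to \<open>X\<close> receive morphisms from one copy of the
  truncated complex of \<open>X\<close>, so they are connected. This is injectivity of
  \<Psi>.\<close>

lemma rel_class:
  assumes E: "el_ext_of R M E" and X: "rel E X"
  shows "{E. el_ext_of R M E \<and> rel E X} = el_connected R M `` {E}"
proof -
  have iX: "is_sq_ext R M X" using X by (simp add: rel_def)
  obtain P :: "('r, 'u) u_res" where P: "resolves X P"
    using resolution_exists[OF iX] .
  have "E\<in>el_class R M (tau_ext R M X P)" using el_class_tau[OF iX P] E X by blast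
  then obtain D where D: "el_ext_of R M D" "el_iso R R I D (tau_ext R M X P)" "(D, E)\<in>el_connected R M"
    by (auto simp: el_class_def)
  have "(E, E')\<in>el_connected R M" if E': "el_ext_of R M E'" "rel E' X" for E'
  proof -
    obtain f0 f1 where f: "el_mor R R I D (tau_ext R M X P) f0 f1" using D(2) by (auto simp: el_iso_def)
    obtain g0 g1 where g: "el_mor R R I (tau_ext R M X P) E' g0 g1" using tau_comparison[OF P E'] by blast
    have "(D, E')\<in>el_connected R M"
      using el_mor_trans[OF f g D(1)] D(1) E'(1) unfolding el_connected_def by blast
    then show ?thesis using D(3) connected_equiv by (meson equivE symE transE)
  qed
  then show ?thesis using rel_connected X by (auto simp: el_connected_def)
qed

lemma Psi_eq:
  assumes e: "e\<in>El R M" and E: "E\<in>e"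
  shows "Psi R M e = {Y. rel E Y}" "el_ext_of R M E"
proof -
  have eE: "E'\<in>e \<longleftrightarrow> (E, E')\<in>el_connected R M" for E'
    using quotient_rep[OF connected_equiv e[unfolded El_def] E] by auto
  show iE: "el_ext_of R M E" using eE E by (auto simp: el_connected_def)
  have s: "sq_class R M (regular_ext R M E' D) = {Y. rel E Y}"
    if "E'\<in>e" "splits E' D" for E' and D :: "('r, 'u) u_split"
  proof -
    have c: "(E, E')\<in>el_connected R M" using eE that(1) by blast
    then have "el_ext_of R M E'" by (simp add: el_connected_def)
    from rel_iff[OF this that(2)] rel_connected[OF c] show ?thesis by (simp add: sq_class_def)
  qed
  obtain D where D: "splits E (D :: ('r, 'u) u_split)" using splitting_in_universe[OF iE] by blast
  show "Psi R M e = {Y. rel E Y}"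
    unfolding Psi_def
  proof (rule the_equality)
    show "\<exists>E'\<in>e. \<exists>D :: ('r, 'u) u_split.
       splits E' D \<and> {Y. rel E Y} = sq_class R M (regular_ext R M E' D)"
      using s[OF E D] D E by blast
  qed (use s in blast)
qed

lemma rel_classes:
  assumes E: "el_ext_of R M E" and X: "rel E X"
  shows "{E. el_ext_of R M E \<and> rel E X}\<in>El R M" "{Y. rel E Y}\<in>Sq R M" "X\<in>{Y. rel E Y}"
proof -
  have iX: "is_sq_ext R M X" using X by (simp add: rel_def)
  show "{E. el_ext_of R M E \<and> rel E X}\<in>El R M"
    unfolding rel_class[OF E X] El_def using E by (auto intro: quotientI)
  have "{Y. rel E Y} = {(X, Y). is_sq_ext R M X \<and> is_sq_ext R M Y \<and> sq_iso M X Y} `` {X}"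
    using rel_iso[OF E X] iX by auto
  moreover have "\<dots>\<in>Sq R M" unfolding Sq_def using iX by (intro quotientI) simp
  ultimately show "{Y. rel E Y}\<in>Sq R M" by simp
  show "X\<in>{Y. rel E Y}" using X by simp
qed

lemma rel_exists_ext:
  fixes X :: "('r, 'm, 'u) sq_ext"
  assumes X: "is_sq_ext R M X"
  obtains E where "el_ext_of R M E" "rel E X"
proof -
  obtain P :: "('r, 'u) u_res" where P: "resolves X P"
    using resolution_exists[OF X] .
  obtain E :: "('r, 'm, 'u) u_ext" where E: "el_ext_of R M E" "el_iso R R I E (tau_ext R M X P)" using tau_copy[OF X P] .
  then show thesis using rel_tau[OF X P] that by blast
qed

lemma rel_exists_sq:
  fixes E :: "('r, 'm, 'u) u_ext"
  assumes E: "el_ext_of R M E" and small_M: "carrier M \<lesssim> (UNIV :: 'u set)"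
  obtains X where "rel E X"
proof -
  obtain D where D: "splits E (D :: ('r, 'u) u_split)" using splitting_in_universe[OF E] by blast
  obtain X :: "('r, 'm, 'u) sq_ext" where "is_sq_ext R M X" "sq_iso M X (regular_ext R M E D)"
    using sq_ext_copy[OF regular_ext_sq_ext[OF E D] small_M] by blast
  then show thesis using that rel_iff[OF E D] by blast
qed

lemma Sq_rep:
  assumes \<xi>: "(\<xi> :: ('r, 'm, 'u) sq_ext set)\<in>Sq R M"
  obtains X E where "X\<in>\<xi>" "el_ext_of R M E" "rel E X" "Phi R M \<xi> = {E. el_ext_of R M E \<and> rel E X}" "\<xi> = {Y. rel E Y}"
proof -
  obtain X where X: "X\<in>\<xi>" using \<xi> equiv_Eps_in[OF sq_equiv] unfolding Sq_def by blast
  have "\<xi> = {Y. is_sq_ext R M X \<and> is_sq_ext R M Y \<and> sq_iso M X Y}"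
    using quotient_rep[OF sq_equiv \<xi>[unfolded Sq_def] X] by auto
  then have iX: "is_sq_ext R M X" and e: "\<xi> = {Y. is_sq_ext R M Y \<and> sq_iso M X Y}" using X by auto
  obtain E where E: "el_ext_of R M E" "rel E X" using rel_exists_ext[OF iX] .
  have "\<xi> = {Y. rel E Y}" unfolding e using rel_iso[OF E] by auto
  then show thesis using that[OF X E Phi_eq(1)[OF \<xi> X]] by blast
qed

lemma El_rep:
  assumes e: "(e :: ('r, 'm, 'u) u_ext set)\<in>El R M" and small_M: "carrier M \<lesssim> (UNIV :: 'u set)"
  obtains E X where "E\<in>e" "el_ext_of R M E" "rel E X" "Psi R M e = {Y. rel E Y}" "e = {E. el_ext_of R M E \<and> rel E X}"
proof -
  obtain E where E: "el_ext_of R M E" "e = el_connected R M `` {E}"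
    using e unfolding El_def by (auto elim: quotientE)
  then have Ee: "E\<in>e" using equiv_class_self[OF connected_equiv] by auto
  obtain X where X: "rel E X" using rel_exists_sq[OF E(1) small_M] .
  show thesis using that[OF Ee E(1) X Psi_eq(1)[OF e Ee]] rel_class[OF E(1) X] E(2) by simp
qed

end

text \<open>For a pair with \<open>rel E X\<close>, the component of \<open>E\<close> consists of
  the extensions related to \<open>X\<close>, and the class of \<open>X\<close> of the square-zero
  extensions related to \<open>E\<close>. Both maps exchange these two sets.\<close>

theorem theorem3p6:
  fixes R :: "'r ring" and M :: "('r, 'r, 'm) bimodule"
  assumes "ring R" and "bimodule R R M"
    and "infinite (UNIV :: 'u set)"
    and "carrier R \<lesssim> (UNIV :: 'u set)" and "carrier M \<lesssim> (UNIV :: 'u set)"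
  shows "(Phi R M :: ('r, 'm, 'u) sq_ext set \<Rightarrow> _) \<in> Sq R M \<rightarrow> El R M \<and>
    (Psi R M :: _ \<Rightarrow> ('r, 'm, 'u) sq_ext set) \<in> El R M \<rightarrow> Sq R M \<and>
    (\<forall>\<xi> \<in> (Sq R M :: ('r, 'm, 'u) sq_ext set set). Psi R M (Phi R M \<xi>) = \<xi>) \<and>
    (\<forall>e \<in> (El R M :: ('r, 'u, 'r, 'u, ('m, 'u) tens, 'u, 'u) el_ext set set).
       Phi R M (Psi R M e) = e)"
proof -
  interpret bimodule_universe R "TYPE('u)" M
    using assms(1-4) by (intro bimodule_universe.intro universe.intro bimodule_universe_axioms.intro)
  have Phi: "Phi R M \<xi>\<in>El R M \<and> Psi R M (Phi R M \<xi>) = \<xi>" if \<xi>: "\<xi>\<in>Sq R M" for \<xi> :: "('r, 'm, 'u) sq_ext set"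
  proof -
    obtain X E where XE: "X\<in>\<xi>" "el_ext_of R M E" "rel E X" and P: "Phi R M \<xi> = {E. el_ext_of R M E \<and> rel E X}" and eq: "\<xi> = {Y. rel E Y}"
      using Sq_rep[OF \<xi>] .
    have "Phi R M \<xi>\<in>El R M" unfolding P by (rule rel_classes(1)[OF XE(2,3)])
    moreover have "E\<in>Phi R M \<xi>" using P XE by simp
    ultimately show ?thesis using Psi_eq(1)[of "Phi R M \<xi>" E] eq by simp
  qed
  have Psi: "Psi R M e\<in>(Sq R M :: ('r, 'm, 'u) sq_ext set set) \<and> Phi R M (Psi R M e) = e"
    if e: "e\<in>El R M" for e :: "('r, 'm, 'u) u_ext set"
  proof -
    obtain E X where EX: "E\<in>e" "el_ext_of R M E" "rel E X" and P: "Psi R M e = {Y. rel E Y}" and eq: "e = {E. el_ext_of R M E \<and> rel E X}"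
      using El_rep[OF e assms(5)] .
    have "Psi R M e\<in>Sq R M" "X\<in>Psi R M e" unfolding P by (rule rel_classes(2,3)[OF EX(2,3)])+
    with eq show ?thesis using Phi_eq(1)[of "Psi R M e" X] by simp
  qed
  show ?thesis using Phi Psi by blast
qed

end
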